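(* Let $X$ be the generating vector field of a volume preserving Anosov flow on $M$, and let $X_L$ be the generating vector field of the Liouville reparametrization of the flow. Let $(\alpha_-,\alpha_+)$ be the associated $(-1)$-Cartan structure and $R_{\alpha_-},R_{\alpha_+}$ the Reeb vector fields of $\alpha_-,\alpha_+$. Then: (1) The flow generated by $X_L$ preserves the transverse plane field $\langle R_{\alpha_-},R_{\alpha_+}\rangle$. (2) The pair $(M,X_L)$ can be extended to a Liouville structure $([-1,1]\times M,Y)$ such that $([-1,1]\times M,Y)\big|_{\{0\}\times M}=(M,X_L)$, i.e. $Y$ restricted to $\{0\}\times M$ equals $X_L$.
   Context: Standing assumptions: $M$ is a closed connected oriented 3-manifold; $X$ is a non-vanishing $C^{1+}$ vector field on $M$ ($C^1$ with Hölder continuous derivatives) with flow $\phi^t$; the invariant bundles of the flow are transversely orientable. The flow is Anosov if there is a continuous $\phi^t_*$-invariant splitting $TM\simeq E^{ss}\oplus E^{uu}\oplus\langle X\rangle$ (with $E^{ss},E^{uu}$ line bundles) such that for some $C>0$ and some norm, $\|\phi^t_*(u)\|\le e^{-Ct}\|u\|$ and $\|\phi^t_*(v)\|\ge e^{Ct}\|v\|$ for all $t\ge0$, $u\in E^{ss}$, $v\in E^{uu}$. It is volume preserving if it preserves a continuous volume form. Let $E^s=E^{ss}\oplus\langle X\rangle$ and $E^u=E^{uu}\oplus\langle X\rangle$ be the weak stable and unstable bundles; they are $C^1$ plane fields for $C^{1+}$ Anosov flows. Associated $(-1)$-Cartan structure and Liouville reparametrization: for a volume preserving Anosov flow one chooses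 $C^1$ 1-forms $\alpha_u,\alpha_s$ with $\ker\alpha_u=E^s$, $\ker\alpha_s=E^u$, such that $\alpha_s\wedge\alpha_u\wedge\alpha_X$ is a positive invariant volume form for any 1-form $\alpha_X$ with $\alpha_X(X)=1$, and such that $\mathcal L_X\alpha_u=r_u\alpha_u$, $\mathcal L_X\alpha_s=r_s\alpha_s$ with $r_u=-r_s>0$ (the expansion rates). (Concretely: $\alpha_u$ is chosen with $r_u>0$, $e_u\in E^u$ is a vector field with $\alpha_u(e_u)=1$, and $\alpha_s=\Omega(\cdot,e_u,X)$ for an invariant positive volume form $\Omega$.) Set $\alpha_-:=\alpha_u+\alpha_s$ and $\alpha_+:=\alpha_u-\alpha_s$. These are a negative and a positive $C^1$ contact form, $X\subset\ker\alpha_-\cap\ker\alpha_+$, and $(\alpha_-,\alpha_+)$ is a $(-1)$-Cartan structure, i.e. $\alpha_+\wedge d\alpha_+=-\alpha_-\wedge d\alpha_-$ and $\alpha_+\wedge d\alpha_-=-\alpha_-\wedge d\alpha_+=0$. The Liouville reparametrization is the flow generated by $X_L:=\frac1{r_u}X$. The Reeb vector field $R_\alpha$ of a contact form $\alpha$ is the unique (here only $C^0$) vector field with $d\alpha(R_\alpha,\cdot)=0$ and $\alpha(R_\alpha)=1$. An exact symplectic 4-manifold is $(W,d\alpha)$ with $W$ an oriented 4-manifold with boundary and $d\alpha\wedge d\alpha>0$ (here $\alpha$ is allowed to be only $C^1$, so that $d\alpha$ is a symplectic structure in the $C^0$ sense). Let $Y$ be the unique vector field with $\iota_Yd\alpha=\alpha$.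 If $Y$ points outward along $\partial W$, $Y$ is called a Liouville vector field and $(W,Y)$ a Liouville structure. *)

theory Defs
  imports "HOL-Analysis.Analysis"
begin

section \<open>Smooth manifolds with boundary\<close>

text \<open>
  Derivatives are taken within the set \<open>S\<close>, so that the notion also makes sense on relatively
  open subsets of a closed half space, where these derivatives are unique.
\<close>

primrec Ck_on :: "nat \<Rightarrow> ('a::euclidean_space \<Rightarrow> 'b::real_normed_vector) \<Rightarrow> 'a set \<Rightarrow> bool" where
  "Ck_on 0 f S \<longleftrightarrow> continuous_on S f"
| "Ck_on (Suc k) f S \<longleftrightarrow>
     (\<exists>g. (\<forall>x\<in>S. (f has_derivative (\<lambda>h. \<Sum>b\<in>Basis. (h \<bullet> b) *\<^sub>R g b x)) (at x within S))
        \<and> (\<forall>b\<in>Basis. Ck_on k (g b) S))"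

definition smooth_on :: "('a::euclidean_space \<Rightarrow> 'b::real_normed_vector) \<Rightarrow> 'a set \<Rightarrow> bool" where
  "smooth_on f S \<longleftrightarrow> (\<forall>k. Ck_on k f S)"

text \<open>A chart is a pair of its domain and its coordinate map.\<close>

type_synonym ('a, 'n) chart = "'a set \<times> ('a \<Rightarrow> real ^ 'n)"

abbreviation cdom :: "('a, 'n::finite) chart \<Rightarrow> 'a set" where "cdom c \<equiv> fst c"
abbreviation cmap :: "('a, 'n::finite) chart \<Rightarrow> 'a \<Rightarrow> real ^ 'n" where "cmap c \<equiv> snd c"
abbreviation cimg :: "('a, 'n::finite) chart \<Rightarrow> (real ^ 'n) set" where "cimg c \<equiv> snd c ` fst c"
abbreviation cinv :: "('a, 'n::finite) chart \<Rightarrow> real ^ 'n \<Rightarrow> 'a" where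
  "cinv c \<equiv> inv_into (fst c) (snd c)"

definition trans_deriv ::
    "('a, 'n::finite) chart \<Rightarrow> ('a, 'n) chart \<Rightarrow> 'a \<Rightarrow> real ^ 'n \<Rightarrow> real ^ 'n" where
  "trans_deriv c d p =
     frechet_derivative (cmap d \<circ> cinv c) (at (cmap c p) within cmap c ` (cdom c \<inter> cdom d))"

text \<open>
  Chart images are relatively open in a closed half space; \<open>n = 0\<close> and \<open>a \<le> 0\<close> gives the
  whole space.  Second countability is not required: it is automatic for the compact manifolds
  considered here.
\<close>

definition oriented_manifold :: "('a::t2_space) set \<Rightarrow> ('a, 'n::finite) chart set \<Rightarrow> bool" where
  "oriented_manifold M A \<longleftrightarrow>
     (\<Union>c\<in>A. cdom c) = M \<and>
     (\<forall>c\<in>A. openin (top_of_set M) (cdom c)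
         \<and> (\<exists>n a. openin (top_of_set {x. a \<le> n \<bullet> x}) (cimg c))
         \<and> (\<exists>g. homeomorphism (cdom c) (cimg c) (cmap c) g)) \<and>
     (\<forall>c\<in>A. \<forall>d\<in>A. smooth_on (cmap d \<circ> cinv c) (cmap c ` (cdom c \<inter> cdom d))
         \<and> (\<forall>p\<in>cdom c \<inter> cdom d. det (matrix (trans_deriv c d p)) > 0))"

definition mfd_boundary :: "'a set \<Rightarrow> ('a, 'n::finite) chart set \<Rightarrow> 'a set" where
  "mfd_boundary M A = {p \<in> M. \<exists>c\<in>A. p \<in> cdom c \<and> cmap c p \<notin> interior (cimg c)}"

definition closed_connected_oriented_3_manifold ::
    "('a::t2_space) set \<Rightarrow> ('a, 3) chart set \<Rightarrow> bool" where
  "closed_connected_oriented_3_manifold M A \<longleftrightarrow>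
     oriented_manifold M A \<and> compact M \<and> connected M \<and> M \<noteq> {} \<and> mfd_boundary M A = {}"


section \<open>Tangent vectors\<close>

text \<open>
  A tangent vector at \<open>p\<close> is the family of its components in all charts around \<open>p\<close>, transforming
  by the derivatives of the transition maps; the components are 0 in all other charts, so that
  tangent vectors are equal iff they are equal as functions.
\<close>

type_synonym ('a, 'n) tvec = "('a, 'n) chart \<Rightarrow> real ^ 'n"

definition tangent_space :: "('a, 'n::finite) chart set \<Rightarrow> 'a \<Rightarrow> ('a, 'n) tvec set" where
  "tangent_space A p =
     {v. (\<forall>c. \<not> (c \<in> A \<and> p \<in> cdom c) \<longrightarrow> v c = 0) \<and>
         (\<forall>c\<in>A. \<forall>d\<in>A. p \<in> cdom c \<longrightarrow> p \<in> cdom d \<longrightarrow> v d = trans_deriv c d p (v c))}"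

definition tzero :: "('a, 'n::finite) tvec" where
  "tzero = (\<lambda>c. 0)"

definition tadd :: "('a, 'n::finite) tvec \<Rightarrow> ('a, 'n) tvec \<Rightarrow> ('a, 'n) tvec" where
  "tadd u v = (\<lambda>c. u c + v c)"

definition tscale :: "real \<Rightarrow> ('a, 'n::finite) tvec \<Rightarrow> ('a, 'n) tvec" where
  "tscale a u = (\<lambda>c. a *\<^sub>R u c)"

text \<open>The tangent vector at \<open>p\<close> whose component in the chart \<open>c\<close> is \<open>h\<close>.\<close>

definition coord_vec ::
    "('a, 'n::finite) chart set \<Rightarrow> 'a \<Rightarrow> ('a, 'n) chart \<Rightarrow> real ^ 'n \<Rightarrow> ('a, 'n) tvec" where
  "coord_vec A p c h = (\<lambda>d. if d \<in> A \<and> p \<in> cdom d then trans_deriv c d p h else 0)"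

definition chart_at :: "('a, 'n::finite) chart set \<Rightarrow> 'a \<Rightarrow> ('a, 'n) chart" where
  "chart_at A p = (SOME c. c \<in> A \<and> p \<in> cdom c)"

definition mfd_differentiable ::
    "('a::t2_space) set \<Rightarrow> ('a, 'n::finite) chart set \<Rightarrow> ('b::t2_space, 'm::finite) chart set \<Rightarrow>
     ('a \<Rightarrow> 'b) \<Rightarrow> 'a \<Rightarrow> bool" where
  "mfd_differentiable M A B f p \<longleftrightarrow>
     continuous (at p within M) f \<and>
     (\<forall>c\<in>A. \<forall>d\<in>B. p \<in> cdom c \<longrightarrow> f p \<in> cdom d \<longrightarrow>
        (cmap d \<circ> f \<circ> cinv c) differentiable
          (at (cmap c p) within cmap c ` {q \<in> cdom c. f q \<in> cdom d}))"

text \<open>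
  The differential \<open>f\<^sub>* v\<close> of a map at \<open>p\<close>; by the chain rule it does not depend on the charts
  used, provided the map is differentiable at \<open>p\<close>.
\<close>

definition push ::
    "('a, 'n::finite) chart set \<Rightarrow> ('b, 'm::finite) chart set \<Rightarrow> ('a \<Rightarrow> 'b) \<Rightarrow> 'a \<Rightarrow>
     ('a, 'n) tvec \<Rightarrow> ('b, 'm) tvec" where
  "push A B f p v =
     (let c = chart_at A p; d = chart_at B (f p) in
      coord_vec B (f p) d
        (frechet_derivative (cmap d \<circ> f \<circ> cinv c)
           (at (cmap c p) within cmap c ` {q \<in> cdom c. f q \<in> cdom d}) (v c)))"


section \<open>Vector fields and differential forms\<close>

definition vector_field ::
    "'a set \<Rightarrow> ('a, 'n::finite) chart set \<Rightarrow> ('a \<Rightarrow> ('a, 'n) tvec) \<Rightarrow> bool" where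
  "vector_field M A X \<longleftrightarrow> (\<forall>p\<in>M. X p \<in> tangent_space A p)"

definition Ck_vector_field ::
    "nat \<Rightarrow> 'a set \<Rightarrow> ('a, 'n::finite) chart set \<Rightarrow> ('a \<Rightarrow> ('a, 'n) tvec) \<Rightarrow> bool" where
  "Ck_vector_field k M A X \<longleftrightarrow>
     vector_field M A X \<and> (\<forall>c\<in>A. Ck_on k (\<lambda>x. X (cinv c x) c) (cimg c))"

definition C1_Hoelder_vector_field ::
    "'a set \<Rightarrow> ('a, 'n::finite) chart set \<Rightarrow> ('a \<Rightarrow> ('a, 'n) tvec) \<Rightarrow> bool" where
  "C1_Hoelder_vector_field M A X \<longleftrightarrow>
     Ck_vector_field 1 M A X \<and>
     (\<exists>\<gamma>>0. \<forall>c\<in>A. \<forall>x\<in>cimg c. \<exists>\<epsilon>>0. \<exists>K. \<forall>y\<in>cimg c \<inter> ball x \<epsilon>. \<forall>z\<in>cimg c \<inter> ball x \<epsilon>.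
        onorm (\<lambda>h. frechet_derivative (\<lambda>x. X (cinv c x) c) (at y within cimg c) h
                 - frechet_derivative (\<lambda>x. X (cinv c x) c) (at z within cimg c) h)
          \<le> K * dist y z powr \<gamma>)"

definition nonvanishing :: "'a set \<Rightarrow> ('a \<Rightarrow> ('a, 'n::finite) tvec) \<Rightarrow> bool" where
  "nonvanishing M X \<longleftrightarrow> (\<forall>p\<in>M. X p \<noteq> tzero)"

type_synonym ('a, 'n) form1 = "'a \<Rightarrow> ('a, 'n) tvec \<Rightarrow> real"
type_synonym ('a, 'n) form2 = "'a \<Rightarrow> ('a, 'n) tvec \<Rightarrow> ('a, 'n) tvec \<Rightarrow> real"
type_synonym ('a, 'n) form3 =
  "'a \<Rightarrow> ('a, 'n) tvec \<Rightarrow> ('a, 'n) tvec \<Rightarrow> ('a, 'n) tvec \<Rightarrow> real"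
type_synonym ('a, 'n) form4 =
  "'a \<Rightarrow> ('a, 'n) tvec \<Rightarrow> ('a, 'n) tvec \<Rightarrow> ('a, 'n) tvec \<Rightarrow> ('a, 'n) tvec \<Rightarrow> real"

definition one_form :: "'a set \<Rightarrow> ('a, 'n::finite) chart set \<Rightarrow> ('a, 'n) form1 \<Rightarrow> bool" where
  "one_form M A \<alpha> \<longleftrightarrow>
     (\<forall>p\<in>M. \<forall>u\<in>tangent_space A p. \<forall>v\<in>tangent_space A p. \<forall>a b.
        \<alpha> p (tadd (tscale a u) (tscale b v)) = a * \<alpha> p u + b * \<alpha> p v)"

definition Ck_one_form ::
    "nat \<Rightarrow> 'a set \<Rightarrow> ('a, 'n::finite) chart set \<Rightarrow> ('a, 'n) form1 \<Rightarrow> bool" where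
  "Ck_one_form k M A \<alpha> \<longleftrightarrow>
     one_form M A \<alpha> \<and>
     (\<forall>c\<in>A. \<forall>b\<in>Basis. Ck_on k (\<lambda>x. \<alpha> (cinv c x) (coord_vec A (cinv c x) c b)) (cimg c))"

definition form1_add :: "('a, 'n::finite) form1 \<Rightarrow> ('a, 'n) form1 \<Rightarrow> ('a, 'n) form1" where
  "form1_add \<alpha> \<beta> = (\<lambda>p v. \<alpha> p v + \<beta> p v)"

definition form1_diff :: "('a, 'n::finite) form1 \<Rightarrow> ('a, 'n) form1 \<Rightarrow> ('a, 'n) form1" where
  "form1_diff \<alpha> \<beta> = (\<lambda>p v. \<alpha> p v - \<beta> p v)"

text \<open>
  The exterior derivative of a \<open>C\<^sup>1\<close> form, computed in a chart by
  \<open>d\<alpha>(u, v) = D\<^sub>u (\<alpha>(v)) - D\<^sub>v (\<alpha>(u))\<close>, where \<open>u\<close> and \<open>v\<close> are extended to vector fields with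
  constant components; the result does not depend on the chart.
\<close>

definition ext_d :: "('a, 'n::finite) chart set \<Rightarrow> ('a, 'n) form1 \<Rightarrow> ('a, 'n) form2" where
  "ext_d A \<alpha> = (\<lambda>p u v.
     (let c = chart_at A p;
          D = (\<lambda>w z. frechet_derivative (\<lambda>x. \<alpha> (cinv c x) (coord_vec A (cinv c x) c (z c)))
                       (at (cmap c p) within cimg c) (w c))
      in D u v - D v u))"

definition wedge12 :: "('a, 'n::finite) form1 \<Rightarrow> ('a, 'n) form2 \<Rightarrow> ('a, 'n) form3" where
  "wedge12 \<alpha> \<beta> = (\<lambda>p u v w. \<alpha> p u * \<beta> p v w - \<alpha> p v * \<beta> p u w + \<alpha> p w * \<beta> p u v)"

definition wedge111 ::
    "('a, 'n::finite) form1 \<Rightarrow> ('a, 'n) form1 \<Rightarrow> ('a, 'n) form1 \<Rightarrow> ('a, 'n) form3" where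
  "wedge111 \<alpha> \<beta> \<gamma> = wedge12 \<alpha> (\<lambda>p u v. \<beta> p u * \<gamma> p v - \<beta> p v * \<gamma> p u)"

definition wedge22 :: "('a, 'n::finite) form2 \<Rightarrow> ('a, 'n) form2 \<Rightarrow> ('a, 'n) form4" where
  "wedge22 \<beta> \<gamma> = (\<lambda>p u v w x.
       \<beta> p u v * \<gamma> p w x - \<beta> p u w * \<gamma> p v x + \<beta> p u x * \<gamma> p v w
     + \<beta> p v w * \<gamma> p u x - \<beta> p v x * \<gamma> p u w + \<beta> p w x * \<gamma> p u v)"

definition forms3_equal ::
    "'a set \<Rightarrow> ('a, 'n::finite) chart set \<Rightarrow> ('a, 'n) form3 \<Rightarrow> ('a, 'n) form3 \<Rightarrow> bool" where
  "forms3_equal M A \<Omega> \<Omega>' \<longleftrightarrow>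
     (\<forall>p\<in>M. \<forall>u\<in>tangent_space A p. \<forall>v\<in>tangent_space A p. \<forall>w\<in>tangent_space A p.
        \<Omega> p u v w = \<Omega>' p u v w)"

definition three_form :: "'a set \<Rightarrow> ('a, 'n::finite) chart set \<Rightarrow> ('a, 'n) form3 \<Rightarrow> bool" where
  "three_form M A \<Omega> \<longleftrightarrow>
     (\<forall>p\<in>M. \<forall>u\<in>tangent_space A p. \<forall>v\<in>tangent_space A p. \<forall>w\<in>tangent_space A p.
        (\<forall>z\<in>tangent_space A p. \<forall>a b.
           \<Omega> p (tadd (tscale a u) (tscale b z)) v w = a * \<Omega> p u v w + b * \<Omega> p z v w)
        \<and> \<Omega> p u v w = - \<Omega> p v u w \<and> \<Omega> p u v w = - \<Omega> p u w v)"

definition continuous_3_form :: "'a set \<Rightarrow> ('a, 3) chart set \<Rightarrow> ('a, 3) form3 \<Rightarrow> bool" where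
  "continuous_3_form M A \<Omega> \<longleftrightarrow>
     three_form M A \<Omega> \<and>
     (\<forall>c\<in>A. continuous_on (cimg c) (\<lambda>x. \<Omega> (cinv c x)
        (coord_vec A (cinv c x) c (axis 1 1)) (coord_vec A (cinv c x) c (axis 2 1))
        (coord_vec A (cinv c x) c (axis 3 1))))"

definition positive_3_form :: "'a set \<Rightarrow> ('a, 3) chart set \<Rightarrow> ('a, 3) form3 \<Rightarrow> bool" where
  "positive_3_form M A \<Omega> \<longleftrightarrow>
     (\<forall>p\<in>M. \<forall>c\<in>A. p \<in> cdom c \<longrightarrow>
        \<Omega> p (coord_vec A p c (axis 1 1)) (coord_vec A p c (axis 2 1))
            (coord_vec A p c (axis 3 1)) > 0)"

definition positive_4_form :: "'a set \<Rightarrow> ('a, 4) chart set \<Rightarrow> ('a, 4) form4 \<Rightarrow> bool" where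
  "positive_4_form M A \<Omega> \<longleftrightarrow>
     (\<forall>p\<in>M. \<forall>c\<in>A. p \<in> cdom c \<longrightarrow>
        \<Omega> p (coord_vec A p c (axis 1 1)) (coord_vec A p c (axis 2 1))
            (coord_vec A p c (axis 3 1)) (coord_vec A p c (axis 4 1)) > 0)"

text \<open>A volume form is continuous and nowhere zero; its sign is not prescribed.\<close>

definition volume_form :: "'a set \<Rightarrow> ('a, 3) chart set \<Rightarrow> ('a, 3) form3 \<Rightarrow> bool" where
  "volume_form M A \<Omega> \<longleftrightarrow>
     continuous_3_form M A \<Omega> \<and>
     (\<forall>p\<in>M. \<exists>u\<in>tangent_space A p. \<exists>v\<in>tangent_space A p. \<exists>w\<in>tangent_space A p.
        \<Omega> p u v w \<noteq> 0)"


section \<open>Flows and invariant objects\<close>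

definition generates_flow ::
    "('a::t2_space) set \<Rightarrow> ('a, 'n::finite) chart set \<Rightarrow> ('a \<Rightarrow> ('a, 'n) tvec) \<Rightarrow>
     (real \<Rightarrow> 'a \<Rightarrow> 'a) \<Rightarrow> bool" where
  "generates_flow M A X \<phi> \<longleftrightarrow>
     (\<forall>p\<in>M. \<phi> 0 p = p) \<and>
     (\<forall>p\<in>M. \<forall>t. \<phi> t p \<in> M) \<and>
     (\<forall>p\<in>M. \<forall>s t. \<phi> (s + t) p = \<phi> s (\<phi> t p)) \<and>
     (\<forall>p\<in>M. \<forall>t. isCont (\<lambda>s. \<phi> s p) t \<and>
        (\<forall>c\<in>A. \<phi> t p \<in> cdom c \<longrightarrow>
           ((\<lambda>s. cmap c (\<phi> s p)) has_vector_derivative X (\<phi> t p) c) (at t)))"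

text \<open>
  Invariance of a family of subspaces of the tangent spaces; it includes that the time-\<open>t\<close> maps
  are differentiable, so that the differentials are meaningful.
\<close>

definition preserves_bundle ::
    "('a::t2_space) set \<Rightarrow> ('a, 'n::finite) chart set \<Rightarrow> (real \<Rightarrow> 'a \<Rightarrow> 'a) \<Rightarrow>
     ('a \<Rightarrow> ('a, 'n) tvec set) \<Rightarrow> bool" where
  "preserves_bundle M A \<phi> E \<longleftrightarrow>
     (\<forall>t. \<forall>p\<in>M. mfd_differentiable M A A (\<phi> t) p \<and> push A A (\<phi> t) p ` E p = E (\<phi> t p))"

definition preserves_3_form ::
    "('a::t2_space) set \<Rightarrow> ('a, 'n::finite) chart set \<Rightarrow> (real \<Rightarrow> 'a \<Rightarrow> 'a) \<Rightarrow>
     ('a, 'n) form3 \<Rightarrow> bool" where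
  "preserves_3_form M A \<phi> \<Omega> \<longleftrightarrow>
     (\<forall>t. \<forall>p\<in>M. mfd_differentiable M A A (\<phi> t) p \<and>
        (\<forall>u\<in>tangent_space A p. \<forall>v\<in>tangent_space A p. \<forall>w\<in>tangent_space A p.
           \<Omega> (\<phi> t p) (push A A (\<phi> t) p u) (push A A (\<phi> t) p v) (push A A (\<phi> t) p w)
             = \<Omega> p u v w))"

definition volume_preserving ::
    "('a::t2_space) set \<Rightarrow> ('a, 3) chart set \<Rightarrow> (real \<Rightarrow> 'a \<Rightarrow> 'a) \<Rightarrow> bool" where
  "volume_preserving M A \<phi> \<longleftrightarrow> (\<exists>\<Omega>. volume_form M A \<Omega> \<and> preserves_3_form M A \<phi> \<Omega>)"

text \<open>\<open>\<L>\<^sub>X \<alpha> = \<beta>\<close>, the Lie derivative being the derivative at time 0 of the pullback of \<open>\<alpha>\<close> by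
  the flow \<open>\<phi>\<close> of \<open>X\<close>.\<close>

definition has_Lie_derivative ::
    "'a set \<Rightarrow> ('a, 'n::finite) chart set \<Rightarrow> (real \<Rightarrow> 'a \<Rightarrow> 'a) \<Rightarrow>
     ('a, 'n) form1 \<Rightarrow> ('a, 'n) form1 \<Rightarrow> bool" where
  "has_Lie_derivative M A \<phi> \<alpha> \<beta> \<longleftrightarrow>
     (\<forall>p\<in>M. \<forall>v\<in>tangent_space A p.
        ((\<lambda>t. \<alpha> (\<phi> t p) (push A A (\<phi> t) p v)) has_real_derivative \<beta> p v) (at 0))"


section \<open>Anosov flows\<close>

definition continuous_line_bundle ::
    "('a::t2_space) set \<Rightarrow> ('a, 'n::finite) chart set \<Rightarrow> ('a \<Rightarrow> ('a, 'n) tvec set) \<Rightarrow> bool" where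
  "continuous_line_bundle M A E \<longleftrightarrow>
     (\<forall>p\<in>M. \<exists>U e. openin (top_of_set M) U \<and> p \<in> U \<and> vector_field U A e \<and> nonvanishing U e \<and>
        (\<forall>c\<in>A. continuous_on (cmap c ` (cdom c \<inter> U)) (\<lambda>x. e (cinv c x) c)) \<and>
        (\<forall>q\<in>U. E q = range (\<lambda>a. tscale a (e q))))"

definition continuous_norm ::
    "'a set \<Rightarrow> ('a, 'n::finite) chart set \<Rightarrow> ('a \<Rightarrow> ('a, 'n) tvec \<Rightarrow> real) \<Rightarrow> bool" where
  "continuous_norm M A N \<longleftrightarrow>
     (\<forall>p\<in>M. \<forall>u\<in>tangent_space A p.
        N p u \<ge> 0 \<and> (N p u = 0 \<longleftrightarrow> u = tzero) \<and> (\<forall>a. N p (tscale a u) = \<bar>a\<bar> * N p u) \<and>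
        (\<forall>v\<in>tangent_space A p. N p (tadd u v) \<le> N p u + N p v)) \<and>
     (\<forall>c\<in>A. continuous_on (cimg c \<times> UNIV)
        (\<lambda>(x, h). N (cinv c x) (coord_vec A (cinv c x) c h)))"

definition Anosov_splitting ::
    "('a::t2_space) set \<Rightarrow> ('a, 3) chart set \<Rightarrow> ('a \<Rightarrow> ('a, 3) tvec) \<Rightarrow> (real \<Rightarrow> 'a \<Rightarrow> 'a) \<Rightarrow>
     ('a \<Rightarrow> ('a, 3) tvec set) \<Rightarrow> ('a \<Rightarrow> ('a, 3) tvec set) \<Rightarrow> bool" where
  "Anosov_splitting M A X \<phi> Ess Euu \<longleftrightarrow>
     continuous_line_bundle M A Ess \<and> continuous_line_bundle M A Euu \<and>
     (\<forall>p\<in>M. \<forall>v\<in>tangent_space A p. \<exists>!(u, w, a).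
        u \<in> Ess p \<and> w \<in> Euu p \<and> v = tadd (tadd u w) (tscale a (X p))) \<and>
     preserves_bundle M A \<phi> Ess \<and> preserves_bundle M A \<phi> Euu \<and>
     (\<exists>C>0. \<exists>N. continuous_norm M A N \<and>
        (\<forall>p\<in>M. \<forall>t\<ge>0.
           (\<forall>u\<in>Ess p. N (\<phi> t p) (push A A (\<phi> t) p u) \<le> exp (- C * t) * N p u) \<and>
           (\<forall>v\<in>Euu p. N (\<phi> t p) (push A A (\<phi> t) p v) \<ge> exp (C * t) * N p v)))"

text \<open>The weak bundles \<open>E\<^sup>s\<close>, \<open>E\<^sup>u\<close> obtained from \<open>E\<^sup>s\<^sup>s\<close>, \<open>E\<^sup>u\<^sup>u\<close>.\<close>

definition weak_bundle ::
    "('a \<Rightarrow> ('a, 'n::finite) tvec) \<Rightarrow> ('a \<Rightarrow> ('a, 'n) tvec set) \<Rightarrow> 'a \<Rightarrow> ('a, 'n) tvec set" where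
  "weak_bundle X E p = {tadd u (tscale a (X p)) | u a. u \<in> E p}"

definition has_kernel ::
    "'a set \<Rightarrow> ('a, 'n::finite) chart set \<Rightarrow> ('a, 'n) form1 \<Rightarrow> ('a \<Rightarrow> ('a, 'n) tvec set) \<Rightarrow> bool" where
  "has_kernel M A \<alpha> E \<longleftrightarrow> (\<forall>p\<in>M. {v \<in> tangent_space A p. \<alpha> p v = 0} = E p)"

text \<open>For a plane field, an orientation of the quotient line bundle amounts to a continuous form
  with that kernel.\<close>

definition transversely_orientable ::
    "'a set \<Rightarrow> ('a, 'n::finite) chart set \<Rightarrow> ('a \<Rightarrow> ('a, 'n) tvec set) \<Rightarrow> bool" where
  "transversely_orientable M A E \<longleftrightarrow> (\<exists>\<alpha>. Ck_one_form 0 M A \<alpha> \<and> has_kernel M A \<alpha> E)"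


section \<open>Contact forms and the associated Cartan structure\<close>

definition positive_contact_form ::
    "'a set \<Rightarrow> ('a, 3) chart set \<Rightarrow> ('a, 3) form1 \<Rightarrow> bool" where
  "positive_contact_form M A \<alpha> \<longleftrightarrow>
     Ck_one_form 1 M A \<alpha> \<and> positive_3_form M A (wedge12 \<alpha> (ext_d A \<alpha>))"

definition negative_contact_form ::
    "'a set \<Rightarrow> ('a, 3) chart set \<Rightarrow> ('a, 3) form1 \<Rightarrow> bool" where
  "negative_contact_form M A \<alpha> \<longleftrightarrow>
     Ck_one_form 1 M A \<alpha> \<and> positive_3_form M A (\<lambda>p u v w. - wedge12 \<alpha> (ext_d A \<alpha>) p u v w)"

definition Cartan_structure_m1 ::
    "'a set \<Rightarrow> ('a, 3) chart set \<Rightarrow> ('a, 3) form1 \<Rightarrow> ('a, 3) form1 \<Rightarrow> bool" where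
  "Cartan_structure_m1 M A \<alpha>m \<alpha>p \<longleftrightarrow>
     negative_contact_form M A \<alpha>m \<and> positive_contact_form M A \<alpha>p \<and>
     forms3_equal M A (wedge12 \<alpha>p (ext_d A \<alpha>p)) (\<lambda>p u v w. - wedge12 \<alpha>m (ext_d A \<alpha>m) p u v w) \<and>
     forms3_equal M A (wedge12 \<alpha>p (ext_d A \<alpha>m)) (\<lambda>p u v w. 0) \<and>
     forms3_equal M A (wedge12 \<alpha>m (ext_d A \<alpha>p)) (\<lambda>p u v w. 0)"

text \<open>
  \<open>\<alpha>u\<close> and \<open>\<alpha>s\<close> are the forms from which the structure is built and \<open>r\<close> is the expansion rate
  \<open>r\<^sub>u = - r\<^sub>s\<close>.  The quantified form \<open>\<alpha>X\<close> need not be continuous: the 3-form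
  \<open>\<alpha>\<^sub>s \<and> \<alpha>\<^sub>u \<and> \<alpha>\<^sub>X\<close> does not depend on its choice.  The last conjunct follows from the others; it
  only records that the pair so obtained is a \<open>(-1)\<close>-Cartan structure.
\<close>

definition associated_Cartan_structure ::
    "('a::t2_space) set \<Rightarrow> ('a, 3) chart set \<Rightarrow> ('a \<Rightarrow> ('a, 3) tvec) \<Rightarrow> (real \<Rightarrow> 'a \<Rightarrow> 'a) \<Rightarrow>
     ('a \<Rightarrow> ('a, 3) tvec set) \<Rightarrow> ('a \<Rightarrow> ('a, 3) tvec set) \<Rightarrow> ('a \<Rightarrow> real) \<Rightarrow>
     ('a, 3) form1 \<Rightarrow> ('a, 3) form1 \<Rightarrow> bool" where
  "associated_Cartan_structure M A X \<phi> Es Eu r \<alpha>m \<alpha>p \<longleftrightarrow>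
     (\<exists>\<alpha>u \<alpha>s.
        Ck_one_form 1 M A \<alpha>u \<and> Ck_one_form 1 M A \<alpha>s \<and>
        has_kernel M A \<alpha>u Es \<and> has_kernel M A \<alpha>s Eu \<and>
        (\<forall>\<alpha>X. one_form M A \<alpha>X \<longrightarrow> (\<forall>p\<in>M. \<alpha>X p (X p) = 1) \<longrightarrow>
           volume_form M A (wedge111 \<alpha>s \<alpha>u \<alpha>X) \<and>
           positive_3_form M A (wedge111 \<alpha>s \<alpha>u \<alpha>X) \<and>
           preserves_3_form M A \<phi> (wedge111 \<alpha>s \<alpha>u \<alpha>X)) \<and>
        has_Lie_derivative M A \<phi> \<alpha>u (\<lambda>p v. r p * \<alpha>u p v) \<and>
        has_Lie_derivative M A \<phi> \<alpha>s (\<lambda>p v. - r p * \<alpha>s p v) \<and>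
        (\<forall>p\<in>M. r p > 0) \<and>
        \<alpha>m = form1_add \<alpha>u \<alpha>s \<and> \<alpha>p = form1_diff \<alpha>u \<alpha>s) \<and>
     Cartan_structure_m1 M A \<alpha>m \<alpha>p"

definition Liouville_reparametrization ::
    "('a \<Rightarrow> real) \<Rightarrow> ('a \<Rightarrow> ('a, 3) tvec) \<Rightarrow> 'a \<Rightarrow> ('a, 3) tvec" where
  "Liouville_reparametrization r X = (\<lambda>p. tscale (1 / r p) (X p))"

definition Reeb_vector_field ::
    "'a set \<Rightarrow> ('a, 3) chart set \<Rightarrow> ('a, 3) form1 \<Rightarrow> ('a \<Rightarrow> ('a, 3) tvec) \<Rightarrow> bool" where
  "Reeb_vector_field M A \<alpha> R \<longleftrightarrow>
     Ck_vector_field 0 M A R \<and>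
     (\<forall>p\<in>M. \<alpha> p (R p) = 1 \<and> (\<forall>v\<in>tangent_space A p. ext_d A \<alpha> p (R p) v = 0))"

definition span2 ::
    "('a \<Rightarrow> ('a, 'n::finite) tvec) \<Rightarrow> ('a \<Rightarrow> ('a, 'n) tvec) \<Rightarrow> 'a \<Rightarrow> ('a, 'n) tvec set" where
  "span2 R S p = {tadd (tscale a (R p)) (tscale b (S p)) | a b. True}"

text \<open>The fields \<open>R\<close>, \<open>S\<close> span a plane field transverse to \<open>X\<close>: together with \<open>X\<close> they form a
  basis of each (3-dimensional) tangent space.\<close>

definition transverse_plane_field ::
    "'a set \<Rightarrow> ('a, 3) chart set \<Rightarrow> ('a \<Rightarrow> ('a, 3) tvec) \<Rightarrow> ('a \<Rightarrow> ('a, 3) tvec) \<Rightarrow>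
     ('a \<Rightarrow> ('a, 3) tvec) \<Rightarrow> bool" where
  "transverse_plane_field M A X R S \<longleftrightarrow>
     (\<forall>p\<in>M. \<forall>v\<in>tangent_space A p. \<exists>!(a, b, k).
        v = tadd (tadd (tscale a (R p)) (tscale b (S p))) (tscale k (X p)))"


section \<open>Liouville structures\<close>

definition exact_symplectic_4_manifold ::
    "('a::t2_space) set \<Rightarrow> ('a, 4) chart set \<Rightarrow> ('a, 4) form1 \<Rightarrow> bool" where
  "exact_symplectic_4_manifold W A \<alpha> \<longleftrightarrow>
     oriented_manifold W A \<and> Ck_one_form 1 W A \<alpha> \<and>
     positive_4_form W A (wedge22 (ext_d A \<alpha>) (ext_d A \<alpha>))"

text \<open>If the half space \<open>{x. a \<le> n \<bullet> x}\<close> contains the image of a chart as a relatively open set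
  and the boundary point \<open>p\<close> is mapped to its bounding hyperplane, then \<open>- n\<close> is an outer normal.\<close>

definition points_outward ::
    "'a set \<Rightarrow> ('a, 'n::finite) chart set \<Rightarrow> ('a \<Rightarrow> ('a, 'n) tvec) \<Rightarrow> bool" where
  "points_outward W A Y \<longleftrightarrow>
     (\<forall>p\<in>mfd_boundary W A. \<forall>c\<in>A. p \<in> cdom c \<longrightarrow>
        (\<forall>n a. n \<noteq> 0 \<longrightarrow> openin (top_of_set {x. a \<le> n \<bullet> x}) (cimg c) \<longrightarrow> n \<bullet> cmap c p = a \<longrightarrow>
           n \<bullet> Y p c < 0))"

definition Liouville_structure ::
    "('a::t2_space) set \<Rightarrow> ('a, 4) chart set \<Rightarrow> ('a \<Rightarrow> ('a, 4) tvec) \<Rightarrow> bool" where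
  "Liouville_structure W A Y \<longleftrightarrow>
     (\<exists>\<alpha>. exact_symplectic_4_manifold W A \<alpha> \<and> vector_field W A Y \<and>
        (\<forall>p\<in>W. \<forall>v\<in>tangent_space A p. ext_d A \<alpha> p (Y p) v = \<alpha> p v) \<and>
        points_outward W A Y)"

text \<open>
  The product \<open>[-1,1] \<times> M\<close>, with the coordinate on the interval coming first in the orientation.
  The charts over \<open>[-1,1)\<close> and \<open>(-1,1]\<close> have values in two different half spaces.
\<close>

definition cylinder_coord :: "('a \<Rightarrow> real ^ 3) \<Rightarrow> real \<times> 'a \<Rightarrow> real ^ 4" where
  "cylinder_coord f = (\<lambda>(s, p). vector [s, f p $ 1, f p $ 2, f p $ 3])"

definition cylinder_atlas :: "('a, 3) chart set \<Rightarrow> (real \<times> 'a, 4) chart set" where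
  "cylinder_atlas A =
     (\<lambda>c. ({-1..<1} \<times> cdom c, cylinder_coord (cmap c))) ` A \<union>
     (\<lambda>c. ({-1<..1} \<times> cdom c, cylinder_coord (cmap c))) ` A"

end

theory Submission
  imports Defs
begin

text \<open>
  Since \<open>X\<close> lies in the kernels of \<open>\<alpha>\<^sub>u\<close> and \<open>\<alpha>\<^sub>s\<close>, Cartan's formula turns the hypotheses on the Lie
  derivatives into \<open>\<iota>\<^sub>X d\<alpha>\<^sub>u = r \<alpha>\<^sub>u\<close> and \<open>\<iota>\<^sub>X d\<alpha>\<^sub>s = - r \<alpha>\<^sub>s\<close>.  Together with the equations of the two Reeb
  fields this is a problem of linear algebra in each tangent space (\<open>Reeb_algebra\<close>), whose solution is
  \<open>d\<alpha>\<^sub>u = \<beta> \<and> \<alpha>\<^sub>u\<close> and \<open>d\<alpha>\<^sub>s = - \<beta> \<and> \<alpha>\<^sub>s\<close>, where \<open>\<beta>\<close> is a continuous 1-form with kernel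
  \<open>\<langle>R\<^sub>-, R\<^sub>+\<rangle>\<close> and \<open>\<beta>(X) = r\<close>, that is, \<open>\<beta>(X\<^sub>L) = 1\<close>.  In particular \<open>r\<close> is continuous.

  \<^bold>\<open>The plane field.\<close>  For smooth data the Lie derivative of \<open>\<beta>\<close> along \<open>X\<^sub>L\<close> would be seen to vanish by
  differentiating the structure equations once more.  Here \<open>\<beta>\<close> and \<open>X\<^sub>L\<close> are only continuous, and already the
  differentiability of the flow \<open>\<psi>\<close> of \<open>X\<^sub>L\<close> is an issue.  The flow \<open>\<phi>\<close> of \<open>X\<close> multiplies \<open>\<alpha>\<^sub>u\<close> by \<open>exp f\<^sub>t\<close> and
  \<open>\<alpha>\<^sub>s\<close> by \<open>exp (- f\<^sub>t)\<close>, where \<open>f\<^sub>t(p)\<close> is the integral of \<open>r\<close> along the orbit of \<open>p\<close> from time 0 to \<open>t\<close>.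
  The crucial fact (\<open>log_expansion_has_derivative\<close>) is that \<open>f\<^sub>t\<close> is differentiable, although \<open>r\<close> may fail to
  be, with \<open>df\<^sub>t = (\<phi>\<^sup>t)\<^sup>*\<beta> - \<beta>\<close>.  A point \<open>p\<close> travels for the time \<open>f\<^sub>T(p)\<close> under \<open>\<psi>\<close> to reach \<open>\<phi>\<^sup>T(p)\<close>, so
  \<open>\<psi>\<^sup>t(p) = \<psi>\<^sup>t\<^sup>-\<^sup>f\<^sup>(\<^sup>p\<^sup>)(\<phi>\<^sup>T(p))\<close> with \<open>f = f\<^sub>T\<close>.  If \<open>T\<close> is chosen such that \<open>f(p\<^sub>0) = t\<close>, the remaining time is 0 at
  \<open>p\<^sub>0\<close>, and \<open>\<psi>\<^sup>t\<close> has the differential \<open>v \<mapsto> \<phi>\<^sup>T\<^sub>* v - df(v) X\<^sub>L\<close> at \<open>p\<^sub>0\<close>.  The formula for \<open>df\<close> and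
  \<open>\<beta>(X\<^sub>L) = 1\<close> show that it preserves \<open>\<beta>\<close>, hence the kernel of \<open>\<beta>\<close>.

  To differentiate \<open>f = f\<^sub>T\<close>, divide the mean value of the form \<open>(\<phi>\<^sup>T)\<^sup>*\<alpha>\<^sub>u\<close> along a short segment in a fixed
  direction by the value of \<open>\<alpha>\<^sub>u\<close> in this direction.  As the segment shrinks, the logarithm of this quotient
  tends to \<open>f\<close>.  The mean values are line integrals over \<open>C\<^sup>1\<close> curves of a form with \<open>C\<^sup>1\<close> coefficients and can be differentiated
  (\<open>first_variation\<close>); in the directions of \<open>ker \<alpha>\<^sub>u\<close> the derivatives converge to the expected limit
  (\<open>slope_in_kernel\<close>).  The directions of \<open>ker \<alpha>\<^sub>s\<close> are treated in the same way with \<open>\<alpha>\<^sub>s\<close> and \<open>- f\<close>.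
  Vector fields in these kernels are merely continuous, so their integral curves have to be
  replaced by Euler polygons; the resulting notion of slope (\<open>has_slope_along\<close>) is additive in the vector field,
  and continuous slopes in all directions give a derivative (\<open>has_derivative_of_slopes\<close>).

  \<^bold>\<open>The Liouville structure.\<close>  On \<open>[-1,1] \<times> M\<close> put \<open>\<lambda> = \<alpha>\<^sub>u - s \<alpha>\<^sub>s\<close>, which interpolates linearly between
  \<open>\<alpha>\<^sub>-\<close> at \<open>s = -1\<close> and \<open>\<alpha>\<^sub>+\<close> at \<open>s = 1\<close>.  The structure equations give
  \<open>d\<lambda> = \<beta> \<and> \<alpha>\<^sub>u + s \<beta> \<and> \<alpha>\<^sub>s - ds \<and> \<alpha>\<^sub>s\<close>, whence \<open>d\<lambda> \<and> d\<lambda> = 2 ds \<and> \<alpha>\<^sub>s \<and> \<alpha>\<^sub>u \<and> \<beta> > 0\<close>, and the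
  vector field \<open>2s \<partial>\<^sub>s + X\<^sub>L\<close> satisfies \<open>\<iota> d\<lambda> = \<lambda>\<close>.  It points outward at \<open>s = -1\<close> and \<open>s = 1\<close> and equals \<open>X\<^sub>L\<close>
  at \<open>s = 0\<close>.
\<close>

section \<open>The first variation of a line integral\<close>

lemma continuous_on_derivative_compose:
  fixes F' :: "'a::topological_space \<Rightarrow> 'b::euclidean_space \<Rightarrow> 'c::real_normed_vector"
  assumes lin: "\<And>x. x \<in> U \<Longrightarrow> linear (F' x)"
    and cont: "\<And>h. continuous_on U (\<lambda>x. F' x h)"
    and g: "continuous_on S g" "g ` S \<subseteq> U" and h: "continuous_on S h"
  shows "continuous_on S (\<lambda>s. F' (g s) (h s))"
proof -
  have "F' (g s) (h s) = (\<Sum>b\<in>Basis. (h s \<bullet> b) *\<^sub>R F' (g s) b)" if "s \<in> S" for s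
  proof -
    have "linear (F' (g s))" using lin g(2) that by blast
    then have "F' (g s) (\<Sum>b\<in>Basis. (h s \<bullet> b) *\<^sub>R b) = (\<Sum>b\<in>Basis. (h s \<bullet> b) *\<^sub>R F' (g s) b)"
      by (simp add: linear_sum linear_scale)
    then show ?thesis by (simp add: euclidean_representation)
  qed
  moreover have "continuous_on S (\<lambda>s. \<Sum>b\<in>Basis. (h s \<bullet> b) *\<^sub>R F' (g s) b)"
    using g h by (intro continuous_intros continuous_on_compose2[OF cont]) auto
  ultimately show ?thesis
    by (simp cong: continuous_on_cong)
qed

lemma has_field_derivative_transform_on:
  assumes "x \<in> S" "\<And>y. y \<in> S \<Longrightarrow> g y = f y" "(f has_field_derivative D) (at x within S)"
  shows "(g has_field_derivative D) (at x within S)"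
  using has_derivative_transform[OF assms(1,2)] assms(3) by (simp add: has_field_derivative_def)

text \<open>
  The integral on the left is the line integral of the 1-form \<open>y \<mapsto> \<langle>B y, _\<rangle>\<close> over the image under \<open>F\<close> of the
  segment from \<open>p + \<delta> w\<close> to \<open>p + \<delta> w + v\<close>.  Its derivative consists of the boundary terms and the integral of the
  exterior derivative of the form.  The factor \<open>F' v\<close> of the integrand cannot be differentiated
  with respect to \<open>\<delta>\<close>, because \<open>F\<close> is only \<open>C\<^sup>1\<close>.  It is a derivative along the segment, however, so that an
  integration by parts moves this derivative to the other factor.
\<close>

lemma first_variation:
  fixes F :: "'a::euclidean_space \<Rightarrow> 'b::euclidean_space" and B :: "'b \<Rightarrow> 'b"
  assumes U: "open U" and FV: "F ` U \<subseteq> V"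
    and F: "\<And>x. x \<in> U \<Longrightarrow> (F has_derivative F' x) (at x)" "\<And>h. continuous_on U (\<lambda>x. F' x h)"
    and B: "\<And>y. y \<in> V \<Longrightarrow> (B has_derivative B' y) (at y)" "\<And>h. continuous_on V (\<lambda>y. B' y h)"
    and seg: "\<And>\<sigma>. \<sigma> \<in> {0..1} \<Longrightarrow> p + \<sigma> *\<^sub>R v \<in> U"
  shows "((\<lambda>\<delta>. integral {0..1} (\<lambda>\<sigma>. B (F (p + \<delta> *\<^sub>R w + \<sigma> *\<^sub>R v)) \<bullet> F' (p + \<delta> *\<^sub>R w + \<sigma> *\<^sub>R v) v))
      has_real_derivative
        B (F (p + v)) \<bullet> F' (p + v) w - B (F p) \<bullet> F' p w
        + integral {0..1} (\<lambda>\<sigma>. B' (F (p + \<sigma> *\<^sub>R v)) (F' (p + \<sigma> *\<^sub>R v) w) \<bullet> F' (p + \<sigma> *\<^sub>R v) v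
                               - B' (F (p + \<sigma> *\<^sub>R v)) (F' (p + \<sigma> *\<^sub>R v) v) \<bullet> F' (p + \<sigma> *\<^sub>R v) w)) (at 0)"
    (is "((\<lambda>\<delta>. integral _ (?i \<delta>)) has_real_derivative ?D) _")
proof -
  let ?x = "\<lambda>\<delta> \<sigma>. p + \<delta> *\<^sub>R w + \<sigma> *\<^sub>R v"
  have "compact ((\<lambda>\<sigma>. p + \<sigma> *\<^sub>R v) ` {0..1})"
    by (intro compact_continuous_image continuous_intros) auto
  then obtain e where e: "e > 0" "(\<Union>x\<in>(\<lambda>\<sigma>. p + \<sigma> *\<^sub>R v) ` {0..1}. ball x e) \<subseteq> U"
    using compact_subset_open_imp_ball_epsilon_subset[of "(\<lambda>\<sigma>. p + \<sigma> *\<^sub>R v) ` {0..1}" U] U seg by blast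
  define d where "d = e / (2 * (norm w + 1))"
  have d: "d > 0" using e by (simp add: d_def add_nonneg_pos)
  define I where "I = {-d..d}"
  have I: "0 \<in> I" "convex I" "compact I" "interior I = {-d<..<d}" using d by (auto simp: I_def)
  have xU: "?x \<delta> \<sigma> \<in> U" if "\<delta> \<in> I" "\<sigma> \<in> {0..1}" for \<delta> \<sigma>
  proof -
    have "\<bar>\<delta>\<bar> * norm w \<le> d * (norm w + 1)" using that(1) by (intro mult_mono) (auto simp: I_def)
    also have "\<dots> = e / 2" 
      using add_nonneg_pos[OF norm_ge_zero[of w] zero_less_one] by (simp add: d_def divide_simps)
    also have "\<dots> < e" using e by simp
    finally have "?x \<delta> \<sigma> \<in> ball (p + \<sigma> *\<^sub>R v) e" by (simp add: dist_norm)
    then show ?thesis using e that by blast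
  qed
  have linF: "linear (F' x)" if "x \<in> U" for x using F(1)[OF that] by (rule has_derivative_linear)
  have linB: "linear (B' x)" if "x \<in> V" for x using B(1)[OF that] by (rule has_derivative_linear)
  note cF' = continuous_on_derivative_compose[of U F', OF linF F(2)]
  note cB' = continuous_on_derivative_compose[of V B', OF linB B(2)]
  have cF: "continuous_on U F" by (rule has_derivative_continuous_on, rule has_derivative_at_withinI, rule F(1))
  have cB: "continuous_on V B" by (rule has_derivative_continuous_on, rule has_derivative_at_withinI, rule B(1))
  have cF2: "continuous_on S (\<lambda>s. F (g s))" if "continuous_on S g" "g ` S \<subseteq> U" for S :: "'t::topological_space set" and g
    using continuous_on_compose2[OF cF that] .
  have cB2: "continuous_on S (\<lambda>s. B (g s))" if "continuous_on S g" "g ` S \<subseteq> V" for S :: "'t::topological_space set" and g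
    using continuous_on_compose2[OF cB that] .
  have FxV: "F (?x \<delta> \<sigma>) \<in> V" if "\<delta> \<in> I" "\<sigma> \<in> {0..1}" for \<delta> \<sigma> using xU[OF that] FV by blast
  note cont = cF' cB' cF2 cB2
  have x0: "?x 0 \<sigma> = p + \<sigma> *\<^sub>R v" for \<sigma> by simp
  have xU0: "p + \<sigma> *\<^sub>R v \<in> U" "F (p + \<sigma> *\<^sub>R v) \<in> V" if "\<sigma> \<in> {0..1}" for \<sigma>
    using xU[OF I(1) that] FxV[OF I(1) that] by auto
  define x where "x = ?x"
  have xUim: "x \<delta> ` {0..1} \<subseteq> U" "(\<lambda>\<sigma>. F (x \<delta> \<sigma>)) ` {0..1} \<subseteq> V" if "\<delta> \<in> I" for \<delta>
    using xU FxV that by (auto simp: x_def)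
  have xUim2: "(\<lambda>z. x (fst z) (snd z)) ` (I \<times> {0..1}) \<subseteq> U" "(\<lambda>z. F (x (fst z) (snd z))) ` (I \<times> {0..1}) \<subseteq> V"
      "(\<lambda>z. x 0 (snd z)) ` (I \<times> {0..1}) \<subseteq> U" "(\<lambda>z. F (x 0 (snd z))) ` (I \<times> {0..1}) \<subseteq> V"
    using xU FxV xU0 I(1) by (auto simp: x_def)
  have cx: "continuous_on {0..1} (x \<delta>)" for \<delta> by (auto simp: x_def intro!: continuous_intros)
  have cx2: "continuous_on (I \<times> {0..1}) (\<lambda>z. x (fst z) (snd z))" "continuous_on (I \<times> {0..1}) (\<lambda>z. x 0 (snd z))"
    by (auto simp: x_def intro!: continuous_intros)
  have dx: "((\<lambda>\<delta>. F (x \<delta> \<sigma>)) has_vector_derivative F' (x \<delta> \<sigma>) w) (at \<delta> within I)" if "\<delta> \<in> I" "\<sigma> \<in> {0..1}" for \<delta> \<sigma>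
  proof -
    have "((\<lambda>\<delta>. x \<delta> \<sigma>) has_vector_derivative w) (at \<delta> within I)"
      unfolding x_def by (auto intro!: derivative_eq_intros)
    from vector_derivative_diff_chain_within[OF this, of F "F' (x \<delta> \<sigma>)"] F(1)[of "x \<delta> \<sigma>"] xU[OF that]
    show ?thesis by (auto simp: x_def o_def has_derivative_at_withinI)
  qed
  have ds: "((\<lambda>\<sigma>. F (x \<delta> \<sigma>)) has_vector_derivative F' (x \<delta> \<sigma>) v) (at \<sigma> within {0..1})" if "\<delta> \<in> I" "\<sigma> \<in> {0..1}" for \<delta> \<sigma>
  proof -
    have "(x \<delta> has_vector_derivative v) (at \<sigma> within {0..1})"
      unfolding x_def by (auto intro!: derivative_eq_intros)
    from vector_derivative_diff_chain_within[OF this, of F "F' (x \<delta> \<sigma>)"] F(1)[of "x \<delta> \<sigma>"] xU[OF that]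
    show ?thesis by (auto simp: x_def o_def has_derivative_at_withinI)
  qed
  have dB: "((\<lambda>s. B (c s)) has_vector_derivative B' (c t) c') (at t within S)"
    if "(c has_vector_derivative c') (at t within S)" "c t \<in> V" for c c' t S
    using vector_derivative_diff_chain_within[OF that(1), of B "B' (c t)"] B(1)[OF that(2)]
    by (auto simp: o_def has_derivative_at_withinI)
  have box: "cbox 0 (1::real) = {0..1}" by simp
  have di: "((\<lambda>s. a s \<bullet> b s) has_real_derivative a' \<bullet> b t + a t \<bullet> b') (at t within S)"
    if "(a has_vector_derivative a') (at t within S)" "(b has_vector_derivative b') (at t within S)"
    for a b :: "real \<Rightarrow> 'b" and a' b' t S
    using has_derivative_inner[OF that[unfolded has_vector_derivative_def]]
    unfolding has_field_derivative_def by (rule has_derivative_eq_rhs) (auto simp: algebra_simps)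
  \<comment> \<open>the part in which only the form is moved\<close>
  have h1: "((\<lambda>\<delta>. integral {0..1} (\<lambda>\<sigma>. B (F (x \<delta> \<sigma>)) \<bullet> F' (x 0 \<sigma>) v)) has_real_derivative
      integral {0..1} (\<lambda>\<sigma>. B' (F (x 0 \<sigma>)) (F' (x 0 \<sigma>) w) \<bullet> F' (x 0 \<sigma>) v)) (at 0 within I)"
    unfolding box[symmetric]
  proof (rule leibniz_rule_field_derivative[where fx = "\<lambda>\<delta> \<sigma>. B' (F (x \<delta> \<sigma>)) (F' (x \<delta> \<sigma>) w) \<bullet> F' (x 0 \<sigma>) v", OF _ _ _ I(1,2)], unfold box)
    fix \<delta> \<sigma> :: real assume *: "\<delta> \<in> I" "\<sigma> \<in> {0..1}"
    show "((\<lambda>\<delta>. B (F (x \<delta> \<sigma>)) \<bullet> F' (x 0 \<sigma>) v) has_real_derivative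
      B' (F (x \<delta> \<sigma>)) (F' (x \<delta> \<sigma>) w) \<bullet> F' (x 0 \<sigma>) v) (at \<delta> within I)"
      using di[OF dB[OF dx[OF *]] has_vector_derivative_const[of "F' (x 0 \<sigma>) v"]] FxV[OF *] by (simp add: x_def)
  next
    fix \<delta> :: real assume *: "\<delta> \<in> I"
    show "(\<lambda>\<sigma>. B (F (x \<delta> \<sigma>)) \<bullet> F' (x 0 \<sigma>) v) integrable_on {0..1}"
      by (intro integrable_continuous_real continuous_intros cont cx xUim * I)
  next
    show "continuous_on (I \<times> {0..1}) (\<lambda>(\<delta>, \<sigma>). B' (F (x \<delta> \<sigma>)) (F' (x \<delta> \<sigma>) w) \<bullet> F' (x 0 \<sigma>) v)"
      unfolding split_beta by (intro continuous_intros cont cx2 xUim2)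
  qed
  \<comment> \<open>the part in which only the curve is moved, after an integration by parts\<close>
  have h2: "((\<lambda>\<delta>. integral {0..1} (\<lambda>\<sigma>. B' (F (x 0 \<sigma>)) (F' (x 0 \<sigma>) v) \<bullet> F (x \<delta> \<sigma>))) has_real_derivative
      integral {0..1} (\<lambda>\<sigma>. B' (F (x 0 \<sigma>)) (F' (x 0 \<sigma>) v) \<bullet> F' (x 0 \<sigma>) w)) (at 0 within I)"
    unfolding box[symmetric]
  proof (rule leibniz_rule_field_derivative[where fx = "\<lambda>\<delta> \<sigma>. B' (F (x 0 \<sigma>)) (F' (x 0 \<sigma>) v) \<bullet> F' (x \<delta> \<sigma>) w", OF _ _ _ I(1,2)], unfold box)
    fix \<delta> \<sigma> :: real assume *: "\<delta> \<in> I" "\<sigma> \<in> {0..1}"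
    show "((\<lambda>\<delta>. B' (F (x 0 \<sigma>)) (F' (x 0 \<sigma>) v) \<bullet> F (x \<delta> \<sigma>)) has_real_derivative
      B' (F (x 0 \<sigma>)) (F' (x 0 \<sigma>) v) \<bullet> F' (x \<delta> \<sigma>) w) (at \<delta> within I)"
      using di[OF has_vector_derivative_const[of "B' (F (x 0 \<sigma>)) (F' (x 0 \<sigma>) v)"] dx[OF *]] by simp
  next
    fix \<delta> :: real assume *: "\<delta> \<in> I"
    show "(\<lambda>\<sigma>. B' (F (x 0 \<sigma>)) (F' (x 0 \<sigma>) v) \<bullet> F (x \<delta> \<sigma>)) integrable_on {0..1}"
      by (intro integrable_continuous_real continuous_intros cont cx xUim * I)
  next
    show "continuous_on (I \<times> {0..1}) (\<lambda>(\<delta>, \<sigma>). B' (F (x 0 \<sigma>)) (F' (x 0 \<sigma>) v) \<bullet> F' (x \<delta> \<sigma>) w)"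
      unfolding split_beta by (intro continuous_intros cont cx2 xUim2)
  qed
  have parts: "integral {0..1} (\<lambda>\<sigma>. B (F (x 0 \<sigma>)) \<bullet> F' (x \<delta> \<sigma>) v)
      = B (F (p + v)) \<bullet> F (p + v + \<delta> *\<^sub>R w) - B (F p) \<bullet> F (p + \<delta> *\<^sub>R w)
        - integral {0..1} (\<lambda>\<sigma>. B' (F (x 0 \<sigma>)) (F' (x 0 \<sigma>) v) \<bullet> F (x \<delta> \<sigma>))" if *: "\<delta> \<in> I" for \<delta>
  proof -
    have "((\<lambda>\<sigma>. B' (F (x 0 \<sigma>)) (F' (x 0 \<sigma>) v) \<bullet> F (x \<delta> \<sigma>) + B (F (x 0 \<sigma>)) \<bullet> F' (x \<delta> \<sigma>) v) has_integral
        B (F (x 0 1)) \<bullet> F (x \<delta> 1) - B (F (x 0 0)) \<bullet> F (x \<delta> 0)) {0..1}"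
    proof (rule fundamental_theorem_of_calculus)
      fix \<sigma> :: real assume s: "\<sigma> \<in> {0..1}"
      show "((\<lambda>\<sigma>. B (F (x 0 \<sigma>)) \<bullet> F (x \<delta> \<sigma>)) has_vector_derivative
         B' (F (x 0 \<sigma>)) (F' (x 0 \<sigma>) v) \<bullet> F (x \<delta> \<sigma>) + B (F (x 0 \<sigma>)) \<bullet> F' (x \<delta> \<sigma>) v) (at \<sigma> within {0..1})"
        using di[OF dB[OF ds[OF I(1) s]] ds[OF * s]] FxV[OF I(1) s] 
        by (simp add: x_def has_real_derivative_iff_has_vector_derivative)
    qed simp
    then have "integral {0..1} (\<lambda>\<sigma>. B' (F (x 0 \<sigma>)) (F' (x 0 \<sigma>) v) \<bullet> F (x \<delta> \<sigma>) + B (F (x 0 \<sigma>)) \<bullet> F' (x \<delta> \<sigma>) v)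
        = B (F (x 0 1)) \<bullet> F (x \<delta> 1) - B (F (x 0 0)) \<bullet> F (x \<delta> 0)" by (rule integral_unique)
    moreover have "integral {0..1} (\<lambda>\<sigma>. B' (F (x 0 \<sigma>)) (F' (x 0 \<sigma>) v) \<bullet> F (x \<delta> \<sigma>) + B (F (x 0 \<sigma>)) \<bullet> F' (x \<delta> \<sigma>) v)
      = integral {0..1} (\<lambda>\<sigma>. B' (F (x 0 \<sigma>)) (F' (x 0 \<sigma>) v) \<bullet> F (x \<delta> \<sigma>))
        + integral {0..1} (\<lambda>\<sigma>. B (F (x 0 \<sigma>)) \<bullet> F' (x \<delta> \<sigma>) v)"
      by (rule integral_add; intro integrable_continuous_real continuous_intros cont cx xUim * I)
    ultimately show ?thesis by (simp add: x_def add_ac)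
  qed
  have dend: "((\<lambda>\<delta>. B (F (p + v)) \<bullet> F (p + v + \<delta> *\<^sub>R w) - B (F p) \<bullet> F (p + \<delta> *\<^sub>R w)) has_real_derivative
      B (F (p + v)) \<bullet> F' (p + v) w - B (F p) \<bullet> F' p w) (at 0 within I)"
    using DERIV_diff[OF di[OF has_vector_derivative_const[of "B (F (p + v))"] dx[OF I(1), of 1]]
        di[OF has_vector_derivative_const[of "B (F p)"] dx[OF I(1), of 0]]]
    by (simp add: x_def add_ac)
  have h2b: "((\<lambda>\<delta>. integral {0..1} (\<lambda>\<sigma>. B (F (x 0 \<sigma>)) \<bullet> F' (x \<delta> \<sigma>) v)) has_real_derivative
     B (F (p + v)) \<bullet> F' (p + v) w - B (F p) \<bullet> F' p w 
     - integral {0..1} (\<lambda>\<sigma>. B' (F (x 0 \<sigma>)) (F' (x 0 \<sigma>) v) \<bullet> F' (x 0 \<sigma>) w)) (at 0 within I)"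
    (is "(_ has_real_derivative ?E) _")
  proof (rule has_field_derivative_transform_on[OF I(1)])
    show "((\<lambda>\<delta>. B (F (p + v)) \<bullet> F (p + v + \<delta> *\<^sub>R w) - B (F p) \<bullet> F (p + \<delta> *\<^sub>R w)
        - integral {0..1} (\<lambda>\<sigma>. B' (F (x 0 \<sigma>)) (F' (x 0 \<sigma>) v) \<bullet> F (x \<delta> \<sigma>))) has_real_derivative ?E) (at 0 within I)"
      by (intro DERIV_diff dend h2)
  qed (rule parts)
  \<comment> \<open>the part in which both are moved is of higher order, since \<open>F'\<close> is continuous\<close>
  let ?r = "\<lambda>\<delta> \<sigma>. (B (F (x \<delta> \<sigma>)) - B (F (x 0 \<sigma>))) \<bullet> (F' (x \<delta> \<sigma>) v - F' (x 0 \<sigma>) v)"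
  have h3: "((\<lambda>\<delta>. integral {0..1} (?r \<delta>)) has_real_derivative 0) (at 0 within I)"
  proof -
    have cpt: "compact (I \<times> {0..1::real})" using I(3) by (intro compact_Times) auto
    have "compact ((\<lambda>z. B' (F (x (fst z) (snd z))) (F' (x (fst z) (snd z)) w)) ` (I \<times> {0..1}))"
      by (rule compact_continuous_image[OF _ cpt]) (intro continuous_intros cont cx2 xUim2)
    then obtain C where C: "\<And>\<delta> \<sigma>. \<delta> \<in> I \<Longrightarrow> \<sigma> \<in> {0..1} \<Longrightarrow> norm (B' (F (x \<delta> \<sigma>)) (F' (x \<delta> \<sigma>) w)) \<le> C"
      unfolding compact_eq_bounded_closed bounded_iff by fastforce
    have C0: "C \<ge> 0" using order_trans[OF norm_ge_zero C[OF I(1), of 0]] by simp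
    have lip: "norm (B (F (x \<delta> \<sigma>)) - B (F (x 0 \<sigma>))) \<le> C * \<bar>\<delta>\<bar>" if "\<delta> \<in> I" "\<sigma> \<in> {0..1}" for \<delta> \<sigma>
    proof -
      have "norm (B (F (x \<delta> \<sigma>)) - B (F (x 0 \<sigma>))) \<le> C * norm (\<delta> - 0)"
      proof (rule differentiable_bound[OF I(2), of "\<lambda>\<delta>. B (F (x \<delta> \<sigma>))" "\<lambda>\<delta> h. h *\<^sub>R B' (F (x \<delta> \<sigma>)) (F' (x \<delta> \<sigma>) w)", OF _ _ that(1) I(1)])
        fix s assume s: "s \<in> I"
        show "((\<lambda>\<delta>. B (F (x \<delta> \<sigma>))) has_derivative (\<lambda>h. h *\<^sub>R B' (F (x s \<sigma>)) (F' (x s \<sigma>) w))) (at s within I)"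
          using dB[OF dx[OF s that(2)]] FxV[OF s that(2)] by (simp add: x_def has_vector_derivative_def)
        show "onorm (\<lambda>h. h *\<^sub>R B' (F (x s \<sigma>)) (F' (x s \<sigma>) w)) \<le> C"
          using C[OF s that(2)] by (simp add: onorm_scaleR_left onorm_id) 
      qed
      then show ?thesis by simp
    qed
    have unif: "uniformly_continuous_on (I \<times> {0..1}) (\<lambda>z. F' (x (fst z) (snd z)) v)"
      by (rule compact_uniformly_continuous[OF _ cpt]) (intro continuous_intros cont cx2 xUim2)
    show ?thesis
      unfolding has_field_derivative_iff
    proof (rule tendstoI)
      fix \<epsilon> :: real assume "\<epsilon> > 0"
      define \<eta> where "\<eta> = \<epsilon> / (2 * (C + 1))"
      have \<eta>: "\<eta> > 0" using \<open>\<epsilon> > 0\<close> C0 by (simp add: \<eta>_def)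
      obtain \<delta>0 where \<delta>0: "\<delta>0 > 0" "\<And>z z'. z \<in> I \<times> {0..1} \<Longrightarrow> z' \<in> I \<times> {0..1} \<Longrightarrow> dist z' z < \<delta>0 \<Longrightarrow>
          dist (F' (x (fst z') (snd z')) v) (F' (x (fst z) (snd z)) v) < \<eta>"
        using unif[unfolded uniformly_continuous_on_def, rule_format, OF \<eta>] by blast
      have "\<forall>\<^sub>F \<delta> in at 0 within I. \<delta> \<noteq> 0 \<and> \<delta> \<in> I \<and> \<bar>\<delta>\<bar> < \<delta>0"
        using \<delta>0(1) unfolding eventually_at by (intro exI[of _ \<delta>0]) auto
      then show "\<forall>\<^sub>F \<delta> in at 0 within I.
         dist ((integral {0..1} (?r \<delta>) - integral {0..1} (?r 0)) / (\<delta> - 0)) 0 < \<epsilon>"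
      proof eventually_elim
        case (elim \<delta>)
        have "norm (integral {0..1} (?r \<delta>)) \<le> integral {0..1} (\<lambda>\<sigma>::real. C * \<bar>\<delta>\<bar> * \<eta>)"
        proof (rule integral_norm_bound_integral)
          show "?r \<delta> integrable_on {0..1}"
            by (intro integrable_continuous_real continuous_intros cont cx xUim I) (use elim in auto)
          fix \<sigma> :: real assume s: "\<sigma> \<in> {0..1}"
          have "norm (?r \<delta> \<sigma>) \<le> norm (B (F (x \<delta> \<sigma>)) - B (F (x 0 \<sigma>))) * norm (F' (x \<delta> \<sigma>) v - F' (x 0 \<sigma>) v)"
            using Cauchy_Schwarz_ineq2 by auto
          also have "\<dots> \<le> (C * \<bar>\<delta>\<bar>) * \<eta>"
          proof (rule mult_mono)
            show "norm (F' (x \<delta> \<sigma>) v - F' (x 0 \<sigma>) v) \<le> \<eta>"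
              using \<delta>0(2)[of "(0,\<sigma>)" "(\<delta>,\<sigma>)"] elim s I(1) by (auto simp: dist_Pair_Pair dist_norm)
          qed (use lip elim s C0 in auto)
          finally show "norm (?r \<delta> \<sigma>) \<le> C * \<bar>\<delta>\<bar> * \<eta>" .
        qed auto
        also have "\<dots> = \<bar>\<delta>\<bar> * (C * \<eta>)" by simp
        also have "\<dots> < \<bar>\<delta>\<bar> * \<epsilon>"
        proof (rule mult_strict_left_mono)
          have "C * \<epsilon> < 2 * (C + 1) * \<epsilon>" using C0 \<open>\<epsilon> > 0\<close> by (intro mult_strict_right_mono) auto
          then show "C * \<eta> < \<epsilon>" using C0 \<open>\<epsilon> > 0\<close> by (simp add: \<eta>_def field_simps)
        qed (use elim in auto)
        finally show ?case using elim by (simp add: dist_norm abs_divide field_simps)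
      qed
    qed
  qed
  have split: "integral {0..1} (?i \<delta>) = integral {0..1} (\<lambda>\<sigma>. B (F (x \<delta> \<sigma>)) \<bullet> F' (x 0 \<sigma>) v)
     + integral {0..1} (\<lambda>\<sigma>. B (F (x 0 \<sigma>)) \<bullet> F' (x \<delta> \<sigma>) v) + integral {0..1} (?r \<delta>)
     - integral {0..1} (\<lambda>\<sigma>. B (F (x 0 \<sigma>)) \<bullet> F' (x 0 \<sigma>) v)" if "\<delta> \<in> I" for \<delta>
  proof -
    have int: "(\<lambda>\<sigma>. B (F (x \<delta> \<sigma>)) \<bullet> F' (x 0 \<sigma>) v) integrable_on {0..1}"
       "(\<lambda>\<sigma>. B (F (x 0 \<sigma>)) \<bullet> F' (x \<delta> \<sigma>) v) integrable_on {0..1}"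
       "?r \<delta> integrable_on {0..1}" "(\<lambda>\<sigma>. B (F (x 0 \<sigma>)) \<bullet> F' (x 0 \<sigma>) v) integrable_on {0..1}"
      by (auto intro!: integrable_continuous_real continuous_intros cont cx xUim I that)
    have "?i \<delta> = (\<lambda>\<sigma>. ((B (F (x \<delta> \<sigma>)) \<bullet> F' (x 0 \<sigma>) v + B (F (x 0 \<sigma>)) \<bullet> F' (x \<delta> \<sigma>) v) + ?r \<delta> \<sigma>)
        - B (F (x 0 \<sigma>)) \<bullet> F' (x 0 \<sigma>) v)"
      by (auto simp: x_def inner_diff algebra_simps)
    then show ?thesis
      by (simp only: integral_diff[OF integrable_add[OF integrable_add[OF int(1,2)] int(3)] int(4)]
          integral_add[OF integrable_add[OF int(1,2)] int(3)] integral_add[OF int(1,2)])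
  qed
  have "((\<lambda>\<delta>. integral {0..1} (?i \<delta>)) has_real_derivative
      (integral {0..1} (\<lambda>\<sigma>. B' (F (x 0 \<sigma>)) (F' (x 0 \<sigma>) w) \<bullet> F' (x 0 \<sigma>) v)
       + (B (F (p + v)) \<bullet> F' (p + v) w - B (F p) \<bullet> F' p w 
     - integral {0..1} (\<lambda>\<sigma>. B' (F (x 0 \<sigma>)) (F' (x 0 \<sigma>) v) \<bullet> F' (x 0 \<sigma>) w)) + 0 - 0)) (at 0 within I)"
    (is "(_ has_real_derivative ?E) _")
  proof (rule has_field_derivative_transform_on[OF I(1)])
    show "((\<lambda>\<delta>. integral {0..1} (\<lambda>\<sigma>. B (F (x \<delta> \<sigma>)) \<bullet> F' (x 0 \<sigma>) v)
     + integral {0..1} (\<lambda>\<sigma>. B (F (x 0 \<sigma>)) \<bullet> F' (x \<delta> \<sigma>) v) + integral {0..1} (?r \<delta>)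
     - integral {0..1} (\<lambda>\<sigma>. B (F (x 0 \<sigma>)) \<bullet> F' (x 0 \<sigma>) v)) has_real_derivative ?E) (at 0 within I)"
      by (intro DERIV_diff DERIV_add DERIV_const h1 h2b h3)
  qed (rule split)
  moreover have "integral {0..1} (\<lambda>\<sigma>. B' (F (x 0 \<sigma>)) (F' (x 0 \<sigma>) w) \<bullet> F' (x 0 \<sigma>) v)
      - integral {0..1} (\<lambda>\<sigma>. B' (F (x 0 \<sigma>)) (F' (x 0 \<sigma>) v) \<bullet> F' (x 0 \<sigma>) w)
    = integral {0..1} (\<lambda>\<sigma>. B' (F (x 0 \<sigma>)) (F' (x 0 \<sigma>) w) \<bullet> F' (x 0 \<sigma>) v
        - B' (F (x 0 \<sigma>)) (F' (x 0 \<sigma>) v) \<bullet> F' (x 0 \<sigma>) w)"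
    by (rule integral_diff[symmetric]; intro integrable_continuous_real continuous_intros cont cx xUim I)
  moreover have "at 0 within I = at 0" using I(4) d by (intro at_within_interior) auto
  ultimately show ?thesis by (simp add: x_def algebra_simps)
qed

section \<open>Slopes of a function along a continuous vector field\<close>

lemma compact_neighbourhood_in_open:
  fixes K :: "'a::euclidean_space set"
  assumes "compact K" "open U" "K \<subseteq> U"
  obtains d K' where "d > 0" "compact K'" "K' \<subseteq> U" "\<And>x y. x \<in> K \<Longrightarrow> dist x y \<le> d \<Longrightarrow> y \<in> K'"
proof -
  obtain e where e: "e > 0" "(\<Union>x\<in>K. ball x e) \<subseteq> U"
    using compact_subset_open_imp_ball_epsilon_subset[OF assms] by blast
  let ?K' = "(\<Union>x\<in>K. \<Union>y\<in>cball 0 (e/2). {x + y})"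
  have "compact ?K'" using assms(1) by (intro compact_sums') auto
  moreover have "?K' \<subseteq> U"
  proof clarsimp
    fix x y assume "x \<in> K" "norm (y::'a) * 2 \<le> e"
    then have "x + y \<in> ball x e" using e(1) by (auto simp: dist_norm)
    then show "x + y \<in> U" using e(2) \<open>x \<in> K\<close> by blast
  qed
  moreover have "y \<in> ?K'" if "x \<in> K" "dist x y \<le> e/2" for x y
    by (rule UN_I[OF that(1)], rule UN_I[of "y - x"]) (use that in \<open>auto simp: dist_norm norm_minus_commute\<close>)
  ultimately show thesis using that[of "e/2" ?K'] e(1) by auto
qed

lemma abs_diff_scaled_le:
  fixes h :: real
  assumes "0 < h" "\<bar>a - b\<bar> \<le> e" shows "\<bar>h * a - h * b\<bar> \<le> e * h"
proof -
  have "\<bar>h * a - h * b\<bar> = h * \<bar>a - b\<bar>" using assms(1) by (simp add: abs_mult flip: right_diff_distrib)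
  also have "\<dots> \<le> h * e" using assms by simp
  finally show ?thesis by (simp add: mult.commute)
qed

text \<open>
  \<open>n\<close> steps, each of which is close to \<open>h v\<close> and changes \<open>f\<close> by about \<open>h g\<close>.  The errors are proportional to
  the length of the step, so they add up to errors with the same factors over the total length; \<open>R\<close> only serves to
  keep the polygon in the region where steps are available.
\<close>

lemma Euler_chain:
  fixes p v :: "'a::real_normed_vector" and f :: "'a \<Rightarrow> real"
  assumes step: "\<And>q. dist p q \<le> R \<Longrightarrow>
        \<exists>q'. norm (q' - q - h *\<^sub>R v) \<le> e * h \<and> \<bar>f q' - f q - h * g\<bar> \<le> e' * h"
    and h: "h \<ge> 0" "e \<ge> 0" and n: "real n * h * (norm v + e) \<le> R"
  shows "\<exists>q'. norm (q' - p - (real n * h) *\<^sub>R v) \<le> e * (real n * h)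
           \<and> \<bar>f q' - f p - real n * h * g\<bar> \<le> e' * (real n * h)"
  using n
proof (induction n)
  case 0
  then show ?case by (auto intro: exI[of _ p])
next
  case (Suc n)
  have nh: "real n * h * (norm v + e) \<le> real (Suc n) * h * (norm v + e)"
    using h by (intro mult_right_mono) (auto intro: mult_right_mono)
  then obtain q where q: "norm (q - p - (real n * h) *\<^sub>R v) \<le> e * (real n * h)"
      "\<bar>f q - f p - real n * h * g\<bar> \<le> e' * (real n * h)"
    using Suc by fastforce
  have "norm (q - p) \<le> norm (q - p - (real n * h) *\<^sub>R v) + norm ((real n * h) *\<^sub>R v)"
    by (metis diff_add_cancel norm_triangle_ineq)
  also have "\<dots> \<le> real n * h * (norm v + e)" using q(1) h by (simp add: algebra_simps)
  finally have "dist p q \<le> R" using nh Suc.prems by (simp add: dist_norm norm_minus_commute)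
  from step[OF this] obtain q' where q': "norm (q' - q - h *\<^sub>R v) \<le> e * h" "\<bar>f q' - f q - h * g\<bar> \<le> e' * h"
    by blast
  have "q' - p - (real (Suc n) * h) *\<^sub>R v = (q' - q - h *\<^sub>R v) + (q - p - (real n * h) *\<^sub>R v)"
    by (simp add: algebra_simps)
  then have "norm (q' - p - (real (Suc n) * h) *\<^sub>R v) \<le> e * h + e * (real n * h)"
    using q'(1) q(1) by (metis norm_triangle_mono)
  moreover have "\<bar>f q' - f p - real (Suc n) * h * g\<bar> \<le> e' * h + e' * (real n * h)"
  proof -
    have "f q' - f p - real (Suc n) * h * g = (f q' - f q - h * g) + (f q - f p - real n * h * g)"
      by (simp add: algebra_simps)
    then show ?thesis using q'(2) q(2) by linarith
  qed
  ultimately show ?case by (intro exI[of _ q']) (simp add: algebra_simps)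
qed

text \<open>
  A derivative of \<open>f\<close> along the vector field \<open>w\<close>: suitable points \<open>p'\<close> with displacement \<open>h w(p) + o(h)\<close> have
  the increment \<open>h g(p) + o(h)\<close>, uniformly on compact sets.  The point \<open>p + h w(p)\<close> itself will not do: \<open>p'\<close> is going
  to be the end point of an Euler polygon of \<open>w\<close>, and \<open>f\<close> is not known to be Lipschitz.
\<close>

definition has_slope_along ::
    "'a::euclidean_space set \<Rightarrow> ('a \<Rightarrow> real) \<Rightarrow> ('a \<Rightarrow> 'a) \<Rightarrow> ('a \<Rightarrow> real) \<Rightarrow> bool" where
  "has_slope_along U f w g \<longleftrightarrow> (\<forall>K e. compact K \<longrightarrow> K \<subseteq> U \<longrightarrow> e > 0 \<longrightarrow>
     (\<exists>h0>0. \<forall>h. 0 < h \<longrightarrow> h \<le> h0 \<longrightarrow> (\<forall>p\<in>K. \<exists>p'.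
        norm (p' - p - h *\<^sub>R w p) \<le> e * h \<and> \<bar>f p' - f p - h * g p\<bar> \<le> e * h)))"

lemma has_slope_alongD:
  assumes "has_slope_along U f w g" "compact K" "K \<subseteq> U" "e > 0"
  obtains h0 where "h0 > 0" "\<And>h p. 0 < h \<Longrightarrow> h \<le> h0 \<Longrightarrow> p \<in> K \<Longrightarrow>
     \<exists>p'. norm (p' - p - h *\<^sub>R w p) \<le> e * h \<and> \<bar>f p' - f p - h * g p\<bar> \<le> e * h"
  using assms unfolding has_slope_along_def by meson

lemma has_slope_along_minus:
  assumes "has_slope_along U f w g" shows "has_slope_along U (\<lambda>x. - f x) w (\<lambda>x. - g x)"
proof -
  have "\<bar>- f q - (- f p) - h * (- g p)\<bar> = \<bar>f q - f p - h * g p\<bar>" for p q h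
    by (simp add: algebra_simps abs_minus_commute)
  then show ?thesis using assms unfolding has_slope_along_def by presburger
qed

text \<open>
  If the functions \<open>b\<close> converge uniformly to \<open>f\<close> and their derivatives along \<open>w\<close> converge uniformly to \<open>g\<close>,
  then \<open>f\<close> has the slope \<open>g\<close>.  Increments of \<open>b\<close> are controlled only over tiny steps, whose size
  depends on \<open>b\<close>; an Euler polygon of such steps covers a given distance \<open>h\<close>.
\<close>

lemma has_slope_along_approx:
  fixes w :: "'a::euclidean_space \<Rightarrow> 'a"
  assumes U: "open U" and w: "continuous_on U w" and g: "continuous_on U g"
    and approx: "\<And>K e. compact K \<Longrightarrow> K \<subseteq> U \<Longrightarrow> e > 0 \<Longrightarrow>
      \<exists>b. (\<forall>q\<in>K. \<bar>b q - f q\<bar> \<le> e) \<and>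
          (\<exists>l0>0. \<forall>l. 0 < l \<longrightarrow> l \<le> l0 \<longrightarrow> (\<forall>q\<in>K. \<bar>b (q + l *\<^sub>R w q) - b q - l * g q\<bar> \<le> e * l))"
  shows "has_slope_along U f w g"
  unfolding has_slope_along_def
proof (intro allI impI)
  fix K :: "'a set" and e :: real assume K: "compact K" "K \<subseteq> U" and e: "e > 0"
  obtain d K' where d: "d > 0" and K': "compact K'" "K' \<subseteq> U"
      and dK: "\<And>x y. x \<in> K \<Longrightarrow> dist x y \<le> d \<Longrightarrow> y \<in> K'"
    using compact_neighbourhood_in_open[OF K(1) U K(2)] by metis
  define \<epsilon> where "\<epsilon> = e / 5"
  have \<epsilon>: "\<epsilon> > 0" using e by (simp add: \<epsilon>_def)
  have wK: "continuous_on K' w" "continuous_on K' g" using w g K'(2) continuous_on_subset by auto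
  have "compact (w ` K')" using compact_continuous_image[OF wK(1) K'(1)] .
  then obtain W where W: "\<And>q. q \<in> K' \<Longrightarrow> norm (w q) \<le> W"
    unfolding compact_eq_bounded_closed bounded_iff by auto
  obtain R1 where R1: "R1 > 0" "\<And>p q. p \<in> K' \<Longrightarrow> q \<in> K' \<Longrightarrow> dist p q < R1 \<Longrightarrow> dist (w p) (w q) < \<epsilon>"
    using compact_uniformly_continuous[OF wK(1) K'(1)] \<epsilon> unfolding uniformly_continuous_on_def by metis
  obtain R2 where R2: "R2 > 0" "\<And>p q. p \<in> K' \<Longrightarrow> q \<in> K' \<Longrightarrow> dist p q < R2 \<Longrightarrow> dist (g p) (g q) < \<epsilon>"
    using compact_uniformly_continuous[OF wK(2) K'(1)] \<epsilon> unfolding uniformly_continuous_on_def by metis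
  define R where "R = min d (min R1 R2 / 2)"
  have R: "R > 0" "R \<le> d" "R < R1" "R < R2" using d R1(1) R2(1) by (auto simp: R_def min_def)
  define h0 where "h0 = R / (\<bar>W\<bar> + 2 * \<epsilon> + 1)"
  have den: "\<bar>W\<bar> + 2 * \<epsilon> + 1 > 0" using \<epsilon> by simp
  have h0: "h0 > 0" using R den by (simp add: h0_def)
  show "\<exists>h0>0. \<forall>h. 0 < h \<longrightarrow> h \<le> h0 \<longrightarrow> (\<forall>p\<in>K. \<exists>p'.
        norm (p' - p - h *\<^sub>R w p) \<le> e * h \<and> \<bar>f p' - f p - h * g p\<bar> \<le> e * h)"
  proof (intro exI[of _ h0] conjI h0 allI impI ballI)
    fix h p assume h: "0 < h" "h \<le> h0" and p: "p \<in> K"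
    have "h * (\<bar>W\<bar> + 2 * \<epsilon> + 1) \<le> R" using h(2) den by (simp add: h0_def pos_le_divide_eq)
    moreover have pK: "p \<in> K'" using dK[OF p, of p] d by simp
    ultimately have hR: "h * (norm (w p) + 2 * \<epsilon>) \<le> R"
      using W[OF pK] h(1) by (smt (verit, best) mult_left_mono)
    have near: "q \<in> K'" "norm (w q - w p) \<le> \<epsilon>" "\<bar>g q - g p\<bar> \<le> \<epsilon>" if "dist p q \<le> R" for q
    proof -
      show "q \<in> K'" using dK[OF p, of q] that R by simp
      then show "norm (w q - w p) \<le> \<epsilon>" "\<bar>g q - g p\<bar> \<le> \<epsilon>"
        using R1(2)[OF pK, of q] R2(2)[OF pK, of q] that R by (auto simp: dist_norm norm_minus_commute abs_minus_commute)
    qed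
    \<comment> \<open>The approximation \<open>b\<close> is chosen after \<open>h\<close> and within \<open>\<epsilon> h\<close> of \<open>f\<close>, so that replacing \<open>f\<close> by \<open>b\<close> costs
      only \<open>O(\<epsilon> h)\<close>.\<close>
    obtain b l0 where b: "\<And>q. q \<in> K' \<Longrightarrow> \<bar>b q - f q\<bar> \<le> min \<epsilon> (\<epsilon> * h)" and l0: "l0 > 0"
      and bl: "\<And>l q. 0 < l \<Longrightarrow> l \<le> l0 \<Longrightarrow> q \<in> K' \<Longrightarrow> \<bar>b (q + l *\<^sub>R w q) - b q - l * g q\<bar> \<le> min \<epsilon> (\<epsilon> * h) * l"
      using approx[OF K', of "min \<epsilon> (\<epsilon> * h)"] \<epsilon> h(1) by (metis min_less_iff_conj mult_pos_pos)
    obtain n :: nat where n: "h / l0 < real n" using reals_Archimedean2 by blast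
    have n0: "real n > 0" using n l0 h(1) by (smt (verit) divide_pos_pos)
    define l where "l = h / real n"
    have l: "l > 0" "l \<le> l0" "real n * l = h" using n n0 l0 h(1) by (auto simp: l_def field_simps)
    have "\<exists>q'. norm (q' - p - (real n * l) *\<^sub>R w p) \<le> (2*\<epsilon>) * (real n * l)
           \<and> \<bar>b q' - b p - real n * l * g p\<bar> \<le> (2*\<epsilon>) * (real n * l)"
    proof (rule Euler_chain[where R = R])
      fix q assume q: "dist p q \<le> R"
      have "norm ((q + l *\<^sub>R w q) - q - l *\<^sub>R w p) = l * norm (w q - w p)"
        using l(1) by (simp flip: scaleR_diff_right)
      also have "\<dots> \<le> 2*\<epsilon> * l" using near(2)[OF q] l(1) \<epsilon> by simp
      finally have 1: "norm ((q + l *\<^sub>R w q) - q - l *\<^sub>R w p) \<le> 2*\<epsilon> * l" .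
      have "\<bar>b (q + l *\<^sub>R w q) - b q - l * g q\<bar> \<le> \<epsilon> * l"
        using bl[OF l(1,2) near(1)[OF q]] l(1) by (meson min.cobounded1 mult_right_mono order_trans less_imp_le)
      moreover have "\<bar>l * g q - l * g p\<bar> \<le> \<epsilon> * l"
        using abs_diff_scaled_le[OF l(1) near(3)[OF q]] .
      ultimately have "\<bar>b (q + l *\<^sub>R w q) - b q - l * g p\<bar> \<le> 2*\<epsilon> * l" by (simp add: algebra_simps)
      with 1 show "\<exists>q'. norm (q' - q - l *\<^sub>R w p) \<le> 2*\<epsilon> * l \<and> \<bar>b q' - b q - l * g p\<bar> \<le> 2*\<epsilon> * l" by blast
    qed (use l \<epsilon> hR in auto)
    then obtain q where q: "norm (q - p - h *\<^sub>R w p) \<le> 2*\<epsilon> * h" "\<bar>b q - b p - h * g p\<bar> \<le> 2*\<epsilon> * h"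
      unfolding l(3) by blast
    have "norm (q - p) \<le> norm (q - p - h *\<^sub>R w p) + norm (h *\<^sub>R w p)"
      by (metis diff_add_cancel norm_triangle_ineq)
    also have "\<dots> \<le> R" using q(1) hR h(1) by (simp add: algebra_simps)
    finally have "q \<in> K'" using near(1)[of q] by (simp add: dist_norm norm_minus_commute)
    then have "\<bar>f q - f p - h * g p\<bar> \<le> 4 * \<epsilon> * h" using q(2) b[of q] b[OF pK] by linarith
    moreover have "2 * \<epsilon> * h \<le> e * h" "4 * \<epsilon> * h \<le> e * h" using e h(1) by (auto simp: \<epsilon>_def)
    ultimately show "\<exists>p'. norm (p' - p - h *\<^sub>R w p) \<le> e * h \<and> \<bar>f p' - f p - h * g p\<bar> \<le> e * h"
      using q(1) by (intro exI[of _ q]) linarith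
  qed
qed

text \<open>
  A step along \<open>w1\<close> is followed by a step along \<open>w2\<close>.  By continuity \<open>w2\<close> and \<open>g2\<close> hardly change
  during the first step.
\<close>

lemma has_slope_along_add:
  fixes w1 w2 :: "'a::euclidean_space \<Rightarrow> 'a"
  assumes U: "open U" and 1: "has_slope_along U f w1 g1" and 2: "has_slope_along U f w2 g2"
    and w: "continuous_on U w1" "continuous_on U w2" and g: "continuous_on U g2"
  shows "has_slope_along U f (\<lambda>x. w1 x + w2 x) (\<lambda>x. g1 x + g2 x)"
  unfolding has_slope_along_def
proof (intro allI impI)
  fix K :: "'a set" and e :: real assume K: "compact K" "K \<subseteq> U" and e: "e > 0"
  obtain d K' where d: "d > 0" and K': "compact K'" "K' \<subseteq> U"
      and dK: "\<And>x y. x \<in> K \<Longrightarrow> dist x y \<le> d \<Longrightarrow> y \<in> K'"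
    using compact_neighbourhood_in_open[OF K(1) U K(2)] by metis
  define \<epsilon> where "\<epsilon> = e / 3"
  have \<epsilon>: "\<epsilon> > 0" using e by (simp add: \<epsilon>_def)
  have wK: "continuous_on K' w1" "continuous_on K' w2" "continuous_on K' g2"
    using w g K'(2) continuous_on_subset by auto
  have "compact (w1 ` K')" using compact_continuous_image[OF wK(1) K'(1)] .
  then obtain W where W: "\<And>q. q \<in> K' \<Longrightarrow> norm (w1 q) \<le> W"
    unfolding compact_eq_bounded_closed bounded_iff by auto
  obtain R1 where R1: "R1 > 0" "\<And>p q. p \<in> K' \<Longrightarrow> q \<in> K' \<Longrightarrow> dist p q < R1 \<Longrightarrow> dist (w2 p) (w2 q) < \<epsilon>"
    using compact_uniformly_continuous[OF wK(2) K'(1)] \<epsilon> unfolding uniformly_continuous_on_def by metis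
  obtain R2 where R2: "R2 > 0" "\<And>p q. p \<in> K' \<Longrightarrow> q \<in> K' \<Longrightarrow> dist p q < R2 \<Longrightarrow> dist (g2 p) (g2 q) < \<epsilon>"
    using compact_uniformly_continuous[OF wK(3) K'(1)] \<epsilon> unfolding uniformly_continuous_on_def by metis
  define R where "R = min d (min R1 R2 / 2)"
  have R: "R > 0" "R \<le> d" "R < R1" "R < R2" using d R1(1) R2(1) by (auto simp: R_def min_def)
  obtain h1 where h1: "h1 > 0" "\<And>h p. 0 < h \<Longrightarrow> h \<le> h1 \<Longrightarrow> p \<in> K \<Longrightarrow>
     \<exists>p'. norm (p' - p - h *\<^sub>R w1 p) \<le> \<epsilon> * h \<and> \<bar>f p' - f p - h * g1 p\<bar> \<le> \<epsilon> * h"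
    using has_slope_alongD[OF 1 K \<epsilon>] by metis
  obtain h2 where h2: "h2 > 0" "\<And>h p. 0 < h \<Longrightarrow> h \<le> h2 \<Longrightarrow> p \<in> K' \<Longrightarrow>
     \<exists>p'. norm (p' - p - h *\<^sub>R w2 p) \<le> \<epsilon> * h \<and> \<bar>f p' - f p - h * g2 p\<bar> \<le> \<epsilon> * h"
    using has_slope_alongD[OF 2 K' \<epsilon>] by metis
  have den: "\<bar>W\<bar> + \<epsilon> > 0" using \<epsilon> by simp
  define h0 where "h0 = min (min h1 h2) (R / (\<bar>W\<bar> + \<epsilon>))"
  have h0: "h0 > 0" using R den h1 h2 by (simp add: h0_def)
  show "\<exists>h0>0. \<forall>h. 0 < h \<longrightarrow> h \<le> h0 \<longrightarrow> (\<forall>p\<in>K. \<exists>p'.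
        norm (p' - p - h *\<^sub>R (w1 p + w2 p)) \<le> e * h \<and> \<bar>f p' - f p - h * (g1 p + g2 p)\<bar> \<le> e * h)"
  proof (intro exI[of _ h0] conjI h0 allI impI ballI)
    fix h p assume h: "0 < h" "h \<le> h0" and p: "p \<in> K"
    have hh: "h \<le> h1" "h \<le> h2" using h(2) by (auto simp: h0_def)
    have pK: "p \<in> K'" using dK[OF p, of p] d by simp
    have "h \<le> R / (\<bar>W\<bar> + \<epsilon>)" using h(2) by (simp add: h0_def)
    then have "h * (\<bar>W\<bar> + \<epsilon>) \<le> R" using den by (simp add: pos_le_divide_eq)
    then have hR: "h * (norm (w1 p) + \<epsilon>) \<le> R"
      using W[OF pK] h(1) by (smt (verit, best) mult_left_mono)
    obtain q where q: "norm (q - p - h *\<^sub>R w1 p) \<le> \<epsilon> * h" "\<bar>f q - f p - h * g1 p\<bar> \<le> \<epsilon> * h"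
      using h1(2)[OF h(1) hh(1) p] by blast
    have "norm (q - p) \<le> norm (q - p - h *\<^sub>R w1 p) + norm (h *\<^sub>R w1 p)"
      by (metis diff_add_cancel norm_triangle_ineq)
    also have "\<dots> \<le> R" using q(1) hR h(1) by (simp add: algebra_simps)
    finally have pq: "dist p q \<le> R" by (simp add: dist_norm norm_minus_commute)
    have qK: "q \<in> K'" using dK[OF p, of q] pq R by simp
    obtain q' where q': "norm (q' - q - h *\<^sub>R w2 q) \<le> \<epsilon> * h" "\<bar>f q' - f q - h * g2 q\<bar> \<le> \<epsilon> * h"
      using h2(2)[OF h(1) hh(2) qK] by blast
    have "norm (w2 q - w2 p) \<le> \<epsilon>" and g2: "\<bar>g2 q - g2 p\<bar> \<le> \<epsilon>"
      using R1(2)[OF pK qK] R2(2)[OF pK qK] pq R by (auto simp: dist_norm norm_minus_commute abs_minus_commute)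
    then have "norm (h *\<^sub>R (w2 q - w2 p)) \<le> \<epsilon> * h" using h(1) by (simp add: mult.commute)
    then have "norm ((q' - q - h *\<^sub>R w2 q) + (q - p - h *\<^sub>R w1 p) + h *\<^sub>R (w2 q - w2 p)) \<le> \<epsilon> * h + \<epsilon> * h + \<epsilon> * h"
      using q(1) q'(1) by (intro norm_triangle_mono)
    moreover have "(q' - q - h *\<^sub>R w2 q) + (q - p - h *\<^sub>R w1 p) + h *\<^sub>R (w2 q - w2 p) = q' - p - h *\<^sub>R (w1 p + w2 p)"
      by (simp add: algebra_simps)
    ultimately have "norm (q' - p - h *\<^sub>R (w1 p + w2 p)) \<le> \<epsilon> * h + \<epsilon> * h + \<epsilon> * h" by (simp only:)
    then have "norm (q' - p - h *\<^sub>R (w1 p + w2 p)) \<le> e * h" by (simp add: \<epsilon>_def)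
    moreover have "\<bar>f q' - f p - h * (g1 p + g2 p)\<bar> \<le> e * h"
    proof -
      have "\<bar>h * g2 q - h * g2 p\<bar> \<le> \<epsilon> * h" using abs_diff_scaled_le[OF h(1) g2] .
      then have "\<bar>f q' - f p - h * (g1 p + g2 p)\<bar> \<le> \<epsilon> * h + \<epsilon> * h + \<epsilon> * h"
        using q(2) q'(2) unfolding distrib_left by linarith
      then show ?thesis by (simp add: \<epsilon>_def)
    qed
    ultimately show "\<exists>p'. norm (p' - p - h *\<^sub>R (w1 p + w2 p)) \<le> e * h \<and> \<bar>f p' - f p - h * (g1 p + g2 p)\<bar> \<le> e * h"
      by blast
  qed
qed

text \<open>
  For a constant field the end points of the polygons tend to \<open>x + t v\<close> with increasing accuracy \<open>e\<close>, and the
  continuity of \<open>f\<close> gives the increment at \<open>x + t v\<close> itself.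
\<close>

lemma has_slope_along_constant_increment:
  fixes v :: "'a::euclidean_space"
  assumes "has_slope_along U f (\<lambda>_. v) g" and f: "continuous_on U f"
    and R: "cball x R \<subseteq> U" and g: "\<And>q. q \<in> cball x R \<Longrightarrow> \<bar>g q - g0\<bar> \<le> \<epsilon>"
    and v: "norm v = 1" and t: "0 \<le> t" "t < R"
  shows "\<bar>f (x + t *\<^sub>R v) - f x - t * g0\<bar> \<le> \<epsilon> * t"
proof (cases "t = 0")
  case False
  with t have t0: "t > 0" by simp
  show ?thesis
  proof (rule field_le_epsilon)
    fix \<eta> :: real assume \<eta>: "\<eta> > 0"
    have xt: "x + t *\<^sub>R v \<in> U" using R t v by (auto simp: subset_iff dist_norm)
    obtain \<delta> where \<delta>: "\<delta> > 0" "\<And>y. y \<in> U \<Longrightarrow> dist y (x + t *\<^sub>R v) < \<delta> \<Longrightarrow> \<bar>f y - f (x + t *\<^sub>R v)\<bar> < \<eta>/2"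
      using f xt \<eta> unfolding continuous_on_iff dist_real_def by (metis half_gt_zero)
    \<comment> \<open>The factor \<open>e\<close> is so small that after length \<open>t\<close> the polygon ends in \<open>cball x R\<close> and \<open>f\<close> differs by at most
      \<open>\<eta>/2\<close> from its value at \<open>x + t v\<close>.\<close>
    define e where "e = min (min (\<eta>/2/t) (\<delta>/2/t)) ((R - t)/t)"
    have e: "e > 0" using \<eta> \<delta>(1) t0 t by (simp add: e_def)
    have et: "e * t \<le> \<eta>/2" "e * t \<le> \<delta>/2" "e * t \<le> R - t"
    proof -
      have "e \<le> \<eta>/2/t" "e \<le> \<delta>/2/t" "e \<le> (R - t)/t" by (auto simp: e_def)
      then show "e * t \<le> \<eta>/2" "e * t \<le> \<delta>/2" "e * t \<le> R - t" using t0 by (simp_all add: pos_le_divide_eq)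
    qed
    obtain h0 where h0: "h0 > 0" "\<And>h p. 0 < h \<Longrightarrow> h \<le> h0 \<Longrightarrow> p \<in> cball x R \<Longrightarrow>
       \<exists>p'. norm (p' - p - h *\<^sub>R v) \<le> e * h \<and> \<bar>f p' - f p - h * g p\<bar> \<le> e * h"
      using has_slope_alongD[OF assms(1) compact_cball R e] by metis
    obtain n :: nat where n: "t / h0 < real n" using reals_Archimedean2 by blast
    have n0: "real n > 0" using n h0(1) t0 by (smt (verit) divide_pos_pos)
    define h where "h = t / real n"
    have h: "h > 0" "h \<le> h0" "real n * h = t" using n n0 h0(1) t0 by (auto simp: h_def field_simps)
    have "\<exists>q'. norm (q' - x - (real n * h) *\<^sub>R v) \<le> e * (real n * h)
           \<and> \<bar>f q' - f x - real n * h * g0\<bar> \<le> (e + \<epsilon>) * (real n * h)"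
    proof (rule Euler_chain[where R = R])
      fix q assume "dist x q \<le> R"
      then have q: "q \<in> cball x R" by simp
      obtain q' where q': "norm (q' - q - h *\<^sub>R v) \<le> e * h" "\<bar>f q' - f q - h * g q\<bar> \<le> e * h"
        using h0(2)[OF h(1,2) q] by blast
      have "\<bar>h * g q - h * g0\<bar> \<le> \<epsilon> * h" using abs_diff_scaled_le[OF h(1) g[OF q]] .
      then have "\<bar>f q' - f q - h * g0\<bar> \<le> (e + \<epsilon>) * h" using q'(2) unfolding distrib_right by linarith
      then show "\<exists>q'. norm (q' - q - h *\<^sub>R v) \<le> e * h \<and> \<bar>f q' - f q - h * g0\<bar> \<le> (e + \<epsilon>) * h"
        using q'(1) by blast
    qed (use h e et v in \<open>auto simp: algebra_simps\<close>)
    then obtain q where q: "norm (q - x - t *\<^sub>R v) \<le> e * t" "\<bar>f q - f x - t * g0\<bar> \<le> (e + \<epsilon>) * t"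
      unfolding h(3) by blast
    have d1: "dist q (x + t *\<^sub>R v) \<le> e * t" using q(1) by (simp add: dist_norm algebra_simps)
    have "dist x q \<le> dist x (x + t *\<^sub>R v) + dist q (x + t *\<^sub>R v)" by (metis dist_commute dist_triangle)
    also have "\<dots> \<le> R" using d1 et(3) t v by (simp add: dist_norm)
    finally have "q \<in> U" using R by auto
    then have "\<bar>f q - f (x + t *\<^sub>R v)\<bar> < \<eta>/2" using d1 et(2) \<delta> by (smt (verit) field_sum_of_halves)
    then show "\<bar>f (x + t *\<^sub>R v) - f x - t * g0\<bar> \<le> \<epsilon> * t + \<eta>"
      using q(2) et(1) unfolding distrib_right by linarith
  qed
qed simp

text \<open>
  Continuous slopes in all directions are as good as continuous directional derivatives: on a small ball the slope in
  each unit direction is within \<open>e\<close> of its value at \<open>x\<close>.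
\<close>

lemma has_derivative_of_slopes:
  fixes \<eta> :: "'a::euclidean_space \<Rightarrow> 'a \<Rightarrow> real"
  assumes U: "open U" and x: "x \<in> U" and f: "continuous_on U f"
    and lin: "\<And>q. q \<in> U \<Longrightarrow> linear (\<eta> q)" and cont: "\<And>v. continuous_on U (\<lambda>q. \<eta> q v)"
    and slope: "\<And>v. has_slope_along U f (\<lambda>_. v) (\<lambda>q. \<eta> q v)"
  shows "(f has_derivative \<eta> x) (at x)"
  unfolding has_derivative_at_alt
proof (intro conjI allI impI)
  show "bounded_linear (\<eta> x)" using lin[OF x] by (simp add: linear_conv_bounded_linear)
  fix e :: real assume e: "e > 0"
  have c: "((\<lambda>q. \<eta> q b) \<longlongrightarrow> \<eta> x b) (at x)" for b
    using cont[of b] U x by (simp add: continuous_on_eq_continuous_at isCont_def)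
  have "((\<lambda>q. \<Sum>b\<in>Basis. \<bar>\<eta> q b - \<eta> x b\<bar>) \<longlongrightarrow> (\<Sum>b\<in>(Basis::'a set). \<bar>\<eta> x b - \<eta> x b\<bar>)) (at x)"
    by (intro tendsto_intros c)
  then have "\<forall>\<^sub>F q in at x. (\<Sum>b\<in>Basis. \<bar>\<eta> q b - \<eta> x b\<bar>) < e"
    using e by (intro order_tendstoD) auto
  then obtain d1 where d1: "d1 > 0"
      "\<And>q. q \<noteq> x \<Longrightarrow> dist q x < d1 \<Longrightarrow> (\<Sum>b\<in>Basis. \<bar>\<eta> q b - \<eta> x b\<bar>) < e"
    unfolding eventually_at by auto
  obtain d2 where d2: "d2 > 0" "cball x d2 \<subseteq> U" using U x open_contains_cball by blast
  define R where "R = min (d1/2) d2"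
  have R: "R > 0" "R < d1" "cball x R \<subseteq> U" using d1(1) d2 by (auto simp: R_def)
  show "\<exists>d>0. \<forall>y. norm (y - x) < d \<longrightarrow> norm (f y - f x - \<eta> x (y - x)) \<le> e * norm (y - x)"
  proof (intro exI[of _ R] conjI R(1) allI impI)
    fix y assume y: "norm (y - x) < R"
    show "norm (f y - f x - \<eta> x (y - x)) \<le> e * norm (y - x)"
    proof (cases "y = x")
      case True then show ?thesis using lin[OF x] by (simp add: linear_0)
    next
      case False
      define t where "t = norm (y - x)"
      define v where "v = (y - x) /\<^sub>R t"
      have t: "t > 0" using False by (simp add: t_def)
      have v: "norm v = 1" "y - x = t *\<^sub>R v" using t by (auto simp: v_def t_def)
      have "\<bar>\<eta> q v - \<eta> x v\<bar> \<le> e" if q: "q \<in> cball x R" for q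
      proof -
        have qU: "q \<in> U" using R q by auto
        have rep: "\<eta> z v = (\<Sum>b\<in>Basis. (v \<bullet> b) * \<eta> z b)" if "z \<in> U" for z
          using linear_sum[OF lin[OF that], of "\<lambda>b. (v \<bullet> b) *\<^sub>R b" Basis] linear_scale[OF lin[OF that]]
          by (simp add: euclidean_representation)
        have "\<bar>\<eta> q v - \<eta> x v\<bar> = \<bar>\<Sum>b\<in>Basis. (v \<bullet> b) * (\<eta> q b - \<eta> x b)\<bar>"
          by (simp add: rep[OF qU] rep[OF x] sum_subtractf right_diff_distrib)
        also have "\<dots> \<le> (\<Sum>b\<in>Basis. \<bar>\<eta> q b - \<eta> x b\<bar>)"
        proof (rule order_trans[OF sum_abs], rule sum_mono)
          fix b :: 'a assume "b \<in> Basis"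
          then have "\<bar>v \<bullet> b\<bar> \<le> 1" using Basis_le_norm[of b v] v by simp
          then show "\<bar>(v \<bullet> b) * (\<eta> q b - \<eta> x b)\<bar> \<le> \<bar>\<eta> q b - \<eta> x b\<bar>"
            by (simp add: abs_mult mult_left_le_one_le)
        qed
        also have "\<dots> \<le> e" using d1(2)[of q] q R e by (cases "q = x") (auto simp: dist_commute)
        finally show ?thesis .
      qed
      then have "\<bar>f (x + t *\<^sub>R v) - f x - t * \<eta> x v\<bar> \<le> e * t"
        by (intro has_slope_along_constant_increment[OF slope f R(3) _ v(1)]) (use t y in \<open>auto simp: t_def\<close>)
      moreover have "x + t *\<^sub>R v = y" using v(2) by (simp add: algebra_simps)
      moreover have "\<eta> x (y - x) = t * \<eta> x v" using v(2) linear_scale[OF lin[OF x]] by simp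
      ultimately show ?thesis by (simp add: t_def)
    qed
  qed
qed

section \<open>The logarithm of a conformal factor\<close>

lemma continuous_on_segment_average:
  fixes H :: "'a::real_normed_vector \<Rightarrow> 'a \<Rightarrow> real" and S :: "'t::topological_space set"
  assumes H: "continuous_on (U \<times> UNIV) (\<lambda>(x, h). H x h)"
    and c: "continuous_on S \<kappa>" "continuous_on S q" "continuous_on S w"
    and seg: "\<And>z s. z \<in> S \<Longrightarrow> s \<in> {0..1} \<Longrightarrow> q z + (s * \<kappa> z) *\<^sub>R v \<in> U"
  shows "continuous_on S (\<lambda>z. integral {0..1} (\<lambda>s. H (q z + (s * \<kappa> z) *\<^sub>R v) (w z)))"
proof -
  have "continuous_on (S \<times> {0..1}) (\<lambda>zs. H (q (fst zs) + (snd zs * \<kappa> (fst zs)) *\<^sub>R v) (w (fst zs)))"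
  proof -
    have "continuous_on (S \<times> {0..1}) (\<lambda>zs. (q (fst zs) + (snd zs * \<kappa> (fst zs)) *\<^sub>R v, w (fst zs)))"
      by (intro continuous_intros continuous_on_compose2[OF c(1)] continuous_on_compose2[OF c(2)]
          continuous_on_compose2[OF c(3)]) auto
    moreover have "(\<lambda>zs. (q (fst zs) + (snd zs * \<kappa> (fst zs)) *\<^sub>R v, w (fst zs))) ` (S \<times> {0..1}) \<subseteq> U \<times> UNIV"
      by (auto simp: seg)
    ultimately show ?thesis using continuous_on_compose2[OF H] by fastforce
  qed
  then show ?thesis
    using integral_continuous_on_param[of S 0 "1::real" "\<lambda>z s. H (q z + (s * \<kappa> z) *\<^sub>R v) (w z)"]
    by (simp add: split_beta)
qed

text \<open>
  Two \<open>C\<^sup>1\<close> forms \<open>A\<close> and \<open>B\<close> with \<open>dA = \<beta> \<and> A\<close> and \<open>dB = \<beta>' \<and> B\<close>, and a \<open>C\<^sup>1\<close> map \<open>F\<close> with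
  \<open>F\<^sup>*B = exp f \<cdot> A\<close>.  If \<open>f\<close> were known to be differentiable, taking exterior derivatives would give
  \<open>(df - F\<^sup>*\<beta>' + \<beta>) \<and> A = 0\<close> and thus determine \<open>df\<close> on the kernel of \<open>A\<close>.  Forms are represented by vectors by means
  of the inner product.
\<close>

locale conformal_pullback =
  fixes U V :: "'a::euclidean_space set" and F :: "'a \<Rightarrow> 'a" and F' :: "'a \<Rightarrow> 'a \<Rightarrow> 'a"
    and A B :: "'a \<Rightarrow> 'a" and A' B' :: "'a \<Rightarrow> 'a \<Rightarrow> 'a" and f :: "'a \<Rightarrow> real"
    and \<beta> \<beta>' :: "'a \<Rightarrow> 'a \<Rightarrow> real"
  assumes U: "open U" and FV: "F ` U \<subseteq> V"
    and F: "\<And>x. x \<in> U \<Longrightarrow> (F has_derivative F' x) (at x)" "\<And>h. continuous_on U (\<lambda>x. F' x h)"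
    and A: "\<And>x. x \<in> U \<Longrightarrow> (A has_derivative A' x) (at x)" "\<And>h. continuous_on U (\<lambda>x. A' x h)"
    and B: "\<And>y. y \<in> V \<Longrightarrow> (B has_derivative B' y) (at y)" "\<And>h. continuous_on V (\<lambda>y. B' y h)"
    and f: "continuous_on U f"
    and conf: "\<And>x h. x \<in> U \<Longrightarrow> B (F x) \<bullet> F' x h = exp (f x) * (A x \<bullet> h)"
    and dA: "\<And>x u v. x \<in> U \<Longrightarrow> A' x u \<bullet> v - A' x v \<bullet> u = \<beta> x u * (A x \<bullet> v) - \<beta> x v * (A x \<bullet> u)"
    and dB: "\<And>y u v. y \<in> V \<Longrightarrow> B' y u \<bullet> v - B' y v \<bullet> u = \<beta>' y u * (B y \<bullet> v) - \<beta>' y v * (B y \<bullet> u)"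
    and \<beta>: "\<And>x. x \<in> U \<Longrightarrow> linear (\<beta> x)" "\<And>h. continuous_on U (\<lambda>x. \<beta> x h)"
    and \<beta>': "\<And>y. y \<in> V \<Longrightarrow> linear (\<beta>' y)" "\<And>h. continuous_on V (\<lambda>y. \<beta>' y h)"
begin

lemma continuous_on_fields:
  assumes "continuous_on S g" "g ` S \<subseteq> U"
  shows "continuous_on S (\<lambda>s. F (g s))" "continuous_on S (\<lambda>s. A (g s))" "continuous_on S (\<lambda>s. f (g s))"
    "continuous_on S (\<lambda>s. B (F (g s)))"
proof -
  have "continuous_on U F" "continuous_on U A"
    using F(1) A(1) by (meson has_derivative_at_withinI has_derivative_continuous_on)+
  from this[THEN continuous_on_compose2, OF assms]
  show Fg: "continuous_on S (\<lambda>s. F (g s))" and "continuous_on S (\<lambda>s. A (g s))" .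
  show "continuous_on S (\<lambda>s. f (g s))" by (rule continuous_on_compose2[OF f assms])
  have FgV: "(\<lambda>s. F (g s)) ` S \<subseteq> V" using assms(2) FV by blast
  have "continuous_on V B"
    using B(1) by (meson has_derivative_at_withinI has_derivative_continuous_on)
  from continuous_on_compose2[OF this Fg FgV]
  show "continuous_on S (\<lambda>s. B (F (g s)))" .
qed

lemma continuous_on_derivatives:
  assumes "continuous_on S g" "g ` S \<subseteq> U" "continuous_on S h"
  shows "continuous_on S (\<lambda>s. F' (g s) (h s))" "continuous_on S (\<lambda>s. A' (g s) (h s))"
    "continuous_on S (\<lambda>s. \<beta> (g s) (h s))" "continuous_on S (\<lambda>s. \<beta>' (F (g s)) (F' (g s) (h s)))"
    "continuous_on S (\<lambda>s. B' (F (g s)) (F' (g s) (h s)))"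
proof -
  show F'': "continuous_on S (\<lambda>s. F' (g s) (h s))"
    by (rule continuous_on_derivative_compose[OF _ F(2) assms]) (rule has_derivative_linear[OF F(1)])
  show "continuous_on S (\<lambda>s. A' (g s) (h s))"
    by (rule continuous_on_derivative_compose[OF _ A(2) assms]) (rule has_derivative_linear[OF A(1)])
  show "continuous_on S (\<lambda>s. \<beta> (g s) (h s))"
    by (rule continuous_on_derivative_compose[OF \<beta> assms])
  have FgV: "(\<lambda>s. F (g s)) ` S \<subseteq> V" using assms(2) FV by blast
  note Fg = continuous_on_fields(1)[OF assms(1,2)]
  show "continuous_on S (\<lambda>s. \<beta>' (F (g s)) (F' (g s) (h s)))"
    by (rule continuous_on_derivative_compose[OF \<beta>' Fg FgV F''])
  show "continuous_on S (\<lambda>s. B' (F (g s)) (F' (g s) (h s)))"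
    by (rule continuous_on_derivative_compose[OF _ B(2) Fg FgV F'']) (rule has_derivative_linear[OF B(1)])
qed

text \<open>
  The mean value \<open>a k q\<close> of \<open>F\<^sup>*B\<close>, applied to \<open>v\<close>, over the segment from \<open>q\<close> to \<open>q + k v\<close> tends to
  \<open>exp (f q) (A q \<bullet> v)\<close> as \<open>k \<rightarrow> 0\<close>, so \<open>b k = ln (a k) - ln (A \<bullet> v)\<close> tends to \<open>f\<close>.  By the first variation formula
  the derivative of \<open>a k\<close> in the direction \<open>h\<close> is the mean value of \<open>d(F\<^sup>*B)(h, v)\<close> plus the difference quotient of
  \<open>F\<^sup>*B(h) = exp f \<cdot> A(h)\<close> between the ends of the segment.  For general \<open>h\<close> the latter is beyond control, since \<open>f\<close> is only
  continuous; but if \<open>h = w q\<close> lies in the kernel of \<open>A q\<close>, it equals \<open>exp (f (q + k v))\<close> times a difference quotient of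
  \<open>A\<close> and converges.  The structure equations then identify the limit.
\<close>

lemma slope_in_kernel:
  assumes v: "\<And>x. x \<in> U \<Longrightarrow> A x \<bullet> v > 0"
    and w: "continuous_on U w" "\<And>x. x \<in> U \<Longrightarrow> A x \<bullet> w x = 0"
  shows "has_slope_along U f w (\<lambda>x. \<beta>' (F x) (F' x (w x)) - \<beta> x (w x))"
proof (rule has_slope_along_approx[OF U w(1)])
  show "continuous_on U (\<lambda>x. \<beta>' (F x) (F' x (w x)) - \<beta> x (w x))"
    by (intro continuous_intros continuous_on_fields continuous_on_derivatives w(1)) auto
next
  fix K :: "'a set" and e :: real assume K: "compact K" "K \<subseteq> U" and e: "e > 0"
  \<comment> \<open>\<open>E\<close> is the form \<open>F\<^sup>*B\<close> and \<open>\<Omega>\<close> is its exterior derivative.\<close>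
  define E where "E = (\<lambda>x h. B (F x) \<bullet> F' x h)"
  define \<Omega> where "\<Omega> = (\<lambda>x h k. B' (F x) (F' x h) \<bullet> F' x k - B' (F x) (F' x k) \<bullet> F' x h)"
  have linA: "linear (A' x)" if "x \<in> U" for x using A(1)[OF that] by (rule has_derivative_linear)
  have linF: "linear (F' x)" if "x \<in> U" for x using F(1)[OF that] by (rule has_derivative_linear)
  have linB: "linear (B' (F x))" if "x \<in> U" for x using B(1)[of "F x"] FV that has_derivative_linear by blast
  have Econf: "E x h = exp (f x) * (A x \<bullet> h)" if "x \<in> U" for x h using conf[OF that] by (simp add: E_def)
  have Epos: "E x v > 0" if "x \<in> U" for x using v[OF that] by (simp add: Econf[OF that])
  have Eline: "E x (c *\<^sub>R h) = c * E x h" "\<Omega> x h (c *\<^sub>R k) = c * \<Omega> x h k" if "x \<in> U" for x c h k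
    using linF[OF that] linB[OF that] by (simp_all add: E_def \<Omega>_def linear_scale algebra_simps)
  have \<Omega>eq: "\<Omega> x h v = exp (f x) * (\<beta>' (F x) (F' x h) * (A x \<bullet> v) - \<beta>' (F x) (F' x v) * (A x \<bullet> h))" if "x \<in> U" for x h
    using dB[of "F x" "F' x h" "F' x v"] FV that by (auto simp: \<Omega>_def conf[OF that] algebra_simps)
  have cE: "continuous_on S (\<lambda>s. E (g s) (h s))" if "continuous_on S g" "g ` S \<subseteq> U" "continuous_on S h"
    for S :: "'t::topological_space set" and g h
    unfolding E_def by (intro continuous_intros continuous_on_fields continuous_on_derivatives that)
  have c2: "continuous_on (U \<times> UNIV) (\<lambda>(x, h). E x v)" "continuous_on (U \<times> UNIV) (\<lambda>(x, h). \<Omega> x h v)"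
     "continuous_on (U \<times> UNIV) (\<lambda>(x, h). A' x v \<bullet> h)"
    unfolding E_def \<Omega>_def split_beta by (intro continuous_intros continuous_on_fields continuous_on_derivatives; auto)+
  obtain d1 K1 where d1: "d1 > 0" and K1: "compact K1" "K1 \<subseteq> U"
      and dK1: "\<And>x y. x \<in> K \<Longrightarrow> dist x y \<le> d1 \<Longrightarrow> y \<in> K1"
    using compact_neighbourhood_in_open[OF K(1) U K(2)] by metis
  obtain d2 K2 where d2: "d2 > 0" and K2: "compact K2" "K2 \<subseteq> U"
      and dK2: "\<And>x y. x \<in> K1 \<Longrightarrow> dist x y \<le> d2 \<Longrightarrow> y \<in> K2"
    using compact_neighbourhood_in_open[OF K1(1) U K1(2)] by metis
  define k0 where "k0 = d2 / (norm v + 1)"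
  have nv: "norm v + 1 > 0" by (simp add: add_nonneg_pos)
  have k0: "k0 > 0" using d2 nv by (simp add: k0_def)
  have seg: "q + (s * k) *\<^sub>R v \<in> U" if "q \<in> K1" "k \<in> {0..k0}" "s \<in> {0..1}" for q k s
  proof -
    have "s * k \<le> 1 * k0" using that by (intro mult_mono) auto
    then have "s * k * norm v \<le> k0 * (norm v + 1)" using that k0 by (intro mult_mono) auto
    then have "dist q (q + (s * k) *\<^sub>R v) \<le> d2" using that nv by (simp add: k0_def dist_norm)
    then show ?thesis using dK2[OF that(1)] K2(2) by blast
  qed
  have segv: "q + k *\<^sub>R v \<in> U" if "q \<in> K1" "k \<in> {0..k0}" for q k using seg[OF that, of 1] by simp
  define a where "a = (\<lambda>k q. integral {0..1} (\<lambda>s. E (q + (s * k) *\<^sub>R v) v))"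
  define \<Theta> where "\<Theta> = (\<lambda>k q h. integral {0..1} (\<lambda>s. \<Omega> (q + (s * k) *\<^sub>R v) h v))"
  have ca: "continuous_on S (\<lambda>z. a (\<kappa> z) (q z))"
    if "continuous_on S \<kappa>" "continuous_on S q" "\<And>z. z \<in> S \<Longrightarrow> q z \<in> K1 \<and> \<kappa> z \<in> {0..k0}" for S :: "'t::topological_space set" and \<kappa> q
    unfolding a_def using continuous_on_segment_average[OF c2(1) that(1,2) continuous_on_const] seg that(3) by auto
  have c\<Theta>: "continuous_on S (\<lambda>z. \<Theta> (\<kappa> z) (q z) (h z))"
    if "continuous_on S \<kappa>" "continuous_on S q" "continuous_on S h" "\<And>z. z \<in> S \<Longrightarrow> q z \<in> K1 \<and> \<kappa> z \<in> {0..k0}" for S :: "'t::topological_space set" and \<kappa> q h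
    unfolding \<Theta>_def using continuous_on_segment_average[OF c2(2) that(1,2,3)] seg that(4) by auto
  have apos: "a k q > 0" if "q \<in> K1" "k \<in> {0..k0}" for k q
  proof -
    have "continuous_on {0..1} (\<lambda>s. E (q + (s * k) *\<^sub>R v) v)"
      using seg[OF that] by (intro cE continuous_intros) auto
    moreover have "E (q + (s * k) *\<^sub>R v) v > 0" if "s \<in> {0..1}" for s using Epos seg[OF \<open>q \<in> K1\<close> \<open>k \<in> _\<close> that] by blast
    ultimately show ?thesis unfolding a_def
      using integral_less_real[of 0 "1::real" "\<lambda>_. 0" "\<lambda>s. E (q + (s * k) *\<^sub>R v) v"] by auto
  qed
  have Av: "A q \<bullet> v > 0" if "q \<in> K1" for q using v K1(2) that by blast
  define Db where "Db = (\<lambda>k q h. ((E (q + k *\<^sub>R v) h - E q h) / k + \<Theta> k q h) / a k q - (A' q h \<bullet> v) / (A q \<bullet> v))"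
  define b where "b = (\<lambda>k q. ln (a k q) - ln (A q \<bullet> v))"
  have deriv: "((\<lambda>\<delta>. b k (q + \<delta> *\<^sub>R h)) has_real_derivative Db k q h) (at 0)" if q: "q \<in> K1" and k: "0 < k" "k \<le> k0" for k q h
  proof -
    have k': "k \<in> {0..k0}" using k by auto
    have "((\<lambda>\<delta>. integral {0..1} (\<lambda>s. B (F (q + \<delta> *\<^sub>R h + s *\<^sub>R (k *\<^sub>R v))) \<bullet> F' (q + \<delta> *\<^sub>R h + s *\<^sub>R (k *\<^sub>R v)) (k *\<^sub>R v)))
       has_real_derivative B (F (q + k *\<^sub>R v)) \<bullet> F' (q + k *\<^sub>R v) h - B (F q) \<bullet> F' q h
        + integral {0..1} (\<lambda>s. B' (F (q + s *\<^sub>R (k *\<^sub>R v))) (F' (q + s *\<^sub>R (k *\<^sub>R v)) h) \<bullet> F' (q + s *\<^sub>R (k *\<^sub>R v)) (k *\<^sub>R v)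
                               - B' (F (q + s *\<^sub>R (k *\<^sub>R v))) (F' (q + s *\<^sub>R (k *\<^sub>R v)) (k *\<^sub>R v)) \<bullet> F' (q + s *\<^sub>R (k *\<^sub>R v)) h)) (at 0)"
      by (rule first_variation[OF U FV F B]) (use seg[OF q k'] in auto)
    then have 1: "((\<lambda>\<delta>. integral {0..1} (\<lambda>s. E (q + \<delta> *\<^sub>R h + (s * k) *\<^sub>R v) (k *\<^sub>R v))) has_real_derivative
         E (q + k *\<^sub>R v) h - E q h + integral {0..1} (\<lambda>s. \<Omega> (q + (s * k) *\<^sub>R v) h (k *\<^sub>R v))) (at 0)"
      unfolding E_def \<Omega>_def by simp
    have "integral {0..1} (\<lambda>s. \<Omega> (q + (s * k) *\<^sub>R v) h (k *\<^sub>R v)) = integral {0..1} (\<lambda>s. k * \<Omega> (q + (s * k) *\<^sub>R v) h v)"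
      by (rule integral_cong) (use Eline(2) seg[OF q k'] in blast)
    then have 2: "integral {0..1} (\<lambda>s. \<Omega> (q + (s * k) *\<^sub>R v) h (k *\<^sub>R v)) = k * \<Theta> k q h"
      by (simp add: \<Theta>_def)
    have "compact ((\<lambda>s. q + (s * k) *\<^sub>R v) ` {0..1})"
      by (intro compact_continuous_image continuous_intros) auto
    moreover have "(\<lambda>s. q + (s * k) *\<^sub>R v) ` {0..1} \<subseteq> U" using seg[OF q k'] by auto
    ultimately obtain r where r: "r > 0" "(\<Union>x\<in>(\<lambda>s. q + (s * k) *\<^sub>R v) ` {0..1}. ball x r) \<subseteq> U"
      using compact_subset_open_imp_ball_epsilon_subset[of "(\<lambda>s. q + (s * k) *\<^sub>R v) ` {0..1}" U] U by blast
    have "\<forall>\<^sub>F \<delta> in nhds (0::real). norm (\<delta> *\<^sub>R h) < r"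
    proof -
      have "((\<lambda>\<delta>. norm (\<delta> *\<^sub>R h)) \<longlongrightarrow> norm ((0::real) *\<^sub>R h)) (nhds 0)"
        by (intro tendsto_intros filterlim_ident)
      then show ?thesis using r(1) by (intro order_tendstoD(2)) auto
    qed
    then have ev: "\<forall>\<^sub>F \<delta> in nhds 0. a k (q + \<delta> *\<^sub>R h) = integral {0..1} (\<lambda>s. E (q + \<delta> *\<^sub>R h + (s * k) *\<^sub>R v) (k *\<^sub>R v)) / k"
    proof eventually_elim
      case (elim \<delta>)
      have "q + \<delta> *\<^sub>R h + (s * k) *\<^sub>R v \<in> U" if "s \<in> {0..1}" for s
      proof -
        have "q + \<delta> *\<^sub>R h + (s * k) *\<^sub>R v \<in> ball (q + (s * k) *\<^sub>R v) r" using elim by (simp add: dist_norm)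
        then show ?thesis using r(2) that by blast
      qed
      then have "integral {0..1} (\<lambda>s. E (q + \<delta> *\<^sub>R h + (s * k) *\<^sub>R v) (k *\<^sub>R v)) = integral {0..1} (\<lambda>s. k * E (q + \<delta> *\<^sub>R h + (s * k) *\<^sub>R v) v)"
        by (intro integral_cong) (use Eline(1) in blast)
      then show ?case using k by (simp add: a_def)
    qed
    have "((\<lambda>\<delta>. integral {0..1} (\<lambda>s. E (q + \<delta> *\<^sub>R h + (s * k) *\<^sub>R v) (k *\<^sub>R v)) / k) has_real_derivative
        (E (q + k *\<^sub>R v) h - E q h) / k + \<Theta> k q h) (at 0)"
      using DERIV_cdivide[OF 1, of k] k unfolding 2 by (simp add: add_divide_distrib)
    then have da: "((\<lambda>\<delta>. a k (q + \<delta> *\<^sub>R h)) has_real_derivative (E (q + k *\<^sub>R v) h - E q h) / k + \<Theta> k q h) (at 0)"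
      using DERIV_cong_ev[OF refl ev refl] by blast
    have "((\<lambda>\<delta>. q + \<delta> *\<^sub>R h) has_vector_derivative h) (at 0)" by (auto intro!: derivative_eq_intros)
    from vector_derivative_diff_chain_within[OF this, of A "A' q"] A(1)[of q] q K1(2)
    have "((\<lambda>\<delta>. A (q + \<delta> *\<^sub>R h)) has_vector_derivative A' q h) (at 0)" by (auto simp: o_def has_derivative_at_withinI)
    then have dAv: "((\<lambda>\<delta>. A (q + \<delta> *\<^sub>R h) \<bullet> v) has_real_derivative A' q h \<bullet> v) (at 0)"
      unfolding has_vector_derivative_def has_field_derivative_def
      by (auto intro!: derivative_eq_intros simp: fun_eq_iff mult.commute)
    have "((\<lambda>\<delta>. ln (a k (q + \<delta> *\<^sub>R h)) - ln (A (q + \<delta> *\<^sub>R h) \<bullet> v)) has_real_derivative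
       (1 / a k (q + 0 *\<^sub>R h)) * ((E (q + k *\<^sub>R v) h - E q h) / k + \<Theta> k q h)
       - (1 / (A (q + 0 *\<^sub>R h) \<bullet> v)) * (A' q h \<bullet> v)) (at 0)"
      by (intro DERIV_diff DERIV_chain2[OF DERIV_ln_divide da] DERIV_chain2[OF DERIV_ln_divide dAv])
        (use apos[OF q k'] Av[OF q] in auto)
    then show ?thesis unfolding b_def Db_def by simp
  qed
  \<comment> \<open>\<open>G k q\<close> is \<open>Db k q (w q)\<close> with the difference quotient of \<open>A\<close> written as an integral, which makes sense and is
    continuous up to \<open>k = 0\<close>.\<close>
  define G where "G = (\<lambda>k q. (exp (f (q + k *\<^sub>R v)) * integral {0..1} (\<lambda>s. A' (q + (s * k) *\<^sub>R v) v \<bullet> w q) + \<Theta> k q (w q)) / a k q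
      - (A' q (w q) \<bullet> v) / (A q \<bullet> v))"
  have GDb: "Db k q (w q) = G k q" if q: "q \<in> K1" and k: "0 < k" "k \<le> k0" for k q
  proof -
    have k': "k \<in> {0..k0}" and qU: "q \<in> U" using k q K1(2) by auto
    have "((\<lambda>s. k * (A' (q + (s * k) *\<^sub>R v) v \<bullet> w q)) has_integral A (q + (1 * k) *\<^sub>R v) \<bullet> w q - A (q + (0 * k) *\<^sub>R v) \<bullet> w q) {0..1}"
    proof (rule fundamental_theorem_of_calculus)
      fix s :: real assume s: "s \<in> {0..1}"
      note sU = seg[OF q k' s]
      have "((\<lambda>s. q + (s * k) *\<^sub>R v) has_vector_derivative k *\<^sub>R v) (at s within {0..1})"
        by (auto intro!: derivative_eq_intros)
      from vector_derivative_diff_chain_within[OF this, of A] A(1)[OF sU]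
      have "((\<lambda>s. A (q + (s * k) *\<^sub>R v)) has_vector_derivative A' (q + (s * k) *\<^sub>R v) (k *\<^sub>R v)) (at s within {0..1})"
        by (auto simp: o_def has_derivative_at_withinI)
      then show "((\<lambda>s. A (q + (s * k) *\<^sub>R v) \<bullet> w q) has_vector_derivative k * (A' (q + (s * k) *\<^sub>R v) v \<bullet> w q)) (at s within {0..1})"
        unfolding has_vector_derivative_def
        by (auto intro!: derivative_eq_intros simp: fun_eq_iff linear_scale[OF linA[OF sU]])
    qed simp
    from integral_unique[OF this]
    have "A (q + k *\<^sub>R v) \<bullet> w q = k * integral {0..1} (\<lambda>s. A' (q + (s * k) *\<^sub>R v) v \<bullet> w q)"
      using w(2)[OF qU] by simp
    then have "(E (q + k *\<^sub>R v) (w q) - E q (w q)) / k = exp (f (q + k *\<^sub>R v)) * integral {0..1} (\<lambda>s. A' (q + (s * k) *\<^sub>R v) v \<bullet> w q)"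
      using k w(2)[OF qU] by (simp add: Econf[OF segv[OF q k']] Econf[OF qU])
    then show ?thesis by (simp add: Db_def G_def)
  qed
  have G0: "G 0 q = \<beta>' (F q) (F' q (w q)) - \<beta> q (w q)" if q: "q \<in> K1" for q
  proof -
    have qU: "q \<in> U" using q K1(2) by blast
    have "A' q (w q) \<bullet> v - A' q v \<bullet> w q = \<beta> q (w q) * (A q \<bullet> v)"
      using dA[OF qU, of "w q" v] w(2)[OF qU] by simp
    then show ?thesis
      using Av[OF q] w(2)[OF qU]
      by (simp add: G_def \<Theta>_def a_def Econf[OF qU] \<Omega>eq[OF qU] field_simps)
  qed
  have b0: "b 0 q = f q" if q: "q \<in> K1" for q
  proof -
    have qU: "q \<in> U" using q K1(2) by blast
    show ?thesis using Av[OF q] by (simp add: b_def a_def Econf[OF qU] ln_mult)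
  qed
  have cptI: "compact ({0..k0} \<times> K1)" using K1(1) by (intro compact_Times) auto
  have inK1: "q \<in> K1 \<and> k \<in> {0..k0}" if "(k, q) \<in> {0..k0} \<times> K1" for k q using that by auto
  have cw: "continuous_on S (\<lambda>z. w (q z))" if "continuous_on S q" "q ` S \<subseteq> U" for S :: "'t::topological_space set" and q
    by (rule continuous_on_compose2[OF w(1) that])
  have sndU: "snd ` ({0..k0} \<times> K1) \<subseteq> U" "(\<lambda>z. snd z + fst z *\<^sub>R v) ` ({0..k0} \<times> K1) \<subseteq> U"
    using K1(2) segv by auto
  have anz: "a (fst z) (snd z) \<noteq> 0" "a (fst z) (snd z) > 0" "A (snd z) \<bullet> v > 0" "A (snd z) \<bullet> v \<noteq> 0" if "z \<in> {0..k0} \<times> K1" for z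
    using apos[of "snd z" "fst z"] Av[of "snd z"] that by auto
  have "continuous_on ({0..k0} \<times> K1) (\<lambda>z. integral {0..1} (\<lambda>s. A' (snd z + (s * fst z) *\<^sub>R v) v \<bullet> w (snd z)))"
    by (rule continuous_on_segment_average[OF c2(3)]) (use sndU seg in \<open>auto intro!: continuous_intros cw\<close>)
  then have cG: "continuous_on ({0..k0} \<times> K1) (\<lambda>z. G (fst z) (snd z))"
    unfolding G_def
    by (intro continuous_intros continuous_on_fields continuous_on_derivatives ca c\<Theta> cw sndU) (use anz in auto)
  have cb: "continuous_on ({0..k0} \<times> K1) (\<lambda>z. b (fst z) (snd z))"
    unfolding b_def
    by (intro continuous_intros continuous_on_fields continuous_on_derivatives ca sndU) (use anz in auto)
  obtain r1 where r1: "r1 > 0" "\<And>z z'. z \<in> {0..k0} \<times> K1 \<Longrightarrow> z' \<in> {0..k0} \<times> K1 \<Longrightarrow> dist z' z < r1 \<Longrightarrow>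
      dist (G (fst z') (snd z')) (G (fst z) (snd z)) < e/2"
    using compact_uniformly_continuous[OF cG cptI] e unfolding uniformly_continuous_on_def by (metis half_gt_zero)
  obtain r2 where r2: "r2 > 0" "\<And>z z'. z \<in> {0..k0} \<times> K1 \<Longrightarrow> z' \<in> {0..k0} \<times> K1 \<Longrightarrow> dist z' z < r2 \<Longrightarrow>
      dist (b (fst z') (snd z')) (b (fst z) (snd z)) < e"
    using compact_uniformly_continuous[OF cb cptI] e unfolding uniformly_continuous_on_def by metis
  define k where "k = min k0 (min r1 r2 / 2)"
  have k: "0 < k" "k \<le> k0" "k < r1" "k < r2" using k0 r1(1) r2(1) by (auto simp: k_def min_def)
  have close: "\<bar>G k q - (\<beta>' (F q) (F' q (w q)) - \<beta> q (w q))\<bar> < e/2" "\<bar>b k q - f q\<bar> < e" if "q \<in> K1" for q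
    using r1(2)[of "(0, q)" "(k, q)"] r2(2)[of "(0, q)" "(k, q)"] that k
    by (auto simp: dist_Pair_Pair dist_real_def G0 b0)
  have "compact (w ` K)" by (rule compact_continuous_image[OF continuous_on_subset[OF w(1) K(2)] K(1)])
  then obtain W where W: "\<And>q. q \<in> K \<Longrightarrow> norm (w q) \<le> W"
    unfolding compact_eq_bounded_closed bounded_iff by auto
  define l1 where "l1 = d1 / (\<bar>W\<bar> + 1)"
  have l1: "l1 > 0" using d1 by (simp add: l1_def add_nonneg_pos)
  have inK1': "q + \<xi> *\<^sub>R w q \<in> K1" if "q \<in> K" "\<xi> \<in> {0..l1}" for q \<xi>
  proof -
    have "norm (w q) \<le> \<bar>W\<bar> + 1" using W[OF that(1)] by linarith
    then have "\<xi> * norm (w q) \<le> l1 * (\<bar>W\<bar> + 1)" using that l1 by (intro mult_mono) auto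
    also have "\<dots> = d1" by (simp add: l1_def)
    finally have "dist q (q + \<xi> *\<^sub>R w q) \<le> d1" using that by (simp add: dist_norm)
    then show ?thesis using dK1[OF that(1)] by blast
  qed
  \<comment> \<open>Fix \<open>k\<close>.  The increment of \<open>b k\<close> over \<open>l w(q)\<close> is \<open>l\<close> times a value of \<open>Db k\<close> near \<open>q\<close>, still in the direction
    \<open>w q\<close>; for small \<open>l\<close>, depending on \<open>k\<close>, this is close to \<open>Db k q (w q)\<close>.\<close>
  have cDb: "continuous_on ({0..l1} \<times> K) (\<lambda>z. Db k (snd z + fst z *\<^sub>R w (snd z)) (w (snd z)))"
  proof -
    have 1: "snd ` ({0..l1} \<times> K) \<subseteq> U" using K(2) by auto
    note 2 = inK1' segv[OF inK1'] subsetD[OF K1(2) inK1'] apos[OF inK1', of _ _ k] Av[OF inK1']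
    have c: "continuous_on ({0..l1} \<times> K) (\<lambda>z. w (snd z))" "continuous_on ({0..l1} \<times> K) (\<lambda>z. snd z + fst z *\<^sub>R w (snd z))"
      by (intro continuous_intros cw 1)+
    show ?thesis
      unfolding Db_def
      by (intro continuous_intros continuous_on_fields continuous_on_derivatives ca c\<Theta> cE c)
        (use 2 k in \<open>auto simp: less_le\<close>)
  qed
  have "compact ({0..l1} \<times> K)" using K(1) by (intro compact_Times) auto
  then obtain r3 where r3: "r3 > 0" "\<And>z z'. z \<in> {0..l1} \<times> K \<Longrightarrow> z' \<in> {0..l1} \<times> K \<Longrightarrow> dist z' z < r3 \<Longrightarrow>
      dist (Db k (snd z' + fst z' *\<^sub>R w (snd z')) (w (snd z'))) (Db k (snd z + fst z *\<^sub>R w (snd z)) (w (snd z))) < e/2"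
    using compact_uniformly_continuous[OF cDb] e unfolding uniformly_continuous_on_def by (metis half_gt_zero)
  define l0 where "l0 = min l1 (r3/2)"
  have l0: "l0 > 0" "l0 \<le> l1" "l0 < r3" using l1 r3(1) by (auto simp: l0_def)
  have "\<bar>b k (q + l *\<^sub>R w q) - b k q - l * (\<beta>' (F q) (F' q (w q)) - \<beta> q (w q))\<bar> \<le> e * l"
    if l: "0 < l" "l \<le> l0" and q: "q \<in> K" for l q
  proof -
    have qK1: "q \<in> K1" using dK1[OF q, of q] d1 by simp
    have "\<exists>\<xi>. 0 < \<xi> \<and> \<xi> < l \<and> b k (q + l *\<^sub>R w q) - b k (q + 0 *\<^sub>R w q) = (l - 0) * Db k (q + \<xi> *\<^sub>R w q) (w q)"
    proof (rule MVT2[OF l(1)])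
      fix \<xi> :: real assume \<xi>: "0 \<le> \<xi>" "\<xi> \<le> l"
      have "q + \<xi> *\<^sub>R w q \<in> K1" using inK1'[OF q, of \<xi>] \<xi> l l0 by auto
      from deriv[OF this k(1,2), of "w q"]
      have "((\<lambda>\<delta>. b k (q + \<xi> *\<^sub>R w q + (\<delta> - \<xi>) *\<^sub>R w q)) has_real_derivative Db k (q + \<xi> *\<^sub>R w q) (w q)) (at \<xi>)"
        using DERIV_shift[of "\<lambda>\<delta>. b k (q + \<xi> *\<^sub>R w q + (\<delta> - \<xi>) *\<^sub>R w q)" _ 0 \<xi>] by simp
      then show "((\<lambda>\<delta>. b k (q + \<delta> *\<^sub>R w q)) has_real_derivative Db k (q + \<xi> *\<^sub>R w q) (w q)) (at \<xi>)"
        by (simp add: algebra_simps)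
    qed
    then obtain \<xi> where \<xi>: "0 < \<xi>" "\<xi> < l" "b k (q + l *\<^sub>R w q) - b k q = l * Db k (q + \<xi> *\<^sub>R w q) (w q)" by auto
    have "\<bar>Db k (q + \<xi> *\<^sub>R w q) (w q) - Db k q (w q)\<bar> < e/2"
      using r3(2)[of "(0, q)" "(\<xi>, q)"] q \<xi> l l0 l1 by (auto simp: dist_Pair_Pair dist_real_def)
    then have "\<bar>Db k (q + \<xi> *\<^sub>R w q) (w q) - (\<beta>' (F q) (F' q (w q)) - \<beta> q (w q))\<bar> \<le> e"
      using close(1)[OF qK1] GDb[OF qK1 k(1,2)] by linarith
    from abs_diff_scaled_le[OF l(1) this] show ?thesis using \<xi>(3) by simp
  qed
  moreover have "\<bar>b k q - f q\<bar> \<le> e" if "q \<in> K" for q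
    using close(2)[of q] dK1[OF that, of q] d1 by simp
  ultimately show "\<exists>b. (\<forall>q\<in>K. \<bar>b q - f q\<bar> \<le> e) \<and>
          (\<exists>l0>0. \<forall>l. 0 < l \<longrightarrow> l \<le> l0 \<longrightarrow> (\<forall>q\<in>K. \<bar>b (q + l *\<^sub>R w q) - b q - l * (\<beta>' (F q) (F' q (w q)) - \<beta> q (w q))\<bar> \<le> e * l))"
    using l0(1) by blast
qed

end

text \<open>
  Two forms with opposite conformal factors, whose kernels together span everything: a vector \<open>h\<close> is the sum of
  \<open>h - (Au \<bullet> h) e\<close>, which lies in the kernel of \<open>Au\<close>, and \<open>(Au \<bullet> h) e\<close>, which lies in the kernel of \<open>As\<close>.
\<close>

lemma conformal_factor_has_derivative:
  fixes f :: "'a::euclidean_space \<Rightarrow> real"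
  assumes u: "conformal_pullback U V F F' Au Bu Au' Bu' f \<beta> \<beta>'"
    and s: "conformal_pullback U V F F' As Bs As' Bs' (\<lambda>x. - f x) (\<lambda>x h. - \<beta> x h) (\<lambda>y h. - \<beta>' y h)"
    and vu: "\<And>x. x \<in> U \<Longrightarrow> Au x \<bullet> vu > 0" and vs: "\<And>x. x \<in> U \<Longrightarrow> As x \<bullet> vs > 0"
    and e: "continuous_on U e" "\<And>x. x \<in> U \<Longrightarrow> Au x \<bullet> e x = 1" "\<And>x. x \<in> U \<Longrightarrow> As x \<bullet> e x = 0"
    and x: "x \<in> U"
  shows "(f has_derivative (\<lambda>h. \<beta>' (F x) (F' x h) - \<beta> x h)) (at x)"
proof -
  interpret u: conformal_pullback U V F F' Au Bu Au' Bu' f \<beta> \<beta>' by (rule u)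
  interpret s: conformal_pullback U V F F' As Bs As' Bs' "\<lambda>x. - f x" "\<lambda>x h. - \<beta> x h" "\<lambda>y h. - \<beta>' y h" by (rule s)
  let ?\<eta> = "\<lambda>x h. \<beta>' (F x) (F' x h) - \<beta> x h"
  have lin: "linear (?\<eta> q)" if "q \<in> U" for q
  proof (intro linear_compose_sub u.\<beta> that)
    have "linear (F' q)" "linear (\<beta>' (F q))"
      using u.F(1)[OF that] u.\<beta>'(1)[of "F q"] u.FV that has_derivative_linear by auto
    from linear_compose[OF this] show "linear (\<lambda>h. \<beta>' (F q) (F' q h))" by (simp add: o_def)
  qed
  have cont: "continuous_on U (\<lambda>q. ?\<eta> q (w q))" if "continuous_on U w" for w
    by (intro continuous_intros u.continuous_on_derivatives that) auto
  have cAu: "continuous_on U Au" using u.continuous_on_fields(2)[of U "\<lambda>x. x"] by auto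
  have slope: "has_slope_along U f (\<lambda>_. h) (\<lambda>q. ?\<eta> q h)" for h
  proof -
    define w1 where "w1 = (\<lambda>q. h - (Au q \<bullet> h) *\<^sub>R e q)"
    define w2 where "w2 = (\<lambda>q. (Au q \<bullet> h) *\<^sub>R e q)"
    have cw: "continuous_on U w1" "continuous_on U w2" unfolding w1_def w2_def by (intro continuous_intros cAu e(1))+
    have 1: "has_slope_along U f w1 (\<lambda>q. ?\<eta> q (w1 q))"
      by (rule u.slope_in_kernel[OF vu cw(1)]) (auto simp: w1_def inner_diff e(2))
    have "has_slope_along U (\<lambda>x. - f x) w2 (\<lambda>q. - \<beta>' (F q) (F' q (w2 q)) - - \<beta> q (w2 q))"
      by (rule s.slope_in_kernel[OF vs cw(2)]) (auto simp: w2_def e(3))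
    from has_slope_along_minus[OF this]
    have 2: "has_slope_along U f w2 (\<lambda>q. ?\<eta> q (w2 q))" by simp
    have "has_slope_along U f (\<lambda>x. w1 x + w2 x) (\<lambda>x. ?\<eta> x (w1 x) + ?\<eta> x (w2 x))"
      by (rule has_slope_along_add[OF u.U 1 2 cw cont[OF cw(2)]])
    moreover have "?\<eta> q (w1 q) + ?\<eta> q (w2 q) = ?\<eta> q h" if "q \<in> U" for q
    proof -
      have "?\<eta> q (w1 q + w2 q) = ?\<eta> q (w1 q) + ?\<eta> q (w2 q)" using linear_add[OF lin[OF that]] .
      then show ?thesis by (simp add: w1_def w2_def)
    qed
    ultimately show ?thesis
      unfolding has_slope_along_def by (simp add: w1_def w2_def subset_iff cong: conj_cong)
  qed
  show ?thesis by (rule has_derivative_of_slopes[OF u.U x u.f lin cont[OF continuous_on_const] slope])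
qed

section \<open>Maps of class \<open>C\<^sup>k\<close>\<close>

lemma Ck_on_Suc_imp: "Ck_on (Suc k) f S \<Longrightarrow> Ck_on k f S"
proof (induction k arbitrary: f)
  case 0
  then obtain g where "\<forall>x\<in>S. (f has_derivative (\<lambda>h. \<Sum>b\<in>Basis. (h \<bullet> b) *\<^sub>R g b x)) (at x within S)"
    by auto
  then show ?case by (auto intro: has_derivative_continuous_on)
next
  case (Suc k)
  from Suc.prems obtain g where g: "\<forall>x\<in>S. (f has_derivative (\<lambda>h. \<Sum>b\<in>Basis. (h \<bullet> b) *\<^sub>R g b x)) (at x within S)"
    "\<forall>b\<in>Basis. Ck_on (Suc k) (g b) S" unfolding Ck_on.simps(2)[of "Suc k"] by blast
  then have "\<forall>b\<in>Basis. Ck_on k (g b) S" using Suc.IH by blast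
  with g(1) show ?case by auto
qed

lemma Ck_on_1_has_derivative:
  assumes "Ck_on 1 f S" "open S"
  shows "x \<in> S \<Longrightarrow> (f has_derivative frechet_derivative f (at x)) (at x)"
    and "continuous_on S (\<lambda>x. frechet_derivative f (at x) h)"
proof -
  obtain g where g: "\<And>x. x\<in>S \<Longrightarrow> (f has_derivative (\<lambda>h. \<Sum>b\<in>Basis. (h \<bullet> b) *\<^sub>R g b x)) (at x)"
    "\<And>b. b\<in>Basis \<Longrightarrow> continuous_on S (g b)" using assms by (auto simp: at_within_open[of _ S])
  then show "x \<in> S \<Longrightarrow> (f has_derivative frechet_derivative f (at x)) (at x)"
    using frechet_derivative_works differentiable_def by blast
  have "frechet_derivative f (at x) h = (\<Sum>b\<in>Basis. (h \<bullet> b) *\<^sub>R g b x)" if "x \<in> S" for x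
    by (rule fun_cong[OF frechet_derivative_at[OF g(1)[OF that]], symmetric])
  moreover have "continuous_on S (\<lambda>x. \<Sum>b\<in>Basis. (h \<bullet> b) *\<^sub>R g b x)"
    by (intro continuous_intros g)
  ultimately show "continuous_on S (\<lambda>x. frechet_derivative f (at x) h)"
    by (simp cong: continuous_on_cong)
qed

lemma Ck_on_add: "Ck_on k f S \<Longrightarrow> Ck_on k g S \<Longrightarrow> Ck_on k (\<lambda>x. f x + g x) S"
proof (induction k arbitrary: f g)
  case 0 then show ?case by (simp add: continuous_on_add)
next
  case (Suc k)
  obtain f' where f': "\<And>x. x\<in>S \<Longrightarrow> (f has_derivative (\<lambda>h. \<Sum>b\<in>Basis. (h \<bullet> b) *\<^sub>R f' b x)) (at x within S)"
    "\<And>b. b\<in>Basis \<Longrightarrow> Ck_on k (f' b) S" using Suc.prems(1) by auto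
  obtain g' where g': "\<And>x. x\<in>S \<Longrightarrow> (g has_derivative (\<lambda>h. \<Sum>b\<in>Basis. (h \<bullet> b) *\<^sub>R g' b x)) (at x within S)"
    "\<And>b. b\<in>Basis \<Longrightarrow> Ck_on k (g' b) S" using Suc.prems(2) by auto
  have "((\<lambda>x. f x + g x) has_derivative (\<lambda>h. \<Sum>b\<in>Basis. (h \<bullet> b) *\<^sub>R (f' b x + g' b x))) (at x within S)" if "x \<in> S" for x
    using has_derivative_add[OF f'(1)[OF that] g'(1)[OF that]] by (simp add: sum.distrib scaleR_add_right)
  moreover have "Ck_on k (\<lambda>x. f' b x + g' b x) S" if "b \<in> Basis" for b
    using Suc.IH f'(2) g'(2) that by blast
  ultimately show ?case by (auto intro!: exI[of _ "\<lambda>b x. f' b x + g' b x"])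
qed

lemma Ck_on_const: "Ck_on k (\<lambda>x. c) S"
proof (induction k arbitrary: c)
  case 0 then show ?case by simp
next
  case (Suc k)
  show ?case using Suc by (auto intro!: exI[of _ "\<lambda>b x. 0"])
qed

lemma Ck_on_sum: "finite I \<Longrightarrow> (\<And>i. i \<in> I \<Longrightarrow> Ck_on k (f i) S) \<Longrightarrow> Ck_on k (\<lambda>x. \<Sum>i\<in>I. f i x) S"
  by (induction rule: finite_induct) (auto intro: Ck_on_add Ck_on_const)

lemma Ck_on_linear_compose:
  fixes f :: "'a::euclidean_space \<Rightarrow> 'b::real_normed_vector" and L :: "'b \<Rightarrow> 'c::real_normed_vector"
    and P :: "'d::euclidean_space \<Rightarrow> 'a"
  assumes "Ck_on k f S" "bounded_linear L" and P: "bounded_linear P" "P ` S' \<subseteq> S"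
  shows "Ck_on k (\<lambda>y. L (f (P y))) S'"
  using assms(1,2)
proof (induction k arbitrary: f L)
  case 0
  interpret bounded_linear L by (rule 0)
  interpret P: bounded_linear P by (rule P)
  have "continuous_on S' (\<lambda>y. f (P y))"
    using 0 P(2) continuous_on_compose2[of S f S' P] P.continuous_on[OF continuous_on_id] by simp
  from continuous_on[OF this] show ?case by simp
next
  case (Suc k)
  interpret bounded_linear L by (rule Suc)
  interpret P: bounded_linear P by (rule P)
  obtain g where g: "\<And>x. x\<in>S \<Longrightarrow> (f has_derivative (\<lambda>h. \<Sum>b\<in>Basis. (h \<bullet> b) *\<^sub>R g b x)) (at x within S)"
    "\<And>b. b\<in>Basis \<Longrightarrow> Ck_on k (g b) S" using Suc.prems(1) by auto
  define G where "G = (\<lambda>e y. \<Sum>b\<in>Basis. (P e \<bullet> b) *\<^sub>R L (g b (P y)))"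
  have "((\<lambda>y. L (f (P y))) has_derivative (\<lambda>h. \<Sum>e\<in>Basis. (h \<bullet> e) *\<^sub>R G e y)) (at y within S')" if y: "y \<in> S'" for y
  proof -
    have "(P has_derivative P) (at y within S')" using P.has_derivative[OF has_derivative_ident] .
    from has_derivative_in_compose2[OF g(1) P(2) y this]
    have "((\<lambda>y. f (P y)) has_derivative (\<lambda>h. \<Sum>b\<in>Basis. (P h \<bullet> b) *\<^sub>R g b (P y))) (at y within S')" .
    from has_derivative[OF this]
    have "((\<lambda>y. L (f (P y))) has_derivative (\<lambda>h. L (\<Sum>b\<in>Basis. (P h \<bullet> b) *\<^sub>R g b (P y)))) (at y within S')" .
    moreover have "L (\<Sum>b\<in>Basis. (P h \<bullet> b) *\<^sub>R g b (P y)) = (\<Sum>e\<in>Basis. (h \<bullet> e) *\<^sub>R G e y)" for h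
    proof -
      have "P h = (\<Sum>e\<in>Basis. (h \<bullet> e) *\<^sub>R P e)"
        using P.sum[of "\<lambda>e. (h \<bullet> e) *\<^sub>R e" Basis] by (simp add: euclidean_representation P.scaleR)
      then have "L (\<Sum>b\<in>Basis. (P h \<bullet> b) *\<^sub>R g b (P y))
          = (\<Sum>b\<in>Basis. \<Sum>e\<in>Basis. (h \<bullet> e) *\<^sub>R (P e \<bullet> b) *\<^sub>R L (g b (P y)))"
        by (simp add: sum scaleR inner_sum_left scaleR_sum_left)
      also have "\<dots> = (\<Sum>e\<in>Basis. \<Sum>b\<in>Basis. (h \<bullet> e) *\<^sub>R (P e \<bullet> b) *\<^sub>R L (g b (P y)))" by (rule sum.swap)
      finally show ?thesis by (simp add: G_def scaleR_sum_right)
    qed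
    ultimately show ?thesis by simp
  qed
  moreover have "Ck_on k (G e) S'" for e
    unfolding G_def
  proof (rule Ck_on_sum)
    fix b :: 'a assume "b \<in> Basis"
    have "bounded_linear (\<lambda>z. (P e \<bullet> b) *\<^sub>R L z)"
      by (rule bounded_linear_compose[OF bounded_linear_scaleR_right Suc.prems(2)])
    from Suc.IH[OF g(2)[OF \<open>b \<in> Basis\<close>] this] show "Ck_on k (\<lambda>y. (P e \<bullet> b) *\<^sub>R L (g b (P y))) S'" .
  qed simp
  ultimately show ?case by (auto intro!: exI[of _ G])
qed

lemma Ck_on_cong:
  assumes "\<And>x. x \<in> S \<Longrightarrow> f x = g x" "Ck_on k g S" shows "Ck_on k f S"
proof (cases k)
  case 0
  then show ?thesis using assms by (simp cong: continuous_on_cong)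
next
  case (Suc m)
  then obtain g' where g': "\<And>x. x\<in>S \<Longrightarrow> (g has_derivative (\<lambda>h. \<Sum>b\<in>Basis. (h \<bullet> b) *\<^sub>R g' b x)) (at x within S)"
    "\<And>b. b\<in>Basis \<Longrightarrow> Ck_on m (g' b) S" using assms(2) by auto
  have "(f has_derivative (\<lambda>h. \<Sum>b\<in>Basis. (h \<bullet> b) *\<^sub>R g' b x)) (at x within S)" if "x \<in> S" for x
    by (rule has_derivative_transform[OF that assms(1) g'(1)[OF that]])
  then show ?thesis using g'(2) Suc by auto
qed

lemma Ck_on_linear:
  fixes L :: "'a::euclidean_space \<Rightarrow> 'b::real_normed_vector"
  assumes "bounded_linear L" shows "Ck_on k L S"
proof (cases k)
  case 0
  then show ?thesis using bounded_linear.continuous_on[OF assms continuous_on_id] by simp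
next
  case (Suc m)
  have "L h = (\<Sum>b\<in>Basis. (h \<bullet> b) *\<^sub>R L b)" for h
  proof -
    interpret bounded_linear L by (rule assms)
    have "L (\<Sum>b\<in>Basis. (h \<bullet> b) *\<^sub>R b) = (\<Sum>b\<in>Basis. (h \<bullet> b) *\<^sub>R L b)" by (simp add: sum scaleR)
    then show ?thesis by (simp add: euclidean_representation)
  qed
  then have "(L has_derivative (\<lambda>h. \<Sum>b\<in>Basis. (h \<bullet> b) *\<^sub>R L b)) (at x within S)" for x
    using bounded_linear_imp_has_derivative[OF assms] by (metis (no_types, lifting) ext has_derivative_at_withinI)
  then show ?thesis using Suc by (auto intro!: exI[of _ "\<lambda>b x. L b"] Ck_on_const)
qed

lemma Ck_on_1I:
  assumes "\<And>x. x \<in> S \<Longrightarrow> (f has_derivative f' x) (at x within S)" "\<And>h. continuous_on S (\<lambda>x. f' x h)"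
  shows "Ck_on 1 f S"
proof -
  have "(f has_derivative (\<lambda>h. \<Sum>b\<in>Basis. (h \<bullet> b) *\<^sub>R f' x b)) (at x within S)" if "x \<in> S" for x
  proof -
    have l: "linear (f' x)" using assms(1)[OF that] has_derivative_linear by blast
    have "f' x h = (\<Sum>b\<in>Basis. (h \<bullet> b) *\<^sub>R f' x b)" for h
      using linear_sum[OF l, of "\<lambda>b. (h \<bullet> b) *\<^sub>R b" Basis] linear_scale[OF l] by (simp add: euclidean_representation)
    then show ?thesis using assms(1)[OF that] by (metis (no_types, lifting) ext)
  qed
  then show ?thesis using assms(2) by (auto intro!: exI[of _ "\<lambda>b x. f' x b"])
qed

lemma Ck_on_2_frechet_derivative:
  assumes "Ck_on 2 f S" "open S"
  shows "Ck_on 1 (\<lambda>x. frechet_derivative f (at x) h) S"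
proof -
  obtain g where g: "\<And>x. x\<in>S \<Longrightarrow> (f has_derivative (\<lambda>h. \<Sum>b\<in>Basis. (h \<bullet> b) *\<^sub>R g b x)) (at x)"
    "\<And>b. b\<in>Basis \<Longrightarrow> Ck_on 1 (g b) S"
    using assms by (auto simp: at_within_open[of _ S] numeral_2_eq_2)
  have eq: "frechet_derivative f (at x) h = (\<Sum>b\<in>Basis. (h \<bullet> b) *\<^sub>R g b x)" if "x \<in> S" for x
    by (rule fun_cong[OF frechet_derivative_at[OF g(1)[OF that]], symmetric])
  define G where "G = (\<lambda>c x. \<Sum>b\<in>Basis. (h \<bullet> b) *\<^sub>R frechet_derivative (g b) (at x) c)"
  have "((\<lambda>x. frechet_derivative f (at x) h) has_derivative (\<lambda>k. \<Sum>c\<in>Basis. (k \<bullet> c) *\<^sub>R G c x)) (at x within S)" if x: "x \<in> S" for x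
  proof -
    have "((\<lambda>x. \<Sum>b\<in>Basis. (h \<bullet> b) *\<^sub>R g b x) has_derivative (\<lambda>k. \<Sum>b\<in>Basis. (h \<bullet> b) *\<^sub>R frechet_derivative (g b) (at x) k)) (at x within S)"
      by (rule has_derivative_at_withinI)
        (intro has_derivative_sum has_derivative_scaleR_right Ck_on_1_has_derivative(1)[OF g(2) assms(2)] x)
    moreover have "(\<Sum>b\<in>Basis. (h \<bullet> b) *\<^sub>R frechet_derivative (g b) (at x) k) = (\<Sum>c\<in>Basis. (k \<bullet> c) *\<^sub>R G c x)" for k
    proof -
      have "frechet_derivative (g b) (at x) k = (\<Sum>c\<in>Basis. (k \<bullet> c) *\<^sub>R frechet_derivative (g b) (at x) c)" if "b \<in> Basis" for b
      proof -
        have l: "linear (frechet_derivative (g b) (at x))"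
          using Ck_on_1_has_derivative(1)[OF g(2)[OF that] assms(2) x] has_derivative_linear by blast
        have "frechet_derivative (g b) (at x) (\<Sum>c\<in>Basis. (k \<bullet> c) *\<^sub>R c) = (\<Sum>c\<in>Basis. (k \<bullet> c) *\<^sub>R frechet_derivative (g b) (at x) c)"
          by (simp add: linear_sum[OF l] linear_scale[OF l])
        then show ?thesis by (simp add: euclidean_representation)
      qed
      then have "(\<Sum>b\<in>Basis. (h \<bullet> b) *\<^sub>R frechet_derivative (g b) (at x) k)
          = (\<Sum>b\<in>Basis. \<Sum>c\<in>Basis. (k \<bullet> c) *\<^sub>R (h \<bullet> b) *\<^sub>R frechet_derivative (g b) (at x) c)"
        by (simp add: scaleR_sum_right mult.commute)
      also have "\<dots> = (\<Sum>c\<in>Basis. \<Sum>b\<in>Basis. (k \<bullet> c) *\<^sub>R (h \<bullet> b) *\<^sub>R frechet_derivative (g b) (at x) c)"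
        by (rule sum.swap)
      finally show ?thesis by (simp add: G_def scaleR_sum_right)
    qed
    ultimately have "((\<lambda>x. \<Sum>b\<in>Basis. (h \<bullet> b) *\<^sub>R g b x) has_derivative (\<lambda>k. \<Sum>c\<in>Basis. (k \<bullet> c) *\<^sub>R G c x)) (at x within S)" by simp
    then show ?thesis by (rule has_derivative_transform[OF x eq, rotated])
  qed
  moreover have "continuous_on S (G c)" for c
    unfolding G_def by (intro continuous_intros Ck_on_1_has_derivative(2)[OF g(2) assms(2)])
  ultimately show ?thesis by (auto intro!: exI[of _ G])
qed

text \<open>
  Two applications of the mean value theorem express the second difference quotient by a value of the second
  derivative at a nearby point.  The quotient is symmetric in \<open>u\<close> and \<open>v\<close>, and therefore so are its limits.
\<close>

lemma second_difference_quotient: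
  fixes f :: "'a::euclidean_space \<Rightarrow> real"
  assumes S: "open S" "x \<in> S"
    and f: "\<And>y. y \<in> S \<Longrightarrow> (f has_derivative f' y) (at y)"
    and fu: "\<And>y. y \<in> S \<Longrightarrow> ((\<lambda>z. f' z u) has_derivative fu y) (at y)"
    and cont: "continuous_on S (\<lambda>y. fu y v)"
  shows "((\<lambda>s. (f (x + s *\<^sub>R u + s *\<^sub>R v) - f (x + s *\<^sub>R u) - f (x + s *\<^sub>R v) + f x) / s^2) \<longlongrightarrow> fu x v) (at_right 0)"
proof (rule tendstoI)
  fix e :: real assume e: "e > 0"
  obtain r where r: "r > 0" "ball x r \<subseteq> S" using S openE by blast
  obtain d where d: "d > 0" "\<And>y. y \<in> S \<Longrightarrow> dist y x < d \<Longrightarrow> dist (fu y v) (fu x v) < e"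
    using cont S(2) e unfolding continuous_on_iff by metis
  define n where "n = norm u + norm v + 1"
  have n: "n > 0" unfolding n_def by (simp add: add_nonneg_pos)
  define s0 where "s0 = min r d / n"
  have s0: "s0 > 0" using r d n by (simp add: s0_def)
  have near: "x + a *\<^sub>R u + b *\<^sub>R v \<in> S" "dist (x + a *\<^sub>R u + b *\<^sub>R v) x < d"
    if "0 \<le> a" "0 \<le> b" "a < s0" "b < s0" for a b
  proof -
    have "norm (a *\<^sub>R u + b *\<^sub>R v) \<le> a * norm u + b * norm v"
      using norm_triangle_ineq[of "a *\<^sub>R u" "b *\<^sub>R v"] that by simp
    also have "\<dots> \<le> max a b * norm u + max a b * norm v"
      by (intro add_mono mult_right_mono) auto
    also have "\<dots> \<le> max a b * n" using that by (simp add: n_def algebra_simps)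
    also have "\<dots> < s0 * n" using that n by (intro mult_strict_right_mono) auto
    also have "\<dots> = min r d" using n by (simp add: s0_def)
    finally have *: "norm (a *\<^sub>R u + b *\<^sub>R v) < min r d" .
    have "dist (x + a *\<^sub>R u + b *\<^sub>R v) x = norm (a *\<^sub>R u + b *\<^sub>R v)" by (simp add: dist_norm add.assoc)
    then show "x + a *\<^sub>R u + b *\<^sub>R v \<in> S" "dist (x + a *\<^sub>R u + b *\<^sub>R v) x < d"
      using r(2) * by (auto simp: dist_commute)
  qed
  have "\<forall>\<^sub>F s in at_right (0::real). 0 < s \<and> s < s0"
    using s0 by (auto simp: eventually_at_right_field)
  then show "\<forall>\<^sub>F s in at_right 0. dist ((f (x + s *\<^sub>R u + s *\<^sub>R v) - f (x + s *\<^sub>R u) - f (x + s *\<^sub>R v) + f x) / s^2) (fu x v) < e"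
  proof eventually_elim
    case (elim s)
    have dline: "((\<lambda>t. f (p + t *\<^sub>R u)) has_real_derivative f' (p + t *\<^sub>R u) u) (at t)" if "p + t *\<^sub>R u \<in> S" for p t
    proof -
      have "((\<lambda>t. p + t *\<^sub>R u) has_derivative (\<lambda>h. h *\<^sub>R u)) (at t)" by (auto intro!: derivative_eq_intros)
      from has_derivative_compose[OF this f[OF that]]
      show ?thesis using has_derivative_linear[OF f[OF that]]
        by (simp add: has_field_derivative_def linear_scale mult_commute_abs)
    qed
    have "\<exists>\<xi>. 0 < \<xi> \<and> \<xi> < s \<and> (f (x + s *\<^sub>R v + s *\<^sub>R u) - f (x + s *\<^sub>R u)) - (f (x + s *\<^sub>R v + 0 *\<^sub>R u) - f (x + 0 *\<^sub>R u))
       = (s - 0) * (f' (x + s *\<^sub>R v + \<xi> *\<^sub>R u) u - f' (x + \<xi> *\<^sub>R u) u)"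
    proof (rule MVT2)
      fix t assume t: "0 \<le> t" "t \<le> s"
      show "((\<lambda>t. f (x + s *\<^sub>R v + t *\<^sub>R u) - f (x + t *\<^sub>R u)) has_real_derivative f' (x + s *\<^sub>R v + t *\<^sub>R u) u - f' (x + t *\<^sub>R u) u) (at t)"
        by (intro DERIV_diff dline) (use near[of t s] near[of t 0] t elim s0 in \<open>auto simp: add_ac\<close>)
    qed (use elim in auto)
    then obtain \<xi> where \<xi>: "0 < \<xi>" "\<xi> < s" "f (x + s *\<^sub>R u + s *\<^sub>R v) - f (x + s *\<^sub>R u) - f (x + s *\<^sub>R v) + f x
       = s * (f' (x + \<xi> *\<^sub>R u + s *\<^sub>R v) u - f' (x + \<xi> *\<^sub>R u) u)"
      by (auto simp: algebra_simps)
    have "\<exists>\<zeta>. 0 < \<zeta> \<and> \<zeta> < s \<and> f' (x + \<xi> *\<^sub>R u + s *\<^sub>R v) u - f' (x + \<xi> *\<^sub>R u + 0 *\<^sub>R v) u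
       = (s - 0) * fu (x + \<xi> *\<^sub>R u + \<zeta> *\<^sub>R v) v"
    proof (rule MVT2)
      fix t assume t: "0 \<le> t" "t \<le> s"
      have tS: "x + \<xi> *\<^sub>R u + t *\<^sub>R v \<in> S" using near[of \<xi> t] t elim s0 \<xi> by auto
      have "((\<lambda>t. x + \<xi> *\<^sub>R u + t *\<^sub>R v) has_derivative (\<lambda>h. h *\<^sub>R v)) (at t)" by (auto intro!: derivative_eq_intros)
      from has_derivative_compose[OF this fu[OF tS]]
      show "((\<lambda>t. f' (x + \<xi> *\<^sub>R u + t *\<^sub>R v) u) has_real_derivative fu (x + \<xi> *\<^sub>R u + t *\<^sub>R v) v) (at t)"
        using has_derivative_linear[OF fu[OF tS]]
        by (simp add: has_field_derivative_def linear_scale mult_commute_abs)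
    qed (use elim in auto)
    then obtain \<zeta> where \<zeta>: "0 < \<zeta>" "\<zeta> < s" "f' (x + \<xi> *\<^sub>R u + s *\<^sub>R v) u - f' (x + \<xi> *\<^sub>R u) u = s * fu (x + \<xi> *\<^sub>R u + \<zeta> *\<^sub>R v) v"
      by auto
    have "(f (x + s *\<^sub>R u + s *\<^sub>R v) - f (x + s *\<^sub>R u) - f (x + s *\<^sub>R v) + f x) / s^2 = fu (x + \<xi> *\<^sub>R u + \<zeta> *\<^sub>R v) v"
      using \<xi>(3) \<zeta>(3) elim by (simp add: power2_eq_square)
    then show ?case using d(2)[OF near] \<xi> \<zeta> elim by simp
  qed
qed

lemma second_derivative_symmetric:
  fixes f :: "'a::euclidean_space \<Rightarrow> real"
  assumes f: "Ck_on 2 f S" and S: "open S" "x \<in> S"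
  shows "frechet_derivative (\<lambda>y. frechet_derivative f (at y) u) (at x) v
       = frechet_derivative (\<lambda>y. frechet_derivative f (at y) v) (at x) u"
proof -
  have f1: "Ck_on 1 f S" using f Ck_on_Suc_imp by (metis One_nat_def Suc_1)
  note q = second_difference_quotient[OF S Ck_on_1_has_derivative(1)[OF f1 S(1)]
      Ck_on_1_has_derivative(1)[OF Ck_on_2_frechet_derivative[OF f S(1)] S(1)]
      Ck_on_1_has_derivative(2)[OF Ck_on_2_frechet_derivative[OF f S(1)] S(1)]]
  have "(\<lambda>s. (f (x + s *\<^sub>R u + s *\<^sub>R v) - f (x + s *\<^sub>R u) - f (x + s *\<^sub>R v) + f x) / s\<^sup>2)
      = (\<lambda>s. (f (x + s *\<^sub>R v + s *\<^sub>R u) - f (x + s *\<^sub>R v) - f (x + s *\<^sub>R u) + f x) / s\<^sup>2)"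
    by (auto simp: algebra_simps)
  then show ?thesis using tendsto_unique[OF _ q[of u v]] q[of v u] by simp
qed

lemma has_derivative_transform_nhds:
  assumes "(f has_derivative f') (at x)" "\<forall>\<^sub>F y in nhds x. f y = g y"
  shows "(g has_derivative f') (at x)"
proof (rule has_derivative_transform_eventually[OF assms(1)])
  show "\<forall>\<^sub>F y in at x. f y = g y" using assms(2) by (auto simp: eventually_at_filter elim: eventually_mono)
  show "f x = g x" using eventually_nhds_x_imp_x[OF assms(2)] .
qed simp

section \<open>Charts and tangent vectors\<close>

locale oriented_mfd =
  fixes M :: "'a::t2_space set" and A :: "('a, 'n::finite) chart set"
  assumes mfd: "oriented_manifold M A"
begin

lemma chart_exists: "p \<in> M \<Longrightarrow> \<exists>c\<in>A. p \<in> cdom c"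
  using mfd unfolding oriented_manifold_def by blast

lemma cdom_subset: "c \<in> A \<Longrightarrow> cdom c \<subseteq> M"
  using mfd unfolding oriented_manifold_def by blast

lemma cdom_openin: "c \<in> A \<Longrightarrow> openin (top_of_set M) (cdom c)"
  using mfd unfolding oriented_manifold_def by blast

lemma chart_homeomorphism:
  assumes "c \<in> A" shows "homeomorphism (cdom c) (cimg c) (cmap c) (cinv c)"
proof -
  obtain g where g: "homeomorphism (cdom c) (cimg c) (cmap c) g"
    using mfd assms unfolding oriented_manifold_def by blast
  have inj: "inj_on (cmap c) (cdom c)" using g unfolding homeomorphism_def by (metis inj_on_def)
  have "cinv c x = g x" if "x \<in> cimg c" for x
    using that inj g unfolding homeomorphism_def by (metis imageE inv_into_f_f)
  then show ?thesis using g by (rule homeomorphism_cong[rotated -1]) auto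
qed

lemma cinv_in: "c \<in> A \<Longrightarrow> x \<in> cimg c \<Longrightarrow> cinv c x \<in> cdom c" by (simp add: inv_into_into)
lemma cmap_cinv [simp]: "x \<in> cimg c \<Longrightarrow> cmap c (cinv c x) = x" by (rule f_inv_into_f)
lemma cinv_cmap [simp]: "c \<in> A \<Longrightarrow> p \<in> cdom c \<Longrightarrow> cinv c (cmap c p) = p"
  using chart_homeomorphism unfolding homeomorphism_def by blast

lemma chart_at: "p \<in> M \<Longrightarrow> chart_at A p \<in> A \<and> p \<in> cdom (chart_at A p)"
  using chart_exists unfolding chart_at_def by (metis (mono_tags, lifting) someI_ex)

end

locale closed_mfd = oriented_mfd M A
  for M :: "'a::t2_space set" and A :: "('a, 'n::finite) chart set" +
  assumes no_boundary: "mfd_boundary M A = {}"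
begin

lemma open_cimg: assumes "c \<in> A" shows "open (cimg c)"
proof -
  have "x \<in> interior (cimg c)" if "x \<in> cimg c" for x
    using that assms no_boundary cdom_subset[OF assms] unfolding mfd_boundary_def by blast
  then show ?thesis by (metis interior_subset open_interior subsetI subset_antisym)
qed

lemma open_chart_image:
  assumes "c \<in> A" "openin (top_of_set M) W" shows "open (cmap c ` (cdom c \<inter> W))"
proof -
  have "openin (top_of_set (cdom c)) (cdom c \<inter> W)"
  proof -
    obtain T where T: "open T" "W = M \<inter> T" using assms(2) unfolding openin_open by blast
    then have "cdom c \<inter> W = cdom c \<inter> T" using cdom_subset[OF assms(1)] by blast
    then show ?thesis using T(1) openin_open_Int by simp
  qed
  then have "openin (top_of_set (cimg c)) (cmap c ` (cdom c \<inter> W))"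
    using homeomorphism_imp_open_map[OF chart_homeomorphism[OF assms(1)]] by blast
  then show ?thesis using open_cimg[OF assms(1)] openin_open_trans by blast
qed

lemma openin_cinv_image:
  assumes "c \<in> A" "open O'" "O' \<subseteq> cimg c" shows "openin (top_of_set M) (cinv c ` O')"
proof -
  have "openin (top_of_set (cdom c)) (cinv c ` O')"
    using homeomorphism_imp_open_map[OF homeomorphism_symD[OF chart_homeomorphism[OF assms(1)]]] assms
    by (meson open_openin_trans open_subset)
  then show ?thesis using cdom_openin[OF assms(1)] openin_trans by blast
qed

definition overlap :: "('a, 'n) chart \<Rightarrow> ('a, 'n) chart \<Rightarrow> (real ^ 'n) set" where
  "overlap c d = cmap c ` (cdom c \<inter> cdom d)"

lemma open_overlap: "c \<in> A \<Longrightarrow> d \<in> A \<Longrightarrow> open (overlap c d)"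
  unfolding overlap_def by (intro open_chart_image cdom_openin)

lemma overlap_iff:
  assumes "c \<in> A" "p \<in> cdom c" shows "cmap c p \<in> overlap c d \<longleftrightarrow> p \<in> cdom d"
proof
  assume "cmap c p \<in> overlap c d"
  then obtain q where q: "q \<in> cdom c" "q \<in> cdom d" "cmap c p = cmap c q" by (auto simp: overlap_def)
  then show "p \<in> cdom d" using cinv_cmap[OF assms] cinv_cmap[OF assms(1) q(1)] by metis
qed (use assms in \<open>auto simp: overlap_def\<close>)

lemma transition_Ck: "c \<in> A \<Longrightarrow> d \<in> A \<Longrightarrow> Ck_on k (cmap d \<circ> cinv c) (overlap c d)"
  using mfd unfolding oriented_manifold_def smooth_on_def overlap_def by blast

lemma trans_deriv_eq:
  assumes "c \<in> A" "d \<in> A" "p \<in> cdom c" "p \<in> cdom d"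
  shows "trans_deriv c d p = frechet_derivative (cmap d \<circ> cinv c) (at (cmap c p))"
proof -
  have "cmap c p \<in> overlap c d" using assms overlap_iff by blast
  then have "at (cmap c p) within overlap c d = at (cmap c p)" using open_overlap assms at_within_open by blast
  then show ?thesis by (simp add: trans_deriv_def overlap_def)
qed

lemma transition_has_derivative:
  assumes "c \<in> A" "d \<in> A" "p \<in> cdom c" "p \<in> cdom d"
  shows "(cmap d \<circ> cinv c has_derivative trans_deriv c d p) (at (cmap c p))"
  unfolding trans_deriv_eq[OF assms]
  by (rule Ck_on_1_has_derivative(1)[OF transition_Ck open_overlap]) (use assms overlap_iff in auto)

lemma trans_deriv_linear:
  assumes "c \<in> A" "d \<in> A" "p \<in> cdom c" "p \<in> cdom d"
  shows "linear (trans_deriv c d p)"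
  using transition_has_derivative[OF assms] has_derivative_linear by blast

lemma eventually_in_cimg:
  assumes "c \<in> A" "p \<in> cdom c" "openin (top_of_set M) W" "p \<in> W"
  shows "\<forall>\<^sub>F y in nhds (cmap c p). y \<in> cimg c \<and> cinv c y \<in> W"
proof -
  have "open (cmap c ` (cdom c \<inter> W))" using open_chart_image assms by blast
  moreover have "cmap c p \<in> cmap c ` (cdom c \<inter> W)" using assms by blast
  ultimately have "\<forall>\<^sub>F y in nhds (cmap c p). y \<in> cmap c ` (cdom c \<inter> W)" by (rule eventually_nhds_in_open)
  then show ?thesis by eventually_elim (use assms in auto)
qed

lemma trans_deriv_trans:
  assumes "c \<in> A" "d \<in> A" "e \<in> A" "p \<in> cdom c" "p \<in> cdom d" "p \<in> cdom e"
  shows "trans_deriv d e p (trans_deriv c d p h) = trans_deriv c e p h"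
proof -
  have "(cmap e \<circ> cinv d \<circ> (cmap d \<circ> cinv c) has_derivative trans_deriv d e p \<circ> trans_deriv c d p) (at (cmap c p))"
    using diff_chain_at[OF transition_has_derivative[OF assms(1,2,4,5)], of "cmap e \<circ> cinv d"]
      transition_has_derivative[OF assms(2,3,5,6)] assms by simp
  moreover have "\<forall>\<^sub>F y in nhds (cmap c p). (cmap e \<circ> cinv d \<circ> (cmap d \<circ> cinv c)) y = (cmap e \<circ> cinv c) y"
    using eventually_in_cimg[OF assms(1,4) cdom_openin[OF assms(2)] assms(5)]
    by eventually_elim (use assms in simp)
  ultimately have "(cmap e \<circ> cinv c has_derivative trans_deriv d e p \<circ> trans_deriv c d p) (at (cmap c p))"
    by (rule has_derivative_transform_nhds)
  from has_derivative_unique[OF this transition_has_derivative[OF assms(1,3,4,6)]] show ?thesis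
    by (simp add: fun_eq_iff)
qed

lemma trans_deriv_same:
  assumes "c \<in> A" "p \<in> cdom c" shows "trans_deriv c c p h = h"
proof -
  have "\<forall>\<^sub>F y in nhds (cmap c p). y = (cmap c \<circ> cinv c) y"
    using eventually_in_cimg[OF assms cdom_openin[OF assms(1)] assms(2)] by eventually_elim simp
  then have "((\<lambda>x. x) has_derivative trans_deriv c c p) (at (cmap c p))"
    by (intro has_derivative_transform_nhds[OF transition_has_derivative[OF assms(1,1,2,2)]])
      (simp add: eq_commute)
  then show ?thesis using has_derivative_unique[OF _ has_derivative_ident] by metis
qed

lemma tangent_component:
  assumes "v \<in> tangent_space A p" "c \<in> A" "d \<in> A" "p \<in> cdom c" "p \<in> cdom d"
  shows "v d = trans_deriv c d p (v c)"
  using assms unfolding tangent_space_def by blast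

lemma tangent_outside: "v \<in> tangent_space A p \<Longrightarrow> \<not> (c \<in> A \<and> p \<in> cdom c) \<Longrightarrow> v c = 0"
  unfolding tangent_space_def by blast

lemma tangent_eqI:
  assumes "u \<in> tangent_space A p" "v \<in> tangent_space A p" "c \<in> A" "p \<in> cdom c" "u c = v c"
  shows "u = v"
proof
  fix d show "u d = v d"
    using assms tangent_component[of _ p c d] tangent_outside by (cases "d \<in> A \<and> p \<in> cdom d") metis+
qed

lemma coord_vec_tangent:
  assumes "c \<in> A" "p \<in> cdom c" shows "coord_vec A p c h \<in> tangent_space A p"
  using assms trans_deriv_trans by (auto simp: tangent_space_def coord_vec_def)

lemma coord_vec_apply:
  assumes "c \<in> A" "p \<in> cdom c" shows "coord_vec A p c h c = h"
  using assms trans_deriv_same by (simp add: coord_vec_def)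

lemma coord_vec_component:
  assumes "v \<in> tangent_space A p" "c \<in> A" "p \<in> cdom c" shows "coord_vec A p c (v c) = v"
  using tangent_eqI[OF coord_vec_tangent assms(1)] assms coord_vec_apply by blast

lemma tadd_tangent:
  assumes "u \<in> tangent_space A p" "v \<in> tangent_space A p" shows "tadd u v \<in> tangent_space A p"
proof -
  have "u d + v d = trans_deriv c d p (u c + v c)" if "c \<in> A" "d \<in> A" "p \<in> cdom c" "p \<in> cdom d" for c d
    using tangent_component[OF assms(1) that] tangent_component[OF assms(2) that]
      linear_add[OF trans_deriv_linear[OF that]] by simp
  then show ?thesis
    using tangent_outside[OF assms(1)] tangent_outside[OF assms(2)]
    unfolding tangent_space_def tadd_def mem_Collect_eq by (intro conjI allI ballI impI) (metis add_0, blast)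
qed

lemma tscale_tangent:
  assumes "u \<in> tangent_space A p" shows "tscale a u \<in> tangent_space A p"
proof -
  have "a *\<^sub>R u d = trans_deriv c d p (a *\<^sub>R u c)" if "c \<in> A" "d \<in> A" "p \<in> cdom c" "p \<in> cdom d" for c d
    using tangent_component[OF assms that] linear_scale[OF trans_deriv_linear[OF that]] by simp
  then show ?thesis
    using tangent_outside[OF assms]
    unfolding tangent_space_def tscale_def mem_Collect_eq by (intro conjI allI ballI impI) (metis scaleR_zero_right, blast)
qed

lemma tzero_tangent: "tzero \<in> tangent_space A p"
  using linear_0[OF trans_deriv_linear] by (simp add: tangent_space_def tzero_def)

section \<open>Differentials of maps\<close>

lemma eventually_map_in_chart:
  assumes "continuous (at p within M) f" "\<forall>q\<in>M. f q \<in> M" "c \<in> A" "d \<in> A" "p \<in> cdom c" "f p \<in> cdom d"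
  shows "\<forall>\<^sub>F y in nhds (cmap c p). y \<in> cimg c \<and> f (cinv c y) \<in> cdom d"
proof -
  obtain T where T: "open T" "cdom d = M \<inter> T" using cdom_openin[OF assms(4)] unfolding openin_open by blast
  have pM: "p \<in> M" using assms cdom_subset by blast
  have "\<forall>\<^sub>F q in at p within M. f q \<in> T"
    using assms(1,6) T unfolding continuous_within by (intro topological_tendstoD) auto
  then obtain S where S: "open S" "p \<in> S" "\<And>q. q \<in> S \<Longrightarrow> q \<noteq> p \<Longrightarrow> q \<in> M \<Longrightarrow> f q \<in> T"
    unfolding eventually_at_topological by blast
  have W: "openin (top_of_set M) (M \<inter> S)" using S(1) by (rule openin_open_Int)
  have "f q \<in> cdom d" if "q \<in> M \<inter> S" for q
    using S(3)[of q] that assms(2) assms(6) T by (cases "q = p") auto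
  moreover have "\<forall>\<^sub>F y in nhds (cmap c p). y \<in> cimg c \<and> cinv c y \<in> M \<inter> S"
    by (rule eventually_in_cimg[OF assms(3,5) W]) (use pM S in auto)
  ultimately show ?thesis by (auto elim: eventually_mono)
qed

text \<open>
  The set within which the derivative is taken in the definition of differentiability is a neighbourhood of the point, because
  the map is continuous and the manifold has no boundary.
\<close>

lemma local_rep_differentiable:
  assumes "mfd_differentiable M A A f p" "\<forall>q\<in>M. f q \<in> M" "c \<in> A" "d \<in> A" "p \<in> cdom c" "f p \<in> cdom d"
  shows "at (cmap c p) within cmap c ` {q \<in> cdom c. f q \<in> cdom d} = at (cmap c p)"
    and "(cmap d \<circ> f \<circ> cinv c has_derivative frechet_derivative (cmap d \<circ> f \<circ> cinv c) (at (cmap c p))) (at (cmap c p))"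
proof -
  have "continuous (at p within M) f" using assms(1) unfolding mfd_differentiable_def by blast
  from eventually_map_in_chart[OF this assms(2-6)]
  have "\<forall>\<^sub>F y in nhds (cmap c p). y \<in> cmap c ` {q \<in> cdom c. f q \<in> cdom d}"
  proof eventually_elim
    case (elim y)
    then show ?case using cinv_in[OF assms(3)] by (intro image_eqI[where x = "cinv c y"]) auto
  qed
  then have "cmap c p \<in> interior (cmap c ` {q \<in> cdom c. f q \<in> cdom d})"
    unfolding eventually_nhds interior_def by blast
  then show *: "at (cmap c p) within cmap c ` {q \<in> cdom c. f q \<in> cdom d} = at (cmap c p)"
    by (rule at_within_interior)
  have "(cmap d \<circ> f \<circ> cinv c) differentiable (at (cmap c p) within cmap c ` {q \<in> cdom c. f q \<in> cdom d})"
    using assms(1,3-6) unfolding mfd_differentiable_def by blast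
  then show "(cmap d \<circ> f \<circ> cinv c has_derivative frechet_derivative (cmap d \<circ> f \<circ> cinv c) (at (cmap c p))) (at (cmap c p))"
    unfolding * using frechet_derivative_works by blast
qed

lemma local_rep_change_of_charts:
  assumes cont: "continuous (at p within M) f" and f: "\<forall>q\<in>M. f q \<in> M"
    and c: "c \<in> A" "c' \<in> A" "p \<in> cdom c" "p \<in> cdom c'"
    and d: "d \<in> A" "d' \<in> A" "f p \<in> cdom d" "f p \<in> cdom d'"
    and D: "(cmap d \<circ> f \<circ> cinv c has_derivative D) (at (cmap c p))"
  shows "(cmap d' \<circ> f \<circ> cinv c' has_derivative trans_deriv d d' (f p) \<circ> D \<circ> trans_deriv c' c p) (at (cmap c' p))"
proof -
  have 1: "(cmap d \<circ> f \<circ> cinv c \<circ> (cmap c \<circ> cinv c') has_derivative D \<circ> trans_deriv c' c p) (at (cmap c' p))"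
    using diff_chain_at[OF transition_has_derivative[OF c(2,1,4,3)], of "cmap d \<circ> f \<circ> cinv c" D] D c by simp
  have 2: "(cmap d' \<circ> cinv d \<circ> (cmap d \<circ> f \<circ> cinv c \<circ> (cmap c \<circ> cinv c')) has_derivative
      trans_deriv d d' (f p) \<circ> (D \<circ> trans_deriv c' c p)) (at (cmap c' p))"
    using diff_chain_at[OF 1, of "cmap d' \<circ> cinv d"] transition_has_derivative[OF d] c by simp
  have "\<forall>\<^sub>F y in nhds (cmap c' p). y \<in> cimg c' \<and> f (cinv c' y) \<in> cdom d"
    by (rule eventually_map_in_chart[OF cont f c(2) d(1) c(4) d(3)])
  moreover have "\<forall>\<^sub>F y in nhds (cmap c' p). y \<in> cimg c' \<and> cinv c' y \<in> cdom c"
    by (rule eventually_in_cimg[OF c(2,4) cdom_openin[OF c(1)] c(3)])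
  ultimately have "\<forall>\<^sub>F y in nhds (cmap c' p). (cmap d' \<circ> cinv d \<circ> (cmap d \<circ> f \<circ> cinv c \<circ> (cmap c \<circ> cinv c'))) y = (cmap d' \<circ> f \<circ> cinv c') y"
    by eventually_elim (use c d in simp)
  from has_derivative_transform_nhds[OF 2 this] show ?thesis by (simp only: o_assoc)
qed

lemma mfd_differentiableI:
  assumes "continuous (at p within M) f" "\<forall>q\<in>M. f q \<in> M"
    and "c \<in> A" "p \<in> cdom c" "d \<in> A" "f p \<in> cdom d"
    and "(cmap d \<circ> f \<circ> cinv c has_derivative D) (at (cmap c p))"
  shows "mfd_differentiable M A A f p"
  unfolding mfd_differentiable_def
proof (intro conjI ballI impI assms(1))
  fix c' d' assume c': "c' \<in> A" "p \<in> cdom c'" and d': "d' \<in> A" "f p \<in> cdom d'"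
  show "(cmap d' \<circ> f \<circ> cinv c') differentiable (at (cmap c' p) within cmap c' ` {q \<in> cdom c'. f q \<in> cdom d'})"
    using local_rep_change_of_charts[OF assms(1,2,3) c'(1) assms(4) c'(2) assms(5) d'(1) assms(6) d'(2) assms(7)]
    by (meson differentiableI differentiable_at_withinI)
qed

lemma push_component:
  assumes diff: "mfd_differentiable M A A f p" and f: "\<forall>q\<in>M. f q \<in> M"
    and c: "c \<in> A" "p \<in> cdom c" and d: "d \<in> A" "f p \<in> cdom d" and v: "v \<in> tangent_space A p"
    and D: "(cmap d \<circ> f \<circ> cinv c has_derivative D) (at (cmap c p))"
  shows "push A A f p v d = D (v c)"
proof -
  have p: "p \<in> M" "f p \<in> M" using subsetD[OF cdom_subset] c d by blast+
  define c0 where "c0 = chart_at A p"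
  define d0 where "d0 = chart_at A (f p)"
  have c0: "c0 \<in> A" "p \<in> cdom c0" and d0: "d0 \<in> A" "f p \<in> cdom d0"
    using chart_at[OF p(1)] chart_at[OF p(2)] by (auto simp: c0_def d0_def)
  define D0 where "D0 = frechet_derivative (cmap d0 \<circ> f \<circ> cinv c0) (at (cmap c0 p))"
  note l = local_rep_differentiable[OF diff f c0(1) d0(1) c0(2) d0(2)]
  have cont: "continuous (at p within M) f" using diff unfolding mfd_differentiable_def by blast
  have "push A A f p v = coord_vec A (f p) d0 (D0 (v c0))"
    unfolding push_def Let_def c0_def[symmetric] d0_def[symmetric] by (simp only: l(1) D0_def)
  then have 1: "push A A f p v d = trans_deriv d0 d (f p) (D0 (v c0))" using d by (simp add: coord_vec_def)
  have "trans_deriv d0 d (f p) \<circ> D0 \<circ> trans_deriv c c0 p = D"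
    using has_derivative_unique[OF local_rep_change_of_charts[OF cont f c0(1) c(1) c0(2) c(2) d0(1) d(1) d0(2) d(2) l(2)] D]
    by (simp add: D0_def)
  then have "D (v c) = trans_deriv d0 d (f p) (D0 (trans_deriv c c0 p (v c)))" by (metis comp_apply)
  then show ?thesis using 1 tangent_component[OF v c(1) c0(1) c(2) c0(2)] by simp
qed

lemma push_tangent:
  assumes "p \<in> M" "f p \<in> M" shows "push A A f p v \<in> tangent_space A (f p)"
  unfolding push_def Let_def using chart_at[OF assms(2)] by (intro coord_vec_tangent) auto

lemma push_compose:
  assumes f: "mfd_differentiable M A A f p" "\<forall>q\<in>M. f q \<in> M"
    and g: "mfd_differentiable M A A g (f p)" "\<forall>q\<in>M. g q \<in> M"
    and h: "mfd_differentiable M A A h p" "\<And>q. q \<in> M \<Longrightarrow> h q = g (f q)"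
    and p: "p \<in> M" and v: "v \<in> tangent_space A p"
  shows "push A A h p v = push A A g (f p) (push A A f p v)"
proof -
  have M: "f p \<in> M" "g (f p) \<in> M" "h p \<in> M" "h p = g (f p)" using f(2) g(2) h(2) p by auto
  obtain c d e where c: "c \<in> A" "p \<in> cdom c" and d: "d \<in> A" "f p \<in> cdom d" and e: "e \<in> A" "g (f p) \<in> cdom e"
    using chart_exists p M by meson
  let ?F = "frechet_derivative (cmap d \<circ> f \<circ> cinv c) (at (cmap c p))"
  let ?G = "frechet_derivative (cmap e \<circ> g \<circ> cinv d) (at (cmap d (f p)))"
  have F: "(cmap d \<circ> f \<circ> cinv c has_derivative ?F) (at (cmap c p))"
    by (rule local_rep_differentiable[OF f c(1) d(1) c(2) d(2)])
  have G: "(cmap e \<circ> g \<circ> cinv d has_derivative ?G) (at (cmap d (f p)))"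
    by (rule local_rep_differentiable[OF g d(1) e(1) d(2) e(2)])
  have GF: "(cmap e \<circ> g \<circ> cinv d \<circ> (cmap d \<circ> f \<circ> cinv c) has_derivative ?G \<circ> ?F) (at (cmap c p))"
    by (rule diff_chain_at[OF F]) (use G c in simp)
  have "continuous (at p within M) f" using f(1) unfolding mfd_differentiable_def by blast
  from eventually_map_in_chart[OF this f(2) c(1) d(1) c(2) d(2)]
  have "\<forall>\<^sub>F y in nhds (cmap c p). (cmap e \<circ> g \<circ> cinv d \<circ> (cmap d \<circ> f \<circ> cinv c)) y = (cmap e \<circ> h \<circ> cinv c) y"
  proof eventually_elim
    case (elim y)
    have "cinv c y \<in> M" using elim cinv_in c(1) cdom_subset by blast
    then show ?case using elim d h(2) by simp
  qed
  from has_derivative_transform_nhds[OF GF this]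
  have H: "(cmap e \<circ> h \<circ> cinv c has_derivative ?G \<circ> ?F) (at (cmap c p))" .
  have hM: "\<forall>q\<in>M. h q \<in> M" using h(2) f(2) g(2) by simp
  have pf: "push A A f p v \<in> tangent_space A (f p)" using push_tangent[of p f v] p M(1) by blast
  have he: "h p \<in> cdom e" using e M(4) by simp
  have "push A A h p v e = (?G \<circ> ?F) (v c)"
    by (rule push_component[OF h(1) hM c e(1) he v H])
  also have "\<dots> = push A A g (f p) (push A A f p v) e"
    using push_component[OF g d e pf G] push_component[OF f c d v F] by simp
  finally show ?thesis
    using tangent_eqI[of _ "h p" _ e] push_tangent[of p h v] push_tangent[of "f p" g] p e M by metis
qed

lemma push_ident:
  assumes f: "mfd_differentiable M A A f p" "\<And>q. q \<in> M \<Longrightarrow> f q = q" and p: "p \<in> M" and v: "v \<in> tangent_space A p"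
  shows "push A A f p v = v"
proof -
  obtain c where c: "c \<in> A" "p \<in> cdom c" using chart_exists p by meson
  have "\<forall>\<^sub>F y in nhds (cmap c p). y \<in> cimg c \<and> cinv c y \<in> cdom c"
    using eventually_in_cimg[OF c cdom_openin[OF c(1)] c(2)] .
  then have "\<forall>\<^sub>F y in nhds (cmap c p). y = (cmap c \<circ> f \<circ> cinv c) y"
    by eventually_elim (use f(2) cdom_subset[OF c(1)] in auto)
  from has_derivative_transform_nhds[OF has_derivative_ident this]
  have D: "(cmap c \<circ> f \<circ> cinv c has_derivative (\<lambda>x. x)) (at (cmap c p))" .
  have "push A A f p v c = v c" by (rule push_component[OF f(1) _ c c(1) _ v D]) (use f(2) p c in auto)
  then show ?thesis using tangent_eqI[OF _ v c] push_tangent[OF p, of f v] f(2)[OF p] p by auto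
qed

section \<open>The exterior derivative in an arbitrary chart\<close>

text \<open>
  A 1-form in a chart is represented by a field of vectors, acting by the inner product, so that results on maps
  between Euclidean spaces apply.
\<close>

definition covec :: "('a, 'n) form1 \<Rightarrow> ('a, 'n) chart \<Rightarrow> real ^ 'n \<Rightarrow> real ^ 'n" where
  "covec \<alpha> c x = (\<Sum>b\<in>Basis. \<alpha> (cinv c x) (coord_vec A (cinv c x) c b) *\<^sub>R b)"

definition dcovec :: "('a, 'n) form1 \<Rightarrow> ('a, 'n) chart \<Rightarrow> real ^ 'n \<Rightarrow> real ^ 'n \<Rightarrow> real ^ 'n" where
  "dcovec \<alpha> c x = frechet_derivative (covec \<alpha> c) (at x)"

lemma one_form_coord_vec_linear:
  assumes \<alpha>: "one_form M A \<alpha>" and c: "c \<in> A" "p \<in> cdom c"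
  shows "linear (\<lambda>h. \<alpha> p (coord_vec A p c h))"
proof -
  have p: "p \<in> M" using c cdom_subset by blast
  have lin: "coord_vec A p c (a *\<^sub>R h + b *\<^sub>R k) = tadd (tscale a (coord_vec A p c h)) (tscale b (coord_vec A p c k))" for a b h k
    by (rule tangent_eqI[OF coord_vec_tangent[OF c] tadd_tangent[OF tscale_tangent[OF coord_vec_tangent[OF c]] tscale_tangent[OF coord_vec_tangent[OF c]]] c])
      (simp add: coord_vec_apply[OF c] tadd_def tscale_def)
  have "\<alpha> p (coord_vec A p c (a *\<^sub>R h + b *\<^sub>R k)) = a * \<alpha> p (coord_vec A p c h) + b * \<alpha> p (coord_vec A p c k)" for a b h k
    unfolding lin using \<alpha> p coord_vec_tangent[OF c] unfolding one_form_def by blast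
  from this[of 1 _ 1] this[of _ _ 0] show ?thesis by (intro linearI) simp_all
qed

lemma covec_coord_vec:
  assumes \<alpha>: "one_form M A \<alpha>" and c: "c \<in> A" "x \<in> cimg c"
  shows "\<alpha> (cinv c x) (coord_vec A (cinv c x) c h) = covec \<alpha> c x \<bullet> h"
proof -
  note l = one_form_coord_vec_linear[OF \<alpha> c(1) cinv_in[OF c]]
  have "\<alpha> (cinv c x) (coord_vec A (cinv c x) c (\<Sum>b\<in>Basis. (h \<bullet> b) *\<^sub>R b)) = (\<Sum>b\<in>Basis. (h \<bullet> b) * \<alpha> (cinv c x) (coord_vec A (cinv c x) c b))"
    by (simp add: linear_sum[OF l] linear_scale[OF l])
  then show ?thesis
    unfolding covec_def inner_sum_left inner_scaleR_left euclidean_representation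
    by (simp add: mult.commute inner_commute[of h])
qed

lemma form_eq_covec:
  assumes "one_form M A \<alpha>" "c \<in> A" "p \<in> cdom c" "v \<in> tangent_space A p"
  shows "\<alpha> p v = covec \<alpha> c (cmap c p) \<bullet> v c"
  using covec_coord_vec[OF assms(1,2), of "cmap c p" "v c"] coord_vec_component[OF assms(4,2,3)] assms by simp

lemma covec_has_derivative:
  assumes "Ck_one_form 1 M A \<alpha>" "c \<in> A"
  shows "x \<in> cimg c \<Longrightarrow> (covec \<alpha> c has_derivative dcovec \<alpha> c x) (at x)"
    and "continuous_on (cimg c) (\<lambda>x. dcovec \<alpha> c x h)" and "continuous_on (cimg c) (covec \<alpha> c)"
proof -
  have C: "Ck_on 1 (covec \<alpha> c) (cimg c)"
    unfolding covec_def
  proof (rule Ck_on_sum)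
    fix b :: "real ^ 'n" assume b: "b \<in> Basis"
    have C1: "Ck_on 1 (\<lambda>x. \<alpha> (cinv c x) (coord_vec A (cinv c x) c b)) (cimg c)"
      using assms b unfolding Ck_one_form_def by blast
    show "Ck_on 1 (\<lambda>x. \<alpha> (cinv c x) (coord_vec A (cinv c x) c b) *\<^sub>R b) (cimg c)"
      by (rule Ck_on_linear_compose[OF C1 bounded_linear_scaleR_left bounded_linear_ident]) simp
  qed simp
  show d: "x \<in> cimg c \<Longrightarrow> (covec \<alpha> c has_derivative dcovec \<alpha> c x) (at x)"
    and "continuous_on (cimg c) (\<lambda>x. dcovec \<alpha> c x h)"
    using Ck_on_1_has_derivative[OF C open_cimg[OF assms(2)]] unfolding dcovec_def by blast+
  show "continuous_on (cimg c) (covec \<alpha> c)" 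
    using Ck_on_Suc_imp[of 0 "covec \<alpha> c" "cimg c"] C by (simp only: One_nat_def Ck_on.simps(1) simp_thms)
qed

text \<open>
  Differentiating the transformation law of a form under the transition map \<open>T\<close> produces, besides the expected
  term, the second derivative of \<open>T\<close> paired with the form.  It is symmetric and cancels in the exterior derivative.
\<close>

lemma dcovec_change_of_charts:
  assumes \<alpha>: "Ck_one_form 1 M A \<alpha>" and c: "c \<in> A" "p \<in> cdom c" and d: "d \<in> A" "p \<in> cdom d"
  shows "dcovec \<alpha> c (cmap c p) u \<bullet> v - dcovec \<alpha> c (cmap c p) v \<bullet> u
       = dcovec \<alpha> d (cmap d p) (trans_deriv c d p u) \<bullet> trans_deriv c d p v
         - dcovec \<alpha> d (cmap d p) (trans_deriv c d p v) \<bullet> trans_deriv c d p u"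
proof -
  define T where "T = cmap d \<circ> cinv c"
  define S where "S = overlap c d"
  define x where "x = cmap c p"
  define a where "a = covec \<alpha> d (cmap d p)"
  \<comment> \<open>With the coefficients of the form frozen at \<open>p\<close>, this pairing is the second derivative of a real function.\<close>
  define f where "f = (\<lambda>y. a \<bullet> T y)"
  have S: "open S" "x \<in> S" using open_overlap[OF c(1) d(1)] overlap_iff[OF c] d by (auto simp: S_def x_def)
  have Tx: "T x = cmap d p" using c by (simp add: T_def x_def)
  have TC: "Ck_on k T S" for k using transition_Ck[OF c(1) d(1)] by (simp add: T_def S_def)
  have fC: "Ck_on 2 f S" unfolding f_def
    using Ck_on_linear_compose[OF TC, of "\<lambda>z. a \<bullet> z" "\<lambda>x. x" S 2] by (simp add: bounded_linear_inner_right)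
  have \<alpha>1: "one_form M A \<alpha>" using \<alpha> unfolding Ck_one_form_def by blast
  have DT: "(T has_derivative frechet_derivative T (at y)) (at y)" if "y \<in> S" for y
    using Ck_on_1_has_derivative(1)[OF TC S(1) that] .
  have DTp: "frechet_derivative T (at x) = trans_deriv c d p"
    using trans_deriv_eq[OF c(1) d(1) c(2) d(2)] by (simp add: T_def x_def)
  have ff: "frechet_derivative f (at y) h = a \<bullet> frechet_derivative T (at y) h" if "y \<in> S" for y h
  proof -
    have "(f has_derivative (\<lambda>h. a \<bullet> frechet_derivative T (at y) h)) (at y)"
      unfolding f_def by (intro has_derivative_inner_right DT that)
    from frechet_derivative_at[OF this] show ?thesis by metis
  qed
  have key: "dcovec \<alpha> c x h \<bullet> k = dcovec \<alpha> d (T x) (trans_deriv c d p h) \<bullet> trans_deriv c d p k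
       + frechet_derivative (\<lambda>y. frechet_derivative f (at y) k) (at x) h" for h k
  proof -
    have eq: "covec \<alpha> c y \<bullet> k = covec \<alpha> d (T y) \<bullet> frechet_derivative T (at y) k" if y: "y \<in> S" for y
    proof -
      obtain q where q: "y = cmap c q" "q \<in> cdom c" "q \<in> cdom d" using y by (auto simp: S_def overlap_def)
      have "covec \<alpha> c y \<bullet> k = \<alpha> q (coord_vec A q c k)" using covec_coord_vec[OF \<alpha>1 c(1), of y k] q c by simp
      also have "\<dots> = covec \<alpha> d (cmap d q) \<bullet> coord_vec A q c k d"
        by (rule form_eq_covec[OF \<alpha>1 d(1) q(3) coord_vec_tangent[OF c(1) q(2)]])
      finally show ?thesis using trans_deriv_eq[OF c(1) d(1) q(2,3)] q c d by (simp add: coord_vec_def T_def)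
    qed
    have 1: "((\<lambda>y. covec \<alpha> c y \<bullet> k) has_derivative (\<lambda>h. dcovec \<alpha> c x h \<bullet> k)) (at x)"
      using covec_has_derivative(1)[OF \<alpha> c(1)] c by (intro has_derivative_inner_left) (auto simp: x_def)
    have cd: "((\<lambda>y. covec \<alpha> d (T y)) has_derivative (\<lambda>h. dcovec \<alpha> d (T x) (trans_deriv c d p h))) (at x)"
      using has_derivative_compose[OF DT[OF S(2)] covec_has_derivative(1)[OF \<alpha> d(1)]] d by (simp add: DTp Tx)
    have dd: "((\<lambda>y. frechet_derivative T (at y) k) has_derivative frechet_derivative (\<lambda>y. frechet_derivative T (at y) k) (at x)) (at x)"
      using Ck_on_1_has_derivative(1)[OF Ck_on_2_frechet_derivative[OF TC S(1)] S] .
    have 2: "((\<lambda>y. covec \<alpha> d (T y) \<bullet> frechet_derivative T (at y) k) has_derivative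
       (\<lambda>h. covec \<alpha> d (T x) \<bullet> frechet_derivative (\<lambda>y. frechet_derivative T (at y) k) (at x) h
          + dcovec \<alpha> d (T x) (trans_deriv c d p h) \<bullet> frechet_derivative T (at x) k)) (at x)"
      by (rule has_derivative_inner[OF cd dd])
    have "\<forall>\<^sub>F y in nhds x. covec \<alpha> d (T y) \<bullet> frechet_derivative T (at y) k = covec \<alpha> c y \<bullet> k"
      using eventually_nhds_in_open[OF S] by eventually_elim (simp add: eq)
    from fun_cong[OF has_derivative_unique[OF has_derivative_transform_nhds[OF 2 this] 1], of h]
    have "dcovec \<alpha> c x h \<bullet> k = a \<bullet> frechet_derivative (\<lambda>y. frechet_derivative T (at y) k) (at x) h
          + dcovec \<alpha> d (T x) (trans_deriv c d p h) \<bullet> trans_deriv c d p k"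
      by (simp only: DTp Tx a_def)
    moreover have "frechet_derivative (\<lambda>y. frechet_derivative f (at y) k) (at x) h = a \<bullet> frechet_derivative (\<lambda>y. frechet_derivative T (at y) k) (at x) h"
    proof -
      have "((\<lambda>y. a \<bullet> frechet_derivative T (at y) k) has_derivative (\<lambda>h. a \<bullet> frechet_derivative (\<lambda>y. frechet_derivative T (at y) k) (at x) h)) (at x)"
        by (rule has_derivative_inner_right[OF dd])
      moreover have "\<forall>\<^sub>F y in nhds x. a \<bullet> frechet_derivative T (at y) k = frechet_derivative f (at y) k"
        using eventually_nhds_in_open[OF S] by eventually_elim (simp add: ff)
      ultimately have "((\<lambda>y. frechet_derivative f (at y) k) has_derivative (\<lambda>h. a \<bullet> frechet_derivative (\<lambda>y. frechet_derivative T (at y) k) (at x) h)) (at x)"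
        by (rule has_derivative_transform_nhds)
      from frechet_derivative_at[OF this] show ?thesis by metis
    qed
    ultimately show ?thesis by simp
  qed
  show ?thesis
    using key[of u v] key[of v u] second_derivative_symmetric[OF fC S, of u v] by (simp add: x_def[symmetric] Tx)
qed

lemma ext_d_chart:
  assumes \<alpha>: "Ck_one_form 1 M A \<alpha>" and c: "c \<in> A" "p \<in> cdom c"
    and u: "u \<in> tangent_space A p" and v: "v \<in> tangent_space A p"
  shows "ext_d A \<alpha> p u v = dcovec \<alpha> c (cmap c p) (u c) \<bullet> v c - dcovec \<alpha> c (cmap c p) (v c) \<bullet> u c"
proof -
  define d where "d = chart_at A p"
  have p: "p \<in> M" using c cdom_subset by blast
  have d: "d \<in> A" "p \<in> cdom d" using chart_at[OF p] by (auto simp: d_def)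
  have \<alpha>1: "one_form M A \<alpha>" using \<alpha> unfolding Ck_one_form_def by blast
  have x: "cmap d p \<in> cimg d" using d by blast
  have D: "frechet_derivative (\<lambda>x. \<alpha> (cinv d x) (coord_vec A (cinv d x) d h)) (at (cmap d p) within cimg d) k
      = dcovec \<alpha> d (cmap d p) k \<bullet> h" for h k
  proof -
    have "((\<lambda>x. covec \<alpha> d x \<bullet> h) has_derivative (\<lambda>k. dcovec \<alpha> d (cmap d p) k \<bullet> h)) (at (cmap d p))"
      by (intro has_derivative_inner_left covec_has_derivative(1)[OF \<alpha> d(1)] x)
    moreover have "\<forall>\<^sub>F x in nhds (cmap d p). covec \<alpha> d x \<bullet> h = \<alpha> (cinv d x) (coord_vec A (cinv d x) d h)"
      using eventually_nhds_in_open[OF open_cimg[OF d(1)] x] by eventually_elim (simp add: covec_coord_vec[OF \<alpha>1 d(1)])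
    ultimately have "((\<lambda>x. \<alpha> (cinv d x) (coord_vec A (cinv d x) d h)) has_derivative (\<lambda>k. dcovec \<alpha> d (cmap d p) k \<bullet> h)) (at (cmap d p))"
      by (rule has_derivative_transform_nhds)
    from frechet_derivative_at[OF this] show ?thesis
      using at_within_open[OF x open_cimg[OF d(1)]] by metis
  qed
  have "ext_d A \<alpha> p u v = dcovec \<alpha> d (cmap d p) (u d) \<bullet> v d - dcovec \<alpha> d (cmap d p) (v d) \<bullet> u d"
    unfolding ext_d_def Let_def d_def[symmetric] D ..
  also have "\<dots> = dcovec \<alpha> c (cmap c p) (u c) \<bullet> v c - dcovec \<alpha> c (cmap c p) (v c) \<bullet> u c"
    using dcovec_change_of_charts[OF \<alpha> c d, of "u c" "v c"] tangent_component[OF u c(1) d(1) c(2) d(2)]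
      tangent_component[OF v c(1) d(1) c(2) d(2)] by simp
  finally show ?thesis .
qed

section \<open>Flows in charts\<close>

text \<open>
  As long as the curve remains in the ball, its velocity is within \<open>\<epsilon>\<close> of \<open>w0\<close>, and its distance from \<open>x0\<close> is at most
  the left-hand side of \<open>small\<close>.  So it cannot leave the ball: before the first time outside it would run in the preimage of a smaller closed
  ball, which is compact and thus closed in the Hausdorff space \<open>M\<close>.
\<close>

lemma curve_stays_in_chart:
  fixes \<gamma> :: "real \<Rightarrow> 'a"
  assumes c: "c \<in> A" and \<gamma>M: "\<And>s. s \<in> {0..T} \<Longrightarrow> \<gamma> s \<in> M" and cont: "continuous_on {0..T} \<gamma>"
    and ball: "cball x0 \<delta> \<subseteq> cimg c" and start: "\<gamma> 0 \<in> cdom c" and T: "T \<ge> 0" and \<epsilon>: "\<epsilon> \<ge> 0"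
    and deriv: "\<And>s. s \<in> {0..T} \<Longrightarrow> \<gamma> s \<in> cdom c \<Longrightarrow> cmap c (\<gamma> s) \<in> ball x0 \<delta> \<Longrightarrow>
        ((\<lambda>s. cmap c (\<gamma> s)) has_vector_derivative W s) (at s within {0..T}) \<and> norm (W s - w0) \<le> \<epsilon>"
    and small: "norm (cmap c (\<gamma> 0) - x0) + T * (norm w0 + \<epsilon>) < \<delta>"
    and s: "s \<in> {0..T}"
  shows "\<gamma> s \<in> cdom c \<and> cmap c (\<gamma> s) \<in> ball x0 \<delta> \<and> norm (cmap c (\<gamma> s) - cmap c (\<gamma> 0) - s *\<^sub>R w0) \<le> \<epsilon> * s"
proof -
  define U where "U = cinv c ` ball x0 \<delta>"
  have Uiff: "q \<in> U \<longleftrightarrow> q \<in> cdom c \<and> cmap c q \<in> ball x0 \<delta>" for q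
  proof
    assume "q \<in> U"
    then obtain y where y: "y \<in> ball x0 \<delta>" "q = cinv c y" by (auto simp: U_def)
    then have "y \<in> cimg c" using ball by auto
    then show "q \<in> cdom c \<and> cmap c q \<in> ball x0 \<delta>" using y cinv_in[OF c] by simp
  qed (use cinv_cmap[OF c, of q] in \<open>force simp: U_def\<close>)
  have Uopen: "openin (top_of_set M) U"
    unfolding U_def by (rule openin_cinv_image[OF c open_ball]) (use ball in auto)
  have bound: "norm (cmap c (\<gamma> s) - cmap c (\<gamma> 0) - s *\<^sub>R w0) \<le> \<epsilon> * s"
    if s: "s \<in> {0..T}" and inU: "\<And>r. r \<in> {0..s} \<Longrightarrow> \<gamma> r \<in> U" for s
  proof -
    have "norm ((cmap c (\<gamma> s) - s *\<^sub>R w0) - (cmap c (\<gamma> 0) - 0 *\<^sub>R w0)) \<le> \<epsilon> * norm (s - 0)"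
    proof (rule differentiable_bound[where S = "{0..s}" and f' = "\<lambda>r h. h *\<^sub>R (W r - w0)"])
      fix r assume r: "r \<in> {0..s}"
      have rT: "r \<in> {0..T}" using r s by auto
      have d: "((\<lambda>s. cmap c (\<gamma> s)) has_vector_derivative W r) (at r within {0..T})" "norm (W r - w0) \<le> \<epsilon>"
        using deriv[OF rT] inU[OF r] Uiff by auto
      have "((\<lambda>s. cmap c (\<gamma> s)) has_vector_derivative W r) (at r within {0..s})"
        using has_vector_derivative_within_subset[OF d(1)] s by simp
      moreover have "((\<lambda>s. s *\<^sub>R w0) has_vector_derivative w0) (at r within {0..s})"
        by (auto intro!: derivative_eq_intros)
      ultimately have "((\<lambda>r. cmap c (\<gamma> r) - r *\<^sub>R w0) has_vector_derivative W r - w0) (at r within {0..s})"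
        by (rule has_vector_derivative_diff)
      then show "((\<lambda>r. cmap c (\<gamma> r) - r *\<^sub>R w0) has_derivative (\<lambda>h. h *\<^sub>R (W r - w0))) (at r within {0..s})"
        unfolding has_vector_derivative_def .
      show "onorm (\<lambda>h. h *\<^sub>R (W r - w0)) \<le> \<epsilon>"
        using d(2) by (simp add: onorm_scaleR_left onorm_id)
    qed (use s in auto)
    then show ?thesis using s by (simp add: algebra_simps)
  qed
  have all: "\<gamma> s \<in> U" if "s \<in> {0..T}" for s
  proof (rule ccontr)
    assume "\<gamma> s \<notin> U"
    define B where "B = {s \<in> {0..T}. \<gamma> s \<notin> U}"
    have "B \<noteq> {}" using that \<open>\<gamma> s \<notin> U\<close> by (auto simp: B_def)
    have "closed B"
    proof -
      obtain O' where O': "open O'" "U = M \<inter> O'" using Uopen unfolding openin_open by blast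
      have "B = {0..T} \<inter> \<gamma> -` (- O')" using O' \<gamma>M by (auto simp: B_def)
      moreover have "closed ({0..T} \<inter> \<gamma> -` (- O'))"
        by (rule continuous_closed_preimage[OF cont closed_atLeastAtMost]) (use O' in auto)
      ultimately show ?thesis by simp
    qed
    moreover have "bounded B" by (rule bounded_subset[of "{0..T}"]) (auto simp: B_def)
    ultimately have "compact B" by (simp add: compact_eq_bounded_closed)
    then obtain s1 where s1: "s1 \<in> B" "\<And>r. r \<in> B \<Longrightarrow> s1 \<le> r" 
      using compact_attains_inf[OF _ \<open>B \<noteq> {}\<close>] by metis
    have T0: "0 \<in> {0..T}" using T by simp
    have "0 \<notin> B"
    proof -
      have "T * (norm w0 + \<epsilon>) \<ge> 0" using T \<epsilon> by simp
      then have "norm (cmap c (\<gamma> 0) - x0) < \<delta>" using small by linarith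
      then show ?thesis using start Uiff[of "\<gamma> 0"] by (auto simp: B_def dist_norm norm_minus_commute)
    qed
    then have s1': "0 < s1" "s1 \<le> T" using s1(1) by (auto simp: B_def le_less)
    define \<delta>' where "\<delta>' = norm (cmap c (\<gamma> 0) - x0) + T * (norm w0 + \<epsilon>)"
    define C where "C = cinv c ` cball x0 \<delta>'"
    have "cball x0 \<delta>' \<subseteq> ball x0 \<delta>" using small by (auto simp: \<delta>'_def)
    then have C: "C \<subseteq> U" "cball x0 \<delta>' \<subseteq> cimg c"
      using ball ball_subset_cball[of x0 \<delta>] unfolding C_def U_def by blast+
    have "compact C" unfolding C_def
    proof (rule compact_continuous_image)
      show "continuous_on (cball x0 \<delta>') (cinv c)"
        using chart_homeomorphism[OF c] C(2) unfolding homeomorphism_def by (metis continuous_on_subset)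
    qed simp
    then have "closed C" by (rule compact_imp_closed)
    have inC: "\<gamma> s \<in> C" if "s \<in> {0..<s1}" for s
    proof -
      have sT: "s \<in> {0..T}" using that s1' by auto
      have inU: "\<gamma> r \<in> U" if "r \<in> {0..s}" for r
        using s1(2)[of r] that \<open>s \<in> {0..<s1}\<close> s1' by (force simp: B_def)
      have "norm (cmap c (\<gamma> s) - x0) \<le> norm (cmap c (\<gamma> s) - cmap c (\<gamma> 0) - s *\<^sub>R w0) + norm (cmap c (\<gamma> 0) - x0) + norm (s *\<^sub>R w0)"
        using norm_triangle_ineq[of "cmap c (\<gamma> s) - cmap c (\<gamma> 0) - s *\<^sub>R w0" "(cmap c (\<gamma> 0) - x0) + s *\<^sub>R w0"]
          norm_triangle_ineq[of "cmap c (\<gamma> 0) - x0" "s *\<^sub>R w0"] by (simp add: algebra_simps)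
      also have "\<dots> \<le> norm (cmap c (\<gamma> 0) - x0) + s * (norm w0 + \<epsilon>)"
        using bound[OF sT inU] sT by (simp add: algebra_simps)
      also have "\<dots> \<le> \<delta>'" unfolding \<delta>'_def using sT \<epsilon> by (intro add_left_mono mult_right_mono) auto
      finally have "cmap c (\<gamma> s) \<in> cball x0 \<delta>'" by (simp add: dist_norm norm_minus_commute)
      moreover have "\<gamma> s = cinv c (cmap c (\<gamma> s))" using inU[of s] that Uiff[of "\<gamma> s"] cinv_cmap[OF c] by auto
      ultimately show ?thesis unfolding C_def by blast
    qed
    have "closed ({0..T} \<inter> \<gamma> -` C)"
      using continuous_closed_preimage[OF cont closed_atLeastAtMost \<open>closed C\<close>] .
    moreover have "{0..<s1} \<subseteq> {0..T} \<inter> \<gamma> -` C" using inC s1' by auto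
    ultimately have "closure {0..<s1} \<subseteq> {0..T} \<inter> \<gamma> -` C" by (rule closure_minimal[rotated])
    moreover have "s1 \<in> closure {0..<s1}" using s1' by simp
    ultimately have "\<gamma> s1 \<in> C" by blast
    then show False using C(1) s1(1) by (auto simp: B_def)
  qed
  show ?thesis using all[OF s] Uiff[of "\<gamma> s"] bound[OF s all] s by auto
qed

lemma flow_in_M: "generates_flow M A V \<phi> \<Longrightarrow> p \<in> M \<Longrightarrow> \<phi> t p \<in> M"
  unfolding generates_flow_def by blast
lemma flow_0: "generates_flow M A V \<phi> \<Longrightarrow> p \<in> M \<Longrightarrow> \<phi> 0 p = p"
  unfolding generates_flow_def by blast
lemma flow_add: "generates_flow M A V \<phi> \<Longrightarrow> p \<in> M \<Longrightarrow> \<phi> (s + t) p = \<phi> s (\<phi> t p)"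
  unfolding generates_flow_def by blast
lemma flow_isCont: "generates_flow M A V \<phi> \<Longrightarrow> p \<in> M \<Longrightarrow> isCont (\<lambda>s. \<phi> s p) t"
  unfolding generates_flow_def by blast
lemma flow_deriv: "generates_flow M A V \<phi> \<Longrightarrow> p \<in> M \<Longrightarrow> c \<in> A \<Longrightarrow> \<phi> t p \<in> cdom c \<Longrightarrow>
    ((\<lambda>s. cmap c (\<phi> s p)) has_vector_derivative V (\<phi> t p) c) (at t)"
  unfolding generates_flow_def by blast

text \<open>
  \<open>\<phi>\<^sup>t(x) = x + t V(p\<^sub>0) + o(t)\<close>, uniformly in \<open>x\<close> near \<open>p\<^sub>0\<close>.  The vector field is only assumed to be continuous, so that
  this applies to the Liouville reparametrization.
\<close>

lemma flow_first_order:
  assumes gen: "generates_flow M A V \<phi>" and c: "c \<in> A" "p0 \<in> cdom c"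
    and V: "isCont (\<lambda>x. V (cinv c x) c) (cmap c p0)" and \<epsilon>: "\<epsilon> > 0" and \<eta>: "\<eta> > 0"
  obtains \<rho> t0 where "\<rho> > 0" "t0 > 0"
    "\<And>x t. x \<in> ball (cmap c p0) \<rho> \<Longrightarrow> \<bar>t\<bar> \<le> t0 \<Longrightarrow> x \<in> cimg c \<and> \<phi> t (cinv c x) \<in> cdom c
       \<and> cmap c (\<phi> t (cinv c x)) \<in> ball (cmap c p0) \<eta>
       \<and> norm (cmap c (\<phi> t (cinv c x)) - x - t *\<^sub>R V p0 c) \<le> \<epsilon> * \<bar>t\<bar>"
proof -
  define x0 where "x0 = cmap c p0"
  define w0 where "w0 = V p0 c"
  have x0: "x0 \<in> cimg c" "cinv c x0 = p0" using c by (auto simp: x0_def)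
  obtain d1 where d1: "d1 > 0" "cball x0 d1 \<subseteq> cimg c" using open_cimg[OF c(1)] x0 open_contains_cball by blast
  obtain d2 where d2: "d2 > 0" "\<And>x. dist x x0 < d2 \<Longrightarrow> norm (V (cinv c x) c - w0) < \<epsilon>"
    using V \<epsilon> x0(2) unfolding continuous_at_eps_delta by (auto simp: x0_def[symmetric] w0_def dist_norm)
  define \<delta> where "\<delta> = min \<eta> (min d1 d2)"
  have \<delta>: "\<delta> > 0" "\<delta> \<le> \<eta>" "\<delta> \<le> d1" "\<delta> \<le> d2" using d1 d2 \<eta> by (auto simp: \<delta>_def)
  define K where "K = norm w0 + \<epsilon>"
  have K: "K > 0" using \<epsilon> by (simp add: K_def add_nonneg_pos)
  define t0 where "t0 = \<delta> / (4 * K)"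
  have t0: "t0 > 0" "t0 * K = \<delta> / 4" using \<delta>(1) K by (auto simp: t0_def)
  have ball: "cball x0 \<delta> \<subseteq> cimg c" using \<delta>(3) d1(2) by auto
  have main: "x \<in> cimg c \<and> \<phi> (\<sigma> * s) (cinv c x) \<in> cdom c \<and> cmap c (\<phi> (\<sigma> * s) (cinv c x)) \<in> ball x0 \<delta>
       \<and> norm (cmap c (\<phi> (\<sigma> * s) (cinv c x)) - x - s *\<^sub>R \<sigma> *\<^sub>R w0) \<le> \<epsilon> * s"
    if x: "x \<in> ball x0 (\<delta>/2)" and s: "s \<in> {0..t0}" and \<sigma>: "\<sigma> = 1 \<or> \<sigma> = -1" for x s and \<sigma> :: real
  proof -
    have \<sigma>1: "\<bar>\<sigma>\<bar> = 1" using \<sigma> by auto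
    have xc: "x \<in> cimg c" using x ball \<delta>(1) by auto
    define q where "q = cinv c x"
    have q: "q \<in> cdom c" "q \<in> M" "cmap c q = x" using cinv_in[OF c(1) xc] cdom_subset[OF c(1)] xc by (auto simp: q_def)
    define \<gamma> where "\<gamma> = (\<lambda>s. \<phi> (\<sigma> * s) q)"
    have g0: "\<gamma> 0 = q" using flow_0[OF gen q(2)] by (simp add: \<gamma>_def)
    have "\<gamma> s \<in> cdom c \<and> cmap c (\<gamma> s) \<in> ball x0 \<delta> \<and> norm (cmap c (\<gamma> s) - cmap c (\<gamma> 0) - s *\<^sub>R \<sigma> *\<^sub>R w0) \<le> \<epsilon> * s"
    proof (rule curve_stays_in_chart[where T = t0 and W = "\<lambda>s. \<sigma> *\<^sub>R V (\<gamma> s) c", OF c(1) _ _ ball])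
      show "\<gamma> s \<in> M" for s using flow_in_M[OF gen q(2)] by (simp add: \<gamma>_def)
      have "isCont \<gamma> s" for s
        unfolding \<gamma>_def by (rule isCont_o2[OF _ flow_isCont[OF gen q(2)]]) (intro continuous_intros)
      then show "continuous_on {0..t0} \<gamma>" by (simp add: continuous_at_imp_continuous_on)
      show "\<gamma> 0 \<in> cdom c" using g0 q by simp
      fix r assume r: "r \<in> {0..t0}" "\<gamma> r \<in> cdom c" "cmap c (\<gamma> r) \<in> ball x0 \<delta>"
      have "((\<lambda>s. cmap c (\<phi> s q)) has_vector_derivative V (\<gamma> r) c) (at (\<sigma> * r))"
        using flow_deriv[OF gen q(2) c(1), of "\<sigma> * r"] r(2) by (simp add: \<gamma>_def)
      moreover have "((\<lambda>s. \<sigma> * s) has_vector_derivative \<sigma>) (at r)" 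
        by (auto intro!: derivative_eq_intros)
      ultimately have "((\<lambda>s. cmap c (\<gamma> s)) has_vector_derivative \<sigma> *\<^sub>R V (\<gamma> r) c) (at r)"
        using vector_diff_chain_at[of "\<lambda>s. \<sigma> * s" \<sigma> r "\<lambda>s. cmap c (\<phi> s q)"] by (simp add: o_def \<gamma>_def)
      moreover have "norm (\<sigma> *\<^sub>R V (\<gamma> r) c - \<sigma> *\<^sub>R w0) \<le> \<epsilon>"
      proof -
        have "norm (V (\<gamma> r) c - w0) < \<epsilon>"
          using d2(2)[of "cmap c (\<gamma> r)"] r \<delta>(4) cinv_cmap[OF c(1) r(2)] by (simp add: dist_commute)
        then show ?thesis using \<sigma>1 by (simp flip: scaleR_diff_right)
      qed
      ultimately show "((\<lambda>s. cmap c (\<gamma> s)) has_vector_derivative \<sigma> *\<^sub>R V (\<gamma> r) c) (at r within {0..t0})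
          \<and> norm (\<sigma> *\<^sub>R V (\<gamma> r) c - \<sigma> *\<^sub>R w0) \<le> \<epsilon>" using has_vector_derivative_at_within by blast
    next
      have nw: "norm (\<sigma> *\<^sub>R w0) = norm w0" using \<sigma>1 by simp
      have "t0 * (norm (\<sigma> *\<^sub>R w0) + \<epsilon>) = \<delta> / 4" unfolding nw using t0(2) by (simp add: K_def)
      moreover have "norm (cmap c (\<gamma> 0) - x0) < \<delta> / 2" using x g0 q by (simp add: dist_norm norm_minus_commute)
      ultimately show "norm (cmap c (\<gamma> 0) - x0) + t0 * (norm (\<sigma> *\<^sub>R w0) + \<epsilon>) < \<delta>" using \<delta>(1) by linarith
    qed (use t0 \<epsilon> s in auto)
    then show ?thesis using xc g0 q by (simp add: \<gamma>_def q_def)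
  qed
  show thesis
  proof (rule that)
    show "\<delta> / 2 > 0" "t0 > 0" using \<delta> t0 by auto
    fix x t assume x: "x \<in> ball (cmap c p0) (\<delta>/2)" and t: "\<bar>t\<bar> \<le> t0"
    show "x \<in> cimg c \<and> \<phi> t (cinv c x) \<in> cdom c \<and> cmap c (\<phi> t (cinv c x)) \<in> ball (cmap c p0) \<eta>
       \<and> norm (cmap c (\<phi> t (cinv c x)) - x - t *\<^sub>R V p0 c) \<le> \<epsilon> * \<bar>t\<bar>"
      using main[of x t 1] main[of x "-t" "-1"] x t \<delta>(2) by (cases "t \<ge> 0") (auto simp: x0_def w0_def)
  qed
qed

lemma vector_field_isCont:
  assumes "Ck_vector_field k M A V" "c \<in> A" "p \<in> cdom c"
  shows "isCont (\<lambda>x. V (cinv c x) c) (cmap c p)"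
proof -
  have "Ck_on k (\<lambda>x. V (cinv c x) c) (cimg c)" using assms unfolding Ck_vector_field_def by blast
  then have "Ck_on 0 (\<lambda>x. V (cinv c x) c) (cimg c)" by (induction k) (auto dest: Ck_on_Suc_imp simp del: Ck_on.simps)
  then have "\<forall>x\<in>cimg c. isCont (\<lambda>x. V (cinv c x) c) x"
    unfolding Ck_on.simps(1) using continuous_on_eq_continuous_at[OF open_cimg[OF assms(2)]] by blast
  then show ?thesis using assms(3) by blast
qed

end

section \<open>The Cartan formula\<close>

lemma has_derivative_norm_le:
  fixes f :: "'a::real_normed_vector \<Rightarrow> 'b::real_normed_vector"
  assumes f: "(f has_derivative D) (at x)" and \<rho>: "\<rho> > 0"
    and bound: "\<And>y. y \<in> ball x \<rho> \<Longrightarrow> norm (f y - f x) \<le> k * norm (y - x)"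
  shows "norm (D h) \<le> k * norm h"
proof (rule field_le_epsilon)
  fix \<eta> :: real assume \<eta>: "\<eta> > 0"
  have h1: "norm h + 1 > 0" by (simp add: add_nonneg_pos)
  define e where "e = \<eta> / (norm h + 1)"
  have e: "e > 0" "e * norm h \<le> \<eta>" using \<eta> h1 by (auto simp: e_def field_simps)
  obtain d where d: "d > 0" "\<And>y. norm (y - x) < d \<Longrightarrow> norm (f y - f x - D (y - x)) \<le> e * norm (y - x)"
    using f e(1) unfolding has_derivative_at_alt by metis
  define s where "s = min \<rho> d / 2 / (norm h + 1)"
  have s: "s > 0" using \<rho> d(1) h1 by (simp add: s_def)
  have "s * norm h \<le> s * (norm h + 1)" using s by simp
  also have "\<dots> = min \<rho> d / 2"
    unfolding s_def by (rule nonzero_eq_divide_eq[THEN iffD1, OF _ refl]) (use h1 in simp)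
  finally have sh: "norm (s *\<^sub>R h) < \<rho>" "norm (s *\<^sub>R h) < d" using s \<rho> d(1) by auto
  have "norm (f (x + s *\<^sub>R h) - f x) \<le> k * (s * norm h)"
    using bound[of "x + s *\<^sub>R h"] sh(1) s by (simp add: dist_norm)
  moreover have "norm (f (x + s *\<^sub>R h) - f x - D (s *\<^sub>R h)) \<le> e * (s * norm h)"
    using d(2)[of "x + s *\<^sub>R h"] sh(2) s by simp
  moreover have "norm (D (s *\<^sub>R h)) \<le> norm (f (x + s *\<^sub>R h) - f x) + norm (f (x + s *\<^sub>R h) - f x - D (s *\<^sub>R h))"
    using norm_triangle_ineq4[of "f (x + s *\<^sub>R h) - f x" "f (x + s *\<^sub>R h) - f x - D (s *\<^sub>R h)"] by simp
  moreover have "norm (D (s *\<^sub>R h)) = s * norm (D h)"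
    using linear_scale[OF has_derivative_linear[OF f]] s by simp
  ultimately have "s * norm (D h) \<le> s * (k * norm h + e * norm h)" by (simp add: algebra_simps)
  then have "norm (D h) \<le> k * norm h + e * norm h" using s by simp
  then show "norm (D h) \<le> k * norm h + \<eta>" using e(2) by linarith
qed

text \<open>
  Strict differentiability of \<open>C\<^sup>1\<close> maps.
\<close>

lemma C1_linearization:
  fixes G :: "'a::euclidean_space \<Rightarrow> 'b::euclidean_space"
  assumes S: "open S" "x0 \<in> S" and G: "\<And>x. x \<in> S \<Longrightarrow> (G has_derivative G' x) (at x)"
    and G': "\<And>h. continuous_on S (\<lambda>x. G' x h)" and e: "e > 0"
  obtains \<delta> where "\<delta> > 0" "ball x0 \<delta> \<subseteq> S"
    "\<And>a b. a \<in> ball x0 \<delta> \<Longrightarrow> b \<in> ball x0 \<delta> \<Longrightarrow> norm (G a - G b - G' x0 (a - b)) \<le> e * norm (a - b)"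
proof -
  obtain d1 where d1: "d1 > 0" "ball x0 d1 \<subseteq> S" using S openE by blast
  have c: "((\<lambda>x. G' x h) \<longlongrightarrow> G' x0 h) (at x0)" for h
    using G'[of h] S by (simp add: continuous_on_eq_continuous_at isCont_def)
  have "((\<lambda>x. \<Sum>b\<in>Basis. norm (G' x b - G' x0 b)) \<longlongrightarrow> (\<Sum>b\<in>(Basis::'a set). norm (G' x0 b - G' x0 b))) (at x0)"
    by (intro tendsto_intros c)
  then have "\<forall>\<^sub>F x in at x0. (\<Sum>b\<in>Basis. norm (G' x b - G' x0 b)) < e"
    using e by (intro order_tendstoD) auto
  then obtain d2 where d2: "d2 > 0"
      "\<And>x. x \<noteq> x0 \<Longrightarrow> dist x x0 < d2 \<Longrightarrow> (\<Sum>b\<in>Basis. norm (G' x b - G' x0 b)) < e"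
    unfolding eventually_at by auto
  define \<delta> where "\<delta> = min d1 d2"
  have \<delta>: "\<delta> > 0" "ball x0 \<delta> \<subseteq> S" using d1 d2 by (auto simp: \<delta>_def)
  have lin: "linear (G' x)" if "x \<in> S" for x using G[OF that] has_derivative_linear by blast
  have "norm (G a - G b - G' x0 (a - b)) \<le> e * norm (a - b)" if ab: "a \<in> ball x0 \<delta>" "b \<in> ball x0 \<delta>" for a b
  proof -
    have "norm ((G a - G' x0 a) - (G b - G' x0 b)) \<le> e * norm (a - b)"
    proof (rule differentiable_bound[where S = "ball x0 \<delta>" and f' = "\<lambda>x h. G' x h - G' x0 h", OF convex_ball _ _ ab])
      fix x assume x: "x \<in> ball x0 \<delta>"
      then have xS: "x \<in> S" using \<delta> by blast
      have l0: "(G' x0 has_derivative G' x0) (at x)"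
        using lin[OF S(2)] by (simp add: bounded_linear_imp_has_derivative linear_conv_bounded_linear)
      show "((\<lambda>x. G x - G' x0 x) has_derivative (\<lambda>h. G' x h - G' x0 h)) (at x within ball x0 \<delta>)"
        by (rule has_derivative_at_withinI) (rule has_derivative_diff[OF G[OF xS] l0])
      have s: "(\<Sum>b\<in>Basis. norm (G' x b - G' x0 b)) \<le> e"
        using d2(2)[of x] x e by (cases "x = x0") (auto simp: \<delta>_def dist_commute)
      show "onorm (\<lambda>h. G' x h - G' x0 h) \<le> e"
      proof (rule onorm_le)
        fix h :: 'a
        have rep: "G' y h = (\<Sum>b\<in>Basis. (h \<bullet> b) *\<^sub>R G' y b)" if "y \<in> S" for y
          using linear_sum[OF lin[OF that], of "\<lambda>b. (h \<bullet> b) *\<^sub>R b" Basis] linear_scale[OF lin[OF that]]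
          by (simp add: euclidean_representation)
        have "norm (G' x h - G' x0 h) = norm (\<Sum>b\<in>Basis. (h \<bullet> b) *\<^sub>R (G' x b - G' x0 b))"
          unfolding rep[OF xS] rep[OF S(2)] by (simp add: sum_subtractf scaleR_diff_right)
        also have "\<dots> \<le> (\<Sum>b\<in>Basis. norm h * norm (G' x b - G' x0 b))"
          by (rule order_trans[OF norm_sum], rule sum_mono) (simp add: Basis_le_norm mult_right_mono)
        also have "\<dots> \<le> e * norm h" 
          using mult_left_mono[OF s, of "norm h"] by (simp add: mult.commute flip: sum_distrib_left)
        finally show "norm (G' x h - G' x0 h) \<le> e * norm h" .
      qed
    qed
    moreover have "G a - G b - G' x0 (a - b) = (G a - G' x0 a) - (G b - G' x0 b)"
      unfolding linear_diff[OF lin[OF S(2)]] by simp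
    ultimately show ?thesis by (simp only:)
  qed
  then show thesis using that \<delta> by blast
qed

text \<open>
  The difference \<open>E\<close> of two integral curves satisfies \<open>E' = Q E + O(e |E|)\<close>.  Over a time so short that \<open>|E|\<close> at
  most doubles, integration gives \<open>E(T) = E(0) + T Q E(0)\<close> up to \<open>O(e T |E(0)|)\<close>.
\<close>

lemma integral_curves_difference:
  fixes a b :: "real \<Rightarrow> 'a::real_normed_vector"
  assumes a: "\<And>s. s \<in> {0..T} \<Longrightarrow> (a has_vector_derivative G (a s)) (at s within {0..T})"
    and b: "\<And>s. s \<in> {0..T} \<Longrightarrow> (b has_vector_derivative G (b s)) (at s within {0..T})"
    and Q: "bounded_linear Q" "\<And>h. norm (Q h) \<le> B * norm h" and B: "B \<ge> 0" and e: "e > 0"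
    and lin: "\<And>s. s \<in> {0..T} \<Longrightarrow> norm (G (a s) - G (b s) - Q (a s - b s)) \<le> e * norm (a s - b s)"
    and T: "T \<ge> 0" "2 * T * (B + e) \<le> 1" "2 * T * B * (B + e) \<le> e"
  shows "norm (a T - b T - (a 0 - b 0) - T *\<^sub>R Q (a 0 - b 0)) \<le> 3 * e * T * norm (a 0 - b 0)"
proof -
  interpret Q: bounded_linear Q by (rule Q)
  define E where "E = (\<lambda>s. a s - b s)"
  define L where "L = B + e"
  have L: "L \<ge> 0" using B e by (simp add: L_def)
  have E': "(E has_vector_derivative G (a s) - G (b s)) (at s within {0..T})" if "s \<in> {0..T}" for s
    unfolding E_def using has_vector_derivative_diff[OF a[OF that] b[OF that]] .
  have GL: "norm (G (a s) - G (b s)) \<le> L * norm (E s)" if "s \<in> {0..T}" for s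
  proof -
    have "norm (G (a s) - G (b s)) \<le> norm (G (a s) - G (b s) - Q (E s)) + norm (Q (E s))"
      by (metis diff_add_cancel norm_triangle_ineq)
    also have "\<dots> \<le> e * norm (E s) + B * norm (E s)" using lin[OF that] Q(2)[of "E s"] by (simp add: E_def)
    finally show ?thesis by (simp add: L_def algebra_simps)
  qed
  have contE: "continuous_on {0..T} E"
    using E' has_vector_derivative_continuous continuous_on_eq_continuous_within by blast
  have T0: "0 \<in> {0..T}" using T by simp
  obtain s1 where s1: "s1 \<in> {0..T}" "\<And>s. s \<in> {0..T} \<Longrightarrow> norm (E s) \<le> norm (E s1)"
    using continuous_attains_sup[of "{0..T}" "\<lambda>s. norm (E s)"] contE T0 continuous_on_norm by blast
  have drift: "norm (E s - E 0) \<le> L * m * s" if s: "s \<in> {0..T}" and m: "\<And>r. r \<in> {0..T} \<Longrightarrow> norm (E r) \<le> m" for s m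
  proof -
    have "norm (E s - E 0) \<le> (L * m) * norm (s - 0)"
    proof (rule differentiable_bound[where S = "{0..T}" and f' = "\<lambda>r h. h *\<^sub>R (G (a r) - G (b r))", OF _ _ _ s T0])
      fix r assume r: "r \<in> {0..T}"
      show "(E has_derivative (\<lambda>h. h *\<^sub>R (G (a r) - G (b r)))) (at r within {0..T})"
        using E'[OF r] unfolding has_vector_derivative_def .
      have "norm (G (a r) - G (b r)) \<le> L * m" using GL[OF r] mult_left_mono[OF m[OF r] L] by linarith
      then show "onorm (\<lambda>h. h *\<^sub>R (G (a r) - G (b r))) \<le> L * m" by (simp add: onorm_scaleR_left onorm_id)
    qed simp
    then show ?thesis using s by simp
  qed
  have m2: "norm (E s) \<le> 2 * norm (E 0)" if "s \<in> {0..T}" for s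
  proof -
    have "norm (E s1) \<le> norm (E 0) + norm (E s1 - E 0)" by (metis add.commute diff_add_cancel norm_triangle_ineq)
    also have "norm (E s1 - E 0) \<le> L * norm (E s1) * s1" using drift[OF s1] .
    also have "\<dots> \<le> L * norm (E s1) * T" using s1(1) L by (intro mult_left_mono) auto
    also have "\<dots> \<le> norm (E s1) / 2"
      using mult_right_mono[OF T(2), of "norm (E s1)"] by (simp add: L_def algebra_simps)
    finally show ?thesis using s1(2)[OF that] by simp
  qed
  have "norm ((E T - T *\<^sub>R Q (E 0)) - (E 0 - 0 *\<^sub>R Q (E 0))) \<le> (3 * e * norm (E 0)) * norm (T - 0)"
  proof (rule differentiable_bound[where S = "{0..T}" and f' = "\<lambda>r h. h *\<^sub>R (G (a r) - G (b r) - Q (E 0))"])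
    fix r assume r: "r \<in> {0..T}"
    have "((\<lambda>s. s *\<^sub>R Q (E 0)) has_vector_derivative Q (E 0)) (at r within {0..T})"
      by (auto intro!: derivative_eq_intros)
    from has_vector_derivative_diff[OF E'[OF r] this]
    show "((\<lambda>s. E s - s *\<^sub>R Q (E 0)) has_derivative (\<lambda>h. h *\<^sub>R (G (a r) - G (b r) - Q (E 0)))) (at r within {0..T})"
      unfolding has_vector_derivative_def .
    have "norm (G (a r) - G (b r) - Q (E 0)) \<le> norm (G (a r) - G (b r) - Q (E r)) + norm (Q (E r - E 0))"
      using norm_triangle_ineq[of "G (a r) - G (b r) - Q (E r)" "Q (E r - E 0)"] by (simp add: Q.diff)
    also have "\<dots> \<le> e * (2 * norm (E 0)) + B * (L * (2 * norm (E 0)) * T)"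
    proof (rule add_mono)
      show "norm (G (a r) - G (b r) - Q (E r)) \<le> e * (2 * norm (E 0))"
      proof -
        have "norm (G (a r) - G (b r) - Q (E r)) \<le> e * norm (E r)" using lin[OF r] by (simp only: E_def)
        then show ?thesis using mult_left_mono[OF m2[OF r], of e] e by linarith
      qed
      have "norm (E r - E 0) \<le> L * (2 * norm (E 0)) * r" by (rule drift[OF r m2])
      also have "\<dots> \<le> L * (2 * norm (E 0)) * T" using r L by (intro mult_left_mono) auto
      finally show "norm (Q (E r - E 0)) \<le> B * (L * (2 * norm (E 0)) * T)"
        using Q(2)[of "E r - E 0"] B by (meson mult_left_mono order_trans)
    qed
    also have "\<dots> \<le> 3 * e * norm (E 0)"
      using mult_right_mono[OF T(3), of "norm (E 0)"] by (simp add: L_def algebra_simps)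
    finally show "onorm (\<lambda>h. h *\<^sub>R (G (a r) - G (b r) - Q (E 0))) \<le> 3 * e * norm (E 0)"
      by (simp add: onorm_scaleR_left onorm_id)
  qed (use T in auto)
  then show ?thesis using T by (simp add: E_def algebra_simps)
qed

context closed_mfd
begin

lemma vector_field_has_derivative:
  assumes "Ck_vector_field 1 M A X" "c \<in> A"
  shows "x \<in> cimg c \<Longrightarrow> ((\<lambda>x. X (cinv c x) c) has_derivative frechet_derivative (\<lambda>x. X (cinv c x) c) (at x)) (at x)"
    and "continuous_on (cimg c) (\<lambda>x. frechet_derivative (\<lambda>x. X (cinv c x) c) (at x) h)"
proof -
  have "Ck_on 1 (\<lambda>x. X (cinv c x) c) (cimg c)" using assms unfolding Ck_vector_field_def by blast
  from Ck_on_1_has_derivative[OF this open_cimg[OF assms(2)]]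
  show "x \<in> cimg c \<Longrightarrow> ((\<lambda>x. X (cinv c x) c) has_derivative frechet_derivative (\<lambda>x. X (cinv c x) c) (at x)) (at x)"
    and "continuous_on (cimg c) (\<lambda>x. frechet_derivative (\<lambda>x. X (cinv c x) c) (at x) h)" by blast+
qed

text \<open>
  The differential of the flow is \<open>id + t DX + o(t)\<close>, by comparison of the orbits of neighbouring points.  The bound is
  uniform in the initial points and therefore passes to the differential.
\<close>

lemma flow_differential_first_order:
  assumes gen: "generates_flow M A X \<phi>" and X: "Ck_vector_field 1 M A X"
    and c: "c \<in> A" "p0 \<in> cdom c" and diff: "\<And>t. mfd_differentiable M A A (\<phi> t) p0" and e: "e > 0"
  obtains t0 where "t0 > 0" "\<And>t. t \<in> {0..t0} \<Longrightarrow> \<phi> t p0 \<in> cdom c"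
    "\<And>t h. t \<in> {0..t0} \<Longrightarrow> norm (frechet_derivative (cmap c \<circ> \<phi> t \<circ> cinv c) (at (cmap c p0)) h - h
        - t *\<^sub>R frechet_derivative (\<lambda>x. X (cinv c x) c) (at (cmap c p0)) h) \<le> e * t * norm h"
proof -
  define x0 where "x0 = cmap c p0"
  define G where "G = (\<lambda>x. X (cinv c x) c)"
  define Q where "Q = frechet_derivative G (at x0)"
  have x0: "x0 \<in> cimg c" "cinv c x0 = p0" using c by (auto simp: x0_def)
  have p0M: "p0 \<in> M" using c cdom_subset by blast
  note G' = vector_field_has_derivative[OF X c(1), folded G_def]
  have Qb: "bounded_linear Q" using G'(1)[OF x0(1)] unfolding Q_def by (rule has_derivative_bounded_linear)
  obtain B where B: "B > 0" "\<And>h. norm (Q h) \<le> B * norm h"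
    using bounded_linear.pos_bounded[OF Qb] by (auto simp: mult.commute)
  define \<epsilon> where "\<epsilon> = e / 3"
  have \<epsilon>: "\<epsilon> > 0" using e by (simp add: \<epsilon>_def)
  obtain \<delta> where \<delta>: "\<delta> > 0" "ball x0 \<delta> \<subseteq> cimg c"
    "\<And>a b. a \<in> ball x0 \<delta> \<Longrightarrow> b \<in> ball x0 \<delta> \<Longrightarrow> norm (G a - G b - Q (a - b)) \<le> \<epsilon> * norm (a - b)"
    using C1_linearization[OF open_cimg[OF c(1)] x0(1) G' \<epsilon>] unfolding Q_def by metis
  obtain \<rho> t1 where \<rho>: "\<rho> > 0" "t1 > 0"
    and flow: "\<And>x t. x \<in> ball x0 \<rho> \<Longrightarrow> \<bar>t\<bar> \<le> t1 \<Longrightarrow> x \<in> cimg c \<and> \<phi> t (cinv c x) \<in> cdom c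
       \<and> cmap c (\<phi> t (cinv c x)) \<in> ball x0 \<delta>"
    using flow_first_order[OF gen c vector_field_isCont[OF X c] zero_less_one \<delta>(1)] unfolding x0_def by metis
  define t0 where "t0 = min t1 (min (1 / (2 * (B + \<epsilon>))) (\<epsilon> / (2 * B * (B + \<epsilon>))))"
  have t0: "t0 > 0" "t0 \<le> t1" using \<rho>(2) B(1) \<epsilon> by (auto simp: t0_def)
  have t0': "2 * t0 * (B + \<epsilon>) \<le> 1" "2 * t0 * B * (B + \<epsilon>) \<le> \<epsilon>"
  proof -
    have "t0 \<le> 1 / (2 * (B + \<epsilon>))" "t0 \<le> \<epsilon> / (2 * B * (B + \<epsilon>))" by (auto simp: t0_def)
    moreover have "2 * (B + \<epsilon>) > 0" "2 * B * (B + \<epsilon>) > 0" using B(1) \<epsilon> by auto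
    ultimately have "t0 * (2 * (B + \<epsilon>)) \<le> 1" "t0 * (2 * B * (B + \<epsilon>)) \<le> \<epsilon>"
      by (simp_all only: pos_le_divide_eq)
    then show "2 * t0 * (B + \<epsilon>) \<le> 1" "2 * t0 * B * (B + \<epsilon>) \<le> \<epsilon>" by (simp_all add: mult_ac)
  qed
  have curve: "((\<lambda>s. cmap c (\<phi> s (cinv c y))) has_vector_derivative G (cmap c (\<phi> s (cinv c y)))) (at s within {0..t})"
    if y: "y \<in> ball x0 \<rho>" and s: "s \<in> {0..t}" "t \<le> t0" for y s t
  proof -
    have f: "y \<in> cimg c \<and> \<phi> s (cinv c y) \<in> cdom c" using flow[OF y, of s] s t0 by auto
    have "cinv c y \<in> M" using f cinv_in[OF c(1)] cdom_subset[OF c(1)] by blast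
    from flow_deriv[OF gen this c(1)] f
    have "((\<lambda>s. cmap c (\<phi> s (cinv c y))) has_vector_derivative X (\<phi> s (cinv c y)) c) (at s)" by blast
    then show ?thesis using f cinv_cmap[OF c(1)] by (simp add: G_def has_vector_derivative_at_within)
  qed
  have x0b: "x0 \<in> ball x0 \<rho>" using \<rho> by simp
  show thesis
  proof (rule that[OF t0(1)])
    fix t assume t: "t \<in> {0..t0}"
    show ptc: "\<phi> t p0 \<in> cdom c" using flow[OF x0b, of t] t t0 x0 by simp
    fix h
    define F where "F = cmap c \<circ> \<phi> t \<circ> cinv c"
    have M: "\<forall>q\<in>M. \<phi> t q \<in> M" using flow_in_M[OF gen] by blast
    have F: "(F has_derivative frechet_derivative F (at x0)) (at x0)"
      using local_rep_differentiable(2)[OF diff M c(1,1) c(2) ptc] unfolding F_def x0_def .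
    have "norm (F y - F x0 - (y - x0) - t *\<^sub>R Q (y - x0)) \<le> 3 * \<epsilon> * t * norm (y - x0)" if y: "y \<in> ball x0 \<rho>" for y
    proof -
      define a where "a = (\<lambda>s. cmap c (\<phi> s (cinv c y)))"
      define b where "b = (\<lambda>s. cmap c (\<phi> s (cinv c x0)))"
      have ab: "a s \<in> ball x0 \<delta>" "b s \<in> ball x0 \<delta>" if "s \<in> {0..t}" for s
        using flow[OF y, of s] flow[OF x0b, of s] that t t0 by (auto simp: a_def b_def)
      have st: "cinv c y \<in> M" "y \<in> cimg c"
        using flow[OF y, of 0] \<rho>(2) cinv_in[OF c(1)] cdom_subset[OF c(1)] by auto
      have "norm (a t - b t - (a 0 - b 0) - t *\<^sub>R Q (a 0 - b 0)) \<le> 3 * \<epsilon> * t * norm (a 0 - b 0)"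
      proof (rule integral_curves_difference[OF _ _ Qb B(2) less_imp_le[OF B(1)] \<epsilon>])
        show "(a has_vector_derivative G (a s)) (at s within {0..t})"
             "(b has_vector_derivative G (b s)) (at s within {0..t})" if "s \<in> {0..t}" for s
          unfolding a_def b_def using curve[OF y that] curve[OF x0b that] t by auto
        show "norm (G (a s) - G (b s) - Q (a s - b s)) \<le> \<epsilon> * norm (a s - b s)" if "s \<in> {0..t}" for s
          by (rule \<delta>(3)[OF ab[OF that]])
        show "0 \<le> t" using t by simp
        have "2 * t * (B + \<epsilon>) \<le> 2 * t0 * (B + \<epsilon>)" "2 * t * B * (B + \<epsilon>) \<le> 2 * t0 * B * (B + \<epsilon>)"
          using t B(1) \<epsilon> by (auto intro!: mult_right_mono)
        then show "2 * t * (B + \<epsilon>) \<le> 1" "2 * t * B * (B + \<epsilon>) \<le> \<epsilon>" using t0' by linarith+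
      qed
      moreover have "a 0 = y" "b 0 = x0" using flow_0[OF gen] st p0M x0 by (auto simp: a_def b_def x0_def)
      ultimately show ?thesis by (simp add: a_def b_def F_def)
    qed
    then have bd: "norm ((F y - y - t *\<^sub>R Q y) - (F x0 - x0 - t *\<^sub>R Q x0)) \<le> (e * t) * norm (y - x0)" if "y \<in> ball x0 \<rho>" for y
      using that by (simp add: \<epsilon>_def linear_diff[OF bounded_linear.linear[OF Qb]] algebra_simps)
    have "((\<lambda>y. F y - y - t *\<^sub>R Q y) has_derivative (\<lambda>h. frechet_derivative F (at x0) h - h - t *\<^sub>R Q h)) (at x0)"
      by (intro has_derivative_diff F has_derivative_ident has_derivative_scaleR_right bounded_linear_imp_has_derivative Qb)
    from has_derivative_norm_le[OF this \<rho>(1) bd]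
    show "norm (frechet_derivative (cmap c \<circ> \<phi> t \<circ> cinv c) (at (cmap c p0)) h - h
        - t *\<^sub>R frechet_derivative (\<lambda>x. X (cinv c x) c) (at (cmap c p0)) h) \<le> e * t * norm h"
      by (simp add: F_def Q_def G_def x0_def)
  qed
qed

text \<open>
  In a chart the product rule gives
  \<open>(L\<^sub>X \<alpha>)(v) = \<alpha>(DX v) + (D\<^sub>X \<alpha>)(v)\<close>, and differentiating \<open>\<alpha>(X) = 0\<close> in the direction \<open>v\<close> gives
  \<open>\<alpha>(DX v) = - (D\<^sub>v \<alpha>)(X)\<close>; together they say \<open>L\<^sub>X \<alpha> = \<iota>\<^sub>X d\<alpha>\<close>.
\<close>

lemma Cartan_formula:
  assumes gen: "generates_flow M A X \<phi>" and X: "Ck_vector_field 1 M A X"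
    and c: "c \<in> A" "p0 \<in> cdom c" and diff: "\<And>t. mfd_differentiable M A A (\<phi> t) p0"
    and \<alpha>: "Ck_one_form 1 M A \<alpha>" and \<alpha>X: "\<And>p. p \<in> M \<Longrightarrow> \<alpha> p (X p) = 0"
    and Lie: "((\<lambda>t. \<alpha> (\<phi> t p0) (push A A (\<phi> t) p0 v)) has_real_derivative l) (at 0)"
    and v: "v \<in> tangent_space A p0"
  shows "l = dcovec \<alpha> c (cmap c p0) (X p0 c) \<bullet> v c - dcovec \<alpha> c (cmap c p0) (v c) \<bullet> X p0 c"
proof -
  define x0 where "x0 = cmap c p0"
  define h where "h = v c"
  define G where "G = (\<lambda>x. X (cinv c x) c)"
  define Q where "Q = frechet_derivative G (at x0)"
  define D where "D = (\<lambda>t. frechet_derivative (cmap c \<circ> \<phi> t \<circ> cinv c) (at x0))"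
  have x0: "x0 \<in> cimg c" "cinv c x0 = p0" using c by (auto simp: x0_def)
  have p0M: "p0 \<in> M" using c cdom_subset by blast
  have \<alpha>1: "one_form M A \<alpha>" using \<alpha> unfolding Ck_one_form_def by blast
  have M: "\<forall>q\<in>M. \<phi> t q \<in> M" for t using flow_in_M[OF gen] by blast
  obtain t0 where t0: "t0 > 0" "\<And>t. t \<in> {0..t0} \<Longrightarrow> \<phi> t p0 \<in> cdom c"
    using flow_differential_first_order[OF gen X c diff zero_less_one] by metis
  have nontriv: "at 0 within {0..t0} \<noteq> bot" using t0(1) by (simp add: trivial_limit_within islimpt_Icc)
  \<comment> \<open>the differential of the flow at time t is \<open>id + t Q + o(t)\<close>\<close>
  have dD: "((\<lambda>t. D t h) has_vector_derivative Q h) (at 0 within {0..t0})"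
    unfolding has_vector_derivative_def has_derivative_within_alt
  proof (intro conjI allI impI)
    fix e :: real assume e: "e > 0"
    have h1: "norm h + 1 > 0" by (simp add: add_nonneg_pos)
    define e' where "e' = e / (norm h + 1)"
    have e': "e' > 0" "e' * norm h \<le> e" using e h1 by (auto simp: e'_def field_simps)
    obtain t1 where t1: "t1 > 0" "\<And>t k. t \<in> {0..t1} \<Longrightarrow> norm (D t k - k - t *\<^sub>R Q k) \<le> e' * t * norm k"
      using flow_differential_first_order[OF gen X c diff e'(1)] unfolding D_def Q_def G_def x0_def by metis
    have D0: "D 0 h = h" using t1(2)[of 0 h] t1(1) by simp
    show "\<exists>d>0. \<forall>y\<in>{0..t0}. norm (y - 0) < d \<longrightarrow> norm (D y h - D 0 h - (y - 0) *\<^sub>R Q h) \<le> e * norm (y - 0)"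
    proof (intro exI[of _ t1] conjI t1(1) ballI impI)
      fix t assume t: "t \<in> {0..t0}" "norm (t - 0) < t1"
      have "norm (D t h - h - t *\<^sub>R Q h) \<le> (e' * norm h) * t" using t1(2)[of t h] t by (simp add: mult_ac)
      also have "\<dots> \<le> e * t" using e'(2) t by (intro mult_right_mono) auto
      finally show "norm (D t h - D 0 h - (t - 0) *\<^sub>R Q h) \<le> e * norm (t - 0)" using t D0 by simp
    qed
  qed (simp add: bounded_linear_scaleR_left)
  define x where "x = (\<lambda>t. cmap c (\<phi> t p0))"
  have x00: "x 0 = x0" using flow_0[OF gen p0M] by (simp add: x_def x0_def)
  have "(x has_vector_derivative X p0 c) (at 0)"
    using flow_deriv[OF gen p0M c(1), of 0] flow_0[OF gen p0M] c(2) by (simp add: x_def)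
  then have "(x has_vector_derivative X p0 c) (at 0 within {0..t0})" by (rule has_vector_derivative_at_within)
  from vector_derivative_diff_chain_within[OF this, of "covec \<alpha> c" "dcovec \<alpha> c x0"]
  have dx: "((\<lambda>t. covec \<alpha> c (x t)) has_vector_derivative dcovec \<alpha> c x0 (X p0 c)) (at 0 within {0..t0})"
    using covec_has_derivative(1)[OF \<alpha> c(1) x0(1)] x00 by (simp add: o_def has_derivative_at_withinI)
  have D0: "D 0 h = h"
  proof -
    obtain t1 where "t1 > 0" "\<And>t k. t \<in> {0..t1} \<Longrightarrow> norm (D t k - k - t *\<^sub>R Q k) \<le> 1 * t * norm k"
      using flow_differential_first_order[OF gen X c diff zero_less_one] unfolding D_def Q_def G_def x0_def by metis
    from this(2)[of 0 h] this(1) show ?thesis by simp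
  qed
  have prod: "((\<lambda>t. covec \<alpha> c (x t) \<bullet> D t h) has_vector_derivative
      covec \<alpha> c x0 \<bullet> Q h + dcovec \<alpha> c x0 (X p0 c) \<bullet> h) (at 0 within {0..t0})"
    using has_derivative_inner[OF dx[unfolded has_vector_derivative_def] dD[unfolded has_vector_derivative_def]] x00 D0
    unfolding has_vector_derivative_def by (simp add: algebra_simps)
  have eq: "\<alpha> (\<phi> t p0) (push A A (\<phi> t) p0 v) = covec \<alpha> c (x t) \<bullet> D t h" if t: "t \<in> {0..t0}" for t
  proof -
    have tc: "\<phi> t p0 \<in> cdom c" by (rule t0(2)[OF t])
    have "push A A (\<phi> t) p0 v c = D t h"
      unfolding D_def h_def x0_def
      by (rule push_component[OF diff M c c(1) tc v local_rep_differentiable(2)[OF diff M c(1,1) c(2) tc]])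
    then show ?thesis
      using form_eq_covec[OF \<alpha>1 c(1) tc push_tangent[of p0 "\<phi> t" v]] p0M flow_in_M[OF gen p0M] by (simp add: x_def)
  qed
  have "((\<lambda>t. \<alpha> (\<phi> t p0) (push A A (\<phi> t) p0 v)) has_vector_derivative
      covec \<alpha> c x0 \<bullet> Q h + dcovec \<alpha> c x0 (X p0 c) \<bullet> h) (at 0 within {0..t0})"
    by (rule has_vector_derivative_transform[OF _ eq prod]) (use t0(1) in auto)
  moreover have "((\<lambda>t. \<alpha> (\<phi> t p0) (push A A (\<phi> t) p0 v)) has_vector_derivative l) (at 0 within {0..t0})"
    using Lie by (simp add: has_real_derivative_iff_has_vector_derivative has_vector_derivative_at_within)
  ultimately have l: "l = covec \<alpha> c x0 \<bullet> Q h + dcovec \<alpha> c x0 (X p0 c) \<bullet> h"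
    using vector_derivative_unique_within[OF nontriv] by blast
  have zero: "covec \<alpha> c y \<bullet> G y = 0" if "y \<in> cimg c" for y
  proof -
    have q: "cinv c y \<in> cdom c" "cinv c y \<in> M" using cinv_in[OF c(1) that] cdom_subset[OF c(1)] by auto
    have "X (cinv c y) \<in> tangent_space A (cinv c y)"
      using X q(2) unfolding Ck_vector_field_def vector_field_def by blast
    from form_eq_covec[OF \<alpha>1 c(1) q(1) this] show ?thesis using \<alpha>X[OF q(2)] that by (simp add: G_def)
  qed
  have "((\<lambda>y. covec \<alpha> c y \<bullet> G y) has_derivative (\<lambda>h. covec \<alpha> c x0 \<bullet> Q h + dcovec \<alpha> c x0 h \<bullet> G x0)) (at x0)"
    by (rule has_derivative_inner[OF covec_has_derivative(1)[OF \<alpha> c(1) x0(1)]])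
      (use vector_field_has_derivative(1)[OF X c(1) x0(1)] in \<open>simp add: G_def Q_def\<close>)
  moreover have "\<forall>\<^sub>F y in nhds x0. covec \<alpha> c y \<bullet> G y = 0"
    using eventually_nhds_in_open[OF open_cimg[OF c(1)] x0(1)] by eventually_elim (rule zero)
  ultimately have "((\<lambda>y. 0) has_derivative (\<lambda>h. covec \<alpha> c x0 \<bullet> Q h + dcovec \<alpha> c x0 h \<bullet> G x0)) (at x0)"
    by (rule has_derivative_transform_nhds)
  from has_derivative_unique[OF this has_derivative_const]
  have "covec \<alpha> c x0 \<bullet> Q h + dcovec \<alpha> c x0 h \<bullet> G x0 = 0" by (simp add: fun_eq_iff)
  then show ?thesis using l x0(2) by (simp add: h_def x0_def[symmetric] G_def)
qed

end

section \<open>The structure equations of the Cartan structure\<close>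

lemma antiderivative_exists:
  fixes g :: "real \<Rightarrow> real"
  assumes "\<And>t. isCont g t"
  shows "\<exists>G. G 0 = 0 \<and> (\<forall>t. (G has_real_derivative g t) (at t))"
proof -
  obtain G where "\<And>t. (G has_vector_derivative g t) (at t)"
    using einterval_antiderivative[of "-\<infinity>" \<infinity> g] assms by auto
  then have "((\<lambda>t. G t - G 0) has_real_derivative g t) (at t)" for t
    unfolding has_real_derivative_iff_has_vector_derivative
    by (auto intro!: derivative_eq_intros)
  then show ?thesis by (intro exI[of _ "\<lambda>t. G t - G 0"]) simp
qed

lemma equal_of_equal_derivatives:
  fixes f g :: "real \<Rightarrow> real"
  assumes "\<And>t. (f has_real_derivative d t) (at t)" "\<And>t. (g has_real_derivative d t) (at t)" "f a = g a"
  shows "f t = g t"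
proof -
  have "((\<lambda>t. f t - g t) has_real_derivative 0) (at t)" for t using DERIV_diff[OF assms(1) assms(2)] by simp
  then have "f t - g t = f a - g a" using DERIV_isconst_all[of "\<lambda>t. f t - g t"] by blast
  then show ?thesis using assms(3) by simp
qed

text \<open>
  The linear algebra in one tangent space; \<open>au\<close>, \<open>as\<close> stand for \<open>\<alpha>\<^sub>u\<close>, \<open>\<alpha>\<^sub>s\<close>, and \<open>dU\<close>, \<open>dS\<close> for their exterior
  derivatives.  Evaluating the equation of a Reeb vector on \<open>X\<close> gives \<open>\<alpha>\<^sub>u\<close> and \<open>\<alpha>\<^sub>s\<close> on this vector, and evaluating the equation
  of each Reeb vector on the other gives \<open>d\<alpha>\<^sub>u(R\<^sub>-, R\<^sub>+) = d\<alpha>\<^sub>s(R\<^sub>-, R\<^sub>+) = 0\<close>.  Now \<open>d\<alpha>\<^sub>u\<close> and \<open>d\<alpha>\<^sub>s\<close> are known on the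
  basis \<open>R\<^sub>-, R\<^sub>+, X\<close>.
\<close>

lemma Reeb_algebra:
  fixes au as X Rm Rp :: "'v::real_inner" and DU DS :: "'v \<Rightarrow> 'v"
  defines "dU \<equiv> \<lambda>h k. DU h \<bullet> k - DU k \<bullet> h" and "dS \<equiv> \<lambda>h k. DS h \<bullet> k - DS k \<bullet> h"
  defines "b \<equiv> \<lambda>v. dU v (Rm + Rp)"
  assumes lin: "linear DU" "linear DS" and r: "r > 0"
    and X: "au \<bullet> X = 0" "as \<bullet> X = 0" and ker: "\<forall>v. au \<bullet> v = 0 \<longrightarrow> as \<bullet> v = 0 \<longrightarrow> (\<exists>k. v = k *\<^sub>R X)"
    and dX: "\<And>v. dU X v = r * (au \<bullet> v)" "\<And>v. dS X v = - r * (as \<bullet> v)"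
    and Rm: "au \<bullet> Rm + as \<bullet> Rm = 1" "\<And>v. dU Rm v + dS Rm v = 0"
    and Rp: "au \<bullet> Rp - as \<bullet> Rp = 1" "\<And>v. dU Rp v - dS Rp v = 0"
  shows "au \<bullet> Rm = 1/2" "as \<bullet> Rm = 1/2" "au \<bullet> Rp = 1/2" "as \<bullet> Rp = -1/2"
    and "b X = r" "b Rm = 0" "b Rp = 0"
    and "v = (au \<bullet> v + as \<bullet> v) *\<^sub>R Rm + (au \<bullet> v - as \<bullet> v) *\<^sub>R Rp + (b v / r) *\<^sub>R X"
    and "dU u v = b u * (au \<bullet> v) - b v * (au \<bullet> u)"
    and "dS u v = - (b u * (as \<bullet> v) - b v * (as \<bullet> u))"
proof -
  have anti: "dU u v = - dU v u" "dS u v = - dS v u" for u v by (auto simp: dU_def dS_def)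
  have add: "dU u (v + w) = dU u v + dU u w" "dS u (v + w) = dS u v + dS u w"
      "dU (v + w) u = dU v u + dU w u" "dS (v + w) u = dS v u + dS w u" for u v w
    using lin by (simp_all add: dU_def dS_def linear_add inner_add)
  have scale: "dU u (a *\<^sub>R v) = a * dU u v" "dS u (a *\<^sub>R v) = a * dS u v"
      "dU (a *\<^sub>R v) u = a * dU v u" "dS (a *\<^sub>R v) u = a * dS v u" for u v a
    using lin by (simp_all add: dU_def dS_def linear_scale algebra_simps)
  have "r * (au \<bullet> Rm) - r * (as \<bullet> Rm) = 0"
    using Rm(2)[of X] anti(1)[of Rm X] anti(2)[of Rm X] dX(1)[of Rm] dX(2)[of Rm] by linarith
  then have "au \<bullet> Rm = as \<bullet> Rm" using r by (simp flip: right_diff_distrib)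
  then show m: "au \<bullet> Rm = 1/2" "as \<bullet> Rm = 1/2" using Rm(1) by auto
  have "r * (au \<bullet> Rp) + r * (as \<bullet> Rp) = 0"
    using Rp(2)[of X] anti(1)[of Rp X] anti(2)[of Rp X] dX(1)[of Rp] dX(2)[of Rp] by linarith
  then have "au \<bullet> Rp = - (as \<bullet> Rp)" using r by (simp flip: distrib_left add: add_eq_0_iff2)
  then show p: "au \<bullet> Rp = 1/2" "as \<bullet> Rp = -1/2" using Rp(1) by auto
  have "dU Rm Rp = 0 \<and> dS Rm Rp = 0"
    using Rm(2)[of Rp] Rp(2)[of Rm] anti(1)[of Rp Rm] anti(2)[of Rp Rm] by linarith
  then have mp: "dU Rm Rp = 0" "dS Rm Rp = 0" "dU Rp Rm = 0" "dS Rp Rm = 0"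
    using anti(1)[of Rp Rm] anti(2)[of Rp Rm] by auto
  have self: "dU w w = 0" "dS w w = 0" for w by (auto simp: dU_def dS_def)
  show bX: "b X = r" using m p by (simp add: b_def dX inner_add)
  show bm: "b Rm = 0" "b Rp = 0" using mp self by (simp_all add: b_def add)
  have badd: "b (x + y) = b x + b y" "b (c *\<^sub>R x) = c * b x" for x y c by (simp_all add: b_def add scale algebra_simps)
  have dec: "v = (au \<bullet> v + as \<bullet> v) *\<^sub>R Rm + (au \<bullet> v - as \<bullet> v) *\<^sub>R Rp + (b v / r) *\<^sub>R X" for v
  proof -
    define w where "w = v - ((au \<bullet> v + as \<bullet> v) *\<^sub>R Rm + (au \<bullet> v - as \<bullet> v) *\<^sub>R Rp)"
    have "z \<bullet> w = z \<bullet> v - ((au \<bullet> v + as \<bullet> v) * (z \<bullet> Rm) + (au \<bullet> v - as \<bullet> v) * (z \<bullet> Rp))" for z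
      by (simp add: w_def inner_diff_right inner_add_right)
    from this[of au] this[of as] have "au \<bullet> w = 0" "as \<bullet> w = 0" unfolding m p by (simp_all add: field_simps)
    then obtain k where k: "w = k *\<^sub>R X" using ker by blast
    have v: "v = (au \<bullet> v + as \<bullet> v) *\<^sub>R Rm + (au \<bullet> v - as \<bullet> v) *\<^sub>R Rp + k *\<^sub>R X"
      using k by (simp add: w_def algebra_simps)
    have "b v = k * r" by (subst v) (simp only: badd bm bX mult_zero_right add_0)
    then show ?thesis using v r by simp
  qed
  show "v = (au \<bullet> v + as \<bullet> v) *\<^sub>R Rm + (au \<bullet> v - as \<bullet> v) *\<^sub>R Rp + (b v / r) *\<^sub>R X" by (rule dec)
  have Xv: "dU v X = - (r * (au \<bullet> v))" "dS v X = r * (as \<bullet> v)" for v using anti(1)[of v X] anti(2)[of v X] dX by auto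
  have Uv: "dU Rm v = - b v / 2" "dU Rp v = - b v / 2" "dS Rm v = b v / 2" "dS Rp v = - b v / 2" for v
  proof -
    have "dU Rm v = (b v / r) * dU Rm X" "dU Rp v = (b v / r) * dU Rp X"
         "dS Rm v = (b v / r) * dS Rm X" "dS Rp v = (b v / r) * dS Rp X"
      by (subst (1) dec[of v], simp only: add scale self mp mult_zero_right add_0)+
    then show "dU Rm v = - b v / 2" "dU Rp v = - b v / 2" "dS Rm v = b v / 2" "dS Rp v = - b v / 2"
      using r m p by (simp_all add: Xv)
  qed
  have "dU u v = (au \<bullet> u + as \<bullet> u) * dU Rm v + (au \<bullet> u - as \<bullet> u) * dU Rp v + (b u / r) * dU X v"
    by (subst (1) dec[of u]) (simp only: add scale)
  then show "dU u v = b u * (au \<bullet> v) - b v * (au \<bullet> u)" using r by (simp add: Uv dX field_simps)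
  have "dS u v = (au \<bullet> u + as \<bullet> u) * dS Rm v + (au \<bullet> u - as \<bullet> u) * dS Rp v + (b u / r) * dS X v"
    by (subst (1) dec[of u]) (simp only: add scale)
  then show "dS u v = - (b u * (as \<bullet> v) - b v * (as \<bullet> u))" using r by (simp add: Uv dX field_simps)
qed

context closed_mfd
begin

lemma at_within_chart_domain:
  assumes "c \<in> A" "p \<in> cdom c" shows "at p within M = at p within cdom c"
proof -
  obtain T where T: "open T" "cdom c = M \<inter> T" using cdom_openin[OF assms(1)] unfolding openin_open by blast
  show ?thesis by (rule at_within_nhd[of _ T]) (use T assms in auto)
qed

lemma continuous_on_of_charts:
  assumes "\<And>c. c \<in> A \<Longrightarrow> continuous_on (cimg c) (\<lambda>x. g (cinv c x))"
  shows "continuous_on M g"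
  unfolding continuous_on_eq_continuous_within
proof
  fix p assume "p \<in> M"
  then obtain c where c: "c \<in> A" "p \<in> cdom c" using chart_exists by blast
  have "continuous_on (cdom c) (cmap c)" using chart_homeomorphism[OF c(1)] unfolding homeomorphism_def by blast
  from continuous_on_compose2[OF assms[OF c(1)] this]
  have "continuous_on (cdom c) (\<lambda>q. g (cinv c (cmap c q)))" by simp
  then have "continuous_on (cdom c) g" using cinv_cmap[OF c(1)] by (simp cong: continuous_on_cong)
  then show "continuous (at p within M) g"
    using c at_within_chart_domain[OF c] by (simp add: continuous_on_eq_continuous_within continuous_within)
qed

lemma ext_d_form1_add:
  assumes "Ck_one_form 1 M A \<alpha>" "Ck_one_form 1 M A \<beta>" "p \<in> M" "u \<in> tangent_space A p" "v \<in> tangent_space A p"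
  shows "ext_d A (form1_add \<alpha> \<beta>) p u v = ext_d A \<alpha> p u v + ext_d A \<beta> p u v"
    and "ext_d A (form1_diff \<alpha> \<beta>) p u v = ext_d A \<alpha> p u v - ext_d A \<beta> p u v"
proof -
  define c where "c = chart_at A p"
  have c: "c \<in> A" "p \<in> cdom c" using chart_at[OF assms(3)] by (auto simp: c_def)
  have x: "cmap c p \<in> cimg c" using c by blast
  let ?f = "\<lambda>\<alpha> w x. \<alpha> (cinv c x) (coord_vec A (cinv c x) c w) :: real"
  have w: "at (cmap c p) within cimg c = at (cmap c p)" using at_within_open[OF x open_cimg[OF c(1)]] .
  have D: "(?f \<alpha> w has_derivative frechet_derivative (?f \<alpha> w) (at (cmap c p) within cimg c)) (at (cmap c p) within cimg c)"
    if "Ck_one_form 1 M A \<alpha>" for \<alpha> w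
  proof -
    have o: "one_form M A \<alpha>" using that unfolding Ck_one_form_def by blast
    have "((\<lambda>x. covec \<alpha> c x \<bullet> w) has_derivative (\<lambda>k. dcovec \<alpha> c (cmap c p) k \<bullet> w)) (at (cmap c p))"
      by (intro has_derivative_inner_left covec_has_derivative(1)[OF that c(1)] x)
    moreover have "\<forall>\<^sub>F x in nhds (cmap c p). covec \<alpha> c x \<bullet> w = ?f \<alpha> w x"
      using eventually_nhds_in_open[OF open_cimg[OF c(1)] x] by eventually_elim (simp add: covec_coord_vec[OF o c(1)])
    ultimately have "(?f \<alpha> w has_derivative (\<lambda>k. dcovec \<alpha> c (cmap c p) k \<bullet> w)) (at (cmap c p))"
      by (rule has_derivative_transform_nhds)
    then show ?thesis unfolding w using frechet_derivative_works differentiableI by blast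
  qed
  note a = has_derivative_add[OF D[OF assms(1)] D[OF assms(2)]] and d = has_derivative_diff[OF D[OF assms(1)] D[OF assms(2)]]
  have a': "frechet_derivative (\<lambda>x. ?f \<alpha> w x + ?f \<beta> w x) (at (cmap c p) within cimg c)
      = (\<lambda>h. frechet_derivative (?f \<alpha> w) (at (cmap c p) within cimg c) h + frechet_derivative (?f \<beta> w) (at (cmap c p) within cimg c) h)" for w
    using frechet_derivative_at[OF a[unfolded w]] unfolding w by metis
  have d': "frechet_derivative (\<lambda>x. ?f \<alpha> w x - ?f \<beta> w x) (at (cmap c p) within cimg c)
      = (\<lambda>h. frechet_derivative (?f \<alpha> w) (at (cmap c p) within cimg c) h - frechet_derivative (?f \<beta> w) (at (cmap c p) within cimg c) h)" for w
    using frechet_derivative_at[OF d[unfolded w]] unfolding w by metis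
  show "ext_d A (form1_add \<alpha> \<beta>) p u v = ext_d A \<alpha> p u v + ext_d A \<beta> p u v"
    unfolding ext_d_def Let_def c_def[symmetric] form1_add_def a' by simp
  show "ext_d A (form1_diff \<alpha> \<beta>) p u v = ext_d A \<alpha> p u v - ext_d A \<beta> p u v"
    unfolding ext_d_def Let_def c_def[symmetric] form1_diff_def d' by simp
qed

text \<open>
  The differential of \<open>u \<mapsto> \<psi>(\<delta> u, x u)\<close> at a parameter where the time \<open>\<delta> u\<close> is 0.  The expansion of the flow for short
  times suffices, so \<open>\<psi>\<close> may be the flow of a continuous vector field.
\<close>

lemma flow_at_variable_time:
  fixes x :: "'b::real_normed_vector \<Rightarrow> real ^ 'n"
  assumes gen: "generates_flow M A V \<psi>" and c: "c \<in> A" "q \<in> cdom c"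
    and V: "isCont (\<lambda>x. V (cinv c x) c) (cmap c q)"
    and x: "(x has_derivative Dx) (at u0)" "x u0 = cmap c q"
    and \<delta>: "(\<delta> has_derivative D\<delta>) (at u0)" "\<delta> u0 = 0"
  shows "((\<lambda>u. cmap c (\<psi> (\<delta> u) (cinv c (x u)))) has_derivative (\<lambda>h. Dx h + D\<delta> h *\<^sub>R V q c)) (at u0)"
    and "\<forall>\<^sub>F u in nhds u0. x u \<in> cimg c \<and> \<psi> (\<delta> u) (cinv c (x u)) \<in> cdom c"
proof -
  have tx: "(x \<longlongrightarrow> cmap c q) (nhds u0)" "(\<delta> \<longlongrightarrow> 0) (nhds u0)"
    using has_derivative_continuous[OF x(1)] has_derivative_continuous[OF \<delta>(1)] x(2) \<delta>(2)
    by (auto simp: isCont_def tendsto_nhds_iff)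
  have ev: "\<forall>\<^sub>F u in nhds u0. x u \<in> cimg c \<and> \<psi> (\<delta> u) (cinv c (x u)) \<in> cdom c
      \<and> norm (cmap c (\<psi> (\<delta> u) (cinv c (x u))) - x u - \<delta> u *\<^sub>R V q c) \<le> e * \<bar>\<delta> u\<bar>" if e: "e > 0" for e
  proof -
    obtain \<rho> t0 where \<rho>: "\<rho> > 0" "t0 > 0"
      and fl: "\<And>x t. x \<in> ball (cmap c q) \<rho> \<Longrightarrow> \<bar>t\<bar> \<le> t0 \<Longrightarrow> x \<in> cimg c \<and> \<psi> t (cinv c x) \<in> cdom c
       \<and> norm (cmap c (\<psi> t (cinv c x)) - x - t *\<^sub>R V q c) \<le> e * \<bar>t\<bar>"
      using flow_first_order[OF gen c V e zero_less_one] by metis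
    have "\<forall>\<^sub>F u in nhds u0. dist (x u) (cmap c q) < \<rho>" "\<forall>\<^sub>F u in nhds u0. dist (\<delta> u) 0 < t0"
      using tendstoD[OF tx(1) \<rho>(1)] tendstoD[OF tx(2) \<rho>(2)] .
    then show ?thesis
    proof eventually_elim
      case (elim u)
      then show ?case using fl[of "x u" "\<delta> u"] by (simp add: dist_commute)
    qed
  qed
  from ev[OF zero_less_one] show "\<forall>\<^sub>F u in nhds u0. x u \<in> cimg c \<and> \<psi> (\<delta> u) (cinv c (x u)) \<in> cdom c"
    by eventually_elim blast
  define Rest where "Rest = (\<lambda>u. cmap c (\<psi> (\<delta> u) (cinv c (x u))) - x u - \<delta> u *\<^sub>R V q c)"
  obtain B where B: "B > 0" "\<And>h. norm (D\<delta> h) \<le> B * norm h"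
    using bounded_linear.pos_bounded[OF has_derivative_bounded_linear[OF \<delta>(1)]] by (auto simp: mult.commute)
  have "(Rest has_derivative (\<lambda>h. 0)) (at u0)"
    unfolding has_derivative_at_alt
  proof (intro conjI allI impI)
    fix e :: real assume e: "e > 0"
    define e' where "e' = e / (B + 1)"
    have e': "e' > 0" "e' * (B + 1) = e" using e B(1) by (auto simp: e'_def)
    obtain d1 where d1: "d1 > 0" "\<And>u. norm (u - u0) < d1 \<Longrightarrow> norm (\<delta> u - \<delta> u0 - D\<delta> (u - u0)) \<le> 1 * norm (u - u0)"
      using \<delta>(1) zero_less_one unfolding has_derivative_at_alt by metis
    obtain d2 where d2: "d2 > 0" "\<And>u. norm (u - u0) < d2 \<Longrightarrow> norm (Rest u) \<le> e' * \<bar>\<delta> u\<bar>"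
      using ev[OF e'(1)] unfolding eventually_nhds_metric Rest_def dist_norm by blast
    have R0: "Rest u0 = 0"
      using d2(2)[of u0] d2(1) \<delta>(2) by simp
    show "\<exists>d>0. \<forall>y. norm (y - u0) < d \<longrightarrow> norm (Rest y - Rest u0 - 0) \<le> e * norm (y - u0)"
    proof (intro exI[of _ "min d1 d2"] conjI allI impI)
      fix u assume u: "norm (u - u0) < min d1 d2"
      have "\<bar>\<delta> u\<bar> \<le> norm (\<delta> u - \<delta> u0 - D\<delta> (u - u0)) + norm (D\<delta> (u - u0))" using \<delta>(2) by simp
      also have "\<dots> \<le> (B + 1) * norm (u - u0)" using d1(2)[of u] B(2)[of "u - u0"] u by (simp add: algebra_simps)
      finally have "e' * \<bar>\<delta> u\<bar> \<le> e' * ((B + 1) * norm (u - u0))" using e'(1) by simp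
      also have "\<dots> = e * norm (u - u0)" using e'(2) by (simp add: mult.assoc[symmetric])
      finally show "norm (Rest u - Rest u0 - 0) \<le> e * norm (u - u0)" using d2(2)[of u] u R0 by simp
    qed (use d1 d2 in simp)
  qed simp
  from has_derivative_add[OF has_derivative_add[OF this x(1)] has_derivative_scaleR_left[OF \<delta>(1), of "V q c"]]
  show "((\<lambda>u. cmap c (\<psi> (\<delta> u) (cinv c (x u)))) has_derivative (\<lambda>h. Dx h + D\<delta> h *\<^sub>R V q c)) (at u0)"
    by (simp add: Rest_def)
qed

lemma continuous_of_local_rep:
  assumes c: "c \<in> A" "p \<in> cdom c" and d: "d \<in> A" "f p \<in> cdom d"
    and ev: "\<forall>\<^sub>F y in nhds (cmap c p). f (cinv c y) \<in> cdom d"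
    and cont: "isCont (cmap d \<circ> f \<circ> cinv c) (cmap c p)"
  shows "continuous (at p within M) f"
proof -
  have "continuous_on (cdom c) (cmap c)" using chart_homeomorphism[OF c(1)] unfolding homeomorphism_def by blast
  then have tc: "(cmap c \<longlongrightarrow> cmap c p) (at p within cdom c)" using c(2) unfolding continuous_on_def by blast
  have "continuous_on (cimg d) (cinv d)" using chart_homeomorphism[OF d(1)] unfolding homeomorphism_def by blast
  then have "isCont (cinv d) (cmap d (f p))"
    using continuous_on_eq_continuous_at[OF open_cimg[OF d(1)]] d(2) by blast
  then have "isCont (\<lambda>y. cinv d ((cmap d \<circ> f \<circ> cinv c) y)) (cmap c p)"
    by (intro isCont_o2[OF cont]) (use cinv_cmap[OF c] in simp)
  from isCont_tendsto_compose[OF this tc]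
  have lim: "((\<lambda>q. cinv d ((cmap d \<circ> f \<circ> cinv c) (cmap c q))) \<longlongrightarrow> f p) (at p within cdom c)"
    using cinv_cmap[OF c] cinv_cmap[OF d] by simp
  have "\<forall>\<^sub>F q in at p within cdom c. f (cinv c (cmap c q)) \<in> cdom d"
    using eventually_compose_filterlim[OF ev tc] .
  moreover have "\<forall>\<^sub>F q in at p within cdom c. q \<in> cdom c" by (simp add: eventually_at_filter)
  ultimately have "\<forall>\<^sub>F q in at p within cdom c. cinv d ((cmap d \<circ> f \<circ> cinv c) (cmap c q)) = f q"
    by eventually_elim (use cinv_cmap[OF c(1)] cinv_cmap[OF d(1)] in simp)
  from Lim_transform_eventually[OF lim this]
  show ?thesis unfolding continuous_within at_within_chart_domain[OF c] .
qed

end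

text \<open>
  The situation of the theorem, with the forms \<open>\<alpha>\<^sub>u\<close> and \<open>\<alpha>\<^sub>s\<close> from which the Cartan structure is built; \<open>Rm\<close> and \<open>Rp\<close> are
  the Reeb fields of \<open>\<alpha>\<^sub>- = \<alpha>\<^sub>u + \<alpha>\<^sub>s\<close> and \<open>\<alpha>\<^sub>+ = \<alpha>\<^sub>u - \<alpha>\<^sub>s\<close>.
\<close>

locale anosov_cartan = closed_mfd M A
  for M :: "'a::t2_space set" and A :: "('a, 3) chart set" +
  fixes X Rm Rp :: "'a \<Rightarrow> ('a, 3) tvec" and \<phi> :: "real \<Rightarrow> 'a \<Rightarrow> 'a"
    and Ess Euu :: "'a \<Rightarrow> ('a, 3) tvec set" and \<alpha>u \<alpha>s :: "('a, 3) form1" and r :: "'a \<Rightarrow> real"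
  assumes compact_M: "compact M"
    and X: "Ck_vector_field 1 M A X" and X0: "nonvanishing M X"
    and gen: "generates_flow M A X \<phi>"
    and splitting: "Anosov_splitting M A X \<phi> Ess Euu"
    and \<alpha>u: "Ck_one_form 1 M A \<alpha>u" and \<alpha>s: "Ck_one_form 1 M A \<alpha>s"
    and ker_u: "has_kernel M A \<alpha>u (weak_bundle X Ess)" and ker_s: "has_kernel M A \<alpha>s (weak_bundle X Euu)"
    and positive: "\<And>\<alpha>X. one_form M A \<alpha>X \<Longrightarrow> (\<forall>p\<in>M. \<alpha>X p (X p) = 1) \<Longrightarrow> positive_3_form M A (wedge111 \<alpha>s \<alpha>u \<alpha>X)"
    and Lie_u: "has_Lie_derivative M A \<phi> \<alpha>u (\<lambda>p v. r p * \<alpha>u p v)"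
    and Lie_s: "has_Lie_derivative M A \<phi> \<alpha>s (\<lambda>p v. - r p * \<alpha>s p v)"
    and r_pos: "\<forall>p\<in>M. r p > 0"
    and Rm: "Reeb_vector_field M A (form1_add \<alpha>u \<alpha>s) Rm"
    and Rp: "Reeb_vector_field M A (form1_diff \<alpha>u \<alpha>s) Rp"
begin

lemma flow_differentiable: "p \<in> M \<Longrightarrow> mfd_differentiable M A A (\<phi> t) p"
  using splitting unfolding Anosov_splitting_def preserves_bundle_def by blast

lemma X_tangent: "p \<in> M \<Longrightarrow> X p \<in> tangent_space A p"
  using X unfolding Ck_vector_field_def vector_field_def by blast
lemma Rm_tangent: "p \<in> M \<Longrightarrow> Rm p \<in> tangent_space A p"
  using Rm unfolding Reeb_vector_field_def Ck_vector_field_def vector_field_def by blast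
lemma Rp_tangent: "p \<in> M \<Longrightarrow> Rp p \<in> tangent_space A p"
  using Rp unfolding Reeb_vector_field_def Ck_vector_field_def vector_field_def by blast

lemma one_form_\<alpha>u: "one_form M A \<alpha>u" and one_form_\<alpha>s: "one_form M A \<alpha>s"
  using \<alpha>u \<alpha>s unfolding Ck_one_form_def by blast+

lemma line_bundle_section:
  assumes "continuous_line_bundle M A E" "p \<in> M"
  obtains U e where "openin (top_of_set M) U" "p \<in> U" "\<And>q. q \<in> U \<Longrightarrow> e q \<in> tangent_space A q"
    "\<And>q. q \<in> U \<Longrightarrow> e q \<noteq> tzero" "\<And>q. q \<in> U \<Longrightarrow> E q = range (\<lambda>a. tscale a (e q))"
    "\<And>c. c \<in> A \<Longrightarrow> continuous_on (cmap c ` (cdom c \<inter> U)) (\<lambda>x. e (cinv c x) c)"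
  using assms unfolding continuous_line_bundle_def vector_field_def nonvanishing_def by metis

lemma bundles: "continuous_line_bundle M A Ess" "continuous_line_bundle M A Euu"
  using splitting unfolding Anosov_splitting_def by blast+

lemma tzero_in_bundle:
  assumes "continuous_line_bundle M A E" "p \<in> M" shows "tzero \<in> E p"
proof -
  obtain U e where "p \<in> U" "E p = range (\<lambda>a. tscale a (e p))" using line_bundle_section[OF assms] by metis
  moreover have "tzero = tscale 0 (e p)" by (simp add: tzero_def tscale_def)
  ultimately show ?thesis by blast
qed

lemma forms_vanish_on_X: assumes p: "p \<in> M" shows "\<alpha>u p (X p) = 0" "\<alpha>s p (X p) = 0"
proof -
  have "X p = tadd tzero (tscale 1 (X p))" by (simp add: tadd_def tzero_def tscale_def)
  then have "X p \<in> weak_bundle X Ess p" "X p \<in> weak_bundle X Euu p"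
    using tzero_in_bundle[OF bundles(1) p] tzero_in_bundle[OF bundles(2) p] unfolding weak_bundle_def by blast+
  then show "\<alpha>u p (X p) = 0" "\<alpha>s p (X p) = 0" using ker_u ker_s p unfolding has_kernel_def by blast+
qed

lemma splitting_unique:
  assumes "p \<in> M" "tadd (tadd u w) (tscale a (X p)) \<in> tangent_space A p"
    "u \<in> Ess p" "w \<in> Euu p" "u' \<in> Ess p" "w' \<in> Euu p"
    "tadd (tadd u w) (tscale a (X p)) = tadd (tadd u' w') (tscale a' (X p))"
  shows "u = u' \<and> w = w' \<and> a = a'"
proof -
  let ?v = "tadd (tadd u w) (tscale a (X p))"
  have "\<exists>!(u, w, a). u \<in> Ess p \<and> w \<in> Euu p \<and> ?v = tadd (tadd u w) (tscale a (X p))"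
    using splitting assms(1,2) unfolding Anosov_splitting_def by blast
  then have "(u, w, a) = (u', w', a')" by (rule ex1E) (use assms in auto)
  then show ?thesis by simp
qed

lemma common_kernel:
  assumes p: "p \<in> M" and v: "v \<in> tangent_space A p" "\<alpha>u p v = 0" "\<alpha>s p v = 0"
  shows "\<exists>k. v = tscale k (X p)"
proof -
  have "v \<in> weak_bundle X Ess p" "v \<in> weak_bundle X Euu p"
    using v p ker_u ker_s unfolding has_kernel_def by blast+
  then obtain u a w b where u: "v = tadd u (tscale a (X p))" "u \<in> Ess p" and w: "v = tadd w (tscale b (X p))" "w \<in> Euu p"
    unfolding weak_bundle_def by blast
  have 1: "v = tadd (tadd u tzero) (tscale a (X p))" "v = tadd (tadd tzero w) (tscale b (X p))"
    using u w by (auto simp: tadd_def tzero_def)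
  have "u = tzero"
    using splitting_unique[OF p _ u(2) tzero_in_bundle[OF bundles(2) p] tzero_in_bundle[OF bundles(1) p] w(2), of a b] 1 v(1) by metis
  then show ?thesis using u(1) by (auto simp: tadd_def tzero_def)
qed

lemma bundle_sections_transverse:
  assumes p: "p \<in> M" and e: "e \<in> tangent_space A p" "e \<noteq> tzero"
  shows "e \<in> Ess p \<Longrightarrow> \<alpha>u p e = 0 \<and> \<alpha>s p e \<noteq> 0" "e \<in> Euu p \<Longrightarrow> \<alpha>s p e = 0 \<and> \<alpha>u p e \<noteq> 0"
proof -
  have e0: "e = tadd e (tscale 0 (X p))" by (simp add: tadd_def tscale_def)
  have no: False if k: "e = tscale k (X p)" and "e \<in> Ess p \<or> e \<in> Euu p" for k
  proof -
    have "e = tadd (tadd e tzero) (tscale 0 (X p))" "e = tadd (tadd tzero e) (tscale 0 (X p))"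
        "e = tadd (tadd tzero tzero) (tscale k (X p))"
      using k by (auto simp: tadd_def tscale_def tzero_def)
    then have "e = tzero"
      using splitting_unique[OF p] that(2) e(1) tzero_in_bundle[OF bundles(1) p] tzero_in_bundle[OF bundles(2) p] by metis
    then show False using e(2) by blast
  qed
  show "e \<in> Ess p \<Longrightarrow> \<alpha>u p e = 0 \<and> \<alpha>s p e \<noteq> 0"
  proof -
    assume E: "e \<in> Ess p"
    then have "e \<in> weak_bundle X Ess p" using e0 unfolding weak_bundle_def by blast
    then have "\<alpha>u p e = 0" using ker_u p unfolding has_kernel_def by blast
    then show ?thesis using common_kernel[OF p e(1)] no E by blast
  qed
  show "e \<in> Euu p \<Longrightarrow> \<alpha>s p e = 0 \<and> \<alpha>u p e \<noteq> 0"
  proof -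
    assume E: "e \<in> Euu p"
    then have "e \<in> weak_bundle X Euu p" using e0 unfolding weak_bundle_def by blast
    then have "\<alpha>s p e = 0" using ker_s p unfolding has_kernel_def by blast
    then show ?thesis using common_kernel[OF p e(1)] no E by blast
  qed
qed

text \<open>
  The form \<open>\<beta> = d\<alpha>\<^sub>u(_, R\<^sub>- + R\<^sub>+)\<close> in the coordinates of a chart.
\<close>

definition \<beta>_chart :: "('a, 3) chart \<Rightarrow> real ^ 3 \<Rightarrow> real ^ 3 \<Rightarrow> real" where
  "\<beta>_chart c x h = dcovec \<alpha>u c x h \<bullet> (Rm (cinv c x) c + Rp (cinv c x) c)
           - dcovec \<alpha>u c x (Rm (cinv c x) c + Rp (cinv c x) c) \<bullet> h"

text \<open>
  \<open>Reeb_algebra\<close> in the coordinates of a chart; \<open>Cartan_formula\<close> supplies the contractions of \<open>X\<close> with the exterior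
  derivatives.
\<close>

lemma structure_in_chart:
  assumes c: "c \<in> A" and x: "x \<in> cimg c"
  defines "p \<equiv> cinv c x"
  defines "au \<equiv> covec \<alpha>u c x" and "as \<equiv> covec \<alpha>s c x"
  shows "au \<bullet> X p c = 0" "as \<bullet> X p c = 0"
    and "au \<bullet> Rm p c = 1/2" "as \<bullet> Rm p c = 1/2" "au \<bullet> Rp p c = 1/2" "as \<bullet> Rp p c = -1/2"
    and "\<beta>_chart c x (X p c) = r p" "\<beta>_chart c x (Rm p c) = 0" "\<beta>_chart c x (Rp p c) = 0"
    and "v = (au \<bullet> v + as \<bullet> v) *\<^sub>R Rm p c + (au \<bullet> v - as \<bullet> v) *\<^sub>R Rp p c + (\<beta>_chart c x v / r p) *\<^sub>R X p c"
    and "dcovec \<alpha>u c x u \<bullet> v - dcovec \<alpha>u c x v \<bullet> u = \<beta>_chart c x u * (au \<bullet> v) - \<beta>_chart c x v * (au \<bullet> u)"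
    and "dcovec \<alpha>s c x u \<bullet> v - dcovec \<alpha>s c x v \<bullet> u = - (\<beta>_chart c x u * (as \<bullet> v) - \<beta>_chart c x v * (as \<bullet> u))"
    and "linear (\<beta>_chart c x)"
proof -
  have pc: "p \<in> cdom c" "cmap c p = x" using cinv_in[OF c x] x by (auto simp: p_def)
  have pM: "p \<in> M" using pc(1) cdom_subset[OF c] by blast
  note lin = has_derivative_linear[OF covec_has_derivative(1)[OF \<alpha>u c x]] has_derivative_linear[OF covec_has_derivative(1)[OF \<alpha>s c x]]
  have ev: "\<alpha>u p v = au \<bullet> v c" "\<alpha>s p v = as \<bullet> v c" if "v \<in> tangent_space A p" for v
    using form_eq_covec[OF one_form_\<alpha>u c pc(1) that] form_eq_covec[OF one_form_\<alpha>s c pc(1) that] pc(2) by (auto simp: au_def as_def)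
  have cv: "coord_vec A p c h \<in> tangent_space A p" "coord_vec A p c h c = h" for h
    using coord_vec_tangent[OF c pc(1)] coord_vec_apply[OF c pc(1)] by auto
  have d: "ext_d A \<alpha>u p u v = dcovec \<alpha>u c x (u c) \<bullet> v c - dcovec \<alpha>u c x (v c) \<bullet> u c"
          "ext_d A \<alpha>s p u v = dcovec \<alpha>s c x (u c) \<bullet> v c - dcovec \<alpha>s c x (v c) \<bullet> u c"
    if "u \<in> tangent_space A p" "v \<in> tangent_space A p" for u v
    using ext_d_chart[OF \<alpha>u c pc(1) that] ext_d_chart[OF \<alpha>s c pc(1) that] pc(2) by auto
  show X1: "au \<bullet> X p c = 0" "as \<bullet> X p c = 0"
    using forms_vanish_on_X[OF pM] ev[OF X_tangent[OF pM]] by auto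
  have rp: "r p > 0" using r_pos pM by blast
  have Lu: "((\<lambda>t. \<alpha>u (\<phi> t p) (push A A (\<phi> t) p (coord_vec A p c v))) has_real_derivative r p * (au \<bullet> v)) (at 0)"
   and Ls: "((\<lambda>t. \<alpha>s (\<phi> t p) (push A A (\<phi> t) p (coord_vec A p c v))) has_real_derivative - r p * (as \<bullet> v)) (at 0)" for v
    using bspec[OF bspec[OF Lie_u[unfolded has_Lie_derivative_def] pM] cv(1)[of v]]
      bspec[OF bspec[OF Lie_s[unfolded has_Lie_derivative_def] pM] cv(1)[of v]]
    by (simp_all only: ev[OF cv(1)] cv(2))
  have dX: "dcovec \<alpha>u c x (X p c) \<bullet> v - dcovec \<alpha>u c x v \<bullet> X p c = r p * (au \<bullet> v)"
           "dcovec \<alpha>s c x (X p c) \<bullet> v - dcovec \<alpha>s c x v \<bullet> X p c = - r p * (as \<bullet> v)" for v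
    using Cartan_formula[OF gen X c pc(1) flow_differentiable[OF pM] \<alpha>u forms_vanish_on_X(1) Lu[of v] cv(1)]
      Cartan_formula[OF gen X c pc(1) flow_differentiable[OF pM] \<alpha>s forms_vanish_on_X(2) Ls[of v] cv(1)] cv(2) pc(2) by auto
  have ker: "\<forall>v. au \<bullet> v = 0 \<longrightarrow> as \<bullet> v = 0 \<longrightarrow> (\<exists>k. v = k *\<^sub>R X p c)"
  proof (intro allI impI)
    fix v assume v0: "au \<bullet> v = 0" "as \<bullet> v = 0"
    obtain k where "coord_vec A p c v = tscale k (X p)"
      using common_kernel[OF pM cv(1)[of v]] ev[OF cv(1)[of v]] cv(2)[of v] v0 by auto
    then have "coord_vec A p c v c = tscale k (X p) c" by simp
    then show "\<exists>k. v = k *\<^sub>R X p c" using cv(2) by (auto simp: tscale_def)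
  qed
  have m1: "au \<bullet> Rm p c + as \<bullet> Rm p c = 1"
    using Rm pM ev[OF Rm_tangent[OF pM]] unfolding Reeb_vector_field_def form1_add_def by auto
  have p1: "au \<bullet> Rp p c - as \<bullet> Rp p c = 1"
    using Rp pM ev[OF Rp_tangent[OF pM]] unfolding Reeb_vector_field_def form1_diff_def by auto
  have m2: "(dcovec \<alpha>u c x (Rm p c) \<bullet> v - dcovec \<alpha>u c x v \<bullet> Rm p c) + (dcovec \<alpha>s c x (Rm p c) \<bullet> v - dcovec \<alpha>s c x v \<bullet> Rm p c) = 0" for v
  proof -
    have "ext_d A (form1_add \<alpha>u \<alpha>s) p (Rm p) (coord_vec A p c v) = 0"
      using Rm pM cv(1) unfolding Reeb_vector_field_def by blast
    then show ?thesis
      using ext_d_form1_add(1)[OF \<alpha>u \<alpha>s pM Rm_tangent[OF pM] cv(1)] d[OF Rm_tangent[OF pM] cv(1)] cv(2) by simp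
  qed
  have p2: "(dcovec \<alpha>u c x (Rp p c) \<bullet> v - dcovec \<alpha>u c x v \<bullet> Rp p c) - (dcovec \<alpha>s c x (Rp p c) \<bullet> v - dcovec \<alpha>s c x v \<bullet> Rp p c) = 0" for v
  proof -
    have "ext_d A (form1_diff \<alpha>u \<alpha>s) p (Rp p) (coord_vec A p c v) = 0"
      using Rp pM cv(1) unfolding Reeb_vector_field_def by blast
    then show ?thesis
      using ext_d_form1_add(2)[OF \<alpha>u \<alpha>s pM Rp_tangent[OF pM] cv(1)] d[OF Rp_tangent[OF pM] cv(1)] cv(2) by simp
  qed
  note R = Reeb_algebra[OF lin rp X1 ker dX m1 m2 p1 p2]
  have \<beta>: "\<beta>_chart c x h = dcovec \<alpha>u c x h \<bullet> (Rm p c + Rp p c) - dcovec \<alpha>u c x (Rm p c + Rp p c) \<bullet> h" for h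
    by (simp add: \<beta>_chart_def p_def)
  show "au \<bullet> Rm p c = 1/2" "as \<bullet> Rm p c = 1/2" "au \<bullet> Rp p c = 1/2" "as \<bullet> Rp p c = -1/2"
    "\<beta>_chart c x (X p c) = r p" "\<beta>_chart c x (Rm p c) = 0" "\<beta>_chart c x (Rp p c) = 0"
    "v = (au \<bullet> v + as \<bullet> v) *\<^sub>R Rm p c + (au \<bullet> v - as \<bullet> v) *\<^sub>R Rp p c + (\<beta>_chart c x v / r p) *\<^sub>R X p c"
    "dcovec \<alpha>u c x u \<bullet> v - dcovec \<alpha>u c x v \<bullet> u = \<beta>_chart c x u * (au \<bullet> v) - \<beta>_chart c x v * (au \<bullet> u)"
    "dcovec \<alpha>s c x u \<bullet> v - dcovec \<alpha>s c x v \<bullet> u = - (\<beta>_chart c x u * (as \<bullet> v) - \<beta>_chart c x v * (as \<bullet> u))"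
    unfolding \<beta> by - (fact R)+
  show "linear (\<beta>_chart c x)"
    unfolding \<beta>_chart_def by (rule linearI) (simp_all add: linear_add[OF lin(1)] linear_scale[OF lin(1)] inner_add algebra_simps)
qed

lemma Reeb_continuous:
  assumes "c \<in> A"
  shows "continuous_on (cimg c) (\<lambda>x. Rm (cinv c x) c)" "continuous_on (cimg c) (\<lambda>x. Rp (cinv c x) c)"
    "continuous_on (cimg c) (\<lambda>x. X (cinv c x) c)"
proof -
  show "continuous_on (cimg c) (\<lambda>x. Rm (cinv c x) c)" "continuous_on (cimg c) (\<lambda>x. Rp (cinv c x) c)"
    using assms Rm Rp unfolding Reeb_vector_field_def Ck_vector_field_def by auto
  show "continuous_on (cimg c) (\<lambda>x. X (cinv c x) c)"
    unfolding continuous_on_eq_continuous_at[OF open_cimg[OF assms]] using vector_field_isCont[OF X assms] by auto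
qed

lemma \<beta>_chart_continuous:
  assumes c: "c \<in> A" and h: "continuous_on (cimg c) h"
  shows "continuous_on (cimg c) (\<lambda>x. \<beta>_chart c x (h x))"
proof -
  have lin: "linear (dcovec \<alpha>u c x)" if "x \<in> cimg c" for x
    by (rule has_derivative_linear[OF covec_has_derivative(1)[OF \<alpha>u c that]])
  note cd = continuous_on_derivative_compose[OF lin covec_has_derivative(2)[OF \<alpha>u c] continuous_on_id]
  show ?thesis
    unfolding \<beta>_chart_def by (intro continuous_intros cd h Reeb_continuous c) auto
qed

text \<open>
  The expansion rate is \<open>\<beta>(X)\<close>, and \<open>\<beta>\<close> is continuous, being made of first derivatives of \<open>\<alpha>\<^sub>u\<close> and Reeb fields.
\<close>

lemma r_continuous_chart: assumes c: "c \<in> A" shows "continuous_on (cimg c) (\<lambda>x. r (cinv c x))"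
proof -
  have "continuous_on (cimg c) (\<lambda>x. \<beta>_chart c x (X (cinv c x) c))" by (rule \<beta>_chart_continuous[OF c Reeb_continuous(3)[OF c]])
  then show ?thesis using structure_in_chart(7)[OF c] by (simp cong: continuous_on_cong)
qed

lemma r_continuous: "continuous_on M r"
  by (rule continuous_on_of_charts) (rule r_continuous_chart)

lemma r_bounded_below: assumes "M \<noteq> {}" obtains m where "m > 0" "\<And>p. p \<in> M \<Longrightarrow> m \<le> r p"
  using continuous_attains_inf[OF compact_M assms r_continuous] r_pos by metis

section \<open>The expansion along the flow\<close>

lemma flow_M: "\<forall>q\<in>M. \<phi> t q \<in> M" using flow_in_M[OF gen] by blast

lemma flow_continuous: "continuous_on M (\<phi> t)"
  using flow_differentiable unfolding continuous_on_eq_continuous_within mfd_differentiable_def by blast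

text \<open>
  Each \<open>\<phi>\<^sup>s\<close> is continuous in the point, and by \<open>flow_first_order\<close> the flow moves points near \<open>\<phi>\<^sup>s(q)\<close> only a
  little in short times, uniformly.
\<close>

lemma r_flow_continuous: "continuous_on (M \<times> UNIV) (\<lambda>z. r (\<phi> (snd z) (fst z)))"
  unfolding continuous_on_def
proof (intro ballI tendstoI)
  fix z and e :: real assume z: "z \<in> M \<times> (UNIV :: real set)" and e: "e > 0"
  define q0 where "q0 = fst z"
  define s0 where "s0 = snd z"
  define p0 where "p0 = \<phi> s0 q0"
  have M: "q0 \<in> M" "p0 \<in> M" using z flow_M by (auto simp: q0_def p0_def)
  obtain c where c: "c \<in> A" "p0 \<in> cdom c" using chart_exists M by blast
  define x0 where "x0 = cmap c p0"
  have x0: "x0 \<in> cimg c" "cinv c x0 = p0" using c by (auto simp: x0_def)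
  have "isCont (\<lambda>x. r (cinv c x)) x0"
    using r_continuous_chart[OF c(1)] continuous_on_eq_continuous_at[OF open_cimg[OF c(1)]] x0 by blast
  then obtain \<eta> where \<eta>: "\<eta> > 0" "\<And>x. dist x x0 < \<eta> \<Longrightarrow> dist (r (cinv c x)) (r p0) < e"
    using e x0(2) unfolding continuous_at_eps_delta dist_real_def by (auto simp: dist_norm)
  obtain \<rho> t0 where \<rho>: "\<rho> > 0" "t0 > 0"
    and fl: "\<And>x t. x \<in> ball x0 \<rho> \<Longrightarrow> \<bar>t\<bar> \<le> t0 \<Longrightarrow> x \<in> cimg c \<and> \<phi> t (cinv c x) \<in> cdom c
       \<and> cmap c (\<phi> t (cinv c x)) \<in> ball x0 \<eta>"
    using flow_first_order[OF gen c vector_field_isCont[OF X c] zero_less_one \<eta>(1)] unfolding x0_def by metis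
  define W where "W = cinv c ` (ball x0 \<rho> \<inter> cimg c)"
  have "openin (top_of_set M) W"
    unfolding W_def by (rule openin_cinv_image[OF c(1)]) (use open_cimg[OF c(1)] in auto)
  then obtain O' where O': "open O'" "W = M \<inter> O'" unfolding openin_open by blast
  have "p0 \<in> W" using x0 \<rho> unfolding W_def by (intro image_eqI[of _ _ x0]) auto
  then have "\<forall>\<^sub>F q in at q0 within M. \<phi> s0 q \<in> O'"
    using flow_continuous[of s0] M(1) O' unfolding continuous_on_def p0_def
    by (intro topological_tendstoD[of "\<phi> s0"]) auto
  then obtain S where S: "open S" "q0 \<in> S" "\<And>q. q \<in> S \<Longrightarrow> q \<noteq> q0 \<Longrightarrow> q \<in> M \<Longrightarrow> \<phi> s0 q \<in> O'"
    unfolding eventually_at_topological by blast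
  have near: "dist (r (\<phi> s q)) (r p0) < e" if q: "q \<in> S" "q \<in> M" and s: "\<bar>s - s0\<bar> < t0" for s q
  proof -
    have "\<phi> s0 q \<in> O'" using S(3)[of q] q \<open>p0 \<in> W\<close> O' by (cases "q = q0") (auto simp: p0_def)
    then have "\<phi> s0 q \<in> W" using O' flow_M q by blast
    then obtain x where x: "x \<in> ball x0 \<rho>" "\<phi> s0 q = cinv c x" by (auto simp: W_def)
    have "\<phi> s q = \<phi> (s - s0) (cinv c x)" using flow_add[OF gen q(2), of "s - s0" s0] x by simp
    moreover have f: "\<phi> (s - s0) (cinv c x) \<in> cdom c" "cmap c (\<phi> (s - s0) (cinv c x)) \<in> ball x0 \<eta>"
      using fl[OF x(1), of "s - s0"] s by auto
    ultimately show ?thesis using \<eta>(2)[of "cmap c (\<phi> (s - s0) (cinv c x))"] cinv_cmap[OF c(1) f(1)] by (simp add: dist_commute)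
  qed
  have "open (S \<times> ball s0 t0)" "z \<in> S \<times> ball s0 t0"
    using S \<rho> by (auto simp: q0_def s0_def open_Times mem_Times_iff)
  moreover have "dist (r (\<phi> (snd y) (fst y))) (r (\<phi> (snd z) (fst z))) < e" if "y \<in> S \<times> ball s0 t0" "y \<in> M \<times> UNIV" for y
    using near[of "fst y" "snd y"] that by (auto simp: p0_def q0_def s0_def dist_real_def abs_minus_commute mem_Times_iff)
  ultimately show "\<forall>\<^sub>F y in at z within M \<times> UNIV. dist (r (\<phi> (snd y) (fst y))) (r (\<phi> (snd z) (fst z))) < e"
    unfolding eventually_at_topological by blast
qed

lemma r_flow_isCont: assumes "p \<in> M" shows "isCont (\<lambda>t. r (\<phi> t p)) t"
proof -
  have "continuous_on UNIV (\<lambda>t. r (\<phi> (snd (p, t)) (fst (p, t))))"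
    by (rule continuous_on_compose2[OF r_flow_continuous]) (use assms in \<open>auto intro!: continuous_intros\<close>)
  then show ?thesis by (simp add: continuous_on_eq_continuous_at)
qed

text \<open>
  The integral of \<open>r\<close> along the orbit of \<open>p\<close> from time 0 to \<open>t\<close>, taken as an antiderivative in order to include
  negative times.
\<close>

definition log_expansion :: "real \<Rightarrow> 'a \<Rightarrow> real" where
  "log_expansion t p = (SOME G. G 0 = 0 \<and> (\<forall>t. (G has_real_derivative r (\<phi> t p)) (at t))) t"

lemma log_expansion:
  assumes "p \<in> M"
  shows "log_expansion 0 p = 0" "((\<lambda>t. log_expansion t p) has_real_derivative r (\<phi> t p)) (at t)"
  using someI_ex[OF antiderivative_exists[OF r_flow_isCont[OF assms]]] by (auto simp: log_expansion_def)

lemma log_expansion_add: assumes p: "p \<in> M" shows "log_expansion (s + t) p = log_expansion s (\<phi> t p) + log_expansion t p"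
proof (rule equal_of_equal_derivatives[where d = "\<lambda>s. r (\<phi> (s + t) p)" and a = 0
      and f = "\<lambda>s. log_expansion (s + t) p" and g = "\<lambda>s. log_expansion s (\<phi> t p) + log_expansion t p"])
  show "((\<lambda>s. log_expansion (s + t) p) has_real_derivative r (\<phi> (s + t) p)) (at s)" for s
    using log_expansion(2)[OF p, of "s + t"] by (simp add: DERIV_shift)
  show "((\<lambda>s. log_expansion s (\<phi> t p) + log_expansion t p) has_real_derivative r (\<phi> (s + t) p)) (at s)" for s
    using DERIV_add[OF log_expansion(2)[of "\<phi> t p" s] DERIV_const] flow_M p flow_add[OF gen p] by simp
qed (use log_expansion(1) p flow_M in simp)

lemma push_flow_add:
  assumes "p \<in> M" "v \<in> tangent_space A p"
  shows "push A A (\<phi> (s + t)) p v = push A A (\<phi> s) (\<phi> t p) (push A A (\<phi> t) p v)"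
  using assms flow_M flow_add[OF gen] by (intro push_compose flow_differentiable) auto

lemma push_flow_0: "p \<in> M \<Longrightarrow> v \<in> tangent_space A p \<Longrightarrow> push A A (\<phi> 0) p v = v"
  using flow_0[OF gen] by (intro push_ident flow_differentiable) auto

lemma push_flow_tangent: "p \<in> M \<Longrightarrow> push A A (\<phi> t) p v \<in> tangent_space A (\<phi> t p)"
  using push_tangent[of p "\<phi> t"] flow_M by blast

text \<open>
  By the group property of the flow, the Lie derivative at time 0 gives a linear differential equation for the
  pulled back form at all times.
\<close>

lemma form_along_flow:
  assumes Lie: "has_Lie_derivative M A \<phi> \<alpha> (\<lambda>p v. \<sigma> * r p * \<alpha> p v)" and p: "p \<in> M" and v: "v \<in> tangent_space A p"
  shows "\<alpha> (\<phi> t p) (push A A (\<phi> t) p v) = exp (\<sigma> * log_expansion t p) * \<alpha> p v"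
proof -
  define y where "y = (\<lambda>t. \<alpha> (\<phi> t p) (push A A (\<phi> t) p v))"
  have y': "(y has_real_derivative \<sigma> * r (\<phi> t p) * y t) (at t)" for t
  proof -
    have "((\<lambda>h. \<alpha> (\<phi> h (\<phi> t p)) (push A A (\<phi> h) (\<phi> t p) (push A A (\<phi> t) p v))) has_real_derivative
        \<sigma> * r (\<phi> t p) * y t) (at 0)"
      using Lie push_flow_tangent[OF p] flow_M p unfolding has_Lie_derivative_def y_def by blast
    then have "((\<lambda>h. y (h + t)) has_real_derivative \<sigma> * r (\<phi> t p) * y t) (at 0)"
      by (simp add: y_def push_flow_add[OF p v] flow_add[OF gen p])
    then show ?thesis using DERIV_shift[of y _ 0 t] by simp
  qed
  have "((\<lambda>t. y t * exp (- \<sigma> * log_expansion t p)) has_real_derivative 0) (at t)" for t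
    by (auto intro!: derivative_eq_intros y' log_expansion(2)[OF p])
  then have "y t * exp (- \<sigma> * log_expansion t p) = y 0 * exp (- \<sigma> * log_expansion 0 p)"
    using DERIV_isconst_all[of "\<lambda>t. y t * exp (- \<sigma> * log_expansion t p)"] by blast
  also have "\<dots> = \<alpha> p v" using flow_0[OF gen p] push_flow_0[OF p v] log_expansion(1)[OF p] by (simp add: y_def)
  finally show ?thesis by (simp add: y_def exp_minus field_simps)
qed

lemma conformal:
  assumes "p \<in> M" "v \<in> tangent_space A p"
  shows "\<alpha>u (\<phi> t p) (push A A (\<phi> t) p v) = exp (log_expansion t p) * \<alpha>u p v"
    and "\<alpha>s (\<phi> t p) (push A A (\<phi> t) p v) = exp (- log_expansion t p) * \<alpha>s p v"
  using form_along_flow[of \<alpha>u 1] form_along_flow[of \<alpha>s "-1"] Lie_u Lie_s assms by auto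

text \<open>
  Differentiating \<open>\<phi>\<^sup>t(\<phi>\<^sup>s(p)) = \<phi>\<^sup>s\<^sup>+\<^sup>t(p)\<close> with respect to \<open>s\<close> at 0.
\<close>

lemma push_flow_X: assumes p: "p \<in> M" shows "push A A (\<phi> t) p (X p) = X (\<phi> t p)"
proof -
  have q: "\<phi> t p \<in> M" using flow_M p by blast
  obtain c d where c: "c \<in> A" "p \<in> cdom c" and d: "d \<in> A" "\<phi> t p \<in> cdom d"
    using chart_exists p q by meson
  let ?D = "frechet_derivative (cmap d \<circ> \<phi> t \<circ> cinv c) (at (cmap c p))"
  note D = local_rep_differentiable(2)[OF flow_differentiable[OF p] flow_M c(1) d(1) c(2) d(2)]
  have 1: "push A A (\<phi> t) p (X p) d = ?D (X p c)"
    by (rule push_component[OF flow_differentiable[OF p] flow_M c d X_tangent[OF p] D])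
  have "((\<lambda>s. cmap c (\<phi> s p)) has_vector_derivative X p c) (at 0)"
    using flow_deriv[OF gen p c(1), of 0] flow_0[OF gen p] c(2) by simp
  from vector_derivative_diff_chain_within[OF this, of "cmap d \<circ> \<phi> t \<circ> cinv c" ?D] D
  have L: "((\<lambda>s. (cmap d \<circ> \<phi> t \<circ> cinv c) (cmap c (\<phi> s p))) has_vector_derivative ?D (X p c)) (at 0)"
    using flow_0[OF gen p] by (simp add: o_def has_derivative_at_withinI)
  have R: "((\<lambda>s. cmap d (\<phi> (s + t) p)) has_vector_derivative X (\<phi> t p) d) (at 0)"
  proof -
    have sh: "((\<lambda>s. s + t) has_vector_derivative 1) (at 0)" by (auto intro!: derivative_eq_intros)
    have "((\<lambda>s. cmap d (\<phi> s p)) has_vector_derivative X (\<phi> t p) d) (at (0 + t)) \<Longrightarrow> ?thesis"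
      using vector_diff_chain_at[OF sh, of "\<lambda>s. cmap d (\<phi> s p)"] by (simp add: o_def)
    then show ?thesis using flow_deriv[OF gen p d] by simp
  qed
  have "\<forall>\<^sub>F s in nhds 0. \<phi> s p \<in> cdom c"
  proof -
    obtain T where T: "open T" "cdom c = M \<inter> T" using cdom_openin[OF c(1)] unfolding openin_open by blast
    have "((\<lambda>s. \<phi> s p) \<longlongrightarrow> \<phi> 0 p) (nhds 0)" using flow_isCont[OF gen p, of 0] by (simp add: isCont_def tendsto_nhds_iff)
    then have "\<forall>\<^sub>F s in nhds 0. \<phi> s p \<in> T"
      by (rule topological_tendstoD[OF _ T(1)]) (use flow_0[OF gen p] c T in auto)
    then show ?thesis by eventually_elim (use T flow_in_M[OF gen p] in blast)
  qed
  then have "\<forall>\<^sub>F s in nhds 0. (cmap d \<circ> \<phi> t \<circ> cinv c) (cmap c (\<phi> s p)) = cmap d (\<phi> (s + t) p)"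
  proof eventually_elim
    case (elim s)
    then show ?case using cinv_cmap[OF c(1) elim] flow_add[OF gen p, of t s] by (simp add: add.commute)
  qed
  from has_derivative_transform_nhds[OF L[unfolded has_vector_derivative_def] this]
  have "((\<lambda>s. cmap d (\<phi> (s + t) p)) has_vector_derivative ?D (X p c)) (at 0)" unfolding has_vector_derivative_def .
  then have "?D (X p c) = X (\<phi> t p) d" using R vector_derivative_unique_at by blast
  then show ?thesis
    using 1 tangent_eqI[OF push_flow_tangent[OF p] X_tangent[OF q] d] by simp
qed

lemma log_expansion_continuous: "continuous_on M (log_expansion T)"
proof -
  have pos: "continuous_on M (log_expansion T)" if T: "T \<ge> 0" for T
  proof -
    have "continuous_on (M \<times> cbox 0 T) (\<lambda>(p, t). r (\<phi> t p))"
      using continuous_on_subset[OF r_flow_continuous, of "M \<times> cbox 0 T"] by (auto simp: split_beta)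
    from integral_continuous_on_param[OF this]
    have "continuous_on M (\<lambda>p. integral {0..T} (\<lambda>t. r (\<phi> t p)))" by simp
    moreover have "log_expansion T p = integral {0..T} (\<lambda>t. r (\<phi> t p))" if "p \<in> M" for p
    proof -
      have "((\<lambda>t. r (\<phi> t p)) has_integral log_expansion T p - log_expansion 0 p) {0..T}"
        using log_expansion(2)[OF that] T by (intro fundamental_theorem_of_calculus)
          (auto simp: has_real_derivative_iff_has_vector_derivative intro: has_vector_derivative_at_within)
      from integral_unique[OF this] show ?thesis using log_expansion(1)[OF that] by simp
    qed
    ultimately show ?thesis by (simp cong: continuous_on_cong)
  qed
  show ?thesis
  proof (cases "T \<ge> 0")
    case False
    have "continuous_on M (\<lambda>p. - log_expansion (- T) (\<phi> T p))"
      by (intro continuous_on_minus continuous_on_compose2[OF pos flow_continuous]) (use False flow_M in auto)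
    moreover have "log_expansion T p = - log_expansion (- T) (\<phi> T p)" if "p \<in> M" for p
      using log_expansion_add[OF that, of "-T" T] log_expansion(1)[OF that] by simp
    ultimately show ?thesis by (simp cong: continuous_on_cong)
  qed (rule pos)
qed

lemma log_expansion_strict_mono: assumes "p \<in> M" "s < t" shows "log_expansion s p < log_expansion t p"
  by (rule DERIV_pos_imp_increasing[OF assms(2)]) (use log_expansion(2)[OF assms(1)] r_pos flow_M assms(1) in blast)

lemma log_expansion_inj: "p \<in> M \<Longrightarrow> log_expansion s p = log_expansion t p \<Longrightarrow> s = t"
  using log_expansion_strict_mono[of p s t] log_expansion_strict_mono[of p t s] by (cases s t rule: linorder_cases) auto

lemma log_expansion_surj: assumes p: "p \<in> M" shows "\<exists>t. log_expansion t p = y"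
proof -
  obtain m where m: "m > 0" "\<And>q. q \<in> M \<Longrightarrow> m \<le> r q" using r_bounded_below p by blast
  have inc: "m * (t - s) \<le> log_expansion t p - log_expansion s p" if "s \<le> t" for s t
  proof -
    have "log_expansion s p - m * s \<le> log_expansion t p - m * t"
    proof (rule DERIV_nonneg_imp_nondecreasing[OF that])
      fix x
      have "((\<lambda>x. log_expansion x p - m * x) has_real_derivative r (\<phi> x p) - m) (at x)"
        by (auto intro!: derivative_eq_intros log_expansion(2)[OF p])
      then show "\<exists>y. ((\<lambda>x. log_expansion x p - m * x) has_real_derivative y) (at x) \<and> 0 \<le> y"
        using m(2) flow_M p by (meson diff_ge_0_iff_ge)
    qed
    then show ?thesis by (simp add: algebra_simps)
  qed
  define T where "T = \<bar>y\<bar> / m"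
  have T: "T \<ge> 0" "m * T = \<bar>y\<bar>" using m by (auto simp: T_def)
  have "log_expansion T p \<ge> \<bar>y\<bar>" "log_expansion (- T) p \<le> - \<bar>y\<bar>"
    using inc[of 0 T] inc[of "-T" 0] T log_expansion(1)[OF p] by auto
  then have "log_expansion (- T) p \<le> y" "y \<le> log_expansion T p" by auto
  moreover have "\<forall>t. - T \<le> t \<and> t \<le> T \<longrightarrow> isCont (\<lambda>t. log_expansion t p) t" using log_expansion(2)[OF p] DERIV_isCont by blast
  ultimately show ?thesis using IVT[of "\<lambda>t. log_expansion t p" "-T" y T] T by auto
qed

section \<open>Continuity of the differential of the flow\<close>

lemma X_component_nonzero: assumes "p \<in> M" "c \<in> A" "p \<in> cdom c" shows "X p c \<noteq> 0"
proof
  assume "X p c = 0"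
  then have "X p = tzero"
    using tangent_eqI[OF X_tangent[OF assms(1)] tzero_tangent assms(2,3)] by (simp add: tzero_def)
  then show False using X0 assms(1) unfolding nonvanishing_def by blast
qed

lemma flow_rep_has_derivative:
  assumes "c \<in> A" "p \<in> cdom c" "d \<in> A" "\<phi> T p \<in> cdom d"
  shows "(cmap d \<circ> \<phi> T \<circ> cinv c has_derivative frechet_derivative (cmap d \<circ> \<phi> T \<circ> cinv c) (at (cmap c p))) (at (cmap c p))"
proof -
  have "p \<in> M" using assms cdom_subset by blast
  from local_rep_differentiable(2)[OF flow_differentiable[OF this] flow_M assms(1,3,2,4)] show ?thesis .
qed

text \<open>
  The differential maps \<open>e\<close> to a multiple of \<open>e'\<close>, and applying \<open>\<alpha>\<close> to both sides determines the factor.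
\<close>

lemma bundle_component:
  assumes E: "continuous_line_bundle M A E" and inv: "preserves_bundle M A \<phi> E"
    and p: "p \<in> M" and c: "c \<in> A" "p \<in> cdom c" and d: "d \<in> A" "\<phi> T p \<in> cdom d"
    and e: "e \<in> E p" "e \<in> tangent_space A p" and e': "E (\<phi> T p) = range (\<lambda>a. tscale a e')"
    and \<alpha>: "one_form M A \<alpha>" "\<alpha> (\<phi> T p) (push A A (\<phi> T) p e) = k * \<alpha> p e"
    and e't: "e' \<in> tangent_space A (\<phi> T p)" "\<alpha> (\<phi> T p) e' \<noteq> 0"
  shows "frechet_derivative (cmap d \<circ> \<phi> T \<circ> cinv c) (at (cmap c p)) (e c)
     = (k * (covec \<alpha> c (cmap c p) \<bullet> e c) / (covec \<alpha> d (cmap d (\<phi> T p)) \<bullet> e' d)) *\<^sub>R e' d"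
proof -
  have "push A A (\<phi> T) p e \<in> E (\<phi> T p)"
    using inv p e(1) unfolding preserves_bundle_def by blast
  then obtain l where l: "push A A (\<phi> T) p e = tscale l e'" using e' by blast
  then have ld: "push A A (\<phi> T) p e d = l *\<^sub>R e' d" by (simp add: tscale_def)
  have D: "push A A (\<phi> T) p e d = frechet_derivative (cmap d \<circ> \<phi> T \<circ> cinv c) (at (cmap c p)) (e c)"
    by (rule push_component[OF flow_differentiable[OF p] flow_M c d e(2) flow_rep_has_derivative[OF c d]])
  have "covec \<alpha> d (cmap d (\<phi> T p)) \<bullet> (l *\<^sub>R e' d) = k * (covec \<alpha> c (cmap c p) \<bullet> e c)"
    using \<alpha>(2) form_eq_covec[OF \<alpha>(1) d push_flow_tangent[OF p]] form_eq_covec[OF \<alpha>(1) c e(2)] ld by simp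
  moreover have "covec \<alpha> d (cmap d (\<phi> T p)) \<bullet> e' d \<noteq> 0" using e't form_eq_covec[OF \<alpha>(1) d e't(1)] by simp
  ultimately have "l = k * (covec \<alpha> c (cmap c p) \<bullet> e c) / (covec \<alpha> d (cmap d (\<phi> T p)) \<bullet> e' d)"
    by (simp add: field_simps)
  then show ?thesis using D ld by simp
qed

lemma section_isCont:
  assumes c: "c \<in> A" "p \<in> cdom c" and U: "openin (top_of_set M) U" "p \<in> U"
    and e: "\<And>c. c \<in> A \<Longrightarrow> continuous_on (cmap c ` (cdom c \<inter> U)) (\<lambda>x. e (cinv c x) c)"
  shows "isCont (\<lambda>x. e (cinv c x) c) (cmap c p)"
  using e[OF c(1)] continuous_on_eq_continuous_at[OF open_chart_image[OF c(1) U(1)]] c U by blast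

text \<open>
  The flow is only known to be differentiable at each point.  But local sections of \<open>E\<^sup>s\<^sup>s\<close> and \<open>E\<^sup>u\<^sup>u\<close> together with \<open>X\<close> form
  continuous frames, and the differential maps the frame at \<open>p\<close> to multiples of the frame at \<open>\<phi>\<^sup>T(p)\<close>.  The
  factors are expressed by \<open>\<alpha>\<^sub>u\<close>, \<open>\<alpha>\<^sub>s\<close> and the conformal factors, all of which are continuous.
\<close>

lemma flow_derivative_isCont:
  assumes c: "c \<in> A" "p1 \<in> cdom c" and d: "d \<in> A" "\<phi> T p1 \<in> cdom d"
  shows "isCont (\<lambda>x. frechet_derivative (cmap d \<circ> \<phi> T \<circ> cinv c) (at x) h) (cmap c p1)"
proof -
  define F where "F = cmap d \<circ> \<phi> T \<circ> cinv c"
  define x1 where "x1 = cmap c p1"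
  define q1 where "q1 = \<phi> T p1"
  have M1: "p1 \<in> M" using c cdom_subset by blast
  have M: "p1 \<in> M" "q1 \<in> M" using M1 flow_M by (auto simp: q1_def)
  have qd: "q1 \<in> cdom d" using d by (simp add: q1_def)
  obtain U1 es where U1: "openin (top_of_set M) U1" "p1 \<in> U1" and es: "\<And>q. q \<in> U1 \<Longrightarrow> es q \<in> tangent_space A q"
    "\<And>q. q \<in> U1 \<Longrightarrow> es q \<noteq> tzero" "\<And>q. q \<in> U1 \<Longrightarrow> Ess q = range (\<lambda>a. tscale a (es q))"
    "\<And>c. c \<in> A \<Longrightarrow> continuous_on (cmap c ` (cdom c \<inter> U1)) (\<lambda>x. es (cinv c x) c)"
    by (rule line_bundle_section[OF bundles(1) M(1)], rule that) assumption+
  obtain U2 eu where U2: "openin (top_of_set M) U2" "p1 \<in> U2" and eu: "\<And>q. q \<in> U2 \<Longrightarrow> eu q \<in> tangent_space A q"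
    "\<And>q. q \<in> U2 \<Longrightarrow> eu q \<noteq> tzero" "\<And>q. q \<in> U2 \<Longrightarrow> Euu q = range (\<lambda>a. tscale a (eu q))"
    "\<And>c. c \<in> A \<Longrightarrow> continuous_on (cmap c ` (cdom c \<inter> U2)) (\<lambda>x. eu (cinv c x) c)"
    by (rule line_bundle_section[OF bundles(2) M(1)], rule that) assumption+
  obtain V1 es' where V1: "openin (top_of_set M) V1" "q1 \<in> V1" and es': "\<And>q. q \<in> V1 \<Longrightarrow> es' q \<in> tangent_space A q"
    "\<And>q. q \<in> V1 \<Longrightarrow> es' q \<noteq> tzero" "\<And>q. q \<in> V1 \<Longrightarrow> Ess q = range (\<lambda>a. tscale a (es' q))"
    "\<And>c. c \<in> A \<Longrightarrow> continuous_on (cmap c ` (cdom c \<inter> V1)) (\<lambda>x. es' (cinv c x) c)"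
    by (rule line_bundle_section[OF bundles(1) M(2)], rule that) assumption+
  obtain V2 eu' where V2: "openin (top_of_set M) V2" "q1 \<in> V2" and eu': "\<And>q. q \<in> V2 \<Longrightarrow> eu' q \<in> tangent_space A q"
    "\<And>q. q \<in> V2 \<Longrightarrow> eu' q \<noteq> tzero" "\<And>q. q \<in> V2 \<Longrightarrow> Euu q = range (\<lambda>a. tscale a (eu' q))"
    "\<And>c. c \<in> A \<Longrightarrow> continuous_on (cmap c ` (cdom c \<inter> V2)) (\<lambda>x. eu' (cinv c x) c)"
    by (rule line_bundle_section[OF bundles(2) M(2)], rule that) assumption+
  have self: "v \<in> range (\<lambda>a. tscale a v)" for v :: "('a, 3) tvec"
    by (rule image_eqI[of _ _ 1]) (simp_all add: tscale_def)
  have in_E: "es q \<in> Ess q" if "q \<in> U1" for q using self[of "es q"] es(3)[OF that] by simp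
  have in_E2: "eu q \<in> Euu q" if "q \<in> U2" for q using self[of "eu q"] eu(3)[OF that] by simp
  have in_E3: "es' q \<in> Ess q" if "q \<in> V1" for q using self[of "es' q"] es'(3)[OF that] by simp
  have in_E4: "eu' q \<in> Euu q" if "q \<in> V2" for q using self[of "eu' q"] eu'(3)[OF that] by simp
  have inv: "preserves_bundle M A \<phi> Ess" "preserves_bundle M A \<phi> Euu"
    using splitting unfolding Anosov_splitting_def by blast+
  define au as bu bs where "au = covec \<alpha>u c" "as = covec \<alpha>s c" "bu = covec \<alpha>u d" "bs = covec \<alpha>s d"
  define ES where "ES = (\<lambda>x. es (cinv c x) c)"
  define EU where "EU = (\<lambda>x. eu (cinv c x) c)"
  define XX where "XX = (\<lambda>x. X (cinv c x) c)"
  define ES' where "ES' = (\<lambda>y. es' (cinv d y) d)"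
  define EU' where "EU' = (\<lambda>y. eu' (cinv d y) d)"
  define XX' where "XX' = (\<lambda>y. X (cinv d y) d)"
  define lf where "lf = (\<lambda>x. log_expansion T (cinv c x))"
  \<comment> \<open>\<open>h = a ES + b EU + k XX\<close>; the coefficients \<open>a\<close> and \<open>b\<close> are read off by \<open>\<alpha>\<^sub>s\<close> and \<open>\<alpha>\<^sub>u\<close>, and the remainder \<open>Z\<close>
    is a multiple of \<open>XX\<close>.  The differential multiplies the first two vectors by \<open>la\<close> and \<open>mu\<close>.\<close>
  define a where "a = (\<lambda>x. (as x \<bullet> h) / (as x \<bullet> ES x))"
  define b where "b = (\<lambda>x. (au x \<bullet> h) / (au x \<bullet> EU x))"
  define Z where "Z = (\<lambda>x. h - a x *\<^sub>R ES x - b x *\<^sub>R EU x)"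
  define k where "k = (\<lambda>x. (Z x \<bullet> XX x) / (XX x \<bullet> XX x))"
  define la where "la = (\<lambda>x. exp (- lf x) * (as x \<bullet> ES x) / (bs (F x) \<bullet> ES' (F x)))"
  define mu where "mu = (\<lambda>x. exp (lf x) * (au x \<bullet> EU x) / (bu (F x) \<bullet> EU' (F x)))"
  define G where "G = (\<lambda>x. a x *\<^sub>R la x *\<^sub>R ES' (F x) + b x *\<^sub>R mu x *\<^sub>R EU' (F x) + k x *\<^sub>R XX' (F x))"
  have x1: "x1 \<in> cimg c" "cinv c x1 = p1" "F x1 = cmap d q1" using c by (auto simp: x1_def F_def q1_def)
  have nz: "as x \<bullet> ES x \<noteq> 0" "au x \<bullet> ES x = 0" "au x \<bullet> EU x \<noteq> 0" "as x \<bullet> EU x = 0"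
    if "x \<in> cimg c" "cinv c x \<in> U1" "cinv c x \<in> U2" for x
  proof -
    have p: "cinv c x \<in> cdom c" "cinv c x \<in> M" using cinv_in[OF c(1) that(1)] cdom_subset[OF c(1)] by auto
    note s = bundle_sections_transverse(1)[OF p(2) es(1,2)[OF that(2)] in_E[OF that(2)]]
      bundle_sections_transverse(2)[OF p(2) eu(1,2)[OF that(3)] in_E2[OF that(3)]]
    show "as x \<bullet> ES x \<noteq> 0" "au x \<bullet> ES x = 0" "au x \<bullet> EU x \<noteq> 0" "as x \<bullet> EU x = 0"
      using s form_eq_covec[OF one_form_\<alpha>u c(1) p(1) es(1)[OF that(2)]] form_eq_covec[OF one_form_\<alpha>s c(1) p(1) es(1)[OF that(2)]]
        form_eq_covec[OF one_form_\<alpha>u c(1) p(1) eu(1)[OF that(3)]] form_eq_covec[OF one_form_\<alpha>s c(1) p(1) eu(1)[OF that(3)]] that(1)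
      by (auto simp: au_as_bu_bs_def ES_def EU_def)
  qed
  have nz': "\<alpha>s q (es' q) \<noteq> 0" "\<alpha>u q (eu' q) \<noteq> 0" if "q \<in> M" "q \<in> V1" "q \<in> V2" for q
    using bundle_sections_transverse(1)[OF that(1) es'(1,2)[OF that(2)] in_E3[OF that(2)]]
      bundle_sections_transverse(2)[OF that(1) eu'(1,2)[OF that(3)] in_E4[OF that(3)]] by auto
  have FD: "(F has_derivative frechet_derivative F (at x1)) (at x1)"
    using flow_rep_has_derivative[OF c d] by (simp add: F_def x1_def)
  have cF: "isCont F x1" using has_derivative_continuous[OF FD] .
  have cov: "isCont (covec \<alpha> c') (cmap c' p)" if "Ck_one_form 1 M A \<alpha>" "c' \<in> A" "p \<in> cdom c'" for \<alpha> c' p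
    using covec_has_derivative(3)[OF that(1,2)] continuous_on_eq_continuous_at[OF open_cimg[OF that(2)]] that(3) by blast
  have c1: "isCont au x1" "isCont as x1" using cov[OF \<alpha>u c] cov[OF \<alpha>s c] by (auto simp: au_as_bu_bs_def x1_def)
  have c2: "isCont (\<lambda>x. bu (F x)) x1" "isCont (\<lambda>x. bs (F x)) x1"
    using isCont_o2[OF cF, of bu] isCont_o2[OF cF, of bs] cov[OF \<alpha>u d(1) qd] cov[OF \<alpha>s d(1) qd] x1 by (auto simp: au_as_bu_bs_def)
  have c3: "isCont ES x1" "isCont EU x1" "isCont XX x1"
    using section_isCont[OF c U1 es(4)] section_isCont[OF c U2 eu(4)] vector_field_isCont[OF X c]
    by (auto simp: ES_def EU_def XX_def x1_def)
  have c4: "isCont (\<lambda>x. ES' (F x)) x1" "isCont (\<lambda>x. EU' (F x)) x1" "isCont (\<lambda>x. XX' (F x)) x1"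
    using isCont_o2[OF cF, of ES'] isCont_o2[OF cF, of EU'] isCont_o2[OF cF, of XX']
      section_isCont[OF d(1) qd V1 es'(4)] section_isCont[OF d(1) qd V2 eu'(4)] vector_field_isCont[OF X d(1) qd] x1
    by (auto simp: ES'_def EU'_def XX'_def)
  have c5: "isCont lf x1"
  proof -
    have "continuous_on (cimg c) (cinv c)" using chart_homeomorphism[OF c(1)] unfolding homeomorphism_def by blast
    from continuous_on_compose2[OF log_expansion_continuous this]
    have "continuous_on (cimg c) lf" using cinv_in[OF c(1)] cdom_subset[OF c(1)] by (auto simp: lf_def)
    then show ?thesis using continuous_on_eq_continuous_at[OF open_cimg[OF c(1)]] x1 by blast
  qed
  have nz1: "as x1 \<bullet> ES x1 \<noteq> 0" "au x1 \<bullet> EU x1 \<noteq> 0" using nz[of x1] x1 U1 U2 by auto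
  have nz2: "bs (F x1) \<bullet> ES' (F x1) \<noteq> 0" "bu (F x1) \<bullet> EU' (F x1) \<noteq> 0"
    using nz'[OF M(2) V1(2) V2(2)] form_eq_covec[OF one_form_\<alpha>s d(1) qd es'(1)[OF V1(2)]] form_eq_covec[OF one_form_\<alpha>u d(1) qd eu'(1)[OF V2(2)]] x1
      cinv_cmap[OF d(1) qd] by (auto simp: au_as_bu_bs_def ES'_def EU'_def)
  have nz3: "XX x1 \<bullet> XX x1 \<noteq> 0" using X_component_nonzero[OF M(1) c] x1 by (simp add: XX_def)
  have ca: "isCont a x1" "isCont b x1" unfolding a_def b_def by (intro continuous_intros c1 c3 nz1)+
  have cZ: "isCont Z x1" unfolding Z_def by (intro continuous_intros ca c3)
  have "isCont G x1"
    unfolding G_def la_def mu_def k_def by (intro continuous_intros ca cZ c1 c2 c3 c4 c5 nz2 nz3)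
  moreover have "\<forall>\<^sub>F x in nhds x1. frechet_derivative F (at x) h = G x"
  proof -
    have Ft: "filterlim F (nhds (cmap d q1)) (nhds x1)" using cF x1 by (simp add: isCont_def tendsto_nhds_iff)
    have e0: "\<forall>\<^sub>F x in nhds x1. x \<in> cimg c \<and> \<phi> T (cinv c x) \<in> cdom d"
      unfolding x1_def by (rule eventually_map_in_chart[OF _ flow_M c(1) d(1) c(2) d(2)])
        (use flow_differentiable[OF M(1)] in \<open>auto simp: mfd_differentiable_def\<close>)
    have e1: "\<forall>\<^sub>F x in nhds x1. x \<in> cimg c \<and> cinv c x \<in> U1" "\<forall>\<^sub>F x in nhds x1. x \<in> cimg c \<and> cinv c x \<in> U2"
      unfolding x1_def by (rule eventually_in_cimg[OF c U1]) (rule eventually_in_cimg[OF c U2])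
    have e2: "\<forall>\<^sub>F x in nhds x1. F x \<in> cimg d \<and> cinv d (F x) \<in> V1" "\<forall>\<^sub>F x in nhds x1. F x \<in> cimg d \<and> cinv d (F x) \<in> V2"
      using eventually_compose_filterlim[OF eventually_in_cimg[OF d(1) qd V1] Ft]
        eventually_compose_filterlim[OF eventually_in_cimg[OF d(1) qd V2] Ft] .
    from e0 e1 e2 show ?thesis
    proof eventually_elim
      case (elim x)
      define p where "p = cinv c x"
      have p: "p \<in> cdom c" "cmap c p = x" "p \<in> M" using elim cinv_in[OF c(1)] cdom_subset[OF c(1)] by (auto simp: p_def)
      have q: "\<phi> T p \<in> cdom d" "\<phi> T p \<in> M" "cinv d (F x) = \<phi> T p" "F x = cmap d (\<phi> T p)"
        using elim flow_M p cinv_cmap[OF d(1)] by (auto simp: p_def F_def)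
      have V: "\<phi> T p \<in> V1" "\<phi> T p \<in> V2" and U: "p \<in> U1" "p \<in> U2" using elim q by (auto simp: p_def)
      note n = nz[of x] nz'[OF q(2) V]
      let ?D = "frechet_derivative F (at x)"
      have lin: "linear ?D"
        using has_derivative_linear[OF flow_rep_has_derivative[OF c(1) p(1) d(1) q(1)]] p(2) by (simp add: F_def)
      have D1: "?D (ES x) = la x *\<^sub>R ES' (F x)"
        using bundle_component[OF bundles(1) inv(1) p(3) c(1) p(1) d(1) q(1) in_E[OF U(1)] es(1)[OF U(1)] es'(3)[OF V(1)]
          one_form_\<alpha>s conformal(2)[OF p(3) es(1)[OF U(1)]] es'(1)[OF V(1)] n(5)] p q(3)
        by (simp add: ES_def ES'_def la_def lf_def au_as_bu_bs_def F_def p_def)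
      have D2: "?D (EU x) = mu x *\<^sub>R EU' (F x)"
        using bundle_component[OF bundles(2) inv(2) p(3) c(1) p(1) d(1) q(1) in_E2[OF U(2)] eu(1)[OF U(2)] eu'(3)[OF V(2)]
          one_form_\<alpha>u conformal(1)[OF p(3) eu(1)[OF U(2)]] eu'(1)[OF V(2)] n(6)] p q(3)
        by (simp add: EU_def EU'_def mu_def lf_def au_as_bu_bs_def F_def p_def)
      have D3: "?D (XX x) = XX' (F x)"
        using push_component[OF flow_differentiable[OF p(3)] flow_M c(1) p(1) d(1) q(1) X_tangent[OF p(3)] flow_rep_has_derivative[OF c(1) p(1) d(1) q(1)]]
          push_flow_X[OF p(3)] p q(3) by (simp add: XX_def XX'_def F_def p_def)
      have "au x \<bullet> Z x = 0" "as x \<bullet> Z x = 0" using n elim by (auto simp: Z_def a_def b_def inner_diff_right)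
      then have Zk: "Z x = (\<beta>_chart c x (Z x) / r p) *\<^sub>R XX x"
        using structure_in_chart(10)[OF c(1), of x "Z x"] elim by (simp add: au_as_bu_bs_def XX_def p_def)
      have "XX x \<noteq> 0" using X_component_nonzero[OF p(3) c(1) p(1)] by (simp add: XX_def p_def)
      then have "k x = \<beta>_chart c x (Z x) / r p"
        unfolding k_def by (subst (1) Zk) simp
      then have "h = a x *\<^sub>R ES x + b x *\<^sub>R EU x + k x *\<^sub>R XX x" using Zk by (simp add: Z_def algebra_simps)
      then have "?D h = a x *\<^sub>R ?D (ES x) + b x *\<^sub>R ?D (EU x) + k x *\<^sub>R ?D (XX x)"
        by (metis linear_add[OF lin] linear_scale[OF lin])
      then show ?case by (simp add: D1 D2 D3 G_def)
    qed
  qed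
  ultimately have "isCont (\<lambda>x. frechet_derivative F (at x) h) x1"
    using isCont_cong[of "\<lambda>x. frechet_derivative F (at x) h" G x1] by simp
  then show ?thesis unfolding F_def x1_def .
qed

section \<open>The derivative of the expansion\<close>

lemma r_nonzero: "p \<in> M \<Longrightarrow> r p \<noteq> 0" using r_pos by force

text \<open>
  The factors by which \<open>\<phi>\<^sup>T\<close> multiplies \<open>\<alpha>\<^sub>u\<close> and \<open>\<alpha>\<^sub>s\<close> are inverse to each other, so
  \<open>conformal_factor_has_derivative\<close> applies to it in charts.  Near the point \<open>x0\<close> the forms are positive on fixed vectors.
\<close>

lemma log_expansion_has_derivative:
  assumes c: "c \<in> A" "p0 \<in> cdom c" and d: "d \<in> A" "\<phi> T p0 \<in> cdom d"
  defines "F \<equiv> cmap d \<circ> \<phi> T \<circ> cinv c" and "x0 \<equiv> cmap c p0"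
  shows "((\<lambda>x. log_expansion T (cinv c x)) has_derivative
     (\<lambda>h. \<beta>_chart d (F x0) (frechet_derivative F (at x0) h) - \<beta>_chart c x0 h)) (at x0)"
proof -
  \<comment> \<open>\<open>R\<^sub>- + R\<^sub>+\<close> and \<open>R\<^sub>- - R\<^sub>+\<close> are dual to \<open>\<alpha>\<^sub>u\<close> and \<open>\<alpha>\<^sub>s\<close>.\<close>
  define e where "e = (\<lambda>x. Rm (cinv c x) c + Rp (cinv c x) c)"
  define e' where "e' = (\<lambda>x. Rm (cinv c x) c - Rp (cinv c x) c)"
  have x0: "x0 \<in> cimg c" "cinv c x0 = p0" using c by (auto simp: x0_def)
  have M0: "p0 \<in> M" using c cdom_subset by blast
  have one: "covec \<alpha>u c x \<bullet> e x = 1" "covec \<alpha>s c x \<bullet> e x = 0" "covec \<alpha>s c x \<bullet> e' x = 1" if "x \<in> cimg c" for x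
    using structure_in_chart(3-6)[OF c(1) that] by (simp_all add: e_def e'_def inner_add_right inner_diff_right)
  have cov: "isCont (covec \<alpha> c) x0" if "Ck_one_form 1 M A \<alpha>" for \<alpha>
    using covec_has_derivative(3)[OF that c(1)] continuous_on_eq_continuous_at[OF open_cimg[OF c(1)]] x0(1) by blast
  have pos: "\<forall>\<^sub>F x in nhds x0. covec \<alpha> c x \<bullet> w > 0" if "Ck_one_form 1 M A \<alpha>" "covec \<alpha> c x0 \<bullet> w = 1" for \<alpha> w
  proof -
    have "((\<lambda>x. covec \<alpha> c x \<bullet> w) \<longlongrightarrow> covec \<alpha> c x0 \<bullet> w) (nhds x0)"
      using cov[OF that(1)] by (intro tendsto_intros) (simp add: isCont_def tendsto_nhds_iff)
    then show ?thesis by (rule order_tendstoD(1)) (simp add: that(2))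
  qed
  have "\<forall>\<^sub>F x in nhds x0. x \<in> cimg c \<and> \<phi> T (cinv c x) \<in> cdom d"
    unfolding x0_def by (rule eventually_map_in_chart[OF _ flow_M c(1) d(1) c(2) d(2)])
      (use flow_differentiable[OF M0] in \<open>auto simp: mfd_differentiable_def\<close>)
  from this pos[OF \<alpha>u one(1)[OF x0(1)]] pos[OF \<alpha>s one(3)[OF x0(1)]]
  have "\<forall>\<^sub>F x in nhds x0. x \<in> cimg c \<and> \<phi> T (cinv c x) \<in> cdom d \<and> covec \<alpha>u c x \<bullet> e x0 > 0 \<and> covec \<alpha>s c x \<bullet> e' x0 > 0"
    by eventually_elim blast
  then obtain U where U: "open U" "x0 \<in> U" "\<And>x. x \<in> U \<Longrightarrow> x \<in> cimg c \<and> \<phi> T (cinv c x) \<in> cdom d \<and> covec \<alpha>u c x \<bullet> e x0 > 0 \<and> covec \<alpha>s c x \<bullet> e' x0 > 0"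
    unfolding eventually_nhds by blast
  have Uc: "U \<subseteq> cimg c" using U(3) by blast
  have inM: "cinv c x \<in> cdom c" "cinv c x \<in> M" if "x \<in> U" for x
    using cinv_in[OF c(1)] cdom_subset[OF c(1)] U(3)[OF that] by auto
  have FD: "(F has_derivative frechet_derivative F (at x)) (at x)" if "x \<in> U" for x
    using flow_rep_has_derivative[OF c(1) inM(1)[OF that] d(1)] U(3)[OF that] by (simp add: F_def)
  have F'c: "continuous_on U (\<lambda>x. frechet_derivative F (at x) h)" for h
    unfolding continuous_on_eq_continuous_at[OF U(1)]
    using flow_derivative_isCont[OF c(1) inM(1) d(1)] U(3) by (auto simp: F_def)
  have Fx: "F x \<in> cimg d" "cinv d (F x) = \<phi> T (cinv c x)" if "x \<in> U" for x
    using U(3)[OF that] cinv_cmap[OF d(1)] by (auto simp: F_def)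
  have lc: "continuous_on U (\<lambda>x. log_expansion T (cinv c x))"
  proof -
    have "continuous_on (cimg c) (cinv c)" using chart_homeomorphism[OF c(1)] unfolding homeomorphism_def by blast
    then have "continuous_on U (cinv c)" using Uc continuous_on_subset by blast
    from continuous_on_compose2[OF log_expansion_continuous this] show ?thesis using inM by auto
  qed
  have pull: "covec \<alpha> d (F x) \<bullet> frechet_derivative F (at x) h = k * (covec \<alpha> c x \<bullet> h)"
    if \<alpha>: "one_form M A \<alpha>" and x: "x \<in> U"
      and k: "\<And>v. v \<in> tangent_space A (cinv c x) \<Longrightarrow> \<alpha> (\<phi> T (cinv c x)) (push A A (\<phi> T) (cinv c x) v) = k * \<alpha> (cinv c x) v" for \<alpha> x h k
  proof -
    define v where "v = coord_vec A (cinv c x) c h"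
    have v: "v \<in> tangent_space A (cinv c x)" "v c = h"
      using coord_vec_tangent[OF c(1) inM(1)[OF x]] coord_vec_apply[OF c(1) inM(1)[OF x]] by (auto simp: v_def)
    have xc: "cmap c (cinv c x) = x" "\<phi> T (cinv c x) \<in> cdom d" using U(3)[OF x] by auto
    have "push A A (\<phi> T) (cinv c x) v d = frechet_derivative F (at x) h"
      using push_component[OF flow_differentiable[OF inM(2)[OF x]] flow_M c(1) inM(1)[OF x] d(1) xc(2) v(1)
          flow_rep_has_derivative[OF c(1) inM(1)[OF x] d(1) xc(2)]] xc v(2) by (simp add: F_def)
    then show ?thesis
      using k[OF v(1)] form_eq_covec[OF \<alpha> d(1) xc(2) push_flow_tangent[OF inM(2)[OF x]]]
        form_eq_covec[OF \<alpha> c(1) inM(1)[OF x] v(1)] xc v(2) by (simp add: F_def)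
  qed
  have \<beta>lin: "linear (\<beta>_chart c' x)" if "c' \<in> A" "x \<in> cimg c'" for c' x using structure_in_chart(13)[OF that] .
  have \<beta>cont: "continuous_on (cimg c') (\<lambda>x. \<beta>_chart c' x h)" if "c' \<in> A" for c' h
    using \<beta>_chart_continuous[OF that continuous_on_const] .
  have inst: "conformal_pullback U (cimg d) F (\<lambda>x. frechet_derivative F (at x)) (covec \<alpha> c) (covec \<alpha> d) (dcovec \<alpha> c) (dcovec \<alpha> d)
      (\<lambda>x. \<sigma> * log_expansion T (cinv c x)) (\<lambda>x h. \<sigma> * \<beta>_chart c x h) (\<lambda>y h. \<sigma> * \<beta>_chart d y h)"
    if \<alpha>: "Ck_one_form 1 M A \<alpha>"
      and scaled: "\<And>p v. p \<in> M \<Longrightarrow> v \<in> tangent_space A p \<Longrightarrow> \<alpha> (\<phi> T p) (push A A (\<phi> T) p v) = exp (\<sigma> * log_expansion T p) * \<alpha> p v"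
      and struct: "\<And>c x u v. c \<in> A \<Longrightarrow> x \<in> cimg c \<Longrightarrow> dcovec \<alpha> c x u \<bullet> v - dcovec \<alpha> c x v \<bullet> u
        = \<sigma> * \<beta>_chart c x u * (covec \<alpha> c x \<bullet> v) - \<sigma> * \<beta>_chart c x v * (covec \<alpha> c x \<bullet> u)" for \<alpha> and \<sigma> :: real
  proof (rule conformal_pullback.intro)
    have \<alpha>1: "one_form M A \<alpha>" using \<alpha> unfolding Ck_one_form_def by blast
    have lin: "linear (\<lambda>h. \<sigma> * \<beta>_chart c' x h)" if "c' \<in> A" "x \<in> cimg c'" for c' x
      using linear_compose_scale_right[OF \<beta>lin[OF that], of \<sigma>] by simp
    show "open U" "F ` U \<subseteq> cimg d" using U(1) Fx by auto
    show "(F has_derivative frechet_derivative F (at x)) (at x)" if "x \<in> U" for x by (rule FD[OF that])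
    show "continuous_on U (\<lambda>x. frechet_derivative F (at x) h)" for h by (rule F'c)
    show "(covec \<alpha> c has_derivative dcovec \<alpha> c x) (at x)" if "x \<in> U" for x
      using covec_has_derivative(1)[OF \<alpha> c(1)] Uc that by blast
    show "continuous_on U (\<lambda>x. dcovec \<alpha> c x h)" for h
      using covec_has_derivative(2)[OF \<alpha> c(1)] Uc continuous_on_subset by blast
    show "(covec \<alpha> d has_derivative dcovec \<alpha> d y) (at y)" if "y \<in> cimg d" for y
      by (rule covec_has_derivative(1)[OF \<alpha> d(1) that])
    show "continuous_on (cimg d) (\<lambda>y. dcovec \<alpha> d y h)" for h by (rule covec_has_derivative(2)[OF \<alpha> d(1)])
    show "continuous_on U (\<lambda>x. \<sigma> * log_expansion T (cinv c x))" by (intro continuous_on_mult continuous_on_const lc)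
    show "covec \<alpha> d (F x) \<bullet> frechet_derivative F (at x) h = exp (\<sigma> * log_expansion T (cinv c x)) * (covec \<alpha> c x \<bullet> h)" if "x \<in> U" for x h
      by (rule pull[OF \<alpha>1 that scaled[OF inM(2)[OF that]]])
    show "dcovec \<alpha> c x u \<bullet> v - dcovec \<alpha> c x v \<bullet> u = \<sigma> * \<beta>_chart c x u * (covec \<alpha> c x \<bullet> v) - \<sigma> * \<beta>_chart c x v * (covec \<alpha> c x \<bullet> u)" if "x \<in> U" for x u v
      by (rule struct[OF c(1)]) (use Uc that in blast)
    show "dcovec \<alpha> d y u \<bullet> v - dcovec \<alpha> d y v \<bullet> u = \<sigma> * \<beta>_chart d y u * (covec \<alpha> d y \<bullet> v) - \<sigma> * \<beta>_chart d y v * (covec \<alpha> d y \<bullet> u)" if "y \<in> cimg d" for y u v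
      by (rule struct[OF d(1) that])
    show "linear (\<lambda>h. \<sigma> * \<beta>_chart c x h)" if "x \<in> U" for x by (rule lin[OF c(1)]) (use Uc that in blast)
    show "continuous_on U (\<lambda>x. \<sigma> * \<beta>_chart c x h)" for h
      by (intro continuous_on_mult continuous_on_const continuous_on_subset[OF \<beta>cont[OF c(1)] Uc])
    show "linear (\<lambda>h. \<sigma> * \<beta>_chart d y h)" if "y \<in> cimg d" for y by (rule lin[OF d(1) that])
    show "continuous_on (cimg d) (\<lambda>y. \<sigma> * \<beta>_chart d y h)" for h
      by (intro continuous_on_mult continuous_on_const \<beta>cont[OF d(1)])
  qed
  have u: "conformal_pullback U (cimg d) F (\<lambda>x. frechet_derivative F (at x)) (covec \<alpha>u c) (covec \<alpha>u d) (dcovec \<alpha>u c) (dcovec \<alpha>u d)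
      (\<lambda>x. log_expansion T (cinv c x)) (\<beta>_chart c) (\<beta>_chart d)"
    using inst[of \<alpha>u 1, OF \<alpha>u] conformal(1) structure_in_chart(11) by simp
  have s: "conformal_pullback U (cimg d) F (\<lambda>x. frechet_derivative F (at x)) (covec \<alpha>s c) (covec \<alpha>s d) (dcovec \<alpha>s c) (dcovec \<alpha>s d)
      (\<lambda>x. - log_expansion T (cinv c x)) (\<lambda>x h. - \<beta>_chart c x h) (\<lambda>y h. - \<beta>_chart d y h)"
    using inst[of \<alpha>s "-1", OF \<alpha>s] conformal(2) structure_in_chart(12) by simp
  have ec: "continuous_on U e"
    unfolding e_def using continuous_on_subset[OF _ Uc] Reeb_continuous[OF c(1)] by (intro continuous_on_add) blast+
  show ?thesis
    by (rule conformal_factor_has_derivative[OF u s _ _ ec _ _ U(2), where vu = "e x0" and vs = "e' x0"])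
      (use U(3) one Uc in auto)
qed

section \<open>The flow of the Liouville reparametrization\<close>

abbreviation XL :: "'a \<Rightarrow> ('a, 3) tvec" where "XL \<equiv> Liouville_reparametrization r X"

lemma XL_apply: "XL p c = (1 / r p) *\<^sub>R X p c"
  by (simp add: Liouville_reparametrization_def tscale_def)

lemma XL_tangent: "p \<in> M \<Longrightarrow> XL p \<in> tangent_space A p"
  unfolding Liouville_reparametrization_def by (intro tscale_tangent X_tangent)

lemma XL_isCont: assumes "c \<in> A" "p \<in> cdom c" shows "isCont (\<lambda>x. XL (cinv c x) c) (cmap c p)"
proof -
  have "isCont (\<lambda>x. r (cinv c x)) (cmap c p)"
    using r_continuous_chart[OF assms(1)] continuous_on_eq_continuous_at[OF open_cimg[OF assms(1)]] assms(2) by blast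
  moreover have "r (cinv c (cmap c p)) \<noteq> 0" 
    unfolding cinv_cmap[OF assms] using r_nonzero subsetD[OF cdom_subset[OF assms(1)] assms(2)] by blast
  ultimately show ?thesis unfolding XL_apply using vector_field_isCont[OF X assms] by (intro continuous_intros)
qed

text \<open>
  A change of time: the orbit of \<open>p\<close> under \<open>\<phi>\<close>, parametrized by \<open>f\<^sub>t(p)\<close> instead of \<open>t\<close>.
\<close>

lemma XL_flow_exists: "\<exists>\<psi>. generates_flow M A XL \<psi>"
proof -
  define \<tau> where "\<tau> = (\<lambda>t p. SOME s. log_expansion s p = t)"
  have \<tau>: "log_expansion (\<tau> t p) p = t" if "p \<in> M" for t p
    unfolding \<tau>_def by (rule someI_ex[OF log_expansion_surj[OF that]])
  have \<tau>': "\<tau> (log_expansion s p) p = s" if "p \<in> M" for s p using log_expansion_inj[OF that] \<tau>[OF that] by blast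
  define \<psi> where "\<psi> = (\<lambda>t p. \<phi> (\<tau> t p) p)"
  have "generates_flow M A XL \<psi>"
    unfolding generates_flow_def
  proof (intro conjI ballI allI impI)
    fix p assume p: "p \<in> M"
    show "\<psi> 0 p = p" using \<tau>'[OF p, of 0] log_expansion(1)[OF p] flow_0[OF gen p] by (simp add: \<psi>_def)
    show "\<psi> t p \<in> M" for t using flow_M p by (simp add: \<psi>_def)
    show "\<psi> (s + t) p = \<psi> s (\<psi> t p)" for s t
    proof -
      have q: "\<psi> t p \<in> M" using flow_M p by (simp add: \<psi>_def)
      have "log_expansion (\<tau> s (\<psi> t p) + \<tau> t p) p = s + t"
        using log_expansion_add[OF p, of "\<tau> s (\<psi> t p)" "\<tau> t p"] \<tau>[OF q] \<tau>[OF p] by (simp add: \<psi>_def)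
      then have "\<tau> (s + t) p = \<tau> s (\<psi> t p) + \<tau> t p" using \<tau>'[OF p] by metis
      then show ?thesis using flow_add[OF gen p] by (simp add: \<psi>_def)
    qed
    have c\<tau>: "isCont (\<lambda>t. \<tau> t p) t" for t
    proof -
      have "isCont (\<lambda>t. \<tau> t p) (log_expansion (\<tau> t p) p)"
        by (rule isCont_inverse_function[of 1, OF zero_less_one])
          (use \<tau>'[OF p] log_expansion(2)[OF p] DERIV_isCont in blast)+
      then show ?thesis using \<tau>[OF p] by simp
    qed
    have d\<tau>: "((\<lambda>t. \<tau> t p) has_real_derivative inverse (r (\<psi> t p))) (at t)" for t
    proof (rule DERIV_inverse_function[where f = "\<lambda>s. log_expansion s p" and a = "t - 1" and b = "t + 1"])
      show "((\<lambda>s. log_expansion s p) has_real_derivative r (\<psi> t p)) (at (\<tau> t p))" using log_expansion(2)[OF p] by (simp add: \<psi>_def)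
      show "r (\<psi> t p) \<noteq> 0" by (rule r_nonzero) (use flow_M p in \<open>simp add: \<psi>_def\<close>)
    qed (use \<tau>[OF p] c\<tau> in auto)
    show "isCont (\<lambda>s. \<psi> s p) t" for t
      unfolding \<psi>_def by (rule isCont_o2[OF c\<tau> flow_isCont[OF gen p]])
    fix t c assume c: "c \<in> A" "\<psi> t p \<in> cdom c"
    have "((\<lambda>s. cmap c (\<phi> s p)) has_vector_derivative X (\<psi> t p) c) (at (\<tau> t p))"
      using flow_deriv[OF gen p c(1), of "\<tau> t p"] c(2) by (simp add: \<psi>_def)
    from vector_diff_chain_at[OF d\<tau>[unfolded has_real_derivative_iff_has_vector_derivative] this]
    show "((\<lambda>s. cmap c (\<psi> s p)) has_vector_derivative XL (\<psi> t p) c) (at t)"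
      by (simp add: o_def \<psi>_def XL_apply inverse_eq_divide)
  qed
  then show ?thesis by blast
qed

text \<open>
  Uniqueness cannot be quoted for the flow of the continuous field \<open>X\<^sub>L\<close>.  Instead, for any flow \<open>\<psi>\<close> of \<open>X\<^sub>L\<close> let \<open>\<sigma>\<close> be the
  time that \<open>X\<close> takes along the orbit, so \<open>\<sigma>' = 1 / r\<close>.  Then \<open>\<phi>\<^sup>-\<^sup>\<sigma>\<^sup>(\<^sup>t\<^sup>)(\<psi>\<^sup>t(p))\<close> has derivative 0, because the
  maps \<open>\<phi>\<^sup>s\<close> are differentiable, and is constant.
\<close>

lemma XL_flow_eq:
  assumes \<psi>: "generates_flow M A XL \<psi>" and p: "p \<in> M"
  shows "\<psi> (log_expansion T p) p = \<phi> T p"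
proof -
  have \<psi>M: "\<psi> t p \<in> M" for t using flow_in_M[OF \<psi> p] .
  have rc: "isCont (\<lambda>t. 1 / r (\<psi> t p)) t" for t
  proof -
    have "continuous_on UNIV (\<lambda>t. \<psi> t p)" using flow_isCont[OF \<psi> p] by (simp add: continuous_at_imp_continuous_on)
    from continuous_on_compose2[OF r_continuous this]
    have "isCont (\<lambda>t. r (\<psi> t p)) t" using \<psi>M by (auto simp: continuous_on_eq_continuous_at)
    moreover have "r (\<psi> t p) \<noteq> 0" by (rule r_nonzero[OF \<psi>M])
    ultimately show ?thesis by (intro continuous_intros)
  qed
  obtain \<sigma> where \<sigma>: "\<sigma> 0 = 0" "\<And>t. (\<sigma> has_real_derivative 1 / r (\<psi> t p)) (at t)"
    using antiderivative_exists[of "\<lambda>t. 1 / r (\<psi> t p)", OF rc] by blast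
  define g where "g = (\<lambda>t. \<phi> (- \<sigma> t) (\<psi> t p))"
  have gM: "g t \<in> M" for t using \<psi>M flow_M by (simp add: g_def)
  \<comment> \<open>in every chart the curve \<open>g\<close> has velocity 0\<close>
  have loc: "(\<forall>\<^sub>F t in nhds t1. g t \<in> cdom d) \<and> ((\<lambda>t. cmap d (g t)) has_vector_derivative 0) (at t1)"
    if d: "d \<in> A" "g t1 \<in> cdom d" for t1 d
  proof -
    define q where "q = \<psi> t1 p"
    have q: "q \<in> M" using \<psi>M by (simp add: q_def)
    obtain c where c: "c \<in> A" "q \<in> cdom c" using chart_exists q by blast
    define x where "x = (\<lambda>t. cmap c (\<psi> t p))"
    define \<delta> where "\<delta> = (\<lambda>t. \<sigma> t1 - \<sigma> t)"
    have dx: "(x has_derivative (\<lambda>h. h *\<^sub>R XL q c)) (at t1)" "x t1 = cmap c q"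
      using flow_deriv[OF \<psi> p c(1), of t1] c(2) by (auto simp: x_def q_def has_vector_derivative_def)
    have d\<delta>: "(\<delta> has_derivative (\<lambda>h. h * (- (1 / r q)))) (at t1)" "\<delta> t1 = 0"
    proof -
      have "(\<delta> has_real_derivative 0 - 1 / r q) (at t1)"
        unfolding \<delta>_def q_def by (intro DERIV_diff DERIV_const \<sigma>(2))
      then show "(\<delta> has_derivative (\<lambda>h. h * (- (1 / r q)))) (at t1)"
        unfolding has_field_derivative_def by (rule has_derivative_eq_rhs) auto
    qed (simp add: \<delta>_def)
    note v = flow_at_variable_time[OF gen c vector_field_isCont[OF X c] dx d\<delta>]
    define \<kappa> where "\<kappa> = (\<lambda>t. \<phi> (\<delta> t) (cinv c (x t)))"
    have "((\<lambda>t. cmap c (\<kappa> t)) has_derivative (\<lambda>h. 0)) (at t1)"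
      using v(1) by (simp add: \<kappa>_def XL_apply)
    moreover have \<kappa>1: "\<kappa> t1 = q" using dx(2) d\<delta>(2) flow_0[OF gen q] c by (simp add: \<kappa>_def)
    moreover have G: "(cmap d \<circ> \<phi> (- \<sigma> t1) \<circ> cinv c has_derivative frechet_derivative (cmap d \<circ> \<phi> (- \<sigma> t1) \<circ> cinv c) (at (cmap c q))) (at (cmap c q))"
      using flow_rep_has_derivative[OF c d(1)] d(2) by (simp add: g_def q_def)
    ultimately have "((\<lambda>t. (cmap d \<circ> \<phi> (- \<sigma> t1) \<circ> cinv c) (cmap c (\<kappa> t))) has_derivative (\<lambda>h. frechet_derivative (cmap d \<circ> \<phi> (- \<sigma> t1) \<circ> cinv c) (at (cmap c q)) 0)) (at t1)"
      using has_derivative_compose[of "\<lambda>t. cmap c (\<kappa> t)" "\<lambda>h. 0" t1 UNIV "cmap d \<circ> \<phi> (- \<sigma> t1) \<circ> cinv c"] by simp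
    then have G0: "((\<lambda>t. (cmap d \<circ> \<phi> (- \<sigma> t1) \<circ> cinv c) (cmap c (\<kappa> t))) has_derivative (\<lambda>h. 0)) (at t1)"
      using linear_0[OF has_derivative_linear[OF G]] by simp
    have "((\<lambda>t. \<psi> t p) \<longlongrightarrow> \<psi> t1 p) (nhds t1)" using flow_isCont[OF \<psi> p, of t1] by (simp add: isCont_def tendsto_nhds_iff)
    moreover obtain O' where O': "open O'" "cdom c = M \<inter> O'" using cdom_openin[OF c(1)] unfolding openin_open by blast
    ultimately have "\<forall>\<^sub>F t in nhds t1. \<psi> t p \<in> O'" using c(2) by (intro topological_tendstoD) (auto simp: q_def)
    then have e1: "\<forall>\<^sub>F t in nhds t1. \<psi> t p \<in> cdom c" by eventually_elim (use O' \<psi>M in blast)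
    have eq: "g t = \<phi> (- \<sigma> t1) (\<kappa> t)" if "\<psi> t p \<in> cdom c" for t
    proof -
      have "\<kappa> t = \<phi> (\<delta> t) (\<psi> t p)" using that c(1) by (simp add: \<kappa>_def x_def)
      then show ?thesis using flow_add[OF gen \<psi>M, of "- \<sigma> t1" "\<delta> t" t] by (simp add: g_def \<delta>_def)
    qed
    have e2: "\<forall>\<^sub>F t in nhds t1. \<kappa> t \<in> cdom c" using v(2) by eventually_elim (simp add: \<kappa>_def)
    from e1 e2 have "\<forall>\<^sub>F t in nhds t1. (cmap d \<circ> \<phi> (- \<sigma> t1) \<circ> cinv c) (cmap c (\<kappa> t)) = cmap d (g t)"
      by eventually_elim (use eq c(1) in simp)
    from has_derivative_transform_nhds[OF G0 this]
    have D: "((\<lambda>t. cmap d (g t)) has_vector_derivative 0) (at t1)" by (simp add: has_vector_derivative_def)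
    have "filterlim (\<lambda>t. cmap c (\<kappa> t)) (nhds (cmap c q)) (nhds t1)"
      using has_derivative_continuous[OF \<open>((\<lambda>t. cmap c (\<kappa> t)) has_derivative (\<lambda>h. 0)) (at t1)\<close>] \<kappa>1
      by (simp add: isCont_def tendsto_nhds_iff)
    moreover have evy: "\<forall>\<^sub>F y in nhds (cmap c q). y \<in> cimg c \<and> \<phi> (- \<sigma> t1) (cinv c y) \<in> cdom d"
      by (rule eventually_map_in_chart[OF _ flow_M c(1) d(1) c(2)])
        (use flow_differentiable[OF q] d(2) in \<open>auto simp: mfd_differentiable_def g_def q_def\<close>)
    ultimately have "\<forall>\<^sub>F t in nhds t1. cmap c (\<kappa> t) \<in> cimg c \<and> \<phi> (- \<sigma> t1) (cinv c (cmap c (\<kappa> t))) \<in> cdom d"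
      by (intro eventually_compose_filterlim[OF evy])
    with e1 e2 have "\<forall>\<^sub>F t in nhds t1. g t \<in> cdom d" by eventually_elim (use eq c(1) in simp)
    with D show ?thesis by blast
  qed
  have "g constant_on UNIV"
  proof (rule locally_constant_imp_constant)
    fix t1 :: real
    obtain d where d: "d \<in> A" "g t1 \<in> cdom d" using chart_exists gM by blast
    obtain e where e: "e > 0" "\<And>t. dist t t1 < e \<Longrightarrow> g t \<in> cdom d"
      using loc[OF d] unfolding eventually_nhds_metric by blast
    have const: "g t = g t1" if "t \<in> ball t1 e" for t
    proof -
      have "((\<lambda>t. cmap d (g t)) has_derivative (\<lambda>h. 0)) (at t within ball t1 e)" if "t \<in> ball t1 e" for t
        using loc[OF d(1) e(2)[of t]] that by (auto simp: has_vector_derivative_def dist_commute intro: has_derivative_at_withinI)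
      from has_derivative_zero_unique[OF convex_ball this, of t1] that e(1)
      have eq: "cmap d (g t) = cmap d (g t1)" by simp
      have gt: "g t \<in> cdom d" using e(2)[of t] that by (simp add: dist_commute)
      show ?thesis using arg_cong[OF eq, of "cinv d"] unfolding cinv_cmap[OF d(1) gt] cinv_cmap[OF d] .
    qed
    show "\<exists>T. openin (top_of_set UNIV) T \<and> t1 \<in> T \<and> (\<forall>t\<in>T. g t = g t1)"
    proof (intro exI[of _ "ball t1 e"] conjI ballI)
      show "t1 \<in> ball t1 e" using e(1) by simp
    qed (simp, rule const)
  qed simp
  then obtain y where "\<And>t. g t = y" unfolding constant_on_def by auto
  then have "g t = g 0" for t by metis
  then have g: "\<phi> (- \<sigma> t) (\<psi> t p) = p" for t using flow_0[OF \<psi> p] flow_0[OF gen p] \<sigma>(1) by (simp add: g_def)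
  have \<psi>\<phi>: "\<psi> t p = \<phi> (\<sigma> t) p" for t
    using flow_add[OF gen \<psi>M, of "\<sigma> t" "- \<sigma> t" t] g[of t] flow_0[OF gen \<psi>M] by simp
  have "log_expansion (\<sigma> t) p = t" for t
  proof (rule equal_of_equal_derivatives[where d = "\<lambda>_. 1" and a = 0 and f = "\<lambda>t. log_expansion (\<sigma> t) p" and g = "\<lambda>t. t"])
    fix t
    have "r (\<psi> t p) \<noteq> 0" by (rule r_nonzero[OF \<psi>M])
    then show "((\<lambda>t. log_expansion (\<sigma> t) p) has_real_derivative 1) (at t)"
      using DERIV_chain2[OF log_expansion(2)[OF p, of "\<sigma> t"] \<sigma>(2)[of t]] \<psi>\<phi>[of t] by simp
  qed (use \<sigma>(1) log_expansion(1)[OF p] in auto)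
  then have "\<sigma> (log_expansion T p) = T" using log_expansion_inj[OF p] by blast
  then show ?thesis using \<psi>\<phi> by simp
qed

lemma span2_iff:
  assumes c: "c \<in> A" "p \<in> cdom c" and v: "v \<in> tangent_space A p"
  shows "v \<in> span2 Rm Rp p \<longleftrightarrow> \<beta>_chart c (cmap c p) (v c) = 0"
proof -
  define x where "x = cmap c p"
  have x: "x \<in> cimg c" "cinv c x = p" using c by (auto simp: x_def)
  have p: "p \<in> M" using c cdom_subset by blast
  note s = structure_in_chart[OF c(1) x(1), unfolded x(2)]
  show ?thesis
  proof
    assume "v \<in> span2 Rm Rp p"
    then obtain a b where "v = tadd (tscale a (Rm p)) (tscale b (Rp p))" unfolding span2_def by blast
    then have "v c = a *\<^sub>R Rm p c + b *\<^sub>R Rp p c" by (simp add: tadd_def tscale_def)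
    then show "\<beta>_chart c (cmap c p) (v c) = 0"
      using s(8,9) by (simp add: linear_add[OF s(13)] linear_scale[OF s(13)] x_def[symmetric])
  next
    assume "\<beta>_chart c (cmap c p) (v c) = 0"
    then obtain a b where ab: "v c = a *\<^sub>R Rm p c + b *\<^sub>R Rp p c" using s(10)[of "v c"] by (auto simp: x_def)
    have t: "tadd (tscale a (Rm p)) (tscale b (Rp p)) \<in> tangent_space A p"
      by (intro tadd_tangent tscale_tangent Rm_tangent Rp_tangent p)
    have "v = tadd (tscale a (Rm p)) (tscale b (Rp p))"
      by (rule tangent_eqI[OF v t c]) (simp add: ab tadd_def tscale_def)
    then show "v \<in> span2 Rm Rp p" unfolding span2_def by blast
  qed
qed

text \<open>
  With \<open>f\<^sub>T(p) = t\<close>, write \<open>\<psi>\<^sup>t(p')\<close> as the image of \<open>\<phi>\<^sup>T(p')\<close> under \<open>\<psi>\<close> for the remaining time \<open>t - f\<^sub>T(p')\<close>, which is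
  0 at \<open>p' = p\<close>.  Thus \<open>\<psi>\<^sup>t\<^sub>* v = \<phi>\<^sup>T\<^sub>* v - df\<^sub>T(v) X\<^sub>L\<close>, and \<open>\<beta>\<close> takes the same value on \<open>v\<close> and \<open>\<psi>\<^sup>t\<^sub>* v\<close> since
  \<open>df\<^sub>T = (\<phi>\<^sup>T)\<^sup>*\<beta> - \<beta>\<close> and \<open>\<beta>(X\<^sub>L) = 1\<close>.
\<close>

lemma XL_flow_push:
  assumes \<psi>: "generates_flow M A XL \<psi>" and p: "p \<in> M"
  shows "mfd_differentiable M A A (\<psi> t) p"
    and "\<And>v. v \<in> tangent_space A p \<Longrightarrow> v \<in> span2 Rm Rp p \<Longrightarrow> push A A (\<psi> t) p v \<in> span2 Rm Rp (\<psi> t p)"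
proof -
  obtain T where T: "log_expansion T p = t" using log_expansion_surj[OF p] by blast
  define q where "q = \<psi> t p"
  have q: "q = \<phi> T p" "q \<in> M" using XL_flow_eq[OF \<psi> p, of T] T flow_M p by (auto simp: q_def)
  have eq: "\<psi> t p' = \<psi> (t - log_expansion T p') (\<phi> T p')" if "p' \<in> M" for p'
    using flow_add[OF \<psi> that, of "t - log_expansion T p'" "log_expansion T p'"] XL_flow_eq[OF \<psi> that, of T] by simp
  obtain c d where c: "c \<in> A" "p \<in> cdom c" and d: "d \<in> A" "q \<in> cdom d" using chart_exists p q(2) by meson
  have d': "\<phi> T p \<in> cdom d" using d q by simp
  define x0 where "x0 = cmap c p"
  define F where "F = cmap d \<circ> \<phi> T \<circ> cinv c"
  define F' where "F' = frechet_derivative F (at x0)"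
  have x0: "cinv c x0 = p" "x0 \<in> cimg c" using c by (auto simp: x0_def)
  have Fd: "(F has_derivative F') (at x0)" "F x0 = cmap d q"
    using flow_rep_has_derivative[OF c d(1) d'] q x0 by (auto simp: F_def F'_def x0_def)
  define \<delta> where "\<delta> = (\<lambda>x. t - log_expansion T (cinv c x))"
  define D\<delta> where "D\<delta> = (\<lambda>h. \<beta>_chart c x0 h - \<beta>_chart d (F x0) (F' h))"
  have d\<delta>: "(\<delta> has_derivative D\<delta>) (at x0)" "\<delta> x0 = 0"
  proof -
    have "(\<delta> has_derivative (\<lambda>h. 0 - (\<beta>_chart d (F x0) (F' h) - \<beta>_chart c x0 h))) (at x0)"
      unfolding \<delta>_def using log_expansion_has_derivative[OF c d(1) d'] unfolding F_def[symmetric] x0_def[symmetric] F'_def[symmetric]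
      by (intro has_derivative_diff has_derivative_const)
    then show "(\<delta> has_derivative D\<delta>) (at x0)" by (simp add: D\<delta>_def)
    show "\<delta> x0 = 0" using T x0 by (simp add: \<delta>_def)
  qed
  note v = flow_at_variable_time[OF \<psi> d XL_isCont[OF d] Fd d\<delta>]
  have ev: "\<forall>\<^sub>F y in nhds x0. y \<in> cimg c \<and> \<phi> T (cinv c y) \<in> cdom d"
    unfolding x0_def by (rule eventually_map_in_chart[OF _ flow_M c(1) d(1) c(2) d'])
      (use flow_differentiable[OF p] in \<open>auto simp: mfd_differentiable_def\<close>)
  then have ev2: "\<forall>\<^sub>F y in nhds x0. \<psi> (\<delta> y) (cinv d (F y)) = \<psi> t (cinv c y)"
  proof eventually_elim
    case (elim y)
    have "cinv c y \<in> M" using elim cinv_in[OF c(1)] cdom_subset[OF c(1)] by blast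
    then show ?case using eq[of "cinv c y"] elim cinv_cmap[OF d(1)] by (simp add: \<delta>_def F_def)
  qed
  then have "\<forall>\<^sub>F y in nhds x0. cmap d (\<psi> (\<delta> y) (cinv d (F y))) = (cmap d \<circ> \<psi> t \<circ> cinv c) y"
    by eventually_elim simp
  from has_derivative_transform_nhds[OF v(1) this]
  have D: "(cmap d \<circ> \<psi> t \<circ> cinv c has_derivative (\<lambda>h. F' h + D\<delta> h *\<^sub>R XL q d)) (at (cmap c p))" unfolding x0_def .
  have evd: "\<forall>\<^sub>F y in nhds (cmap c p). \<psi> t (cinv c y) \<in> cdom d"
    using v(2) ev2 unfolding x0_def[symmetric] by eventually_elim simp
  have \<psi>M: "\<forall>q\<in>M. \<psi> t q \<in> M" using flow_in_M[OF \<psi>] by blast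
  have dq: "\<psi> t p \<in> cdom d" using d by (simp add: q_def)
  have cont: "continuous (at p within M) (\<psi> t)"
    by (rule continuous_of_local_rep[where f = "\<psi> t", OF c d(1) dq evd has_derivative_continuous[OF D]])
  show diff: "mfd_differentiable M A A (\<psi> t) p"
    by (rule mfd_differentiableI[where f = "\<psi> t", OF cont \<psi>M c d(1) dq D])
  fix u assume u: "u \<in> tangent_space A p" "u \<in> span2 Rm Rp p"
  have pu: "push A A (\<psi> t) p u d = F' (u c) + D\<delta> (u c) *\<^sub>R XL q d"
    by (rule push_component[where f = "\<psi> t", OF diff \<psi>M c d(1) dq u(1) D])
  have pt: "push A A (\<psi> t) p u \<in> tangent_space A (\<psi> t p)" using push_tangent[of p "\<psi> t" u] p \<psi>M by blast
  have yq: "cmap d q \<in> cimg d" "cinv d (cmap d q) = q" using d cinv_cmap by auto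
  note s = structure_in_chart[OF d(1) yq(1), unfolded yq(2)]
  have "r q \<noteq> 0" by (rule r_nonzero[OF q(2)])
  then have "\<beta>_chart d (cmap d q) (push A A (\<psi> t) p u d) = \<beta>_chart c x0 (u c)"
    unfolding pu XL_apply using s(7) Fd(2) by (simp add: linear_add[OF s(13)] linear_scale[OF s(13)] D\<delta>_def)
  then show "push A A (\<psi> t) p u \<in> span2 Rm Rp (\<psi> t p)"
    using span2_iff[OF c u(1)] u(2) span2_iff[OF d(1) dq pt] by (simp add: x0_def q_def)
qed

lemma span2_tangent: "p \<in> M \<Longrightarrow> v \<in> span2 Rm Rp p \<Longrightarrow> v \<in> tangent_space A p"
  unfolding span2_def using Rm_tangent Rp_tangent by (auto intro!: tadd_tangent tscale_tangent)

lemma XL_flow_preserves_Reeb_plane: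
  assumes \<psi>: "generates_flow M A XL \<psi>"
  shows "preserves_bundle M A \<psi> (span2 Rm Rp)"
  unfolding preserves_bundle_def
proof (intro allI ballI conjI)
  fix t p assume p: "p \<in> M"
  show "mfd_differentiable M A A (\<psi> t) p" by (rule XL_flow_push(1)[OF \<psi> p])
  have q: "\<psi> t p \<in> M" using flow_in_M[OF \<psi> p] .
  have ret: "\<psi> (- t) (\<psi> t p) = p" using flow_add[OF \<psi> p, of "- t" t] flow_0[OF \<psi> p] by simp
  show "push A A (\<psi> t) p ` span2 Rm Rp p = span2 Rm Rp (\<psi> t p)"
  proof
    show "push A A (\<psi> t) p ` span2 Rm Rp p \<subseteq> span2 Rm Rp (\<psi> t p)"
      using XL_flow_push(2)[OF \<psi> p] span2_tangent[OF p] by blast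
    show "span2 Rm Rp (\<psi> t p) \<subseteq> push A A (\<psi> t) p ` span2 Rm Rp p"
    proof
      fix w assume w: "w \<in> span2 Rm Rp (\<psi> t p)"
      have wt: "w \<in> tangent_space A (\<psi> t p)" by (rule span2_tangent[OF q w])
      define v where "v = push A A (\<psi> (- t)) (\<psi> t p) w"
      have v: "v \<in> span2 Rm Rp p" using XL_flow_push(2)[OF \<psi> q wt w, of "- t"] ret by (simp add: v_def)
      have \<psi>M: "\<forall>q\<in>M. \<psi> s q \<in> M" for s using flow_in_M[OF \<psi>] by blast
      have inv: "\<psi> 0 q = \<psi> t (\<psi> (- t) q)" if "q \<in> M" for q using flow_add[OF \<psi> that, of t "- t"] by simp
      have "push A A (\<psi> 0) (\<psi> t p) w = push A A (\<psi> t) (\<psi> (- t) (\<psi> t p)) v"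
        unfolding v_def
        by (rule push_compose[where f = "\<psi> (- t)" and g = "\<psi> t" and h = "\<psi> 0", OF XL_flow_push(1)[OF \<psi> q] \<psi>M XL_flow_push(1)[OF \<psi>] \<psi>M XL_flow_push(1)[OF \<psi> q] inv q wt])
          (simp add: ret p)
      moreover have "push A A (\<psi> 0) (\<psi> t p) w = w"
        by (rule push_ident[where f = "\<psi> 0", OF XL_flow_push(1)[OF \<psi> q] flow_0[OF \<psi>] q wt])
      ultimately show "w \<in> push A A (\<psi> t) p ` span2 Rm Rp p" using v ret by auto
    qed
  qed
qed

lemma Reeb_plane_transverse: "transverse_plane_field M A XL Rm Rp"
  unfolding transverse_plane_field_def
proof (intro ballI)
  fix p v assume p: "p \<in> M" and v: "v \<in> tangent_space A p"
  obtain c where c: "c \<in> A" "p \<in> cdom c" using chart_exists p by blast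
  define x where "x = cmap c p"
  have x: "x \<in> cimg c" "cinv c x = p" using c by (auto simp: x_def)
  note s = structure_in_chart[OF c(1) x(1), unfolded x(2)]
  have rp: "r p \<noteq> 0" by (rule r_nonzero[OF p])
  let ?w = "\<lambda>a b k. tadd (tadd (tscale a (Rm p)) (tscale b (Rp p))) (tscale k (XL p))"
  have wt: "?w a b k \<in> tangent_space A p" for a b k
    by (intro tadd_tangent tscale_tangent Rm_tangent Rp_tangent XL_tangent p)
  have wc: "?w a b k c = a *\<^sub>R Rm p c + b *\<^sub>R Rp p c + (k / r p) *\<^sub>R X p c" for a b k
    by (simp add: tadd_def tscale_def Liouville_reparametrization_def)
  show "\<exists>!(a, b, k). v = ?w a b k"
  proof (rule ex1I[of _ "(covec \<alpha>u c x \<bullet> v c + covec \<alpha>s c x \<bullet> v c, covec \<alpha>u c x \<bullet> v c - covec \<alpha>s c x \<bullet> v c, \<beta>_chart c x (v c))"])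
    show "case (covec \<alpha>u c x \<bullet> v c + covec \<alpha>s c x \<bullet> v c, covec \<alpha>u c x \<bullet> v c - covec \<alpha>s c x \<bullet> v c, \<beta>_chart c x (v c)) of (a, b, k) \<Rightarrow> v = ?w a b k"
      unfolding prod.case by (rule tangent_eqI[OF v wt c]) (unfold wc, rule s(10))
    fix z assume "case z of (a, b, k) \<Rightarrow> v = ?w a b k"
    then obtain a b k where z: "z = (a, b, k)" "v = ?w a b k" by (cases z) auto
    then have vc: "v c = a *\<^sub>R Rm p c + b *\<^sub>R Rp p c + (k / r p) *\<^sub>R X p c" using wc by simp
    have "covec \<alpha>u c x \<bullet> v c = a / 2 + b / 2" "covec \<alpha>s c x \<bullet> v c = a / 2 - b / 2"
      unfolding vc inner_add_right inner_scaleR_right s(1-6) by simp_all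
    moreover have "\<beta>_chart c x (v c) = k"
      unfolding vc linear_add[OF s(13)] linear_scale[OF s(13)] s(7-9) using rp by simp
    ultimately show "z = (covec \<alpha>u c x \<bullet> v c + covec \<alpha>s c x \<bullet> v c, covec \<alpha>u c x \<bullet> v c - covec \<alpha>s c x \<bullet> v c, \<beta>_chart c x (v c))"
      using z(1) by simp
  qed
qed

end

section \<open>The cylinder as a manifold with boundary\<close>

lemma det_4_block:
  fixes B :: "real ^ 4 ^ 4" and C :: "real ^ 3 ^ 3"
  assumes "B $ 1 $ 1 = 1" "B $ 1 $ 2 = 0" "B $ 1 $ 3 = 0" "B $ 1 $ 4 = 0"
    "B $ 2 $ 1 = 0" "B $ 3 $ 1 = 0" "B $ 4 $ 1 = 0"
    "B $ 2 $ 2 = C $ 1 $ 1" "B $ 2 $ 3 = C $ 1 $ 2" "B $ 2 $ 4 = C $ 1 $ 3"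
    "B $ 3 $ 2 = C $ 2 $ 1" "B $ 3 $ 3 = C $ 2 $ 2" "B $ 3 $ 4 = C $ 2 $ 3"
    "B $ 4 $ 2 = C $ 3 $ 1" "B $ 4 $ 3 = C $ 3 $ 2" "B $ 4 $ 4 = C $ 3 $ 3"
  shows "det B = det C"
proof -
  have f1234: "finite {2::4, 3, 4}" "1 \<notin> {2::4, 3, 4}" and f234: "finite {3::4, 4}" "2 \<notin> {3::4, 4}"
    and f34: "finite {4::4}" "3 \<notin> {4::4}" by auto
  have "det B = B$2$2 * B$3$3 * B$4$4 + B$2$3 * B$3$4 * B$4$2 + B$2$4 * B$3$2 * B$4$3
     - B$2$2 * B$3$4 * B$4$3 - B$2$3 * B$3$2 * B$4$4 - B$2$4 * B$3$3 * B$4$2"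
    unfolding det_def UNIV_4
    unfolding sum_over_permutations_insert[OF f1234]
    unfolding sum_over_permutations_insert[OF f234]
    unfolding sum_over_permutations_insert[OF f34]
    unfolding permutes_sing
    using assms(1-7)
    by (simp add: sign_swap_id permutation_swap_id sign_compose sign_id swap_id_eq permutation_compose)
  then show ?thesis by (simp add: det_3 assms)
qed

lemma vector_4:
  "(vector [a, b, c, d] :: real ^ 4) $ 1 = a" "(vector [a, b, c, d] :: real ^ 4) $ 2 = b"
  "(vector [a, b, c, d] :: real ^ 4) $ 3 = c" "(vector [a, b, c, d] :: real ^ 4) $ 4 = d"
  unfolding vector_def by simp_all

definition drop1 :: "real ^ 4 \<Rightarrow> real ^ 3" where "drop1 y = vector [y $ 2, y $ 3, y $ 4]"

definition cons1 :: "real \<Rightarrow> real ^ 3 \<Rightarrow> real ^ 4" where "cons1 s h = vector [s, h $ 1, h $ 2, h $ 3]"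

lemma cons1_simps [simp]:
  "drop1 (cons1 s h) = h" "cons1 s h $ 1 = s" "cons1 (y $ 1) (drop1 y) = y"
  by (simp_all add: drop1_def cons1_def vec_eq_iff forall_3 forall_4 vector_4)

lemma cons1_add: "cons1 (s + t) (h + k) = cons1 s h + cons1 t k"
  and cons1_scale: "cons1 (a * s) (a *\<^sub>R h) = a *\<^sub>R cons1 s h"
  and drop1_add: "drop1 (x + y) = drop1 x + drop1 y"
  and drop1_scale: "drop1 (a *\<^sub>R x) = a *\<^sub>R drop1 x"
  by (simp_all add: drop1_def cons1_def vec_eq_iff forall_3 forall_4 vector_4)

lemma cons1_inject [simp]: "cons1 s h = cons1 t k \<longleftrightarrow> s = t \<and> h = k"
  by (metis cons1_simps(1,2))

lemma bounded_linear_drop1: "bounded_linear drop1"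
  by (rule linear_conv_bounded_linear[THEN iffD1], rule linearI) (simp_all add: drop1_add drop1_scale)

lemma bounded_linear_cons1_0: "bounded_linear (cons1 0)"
proof (rule linear_conv_bounded_linear[THEN iffD1], rule linearI)
  show "cons1 0 (x + y) = cons1 0 x + cons1 0 y" for x y using cons1_add[of 0 0 x y] by simp
  show "cons1 0 (a *\<^sub>R x) = a *\<^sub>R cons1 0 x" for a x using cons1_scale[of a 0 x] by simp
qed

lemma bounded_linear_cons1_left: "bounded_linear (\<lambda>s. cons1 s 0)"
proof (rule linear_conv_bounded_linear[THEN iffD1], rule linearI)
  show "cons1 (x + y) 0 = cons1 x 0 + cons1 y 0" for x y using cons1_add[of x y 0 0] by simp
  show "cons1 (a *\<^sub>R x) 0 = a *\<^sub>R cons1 x 0" for a x using cons1_scale[of a x 0] by simp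
qed

lemma cons1_split: "cons1 s h = cons1 s 0 + cons1 0 h"
  using cons1_add[of s 0 0 h] by simp

lemma cons1_axis: "cons1 1 0 = axis 1 1" "cons1 0 (axis 1 1) = axis 2 1" "cons1 0 (axis 2 1) = axis 3 1" "cons1 0 (axis 3 1) = axis 4 1"
  by (simp_all add: cons1_def vec_eq_iff forall_4 vector_4 axis_def)

lemma continuous_on_cons1:
  "continuous_on S f \<Longrightarrow> continuous_on S g \<Longrightarrow> continuous_on S (\<lambda>x. cons1 (f x) (g x))"
  by (subst cons1_split) (intro continuous_on_add bounded_linear.continuous_on[OF bounded_linear_cons1_left]
      bounded_linear.continuous_on[OF bounded_linear_cons1_0])

lemma continuous_on_drop1: "continuous_on S drop1"
  using bounded_linear.continuous_on[OF bounded_linear_drop1 continuous_on_id] by simp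

text \<open>
  A derivative is determined by its values in the coordinate directions.  At an end point of the interval, small
  increments of one sign are available in the first direction, which is enough.
\<close>

lemma derivative_unique_interval_times_open:
  fixes f :: "real ^ 4 \<Rightarrow> 'b::real_normed_vector"
  assumes x: "x $ 1 \<in> I" "drop1 x \<in> O'" and O': "open O'"
    and I: "\<And>e. e > 0 \<Longrightarrow> \<exists>\<delta>. 0 < \<bar>\<delta>\<bar> \<and> \<bar>\<delta>\<bar> < e \<and> x $ 1 + \<delta> \<in> I"
    and f: "(f has_derivative f') (at x within {y. y $ 1 \<in> I \<and> drop1 y \<in> O'})"
  shows "frechet_derivative f (at x within {y. y $ 1 \<in> I \<and> drop1 y \<in> O'}) = f'"
proof -
  let ?S = "{y. y $ 1 \<in> I \<and> drop1 y \<in> O'}"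
  have "\<exists>d. 0 < \<bar>d\<bar> \<and> \<bar>d\<bar> < e \<and> x + d *\<^sub>R i \<in> ?S" if i: "i \<in> Basis" and e: "e > 0" for i :: "real ^ 4" and e
  proof -
    obtain j where j: "i = axis j 1" using i by (auto simp: Basis_vec_def)
    show ?thesis
    proof (cases "j = 1")
      case True
      obtain \<delta> where \<delta>: "0 < \<bar>\<delta>\<bar>" "\<bar>\<delta>\<bar> < e" "x $ 1 + \<delta> \<in> I" using I[OF e] by blast
      have "drop1 (x + \<delta> *\<^sub>R i) = drop1 x" "(x + \<delta> *\<^sub>R i) $ 1 = x $ 1 + \<delta>"
        unfolding j True cons1_axis(1)[symmetric] drop1_add drop1_scale by simp_all
      then show ?thesis using \<delta> x by (intro exI[of _ \<delta>]) simp
    next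
      case False
      obtain r where r: "r > 0" "ball (drop1 x) r \<subseteq> O'" using O' x(2) openE by blast
      define \<delta> where "\<delta> = min (e/2) (r / 2 / (norm (drop1 i) + 1))"
      have n: "norm (drop1 i) + 1 > 0" by (simp add: add_nonneg_pos)
      have \<delta>: "\<delta> > 0" "\<delta> < e" "\<delta> \<le> r / 2 / (norm (drop1 i) + 1)" using e r(1) n by (auto simp: \<delta>_def)
      have "\<delta> * norm (drop1 i) \<le> \<delta> * (norm (drop1 i) + 1)" using \<delta>(1) by simp
      also have "\<dots> \<le> r / 2" using \<delta>(3) n by (simp only: pos_le_divide_eq)
      also have "\<dots> < r" using r(1) by simp
      finally have "drop1 (x + \<delta> *\<^sub>R i) \<in> O'"
        using r(2) \<delta>(1) by (auto simp: drop1_add drop1_scale dist_norm subset_iff)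
      moreover have "(x + \<delta> *\<^sub>R i) $ 1 = x $ 1" using False by (simp add: j axis_def)
      ultimately show ?thesis using \<delta> x by (intro exI[of _ \<delta>]) simp
    qed
  qed
  moreover have "(f has_derivative frechet_derivative f (at x within ?S)) (at x within ?S)"
    using f frechet_derivative_works differentiableI by blast
  ultimately show ?thesis using frechet_derivative_unique_within[OF _ f] by blast
qed

locale closed_3_manifold = closed_mfd M A
  for M :: "'a::t2_space set" and A :: "('a, 3) chart set"
begin

text \<open>
  The intervals underlying the two families of charts of the cylinder.
\<close>

definition side :: "bool \<Rightarrow> real set" where "side b = (if b then {-1..<1} else {-1<..1})"

definition cyl :: "bool \<Rightarrow> ('a, 3) chart \<Rightarrow> (real \<times> 'a, 4) chart" where
  "cyl b c = (side b \<times> cdom c, cylinder_coord (cmap c))"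

lemma cylinder_atlas_eq: "cylinder_atlas A = {cyl b c | b c. c \<in> A}"
proof -
  have "{cyl b c | b c. c \<in> A} = cyl True ` A \<union> cyl False ` A"
    by (auto simp: image_iff) (metis (full_types))+
  then show ?thesis by (simp add: cylinder_atlas_def cyl_def side_def)
qed

lemma cyl_in: "c \<in> A \<Longrightarrow> cyl b c \<in> cylinder_atlas A" unfolding cylinder_atlas_eq by blast
lemma cyl_cases: "d \<in> cylinder_atlas A \<Longrightarrow> (\<And>b c. d = cyl b c \<Longrightarrow> c \<in> A \<Longrightarrow> P) \<Longrightarrow> P"
  unfolding cylinder_atlas_eq by blast

lemma cyl_cdom: "cdom (cyl b c) = side b \<times> cdom c" by (simp add: cyl_def)
lemma cyl_cmap: "cmap (cyl b c) (s, p) = cons1 s (cmap c p)" by (simp add: cyl_def cylinder_coord_def cons1_def)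

lemma side_subset: "side b \<subseteq> {-1..1}" by (auto simp: side_def)

lemma side_thick: assumes "s \<in> side b \<inter> side b'" "e > 0" shows "\<exists>\<delta>. 0 < \<bar>\<delta>\<bar> \<and> \<bar>\<delta>\<bar> < e \<and> s + \<delta> \<in> side b \<inter> side b'"
proof (cases "s < 1 \<and> (b \<or> s < 0)")
  case True
  show ?thesis
    by (rule exI[of _ "min (e/2) ((1 - s)/2)"]) (use True assms in \<open>auto simp: side_def min_def field_simps split: if_splits\<close>)
next
  case False
  show ?thesis
    by (rule exI[of _ "- min (e/2) ((s + 1)/2)"]) (use False assms in \<open>auto simp: side_def min_def field_simps split: if_splits\<close>)
qed

lemma cyl_cimg: assumes "c \<in> A" shows "cimg (cyl b c) = {y. y $ 1 \<in> side b \<and> drop1 y \<in> cimg c}"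
proof
  show "cimg (cyl b c) \<subseteq> {y. y $ 1 \<in> side b \<and> drop1 y \<in> cimg c}"
    unfolding cyl_cdom by (auto simp: cyl_cmap)
  show "{y. y $ 1 \<in> side b \<and> drop1 y \<in> cimg c} \<subseteq> cimg (cyl b c)"
  proof
    fix y assume "y \<in> {y. y $ 1 \<in> side b \<and> drop1 y \<in> cimg c}"
    then have y: "y $ 1 \<in> side b" "drop1 y \<in> cimg c" by auto
    have "cmap (cyl b c) (y $ 1, cinv c (drop1 y)) = y" using y by (simp add: cyl_cmap)
    moreover have "(y $ 1, cinv c (drop1 y)) \<in> cdom (cyl b c)" using y cinv_in[OF assms] by (simp add: cyl_cdom)
    ultimately show "y \<in> cimg (cyl b c)" by (metis image_eqI)
  qed
qed

lemma cyl_inj: assumes "c \<in> A" shows "inj_on (cmap (cyl b c)) (cdom (cyl b c))"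
proof (rule inj_onI)
  fix z w assume z: "z \<in> cdom (cyl b c)" "w \<in> cdom (cyl b c)" and e: "cmap (cyl b c) z = cmap (cyl b c) w"
  obtain s p t q where zw: "z = (s, p)" "w = (t, q)" by (cases z, cases w) auto
  have "s = t" "cmap c p = cmap c q" using e by (auto simp: zw cyl_cmap)
  moreover have "p \<in> cdom c" "q \<in> cdom c" using z by (auto simp: zw cyl_cdom)
  ultimately show "z = w" using cinv_cmap[OF assms] zw by metis
qed

lemma cyl_cinv: assumes "c \<in> A" "y $ 1 \<in> side b" "drop1 y \<in> cimg c"
  shows "cinv (cyl b c) y = (y $ 1, cinv c (drop1 y))"
  by (rule inv_into_f_eq[OF cyl_inj[OF assms(1)]])
    (use assms cinv_in[OF assms(1)] in \<open>auto simp: cyl_cdom cyl_cmap\<close>)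

lemma cyl_overlap:
  assumes "c \<in> A" "d \<in> A"
  shows "cmap (cyl b c) ` (cdom (cyl b c) \<inter> cdom (cyl b' d)) = {y. y $ 1 \<in> side b \<inter> side b' \<and> drop1 y \<in> overlap c d}"
    (is "?L = ?R")
proof
  show "?L \<subseteq> ?R" by (auto simp: cyl_cdom cyl_cmap overlap_def)
  show "?R \<subseteq> ?L"
  proof
    fix y assume "y \<in> ?R"
    then have y: "y $ 1 \<in> side b \<inter> side b'" "drop1 y \<in> overlap c d" by auto
    then obtain p where p: "p \<in> cdom c \<inter> cdom d" "drop1 y = cmap c p" by (auto simp: overlap_def)
    have "y = cmap (cyl b c) (y $ 1, p)" by (simp add: cyl_cmap flip: p(2))
    then show "y \<in> ?L" using y p by (intro image_eqI[where x = "(y $ 1, p)"]) (auto simp: cyl_cdom)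
  qed
qed

lemma overlap_subset: "c \<in> A \<Longrightarrow> overlap c d \<subseteq> cimg c" by (auto simp: overlap_def)

lemma cyl_transition:
  assumes "c \<in> A" "d \<in> A" "y $ 1 \<in> side b \<inter> side b'" "drop1 y \<in> overlap c d"
  shows "(cmap (cyl b' d) \<circ> cinv (cyl b c)) y = cons1 (y $ 1) ((cmap d \<circ> cinv c) (drop1 y))"
  using cyl_cinv[OF assms(1), of y b] assms overlap_subset[OF assms(1)] by (auto simp: cyl_cmap subset_iff)

lemma cyl_transition_smooth:
  assumes "c \<in> A" "d \<in> A"
  shows "smooth_on (cmap (cyl b' d) \<circ> cinv (cyl b c)) {y. y $ 1 \<in> side b \<inter> side b' \<and> drop1 y \<in> overlap c d}"
  unfolding smooth_on_def
proof
  fix k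
  let ?S = "{y. y $ 1 \<in> side b \<inter> side b' \<and> drop1 y \<in> overlap c d}"
  have "Ck_on k (\<lambda>y. cons1 (y $ 1) 0 + cons1 0 ((cmap d \<circ> cinv c) (drop1 y))) ?S"
  proof (rule Ck_on_add)
    show "Ck_on k (\<lambda>y. cons1 (y $ 1) 0) ?S"
      by (rule Ck_on_linear) (rule bounded_linear_compose[OF bounded_linear_cons1_left bounded_linear_vec_nth])
    show "Ck_on k (\<lambda>y. cons1 0 ((cmap d \<circ> cinv c) (drop1 y))) ?S"
      by (rule Ck_on_linear_compose[OF transition_Ck[OF assms] bounded_linear_cons1_0 bounded_linear_drop1]) auto
  qed
  then show "Ck_on k (cmap (cyl b' d) \<circ> cinv (cyl b c)) ?S"
    by (rule Ck_on_cong[rotated]) (subst cons1_split[symmetric], rule cyl_transition[OF assms], auto)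
qed

lemma cyl_trans_deriv:
  assumes c: "c \<in> A" "p \<in> cdom c" and d: "d \<in> A" "p \<in> cdom d" and s: "s \<in> side b" "s \<in> side b'"
  shows "trans_deriv (cyl b c) (cyl b' d) (s, p) h = cons1 (h $ 1) (trans_deriv c d p (drop1 h))"
proof -
  let ?S = "{y. y $ 1 \<in> side b \<inter> side b' \<and> drop1 y \<in> overlap c d}"
  define x where "x = cons1 s (cmap c p)"
  have x: "x $ 1 \<in> side b \<inter> side b'" "drop1 x \<in> overlap c d" "drop1 x = cmap c p"
    using s overlap_iff[OF c] d by (auto simp: x_def)
  have "((\<lambda>y. cons1 (y $ 1) 0 + cons1 0 ((cmap d \<circ> cinv c) (drop1 y))) has_derivative
      (\<lambda>h. cons1 (h $ 1) 0 + cons1 0 (trans_deriv c d p (drop1 h)))) (at x)"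
  proof (rule has_derivative_add)
    show "((\<lambda>y. cons1 (y $ 1) 0) has_derivative (\<lambda>h. cons1 (h $ 1) 0)) (at x)"
      by (rule bounded_linear_imp_has_derivative)
        (rule bounded_linear_compose[OF bounded_linear_cons1_left bounded_linear_vec_nth])
    have "(cmap d \<circ> cinv c has_derivative trans_deriv c d p) (at (drop1 x))"
      unfolding x(3) by (rule transition_has_derivative[OF c(1) d(1) c(2) d(2)])
    from has_derivative_compose[OF bounded_linear_imp_has_derivative[OF bounded_linear_drop1] this]
    have "((\<lambda>y. (cmap d \<circ> cinv c) (drop1 y)) has_derivative (\<lambda>h. trans_deriv c d p (drop1 h))) (at x)" .
    from bounded_linear.has_derivative[OF bounded_linear_cons1_0 this]
    show "((\<lambda>y. cons1 0 ((cmap d \<circ> cinv c) (drop1 y))) has_derivative (\<lambda>h. cons1 0 (trans_deriv c d p (drop1 h)))) (at x)" .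
  qed
  then have "((\<lambda>y. cons1 (y $ 1) ((cmap d \<circ> cinv c) (drop1 y))) has_derivative (\<lambda>h. cons1 (h $ 1) (trans_deriv c d p (drop1 h)))) (at x within ?S)"
    by (simp add: has_derivative_at_withinI flip: cons1_split)
  then have D: "(cmap (cyl b' d) \<circ> cinv (cyl b c) has_derivative (\<lambda>h. cons1 (h $ 1) (trans_deriv c d p (drop1 h)))) (at x within ?S)"
    by (rule has_derivative_transform[rotated 2]) (use x in simp, rule cyl_transition[OF c(1) d(1)], auto)
  have "frechet_derivative (cmap (cyl b' d) \<circ> cinv (cyl b c)) (at x within ?S) = (\<lambda>h. cons1 (h $ 1) (trans_deriv c d p (drop1 h)))"
    by (rule derivative_unique_interval_times_open[OF x(1,2) open_overlap[OF c(1) d(1)] side_thick[OF x(1)] D])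
  then show ?thesis by (simp add: trans_deriv_def cyl_overlap[OF c(1) d(1)] cyl_cmap x_def)
qed

lemma cyl_orientation:
  assumes c: "c \<in> A" "p \<in> cdom c" and d: "d \<in> A" "p \<in> cdom d" and s: "s \<in> side b" "s \<in> side b'"
  shows "det (matrix (trans_deriv (cyl b c) (cyl b' d) (s, p))) > 0"
proof -
  have eq: "trans_deriv (cyl b c) (cyl b' d) (s, p) = (\<lambda>h. cons1 (h $ 1) (trans_deriv c d p (drop1 h)))"
    using cyl_trans_deriv[OF assms] by (rule ext)
  have t0: "trans_deriv c d p 0 = 0" using linear_0[OF trans_deriv_linear[OF c(1) d(1) c(2) d(2)]] .
  have ax: "drop1 (axis 1 1) = 0" "drop1 (axis 2 1) = axis 1 1" "drop1 (axis 3 1) = axis 2 1" "drop1 (axis 4 1) = axis 3 1"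
    by (metis cons1_axis cons1_simps(1))+
  have "det (matrix (trans_deriv (cyl b c) (cyl b' d) (s, p))) = det (matrix (trans_deriv c d p))"
    by (rule det_4_block)
      (simp_all add: eq matrix_def ax t0, simp_all add: cons1_def vector_4 axis_def)
  then show ?thesis using mfd c d unfolding oriented_manifold_def by simp
qed

lemma cyl_cdom_openin:
  assumes "c \<in> A" shows "openin (top_of_set ({-1..1} \<times> M)) (cdom (cyl b c))"
proof -
  have "openin (top_of_set {-1..1::real}) (side b)"
  proof (cases b)
    case True
    have "side b = {-1..1} \<inter> {..<1}" using True by (auto simp: side_def)
    then show ?thesis by (metis openin_open_Int open_lessThan)
  next
    case False
    have "side b = {-1..1} \<inter> {-1<..}" using False by (auto simp: side_def)
    then show ?thesis by (metis openin_open_Int open_greaterThan)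
  qed
  then show ?thesis unfolding cyl_cdom using openin_Times cdom_openin[OF assms] by blast
qed

lemma cyl_cimg_openin:
  assumes "c \<in> A" shows "\<exists>n a. openin (top_of_set {x. a \<le> n \<bullet> x}) (cimg (cyl b c))"
proof -
  have cont: "continuous_on UNIV (\<lambda>y::real^4. y $ 1)" by (intro continuous_intros)
  have o: "open {y. drop1 y \<in> cimg c}"
    using open_vimage[OF open_cimg[OF assms] continuous_on_drop1] by (simp add: vimage_def)
  show ?thesis
  proof (cases b)
    case True
    have "cimg (cyl b c) = {x. -1 \<le> axis 1 1 \<bullet> x} \<inter> ({y. y $ 1 < 1} \<inter> {y. drop1 y \<in> cimg c})"
      using True by (auto simp: cyl_cimg[OF assms] side_def inner_axis' )
    moreover have "open ({y::real^4. y $ 1 < 1} \<inter> {y. drop1 y \<in> cimg c})"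
      by (intro open_Int o open_Collect_less cont continuous_on_const)
    ultimately show ?thesis by (metis openin_open_Int)
  next
    case False
    have "cimg (cyl b c) = {x. -1 \<le> (- axis 1 1) \<bullet> x} \<inter> ({y. -1 < y $ 1} \<inter> {y. drop1 y \<in> cimg c})"
      using False by (auto simp: cyl_cimg[OF assms] side_def inner_axis' )
    moreover have "open ({y::real^4. -1 < y $ 1} \<inter> {y. drop1 y \<in> cimg c})"
      by (intro open_Int o open_Collect_less cont continuous_on_const)
    ultimately show ?thesis by (metis openin_open_Int)
  qed
qed

lemma cyl_homeomorphism:
  assumes c: "c \<in> A"
  shows "homeomorphism (cdom (cyl b c)) (cimg (cyl b c)) (cmap (cyl b c)) (\<lambda>y. (y $ 1, cinv c (drop1 y)))"
proof (rule homeomorphismI)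
  note h = chart_homeomorphism[OF c, unfolded homeomorphism_def]
  have "continuous_on (cdom c) (cmap c)" using h by blast
  then have "continuous_on (side b \<times> cdom c) (\<lambda>z. cmap c (snd z))"
    by (rule continuous_on_compose2[OF _ continuous_on_snd[OF continuous_on_id]]) auto
  then have "continuous_on (side b \<times> cdom c) (\<lambda>z. cons1 (fst z) (cmap c (snd z)))"
    by (rule continuous_on_cons1[OF continuous_on_fst[OF continuous_on_id]])
  moreover have "cmap (cyl b c) = (\<lambda>z. cons1 (fst z) (cmap c (snd z)))" by (auto simp: cyl_cmap fun_eq_iff)
  ultimately show "continuous_on (cdom (cyl b c)) (cmap (cyl b c))" by (simp add: cyl_cdom)
  have 1: "continuous_on (cimg (cyl b c)) (\<lambda>y. y $ 1)" by (intro continuous_intros)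
  have sub: "drop1 ` cimg (cyl b c) \<subseteq> cimg c" unfolding cyl_cimg[OF c] by blast
  have "continuous_on (cimg c) (cinv c)" using h by blast
  from continuous_on_compose2[OF this continuous_on_drop1 sub]
  have 2: "continuous_on (cimg (cyl b c)) (\<lambda>y. cinv c (drop1 y))" .
  show "continuous_on (cimg (cyl b c)) (\<lambda>y. (y $ 1, cinv c (drop1 y)))" by (rule continuous_on_Pair[OF 1 2])
  show "cmap (cyl b c) (y $ 1, cinv c (drop1 y)) = y" if "y \<in> cimg (cyl b c)" for y
    using that by (simp only: cyl_cimg[OF c] mem_Collect_eq cyl_cmap cmap_cinv cons1_simps)
  show "(cmap (cyl b c) z $ 1, cinv c (drop1 (cmap (cyl b c) z))) = z" if "z \<in> cdom (cyl b c)" for z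
    using that cinv_cmap[OF c] by (cases z) (simp add: cyl_cmap cyl_cdom)
  show "(\<lambda>y. (y $ 1, cinv c (drop1 y))) ` cimg (cyl b c) \<subseteq> cdom (cyl b c)"
  proof
    fix z assume "z \<in> (\<lambda>y. (y $ 1, cinv c (drop1 y))) ` cimg (cyl b c)"
    then obtain y where "y \<in> cimg (cyl b c)" and z: "z = (y $ 1, cinv c (drop1 y))" by (rule imageE)
    then have "y $ 1 \<in> side b" "drop1 y \<in> cimg c" unfolding cyl_cimg[OF c] by simp_all
    then show "z \<in> cdom (cyl b c)" unfolding z cyl_cdom using cinv_in[OF c] by (intro SigmaI)
  qed
qed simp

lemma cylinder_oriented_manifold: "oriented_manifold ({-1..1} \<times> M) (cylinder_atlas A)"
  unfolding oriented_manifold_def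
proof (intro conjI ballI)
  show "(\<Union>d\<in>cylinder_atlas A. cdom d) = {-1..1} \<times> M"
  proof
    show "(\<Union>d\<in>cylinder_atlas A. cdom d) \<subseteq> {-1..1} \<times> M"
    proof
      fix z assume "z \<in> (\<Union>d\<in>cylinder_atlas A. cdom d)"
      then obtain b c where "c \<in> A" "z \<in> cdom (cyl b c)" by (auto elim: cyl_cases)
      then show "z \<in> {-1..1} \<times> M" using cdom_subset[of c] side_subset[of b] unfolding cyl_cdom by blast
    qed
    show "{-1..1} \<times> M \<subseteq> (\<Union>d\<in>cylinder_atlas A. cdom d)"
    proof
      fix z :: "real \<times> 'a" assume z: "z \<in> {-1..1} \<times> M"
      obtain c where c: "c \<in> A" "snd z \<in> cdom c" using chart_exists[of "snd z"] z by auto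
      have "z \<in> cdom (cyl (fst z < 1) c)" using z c by (auto simp: cyl_cdom side_def mem_Times_iff)
      then show "z \<in> (\<Union>d\<in>cylinder_atlas A. cdom d)" using cyl_in[OF c(1)] by blast
    qed
  qed
next
  fix e assume "e \<in> cylinder_atlas A"
  then obtain b c where e: "e = cyl b c" and c: "c \<in> A" by (rule cyl_cases)
  show "openin (top_of_set ({-1..1} \<times> M)) (cdom e)" unfolding e by (rule cyl_cdom_openin[OF c])
  show "\<exists>n a. openin (top_of_set {x. a \<le> n \<bullet> x}) (cimg e)" unfolding e by (rule cyl_cimg_openin[OF c])
  show "\<exists>g. homeomorphism (cdom e) (cimg e) (cmap e) g" unfolding e using cyl_homeomorphism[OF c] by blast
  fix e' assume "e' \<in> cylinder_atlas A"
  then obtain b' d where e': "e' = cyl b' d" and d: "d \<in> A" by (rule cyl_cases)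
  show "smooth_on (cmap e' \<circ> cinv e) (cmap e ` (cdom e \<inter> cdom e'))"
    unfolding e e' cyl_overlap[OF c d] by (rule cyl_transition_smooth[OF c d])
  fix z assume z: "z \<in> cdom e \<inter> cdom e'"
  obtain s p where sp: "z = (s, p)" by (cases z)
  show "det (matrix (trans_deriv e e' z)) > 0"
    unfolding e e' sp by (rule cyl_orientation) (use z c d in \<open>auto simp: e e' sp cyl_cdom\<close>)
qed

section \<open>1-forms and tangent vectors on the cylinder\<close>

text \<open>
  The part of a tangent vector of the cylinder that is tangent to \<open>M\<close>; \<open>height\<close> is its component along the
  interval.  They are read off in a chart of the family whose interval contains \<open>s\<close>.
\<close>

definition proj_tvec :: "real \<Rightarrow> 'a \<Rightarrow> (real \<times> 'a, 4) tvec \<Rightarrow> ('a, 3) tvec" where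
  "proj_tvec s p V = (\<lambda>c. if c \<in> A \<and> p \<in> cdom c then drop1 (V (cyl (s < 1) c)) else 0)"

definition height :: "real \<Rightarrow> 'a \<Rightarrow> (real \<times> 'a, 4) tvec \<Rightarrow> real" where
  "height s p V = V (cyl (s < 1) (chart_at A p)) $ 1"

lemma side_self: "s \<in> {-1..1} \<Longrightarrow> s \<in> side (s < 1)" by (auto simp: side_def)

lemma cyl_tangent_component:
  assumes V: "V \<in> tangent_space (cylinder_atlas A) (s, p)" and c: "c \<in> A" "p \<in> cdom c" "s \<in> side b"
    and d: "d \<in> A" "p \<in> cdom d" "s \<in> side b'"
  shows "V (cyl b' d) = cons1 (V (cyl b c) $ 1) (trans_deriv c d p (drop1 (V (cyl b c))))"
proof -
  have "(s, p) \<in> cdom (cyl b c)" "(s, p) \<in> cdom (cyl b' d)" using c d by (auto simp: cyl_cdom)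
  then have "V (cyl b' d) = trans_deriv (cyl b c) (cyl b' d) (s, p) (V (cyl b c))"
    using V cyl_in[OF c(1)] cyl_in[OF d(1)] unfolding tangent_space_def by blast
  then show ?thesis using cyl_trans_deriv[OF c(1,2) d(1,2) c(3) d(3)] by simp
qed

lemma cyl_tangent_split:
  assumes V: "V \<in> tangent_space (cylinder_atlas A) (s, p)" and s: "s \<in> {-1..1}"
    and c: "c \<in> A" "p \<in> cdom c" "s \<in> side b"
  shows "V (cyl b c) = cons1 (height s p V) (proj_tvec s p V c)"
proof -
  have p: "p \<in> M" using c cdom_subset by blast
  have c0: "chart_at A p \<in> A" "p \<in> cdom (chart_at A p)" using chart_at[OF p] by auto
  have "V (cyl b c) $ 1 = height s p V"
    using cyl_tangent_component[OF V c0 side_self[OF s] c] by (simp add: height_def)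
  moreover have "drop1 (V (cyl b c)) = proj_tvec s p V c"
    using cyl_tangent_component[OF V c(1,2) side_self[OF s] c] trans_deriv_same[OF c(1,2)] c
    by (simp add: proj_tvec_def)
  ultimately show ?thesis by (metis cons1_simps(3))
qed

lemma proj_tangent:
  assumes V: "V \<in> tangent_space (cylinder_atlas A) (s, p)" and s: "s \<in> {-1..1}"
  shows "proj_tvec s p V \<in> tangent_space A p"
  unfolding tangent_space_def mem_Collect_eq
proof (intro conjI allI ballI impI)
  fix c d assume c: "c \<in> A" "p \<in> cdom c" and d: "d \<in> A" "p \<in> cdom d"
  show "proj_tvec s p V d = trans_deriv c d p (proj_tvec s p V c)"
    using cyl_tangent_component[OF V c side_self[OF s] d side_self[OF s]] c d by (simp add: proj_tvec_def)
qed (auto simp: proj_tvec_def)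

lemma cyl_coord_vec_component:
  assumes c: "c \<in> A" "p \<in> cdom c" "s \<in> side b" and d: "d \<in> A" "p \<in> cdom d" "s \<in> side b'"
  shows "coord_vec (cylinder_atlas A) (s, p) (cyl b c) H (cyl b' d) = cons1 (H $ 1) (trans_deriv c d p (drop1 H))"
proof -
  have "(s, p) \<in> cdom (cyl b' d)" using d by (simp add: cyl_cdom)
  then show ?thesis
    using cyl_in[OF d(1), of b'] cyl_trans_deriv[OF c(1,2) d(1,2) c(3) d(3)] by (simp add: coord_vec_def)
qed

lemma cyl_coord_vec_tangent:
  assumes c: "c \<in> A" "p \<in> cdom c" "s \<in> side b"
  shows "coord_vec (cylinder_atlas A) (s, p) (cyl b c) H \<in> tangent_space (cylinder_atlas A) (s, p)"
  unfolding tangent_space_def mem_Collect_eq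
proof (intro conjI allI ballI impI)
  fix e assume "\<not> (e \<in> cylinder_atlas A \<and> (s, p) \<in> cdom e)"
  then show "coord_vec (cylinder_atlas A) (s, p) (cyl b c) H e = 0" unfolding coord_vec_def by (rule if_not_P)
next
  fix e e' assume e: "e \<in> cylinder_atlas A" "e' \<in> cylinder_atlas A" "(s, p) \<in> cdom e" "(s, p) \<in> cdom e'"
  obtain b1 d1 where 1: "e = cyl b1 d1" "d1 \<in> A" using e(1) by (rule cyl_cases)
  obtain b2 d2 where 2: "e' = cyl b2 d2" "d2 \<in> A" using e(2) by (rule cyl_cases)
  have m: "p \<in> cdom d1" "s \<in> side b1" "p \<in> cdom d2" "s \<in> side b2" using e(3,4) by (auto simp: 1 2 cyl_cdom)
  show "coord_vec (cylinder_atlas A) (s, p) (cyl b c) H e' = trans_deriv e e' (s, p) (coord_vec (cylinder_atlas A) (s, p) (cyl b c) H e)"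
    unfolding 1(1) 2(1) cyl_coord_vec_component[OF c 1(2) m(1,2)] cyl_coord_vec_component[OF c 2(2) m(3,4)]
      cyl_trans_deriv[OF 1(2) m(1) 2(2) m(3) m(2) m(4)]
    using trans_deriv_trans[OF c(1) 1(2) 2(2) c(2) m(1,3)] by simp
qed

lemma cyl_coord_vec_parts:
  assumes c: "c \<in> A" "p \<in> cdom c" "s \<in> side b"
  shows "height s p (coord_vec (cylinder_atlas A) (s, p) (cyl b c) H) = H $ 1"
    and "proj_tvec s p (coord_vec (cylinder_atlas A) (s, p) (cyl b c) H) = coord_vec A p c (drop1 H)"
proof -
  have p: "p \<in> M" and s: "s \<in> {-1..1}" using c cdom_subset side_subset by blast+
  have c0: "chart_at A p \<in> A" "p \<in> cdom (chart_at A p)" using chart_at[OF p] by auto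
  show "height s p (coord_vec (cylinder_atlas A) (s, p) (cyl b c) H) = H $ 1"
    using cyl_coord_vec_component[OF c c0 side_self[OF s]] by (simp add: height_def)
  show "proj_tvec s p (coord_vec (cylinder_atlas A) (s, p) (cyl b c) H) = coord_vec A p c (drop1 H)"
    using cyl_coord_vec_component[OF c _ _ side_self[OF s]] by (auto simp: proj_tvec_def coord_vec_def fun_eq_iff)
qed

definition cyl_form :: "('a, 3) form1 \<Rightarrow> ('a, 3) form1 \<Rightarrow> (real \<times> 'a, 4) form1" where
  "cyl_form \<alpha> \<beta> = (\<lambda>(s, p) V. \<alpha> p (proj_tvec s p V) - s * \<beta> p (proj_tvec s p V))"

lemma cyl_form_one_form:
  assumes "one_form M A \<alpha>" "one_form M A \<beta>"
  shows "one_form ({-1..1} \<times> M) (cylinder_atlas A) (cyl_form \<alpha> \<beta>)"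
  unfolding one_form_def
proof (intro ballI allI)
  fix z U V and a b :: real
  assume z: "z \<in> {-1..1} \<times> M" and U: "U \<in> tangent_space (cylinder_atlas A) z" and V: "V \<in> tangent_space (cylinder_atlas A) z"
  obtain s p where sp: "z = (s, p)" "s \<in> {-1..1}" "p \<in> M" using z by auto
  have "proj_tvec s p (tadd (tscale a U) (tscale b V)) = tadd (tscale a (proj_tvec s p U)) (tscale b (proj_tvec s p V))"
    by (auto simp: proj_tvec_def tadd_def tscale_def drop1_add drop1_scale fun_eq_iff)
  moreover have "proj_tvec s p U \<in> tangent_space A p" "proj_tvec s p V \<in> tangent_space A p"
    using proj_tangent U V sp by auto
  ultimately have "\<alpha> p (proj_tvec s p (tadd (tscale a U) (tscale b V))) = a * \<alpha> p (proj_tvec s p U) + b * \<alpha> p (proj_tvec s p V)"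
      "\<beta> p (proj_tvec s p (tadd (tscale a U) (tscale b V))) = a * \<beta> p (proj_tvec s p U) + b * \<beta> p (proj_tvec s p V)"
    using assms sp(3) unfolding one_form_def by auto
  then show "cyl_form \<alpha> \<beta> z (tadd (tscale a U) (tscale b V)) = a * cyl_form \<alpha> \<beta> z U + b * cyl_form \<alpha> \<beta> z V"
    unfolding cyl_form_def sp(1) by (simp add: algebra_simps)
qed

lemma cyl_form_chart:
  assumes \<alpha>: "one_form M A \<alpha>" and \<beta>: "one_form M A \<beta>" and c: "c \<in> A" and y: "y $ 1 \<in> side b" "drop1 y \<in> cimg c"
  shows "cyl_form \<alpha> \<beta> (cinv (cyl b c) y) (coord_vec (cylinder_atlas A) (cinv (cyl b c) y) (cyl b c) H)
     = covec \<alpha> c (drop1 y) \<bullet> drop1 H - y $ 1 * (covec \<beta> c (drop1 y) \<bullet> drop1 H)"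
  unfolding cyl_cinv[OF c y] cyl_form_def prod.case cyl_coord_vec_parts(2)[OF c cinv_in[OF c y(2)] y(1)]
  by (simp add: covec_coord_vec[OF \<alpha> c y(2)] covec_coord_vec[OF \<beta> c y(2)])

lemma cyl_form_has_derivative:
  assumes \<alpha>: "Ck_one_form 1 M A \<alpha>" and \<beta>: "Ck_one_form 1 M A \<beta>" and c: "c \<in> A" and y: "y \<in> cimg (cyl b c)"
  shows "((\<lambda>y. cyl_form \<alpha> \<beta> (cinv (cyl b c) y) (coord_vec (cylinder_atlas A) (cinv (cyl b c) y) (cyl b c) H)) has_derivative
     (\<lambda>K. dcovec \<alpha> c (drop1 y) (drop1 K) \<bullet> drop1 H
        - (y $ 1 * (dcovec \<beta> c (drop1 y) (drop1 K) \<bullet> drop1 H) + K $ 1 * (covec \<beta> c (drop1 y) \<bullet> drop1 H))))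
     (at y within cimg (cyl b c))" (is "(?f has_derivative ?D) _")
proof -
  have y': "y $ 1 \<in> side b" "drop1 y \<in> cimg c" using y unfolding cyl_cimg[OF c] by auto
  have o: "one_form M A \<alpha>" "one_form M A \<beta>" using \<alpha> \<beta> unfolding Ck_one_form_def by auto
  have d: "((\<lambda>y. covec \<gamma> c (drop1 y) \<bullet> drop1 H) has_derivative (\<lambda>K. dcovec \<gamma> c (drop1 y) (drop1 K) \<bullet> drop1 H)) (at y)"
    if "Ck_one_form 1 M A \<gamma>" for \<gamma>
    by (intro has_derivative_inner_left)
      (rule has_derivative_compose[OF bounded_linear_imp_has_derivative[OF bounded_linear_drop1] covec_has_derivative(1)[OF that c y'(2)]])
  have "((\<lambda>y. covec \<alpha> c (drop1 y) \<bullet> drop1 H - y $ 1 * (covec \<beta> c (drop1 y) \<bullet> drop1 H)) has_derivative ?D) (at y)"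
    by (intro has_derivative_diff has_derivative_mult d \<alpha> \<beta> bounded_linear_imp_has_derivative bounded_linear_vec_nth)
  then have "((\<lambda>y. covec \<alpha> c (drop1 y) \<bullet> drop1 H - y $ 1 * (covec \<beta> c (drop1 y) \<bullet> drop1 H)) has_derivative ?D) (at y within cimg (cyl b c))"
    by (rule has_derivative_at_withinI)
  then show ?thesis
    by (rule has_derivative_transform[OF y, rotated])
      (rule cyl_form_chart[OF o c], auto simp: cyl_cimg[OF c])
qed

lemma cyl_form_C1:
  assumes \<alpha>: "Ck_one_form 1 M A \<alpha>" and \<beta>: "Ck_one_form 1 M A \<beta>"
  shows "Ck_one_form 1 ({-1..1} \<times> M) (cylinder_atlas A) (cyl_form \<alpha> \<beta>)"
  unfolding Ck_one_form_def
proof (intro conjI ballI)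
  have o: "one_form M A \<alpha>" "one_form M A \<beta>" using \<alpha> \<beta> unfolding Ck_one_form_def by auto
  then show "one_form ({-1..1} \<times> M) (cylinder_atlas A) (cyl_form \<alpha> \<beta>)" by (rule cyl_form_one_form)
  fix e and H :: "real ^ 4" assume "e \<in> cylinder_atlas A"
  then obtain b c where e: "e = cyl b c" and c: "c \<in> A" by (rule cyl_cases)
  have sub: "drop1 ` cimg (cyl b c) \<subseteq> cimg c" unfolding cyl_cimg[OF c] by blast
  have cd: "continuous_on (cimg (cyl b c)) (\<lambda>y. dcovec \<gamma> c (drop1 y) k)" "continuous_on (cimg (cyl b c)) (\<lambda>y. covec \<gamma> c (drop1 y))"
    if "Ck_one_form 1 M A \<gamma>" for \<gamma> k
    using continuous_on_compose2[OF covec_has_derivative(2)[OF that c] continuous_on_drop1 sub]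
      continuous_on_compose2[OF covec_has_derivative(3)[OF that c] continuous_on_drop1 sub] .
  show "Ck_on 1 (\<lambda>x. cyl_form \<alpha> \<beta> (cinv e x) (coord_vec (cylinder_atlas A) (cinv e x) e H)) (cimg e)"
    unfolding e
  proof (rule Ck_on_1I[OF cyl_form_has_derivative[OF \<alpha> \<beta> c]])
    show "continuous_on (cimg (cyl b c)) (\<lambda>y. dcovec \<alpha> c (drop1 y) (drop1 K) \<bullet> drop1 H
        - (y $ 1 * (dcovec \<beta> c (drop1 y) (drop1 K) \<bullet> drop1 H) + K $ 1 * (covec \<beta> c (drop1 y) \<bullet> drop1 H)))" for K
      by (intro continuous_intros cd \<alpha> \<beta>)
  qed
qed

lemma cyl_form_ext_d:
  assumes \<alpha>: "Ck_one_form 1 M A \<alpha>" and \<beta>: "Ck_one_form 1 M A \<beta>" and s: "s \<in> {-1..1}" and p: "p \<in> M"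
    and U: "U \<in> tangent_space (cylinder_atlas A) (s, p)" and V: "V \<in> tangent_space (cylinder_atlas A) (s, p)"
  shows "ext_d (cylinder_atlas A) (cyl_form \<alpha> \<beta>) (s, p) U V
      = ext_d A \<alpha> p (proj_tvec s p U) (proj_tvec s p V) - s * ext_d A \<beta> p (proj_tvec s p U) (proj_tvec s p V)
        - (height s p U * \<beta> p (proj_tvec s p V) - height s p V * \<beta> p (proj_tvec s p U))"
proof -
  define e where "e = chart_at (cylinder_atlas A) (s, p)"
  have "e \<in> cylinder_atlas A \<and> (s, p) \<in> cdom e"
  proof -
    have "\<exists>e. e \<in> cylinder_atlas A \<and> (s, p) \<in> cdom e"
    proof -
      obtain c where c: "c \<in> A" "p \<in> cdom c" using chart_exists p by blast
      then show ?thesis using cyl_in[OF c(1)] side_self[OF s] by (intro exI[of _ "cyl (s < 1) c"]) (simp add: cyl_cdom)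
    qed
    then show ?thesis unfolding e_def chart_at_def by (rule someI_ex)
  qed
  then obtain b c where e: "e = cyl b c" and c: "c \<in> A" and sp: "s \<in> side b" "p \<in> cdom c"
    by (auto elim!: cyl_cases simp: cyl_cdom)
  define y where "y = cmap (cyl b c) (s, p)"
  have y: "y = cons1 s (cmap c p)" "y \<in> cimg (cyl b c)" "y $ 1 \<in> side b" "drop1 y \<in> cimg c"
    using sp unfolding cyl_cimg[OF c] by (auto simp: y_def cyl_cmap)
  have o: "one_form M A \<alpha>" "one_form M A \<beta>" using \<alpha> \<beta> unfolding Ck_one_form_def by auto
  let ?f = "\<lambda>H y. cyl_form \<alpha> \<beta> (cinv (cyl b c) y) (coord_vec (cylinder_atlas A) (cinv (cyl b c) y) (cyl b c) H)"
  have thick: "\<exists>\<delta>. 0 < \<bar>\<delta>\<bar> \<and> \<bar>\<delta>\<bar> < e \<and> y $ 1 + \<delta> \<in> side b" if "e > 0" for e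
    using side_thick[of "y $ 1" b b e] y(3) that by simp
  have D: "frechet_derivative (?f H) (at y within cimg (cyl b c)) = (\<lambda>K. dcovec \<alpha> c (drop1 y) (drop1 K) \<bullet> drop1 H
        - (y $ 1 * (dcovec \<beta> c (drop1 y) (drop1 K) \<bullet> drop1 H) + K $ 1 * (covec \<beta> c (drop1 y) \<bullet> drop1 H)))" for H
    using derivative_unique_interval_times_open[OF y(3,4) open_cimg[OF c] thick
        cyl_form_has_derivative[OF \<alpha> \<beta> c y(2), of H, unfolded cyl_cimg[OF c]]]
    unfolding cyl_cimg[OF c] .
  define u where "u = proj_tvec s p U"
  define v where "v = proj_tvec s p V"
  have uv: "u \<in> tangent_space A p" "v \<in> tangent_space A p" using proj_tangent[OF U s] proj_tangent[OF V s] by (auto simp: u_def v_def)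
  have UV: "U (cyl b c) = cons1 (height s p U) (u c)" "V (cyl b c) = cons1 (height s p V) (v c)"
    using cyl_tangent_split[OF U s c sp(2,1)] cyl_tangent_split[OF V s c sp(2,1)] by (auto simp: u_def v_def)
  have "ext_d (cylinder_atlas A) (cyl_form \<alpha> \<beta>) (s, p) U V
     = frechet_derivative (?f (V (cyl b c))) (at y within cimg (cyl b c)) (U (cyl b c))
       - frechet_derivative (?f (U (cyl b c))) (at y within cimg (cyl b c)) (V (cyl b c))"
    unfolding ext_d_def Let_def e_def[symmetric] unfolding e y_def ..
  also have "\<dots> = (dcovec \<alpha> c (cmap c p) (u c) \<bullet> v c - dcovec \<alpha> c (cmap c p) (v c) \<bullet> u c)
      - s * (dcovec \<beta> c (cmap c p) (u c) \<bullet> v c - dcovec \<beta> c (cmap c p) (v c) \<bullet> u c)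
      - (height s p U * (covec \<beta> c (cmap c p) \<bullet> v c) - height s p V * (covec \<beta> c (cmap c p) \<bullet> u c))"
    unfolding D UV unfolding y(1) by (simp add: algebra_simps)
  finally show ?thesis
    using ext_d_chart[OF \<alpha> c sp(2) uv] ext_d_chart[OF \<beta> c sp(2) uv] form_eq_covec[OF o(2) c sp(2) uv(1)]
      form_eq_covec[OF o(2) c sp(2) uv(2)] by (simp add: u_def v_def)
qed

text \<open>
  From a point on the bounding hyperplane of a half space one can move within the half space only to one side.
  All directions along \<open>M\<close> are open in both senses, so they are orthogonal to \<open>n\<close>; the direction of the interval is open in both
  senses unless \<open>s\<close> is an end point.
\<close>

lemma cyl_normal:
  assumes c: "c \<in> A" and z: "s \<in> side b" "p \<in> cdom c"
    and n: "n \<noteq> 0" "openin (top_of_set {x. a \<le> n \<bullet> x}) (cimg (cyl b c))" "n \<bullet> cmap (cyl b c) (s, p) = a"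
  shows "(s = -1 \<and> n $ 1 > 0 \<or> s = 1 \<and> n $ 1 < 0) \<and> (\<forall>H. n \<bullet> H = n $ 1 * H $ 1)"
proof -
  define y where "y = cons1 s (cmap c p)"
  have ge: "n \<bullet> (x - y) \<ge> 0" if "x $ 1 \<in> side b" "drop1 x \<in> cimg c" for x
  proof -
    have "x \<in> {x. a \<le> n \<bullet> x}" using n(2) that unfolding cyl_cimg[OF c] using openin_imp_subset by blast
    then show ?thesis using n(3) by (simp add: y_def cyl_cmap inner_diff_right)
  qed
  have split: "n \<bullet> H = n $ 1 * H $ 1 + n \<bullet> cons1 0 (drop1 H)" for H
    by (simp add: inner_vec_def sum_4 cons1_def drop1_def vector_4)
  obtain r where r: "r > 0" "ball (cmap c p) r \<subseteq> cimg c" using open_cimg[OF c] z(2) openE by blast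
  have hor: "n \<bullet> cons1 0 h = 0" for h
  proof -
    have "n \<bullet> cons1 0 h \<ge> 0" if "norm h < r" for h
    proof -
      have "cmap c p + h \<in> cimg c" using r(2) that by (auto simp: subset_iff dist_norm)
      moreover have "cons1 s (cmap c p + h) - y = cons1 0 h" using cons1_add[of s 0 "cmap c p" h] by (simp add: y_def)
      ultimately show ?thesis using ge[of "cons1 s (cmap c p + h)"] z(1) by simp
    qed
    then have small: "n \<bullet> cons1 0 h = 0" if "norm h < r" for h
      using that cons1_scale[of "-1" 0 h] by (smt (verit, ccfv_SIG) inner_minus_right mult_zero_right norm_minus_cancel scaleR_minus1_left)
    define t where "t = r / 2 / (norm h + 1)"
    have nh: "norm h + 1 > 0" by (simp add: add_nonneg_pos)
    have t: "t > 0" using r nh by (simp add: t_def)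
    have "t * norm h \<le> t * (norm h + 1)" using t by simp
    also have "\<dots> = r / 2" unfolding t_def by (rule nonzero_eq_divide_eq[THEN iffD1, OF _ refl]) (use nh in simp)
    finally have "norm (t *\<^sub>R h) < r" using t r by simp
    from small[OF this] have "n \<bullet> cons1 (t * 0) (t *\<^sub>R h) = 0" by simp
    then have "t * (n \<bullet> cons1 0 h) = 0" unfolding cons1_scale by simp
    then show ?thesis using t by simp
  qed
  have nH: "n \<bullet> H = n $ 1 * H $ 1" for H using split[of H] hor by simp
  have n1: "n $ 1 \<noteq> 0" using n(1) nH[of n] by (metis inner_eq_zero_iff mult_zero_left)
  have dir: "n $ 1 * \<delta> \<ge> 0" if "s + \<delta> \<in> side b" for \<delta>
  proof -
    have "drop1 (cons1 (s + \<delta>) (cmap c p)) \<in> cimg c" using z(2) by simp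
    then show ?thesis using ge[of "cons1 (s + \<delta>) (cmap c p)"] that unfolding nH by (simp add: y_def)
  qed
  have "s = -1 \<and> n $ 1 > 0 \<or> s = 1 \<and> n $ 1 < 0"
  proof (cases "s = -1")
    case True
    then have "b" using z(1) by (auto simp: side_def split: if_splits)
    then show ?thesis using dir[of 1] n1 True by (auto simp: side_def)
  next
    case False
    show ?thesis
    proof (cases "s = 1")
      case True
      then have "\<not> b" using z(1) by (auto simp: side_def split: if_splits)
      then show ?thesis using dir[of "-1"] n1 True by (auto simp: side_def)
    next
      case s1: False
      define \<delta> where "\<delta> = min (s + 1) (1 - s) / 2"
      have sb: "s \<in> {-1..1}" using z(1) side_subset by blast
      have \<delta>: "\<delta> > 0" "-1 < s - \<delta>" "s + \<delta> < 1" using sb s1 False by (auto simp: \<delta>_def min_def field_simps)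
      then have "s + \<delta> \<in> side b" "s + - \<delta> \<in> side b" by (auto simp: side_def)
      from dir[OF this(1)] dir[OF this(2)] have "n $ 1 * \<delta> = 0" by simp
      then show ?thesis using n1 \<delta>(1) by simp
    qed
  qed
  then show ?thesis using nH by blast
qed

end

section \<open>The Liouville structure on the cylinder\<close>

sublocale anosov_cartan \<subseteq> closed_3_manifold M A ..

context anosov_cartan
begin

text \<open>
  The coordinate expressions \<open>\<beta>_chart\<close> combined to a form on \<open>M\<close>.
\<close>

definition \<beta>_form :: "('a, 3) form1" where
  "\<beta>_form p v = \<beta>_chart (chart_at A p) (cmap (chart_at A p) p) (v (chart_at A p))"

lemma Cartan_equations:
  assumes p: "p \<in> M" and u: "u \<in> tangent_space A p" and v: "v \<in> tangent_space A p"
  shows "ext_d A \<alpha>u p u v = \<beta>_form p u * \<alpha>u p v - \<beta>_form p v * \<alpha>u p u"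
    and "ext_d A \<alpha>s p u v = - (\<beta>_form p u * \<alpha>s p v - \<beta>_form p v * \<alpha>s p u)"
    and "\<beta>_form p (XL p) = 1" and "\<beta>_form p (X p) = r p" and "one_form M A \<beta>_form"
proof -
  have lin: "linear (\<beta>_chart (chart_at A p) (cmap (chart_at A p) p))" if "p \<in> M" for p
    using structure_in_chart(13)[of "chart_at A p" "cmap (chart_at A p) p"] chart_at[OF that] by blast
  define c where "c = chart_at A p"
  have c: "c \<in> A" "p \<in> cdom c" using chart_at[OF p] by (auto simp: c_def)
  define x where "x = cmap c p"
  have x: "x \<in> cimg c" "cinv c x = p" using c by (auto simp: x_def)
  note s = structure_in_chart[OF c(1) x(1), unfolded x(2)]
  show "ext_d A \<alpha>u p u v = \<beta>_form p u * \<alpha>u p v - \<beta>_form p v * \<alpha>u p u"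
    using ext_d_chart[OF \<alpha>u c u v] s(11)[of "u c" "v c"] form_eq_covec[OF one_form_\<alpha>u c u] form_eq_covec[OF one_form_\<alpha>u c v]
    by (simp add: \<beta>_form_def c_def[symmetric] x_def)
  show "ext_d A \<alpha>s p u v = - (\<beta>_form p u * \<alpha>s p v - \<beta>_form p v * \<alpha>s p u)"
    using ext_d_chart[OF \<alpha>s c u v] s(12)[of "u c" "v c"] form_eq_covec[OF one_form_\<alpha>s c u] form_eq_covec[OF one_form_\<alpha>s c v]
    by (simp add: \<beta>_form_def c_def[symmetric] x_def)
  show "\<beta>_form p (X p) = r p" using s(7) by (simp add: \<beta>_form_def c_def[symmetric] x_def)
  show "\<beta>_form p (XL p) = 1"
    using s(7) r_nonzero[OF p] by (simp add: \<beta>_form_def c_def[symmetric] x_def[symmetric] XL_apply linear_scale[OF s(13)])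
  show "one_form M A \<beta>_form"
    unfolding one_form_def
  proof (intro ballI allI)
    fix q v w and a b :: real assume q: "q \<in> M"
    show "\<beta>_form q (tadd (tscale a v) (tscale b w)) = a * \<beta>_form q v + b * \<beta>_form q w"
      by (simp add: \<beta>_form_def tadd_def tscale_def linear_add[OF lin[OF q]] linear_scale[OF lin[OF q]])
  qed
qed

text \<open>
  At height \<open>s\<close> this is \<open>(1 - s)/2 \<alpha>\<^sub>- + (1 + s)/2 \<alpha>\<^sub>+\<close>.
\<close>

definition Liouville_form :: "(real \<times> 'a, 4) form1" where "Liouville_form = cyl_form \<alpha>u \<alpha>s"

text \<open>
  The vector field \<open>h \<partial>\<^sub>s + X\<^sub>L\<close> with \<open>h = 2s\<close>: its contraction with \<open>d\<lambda>\<close> is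
  \<open>\<alpha>\<^sub>u + (s - h) \<alpha>\<^sub>s\<close>, which is \<open>\<lambda>\<close> for this value of \<open>h\<close> only.
\<close>

definition Liouville_field :: "real \<times> 'a \<Rightarrow> (real \<times> 'a, 4) tvec" where
  "Liouville_field = (\<lambda>(s, p). coord_vec (cylinder_atlas A) (s, p) (cyl (s < 1) (chart_at A p))
          (cons1 (2 * s) (XL p (chart_at A p))))"

lemma Liouville_field_parts:
  assumes s: "s \<in> {-1..1}" and p: "p \<in> M"
  shows "Liouville_field (s, p) \<in> tangent_space (cylinder_atlas A) (s, p)" "height s p (Liouville_field (s, p)) = 2 * s" "proj_tvec s p (Liouville_field (s, p)) = XL p"
proof -
  have c0: "chart_at A p \<in> A" "p \<in> cdom (chart_at A p)" using chart_at[OF p] by auto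
  show "Liouville_field (s, p) \<in> tangent_space (cylinder_atlas A) (s, p)"
    unfolding Liouville_field_def prod.case by (rule cyl_coord_vec_tangent[OF c0 side_self[OF s]])
  show "height s p (Liouville_field (s, p)) = 2 * s" "proj_tvec s p (Liouville_field (s, p)) = XL p"
    unfolding Liouville_field_def prod.case cyl_coord_vec_parts[OF c0 side_self[OF s]]
    using coord_vec_component[OF XL_tangent[OF p] c0] by simp_all
qed

lemma Liouville_form_ext_d:
  assumes s: "s \<in> {-1..1}" and p: "p \<in> M"
    and U: "U \<in> tangent_space (cylinder_atlas A) (s, p)" and V: "V \<in> tangent_space (cylinder_atlas A) (s, p)"
  defines "u \<equiv> proj_tvec s p U" and "v \<equiv> proj_tvec s p V"
  shows "ext_d (cylinder_atlas A) Liouville_form (s, p) U V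
      = (\<beta>_form p u * \<alpha>u p v - \<beta>_form p v * \<alpha>u p u) + s * (\<beta>_form p u * \<alpha>s p v - \<beta>_form p v * \<alpha>s p u)
        - (height s p U * \<alpha>s p v - height s p V * \<alpha>s p u)"
  unfolding Liouville_form_def cyl_form_ext_d[OF \<alpha>u \<alpha>s s p U V] u_def v_def
    Cartan_equations(1,2)[OF p proj_tangent[OF U s] proj_tangent[OF V s]] by (simp add: algebra_simps)

text \<open>
  \<open>d\<lambda> \<and> d\<lambda> = 2 ds \<and> \<alpha>\<^sub>s \<and> \<alpha>\<^sub>u \<and> \<beta>\<close>, and \<open>\<beta> / r\<close> is one of the forms that take the value 1 on \<open>X\<close>, for which
  positivity is assumed.
\<close>

lemma Liouville_form_symplectic: "positive_4_form ({-1..1} \<times> M) (cylinder_atlas A) (wedge22 (ext_d (cylinder_atlas A) Liouville_form) (ext_d (cylinder_atlas A) Liouville_form))"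
  unfolding positive_4_form_def
proof (intro ballI impI)
  fix z e assume z: "z \<in> {-1..1} \<times> M" and e: "e \<in> cylinder_atlas A" "z \<in> cdom e"
  obtain s p where sp: "z = (s, p)" "s \<in> {-1..1}" "p \<in> M" using z by auto
  obtain b c where bc: "e = cyl b c" "c \<in> A" using e(1) by (rule cyl_cases)
  have c: "c \<in> A" "p \<in> cdom c" "s \<in> side b" using e(2) bc sp by (auto simp: cyl_cdom)
  let ?E = "\<lambda>i. coord_vec (cylinder_atlas A) (s, p) (cyl b c) (axis i 1)"
  let ?e = "\<lambda>i. coord_vec A p c (axis i 1)"
  have ax: "drop1 (axis 1 1) = 0" "drop1 (axis 2 1) = axis 1 1" "drop1 (axis 3 1) = axis 2 1" "drop1 (axis 4 1) = axis 3 1"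
    by (metis cons1_axis cons1_simps(1))+
  have h: "axis 1 (1::real) $ (1::4) = 1" "axis 2 (1::real) $ (1::4) = 0" "axis 3 (1::real) $ (1::4) = 0" "axis 4 (1::real) $ (1::4) = 0"
    by (simp_all add: axis_def)
  have t: "?E i \<in> tangent_space (cylinder_atlas A) (s, p)" for i by (rule cyl_coord_vec_tangent[OF c])
  have zero: "\<gamma> p (coord_vec A p c 0) = 0" if "one_form M A \<gamma>" for \<gamma>
    using linear_0[OF one_form_coord_vec_linear[OF that c(1,2)]] .
  note z0 = zero[OF one_form_\<alpha>u] zero[OF one_form_\<alpha>s] zero[OF Cartan_equations(5)[OF sp(3) X_tangent[OF sp(3)] X_tangent[OF sp(3)]]]
  note d = Liouville_form_ext_d[OF sp(2,3) t t, unfolded cyl_coord_vec_parts[OF c]]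
  have "wedge22 (ext_d (cylinder_atlas A) Liouville_form) (ext_d (cylinder_atlas A) Liouville_form) (s, p) (?E 1) (?E 2) (?E 3) (?E 4)
    = 2 * wedge111 \<alpha>s \<alpha>u \<beta>_form p (?e 1) (?e 2) (?e 3)"
    unfolding wedge22_def d wedge111_def wedge12_def ax h z0 by (simp add: algebra_simps)
  moreover have "wedge111 \<alpha>s \<alpha>u \<beta>_form p (?e 1) (?e 2) (?e 3) = r p * wedge111 \<alpha>s \<alpha>u (\<lambda>p v. \<beta>_form p v / r p) p (?e 1) (?e 2) (?e 3)"
    using r_nonzero[OF sp(3)] by (simp add: wedge111_def wedge12_def field_simps)
  moreover have "wedge111 \<alpha>s \<alpha>u (\<lambda>p v. \<beta>_form p v / r p) p (?e 1) (?e 2) (?e 3) > 0"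
  proof -
    have "one_form M A (\<lambda>p v. \<beta>_form p v / r p)"
      using Cartan_equations(5)[OF sp(3) X_tangent[OF sp(3)] X_tangent[OF sp(3)]]
      unfolding one_form_def by (simp add: add_divide_distrib)
    moreover have "\<forall>q\<in>M. \<beta>_form q (X q) / r q = 1"
    proof
      fix q assume q: "q \<in> M"
      show "\<beta>_form q (X q) / r q = 1"
        unfolding Cartan_equations(4)[OF q X_tangent[OF q] X_tangent[OF q]] using r_nonzero[OF q] by simp
    qed
    ultimately have "positive_3_form M A (wedge111 \<alpha>s \<alpha>u (\<lambda>p v. \<beta>_form p v / r p))" using positive by blast
    then show ?thesis using sp(3) c unfolding positive_3_form_def by blast
  qed
  moreover have "r p > 0" using r_pos sp(3) by blast
  ultimately show "wedge22 (ext_d (cylinder_atlas A) Liouville_form) (ext_d (cylinder_atlas A) Liouville_form) z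
      (coord_vec (cylinder_atlas A) z e (axis 1 1)) (coord_vec (cylinder_atlas A) z e (axis 2 1))
      (coord_vec (cylinder_atlas A) z e (axis 3 1)) (coord_vec (cylinder_atlas A) z e (axis 4 1)) > 0"
    unfolding sp(1) bc(1) by simp
qed

lemma Liouville_field_is_Liouville: "Liouville_structure ({-1..1} \<times> M) (cylinder_atlas A) Liouville_field"
  unfolding Liouville_structure_def
proof (intro exI[of _ Liouville_form] conjI ballI)
  show "exact_symplectic_4_manifold ({-1..1} \<times> M) (cylinder_atlas A) Liouville_form"
    unfolding exact_symplectic_4_manifold_def
    using cylinder_oriented_manifold cyl_form_C1[OF \<alpha>u \<alpha>s] Liouville_form_symplectic by (simp add: Liouville_form_def)
  show "vector_field ({-1..1} \<times> M) (cylinder_atlas A) Liouville_field"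
    unfolding vector_field_def using Liouville_field_parts(1) by auto
  show "ext_d (cylinder_atlas A) Liouville_form z (Liouville_field z) V = Liouville_form z V"
    if z: "z \<in> {-1..1} \<times> M" and V: "V \<in> tangent_space (cylinder_atlas A) z" for z V
  proof -
    obtain s p where sp: "z = (s, p)" "s \<in> {-1..1}" "p \<in> M" using z by auto
    define c where "c = chart_at A p"
    have c: "c \<in> A" "p \<in> cdom c" using chart_at[OF sp(3)] by (auto simp: c_def)
    have "\<alpha>u p (XL p) = 0" "\<alpha>s p (XL p) = 0"
      using forms_vanish_on_X[OF sp(3)]
        form_eq_covec[OF one_form_\<alpha>u c X_tangent[OF sp(3)]] form_eq_covec[OF one_form_\<alpha>u c XL_tangent[OF sp(3)]]
        form_eq_covec[OF one_form_\<alpha>s c X_tangent[OF sp(3)]] form_eq_covec[OF one_form_\<alpha>s c XL_tangent[OF sp(3)]]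
      by (simp_all add: XL_apply)
    then show ?thesis
      using Liouville_form_ext_d[OF sp(2,3) Liouville_field_parts(1)[OF sp(2,3)] V[unfolded sp(1)]] Liouville_field_parts(2,3)[OF sp(2,3)]
        Cartan_equations(3)[OF sp(3) X_tangent[OF sp(3)] X_tangent[OF sp(3)]]
      by (simp add: sp(1) Liouville_form_def cyl_form_def)
  qed
  show "points_outward ({-1..1} \<times> M) (cylinder_atlas A) Liouville_field"
    unfolding points_outward_def
  proof (intro ballI allI impI)
    fix z e n a assume z: "z \<in> mfd_boundary ({-1..1} \<times> M) (cylinder_atlas A)" and e: "e \<in> cylinder_atlas A" "z \<in> cdom e"
      and n: "n \<noteq> 0" "openin (top_of_set {x. a \<le> n \<bullet> x}) (cimg e)" "n \<bullet> cmap e z = a"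
    obtain b c where bc: "e = cyl b c" "c \<in> A" using e(1) by (rule cyl_cases)
    obtain s p where sp: "z = (s, p)" by (cases z)
    have c: "p \<in> cdom c" "s \<in> side b" using e(2) bc sp by (auto simp: cyl_cdom)
    have M: "s \<in> {-1..1}" "p \<in> M" using subsetD[OF side_subset c(2)] subsetD[OF cdom_subset[OF bc(2)] c(1)] by blast+
    have "Liouville_field z e $ 1 = 2 * s"
      using cyl_tangent_split[OF Liouville_field_parts(1)[OF M] M(1) bc(2) c] Liouville_field_parts(2)[OF M] by (simp add: sp bc(1))
    moreover note cyl_normal[OF bc(2) c(2,1) n(1) n(2)[unfolded bc(1)] n(3)[unfolded bc(1) sp]]
    ultimately show "n \<bullet> Liouville_field z e < 0" by auto
  qed
qed

lemma Liouville_field_extends_XL: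
  assumes p: "p \<in> M" shows "Liouville_field (0, p) = push A (cylinder_atlas A) (Pair 0) p (XL p)"
proof -
  define c where "c = chart_at A p"
  have c: "c \<in> A" "p \<in> cdom c" using chart_at[OF p] by (auto simp: c_def)
  define e where "e = chart_at (cylinder_atlas A) (0, p)"
  have s0: "(0::real) \<in> side b" for b by (simp add: side_def)
  have "\<exists>e. e \<in> cylinder_atlas A \<and> (0, p) \<in> cdom e"
    using cyl_in[OF c(1), of True] s0 c(2) by (intro exI[of _ "cyl True c"]) (simp add: cyl_cdom)
  then have "e \<in> cylinder_atlas A \<and> (0, p) \<in> cdom e" unfolding e_def chart_at_def by (rule someI_ex)
  then obtain b d where e: "e = cyl b d" and d: "d \<in> A" "p \<in> cdom d"
    by (auto elim!: cyl_cases simp: cyl_cdom)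
  have S: "cmap c ` {q \<in> cdom c. (0, q) \<in> cdom e} = overlap c d"
    using s0 by (auto simp: overlap_def e cyl_cdom)
  have ov: "cmap c p \<in> overlap c d" using overlap_iff[OF c] d(2) by simp
  have w: "at (cmap c p) within overlap c d = at (cmap c p)" by (rule at_within_open[OF ov open_overlap[OF c(1) d(1)]])
  have eq: "cmap e \<circ> Pair 0 \<circ> cinv c = (\<lambda>y. cons1 0 ((cmap d \<circ> cinv c) y))" by (auto simp: e cyl_cmap fun_eq_iff)
  have "((\<lambda>y. cons1 0 ((cmap d \<circ> cinv c) y)) has_derivative (\<lambda>h. cons1 0 (trans_deriv c d p h))) (at (cmap c p))"
    by (rule bounded_linear.has_derivative[OF bounded_linear_cons1_0 transition_has_derivative[OF c(1) d(1) c(2) d(2)]])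
  from frechet_derivative_at[OF this]
  have D: "frechet_derivative (cmap e \<circ> Pair 0 \<circ> cinv c) (at (cmap c p) within cmap c ` {q \<in> cdom c. (0, q) \<in> cdom e})
      = (\<lambda>h. cons1 0 (trans_deriv c d p h))" unfolding S w eq by simp
  have push: "push A (cylinder_atlas A) (Pair 0) p (XL p) = coord_vec (cylinder_atlas A) (0, p) (cyl b d) (cons1 0 (XL p d))"
    unfolding push_def Let_def c_def[symmetric] e_def[symmetric] D
    using tangent_component[OF XL_tangent[OF p] c(1) d(1) c(2) d(2)] by (simp add: e)
  show ?thesis
  proof
    fix e' show "Liouville_field (0, p) e' = push A (cylinder_atlas A) (Pair 0) p (XL p) e'"
    proof (cases "e' \<in> cylinder_atlas A \<and> (0, p) \<in> cdom e'")
      case True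
      then obtain b' d' where e': "e' = cyl b' d'" "d' \<in> A" "p \<in> cdom d'" by (auto elim!: cyl_cases simp: cyl_cdom)
      have "Liouville_field (0, p) e' = cons1 0 (XL p d')"
        unfolding Liouville_field_def prod.case c_def[symmetric] e'(1)
        using cyl_coord_vec_component[OF c s0 e'(2,3) s0] tangent_component[OF XL_tangent[OF p] c(1) e'(2) c(2) e'(3)] by simp
      moreover have "push A (cylinder_atlas A) (Pair 0) p (XL p) e' = cons1 0 (XL p d')"
        unfolding push e'(1)
        using cyl_coord_vec_component[OF d s0 e'(2,3) s0] tangent_component[OF XL_tangent[OF p] d(1) e'(2) d(2) e'(3)] by simp
      ultimately show ?thesis by simp
    next
      case False
      then show ?thesis unfolding push Liouville_field_def prod.case coord_vec_def by (simp only: if_False)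
    qed
  qed
qed

end

theorem theorem1p8:
  fixes M :: "('a::t2_space) set"
    and A :: "('a, 3) chart set"
    and X Rm Rp XL :: "'a \<Rightarrow> ('a, 3) tvec"
    and \<phi> :: "real \<Rightarrow> 'a \<Rightarrow> 'a"
    and Ess Euu :: "'a \<Rightarrow> ('a, 3) tvec set"
    and \<alpha>m \<alpha>p :: "('a, 3) form1"
    and r :: "'a \<Rightarrow> real"
  assumes "closed_connected_oriented_3_manifold M A"
    and "C1_Hoelder_vector_field M A X"
    and "nonvanishing M X"
    and "generates_flow M A X \<phi>"
    and "Anosov_splitting M A X \<phi> Ess Euu"
    and "transversely_orientable M A (weak_bundle X Ess)"
    and "transversely_orientable M A (weak_bundle X Euu)"
    and "volume_preserving M A \<phi>"
    and "associated_Cartan_structure M A X \<phi> (weak_bundle X Ess) (weak_bundle X Euu) r \<alpha>m \<alpha>p"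
    and "XL = Liouville_reparametrization r X"
    and "Reeb_vector_field M A \<alpha>m Rm"
    and "Reeb_vector_field M A \<alpha>p Rp"
  shows "transverse_plane_field M A XL Rm Rp
       \<and> (\<exists>\<psi>. generates_flow M A XL \<psi>)
       \<and> (\<forall>\<psi>. generates_flow M A XL \<psi> \<longrightarrow> preserves_bundle M A \<psi> (span2 Rm Rp))
       \<and> (\<exists>Y. Liouville_structure ({-1..1} \<times> M) (cylinder_atlas A) Y
             \<and> (\<forall>p\<in>M. Y (0, p) = push A (cylinder_atlas A) (Pair 0) p (XL p)))"
proof -
  obtain \<alpha>u \<alpha>s where ass: "Ck_one_form 1 M A \<alpha>u" "Ck_one_form 1 M A \<alpha>s"
      "has_kernel M A \<alpha>u (weak_bundle X Ess)" "has_kernel M A \<alpha>s (weak_bundle X Euu)"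
      "\<forall>\<alpha>X. one_form M A \<alpha>X \<longrightarrow> (\<forall>p\<in>M. \<alpha>X p (X p) = 1) \<longrightarrow> positive_3_form M A (wedge111 \<alpha>s \<alpha>u \<alpha>X)"
      "has_Lie_derivative M A \<phi> \<alpha>u (\<lambda>p v. r p * \<alpha>u p v)"
      "has_Lie_derivative M A \<phi> \<alpha>s (\<lambda>p v. - r p * \<alpha>s p v)"
      "\<forall>p\<in>M. r p > 0" "\<alpha>m = form1_add \<alpha>u \<alpha>s" "\<alpha>p = form1_diff \<alpha>u \<alpha>s"
    using assms(9) unfolding associated_Cartan_structure_def by blast
  have mfd: "oriented_manifold M A" "compact M" "mfd_boundary M A = {}"
    using assms(1) unfolding closed_connected_oriented_3_manifold_def by blast+
  interpret anosov_cartan M A X Rm Rp \<phi> Ess Euu \<alpha>u \<alpha>s r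
  proof
    show "Ck_vector_field 1 M A X" using assms(2) unfolding C1_Hoelder_vector_field_def by blast
  qed (use mfd assms ass in auto)
  show ?thesis
    unfolding assms(10)
    using Reeb_plane_transverse XL_flow_exists XL_flow_preserves_Reeb_plane Liouville_field_is_Liouville Liouville_field_extends_XL by blast
qed

end
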